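(* Let $(X,T)$ and $(Y,S)$ be topologically free Deaconu-Renault systems. Consider the following conditions. (1) $(X,T)$ and $(Y,S)$ are flip eventually conjugate. (2) There exist an isomorphism $\Phi\colon G(X,T)\to G(Y,S)$ and $\tau\in\mathrm{Aut}(\mathbb{Z})$ such that $\sigma_Y\circ\Phi=\tau\circ\sigma_X$. (3) There exists an isomorphism $\Phi\colon G(X,T)\to G(Y,S)$ such that $\Phi(\ker\sigma_X)=\ker\sigma_Y$. (4) There exists a *-isomorphism $\varphi\colon C^*_r(G(X,T))\to C^*_r(G(Y,S))$ such that $\varphi(C^*_r(\ker\sigma_X))=C^*_r(\ker\sigma_Y)$ and $\varphi(C_0(X))=C_0(Y)$. Then (1)$\Leftrightarrow$(2)$\Rightarrow$(3)$\Leftrightarrow$(4) hold. If $\ker\sigma_X$ and $\ker\sigma_Y$ are topologically transitive, then (3)$\Rightarrow$(2) holds and hence all conditions are equivalent.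
   Context: $\mathbb{N}=\{0,1,2,\dots\}$. A Deaconu-Renault system $(X,T)$ consists of a locally compact Hausdorff space $X$ and a local homeomorphism $T\colon X\to X$ (defined on all of $X$). Its groupoid is $$G(X,T)=\{(y,n-m,x)\in X\times\mathbb{Z}\times X: n,m\in\mathbb{N},\ T^ny=T^mx\},$$ with unit space $\{(x,0,x)\}$ identified with $X$, $d(y,n,x)=x$, $r(y,n,x)=y$, $(z,n,y)(y,m,x)=(z,n+m,x)$, $(y,m,x)^{-1}=(x,-m,y)$, and the topology generated by the sets $Z(U,n,m,V)=\{(y,n-m,x)\in G(X,T): y\in U, x\in V, T^ny=T^mx\}$ for $U,V\subset X$ open and $n,m\in\mathbb{N}$; it is a locally compact Hausdorff étale groupoid. The canonical continuous cocycle is $\sigma_X\colon G(X,T)\to\mathbb{Z}$, $\sigma_X(y,n,x)=n$, and $\ker\sigma_X=\sigma_X^{-1}(\{0\})$ is an open subgroupoid containing $X$. Isomorphisms of these groupoids are isomorphisms of topological groupoids (groupoid isomorphisms that are homeomorphisms). $(X,T)$ is topologically free if $G(X,T)$ is topologically principal, i.e. the set of $x\in X$ with trivial isotropy group $\{\alpha: d(\alpha)=r(\alpha)=x\}=\{x\}$ is dense in $X$. An étale groupoid $H$ is topologically transitive if $r(d^{-1}(U))$ is dense in $H^{(0)}$ for every nonempty open $U\subset H^{(0)}$. A continuous orbit map from $(X,T)$ to $(Y,S)$ is a triplet $(l,k,h)$ of continuous maps $l,k\colon X\to\mathbb{N}$, $h\colon X\to Y$ with $S^{l(x)}(h(x))=S^{k(x)}(h(T(x)))$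 for all $x\in X$. A continuous orbit equivalence between $(X,T)$ and $(Y,S)$ is a 5-tuple $(l,k,l',k',h)$ with $l,k\colon X\to\mathbb{N}$, $l',k'\colon Y\to\mathbb{N}$ continuous and $h\colon X\to Y$ a homeomorphism such that $(l,k,h)$ is a continuous orbit map from $(X,T)$ to $(Y,S)$ and $(l',k',h^{-1})$ is a continuous orbit map from $(Y,S)$ to $(X,T)$. $(X,T)$ and $(Y,S)$ are flip eventually conjugate if there is a continuous orbit equivalence $(l,k,l',k',h)$ with either $l-k=1$ and $l'-k'=1$ (constantly), or $l-k=-1$ and $l'-k'=-1$ (constantly). $C^*_r(\cdot)$ is the reduced groupoid C*-algebra; $C_0(X)\subset C^*_r(\ker\sigma_X)\subset C^*_r(G(X,T))$ are the canonical inclusions, $C^*_r(\ker\sigma_X)$ being the closure of $C_c(\ker\sigma_X)$ in $C^*_r(G(X,T))$. *)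

theory Defs
  imports "HOL-Analysis.Analysis" "HOL-Algebra.Bij" "HOL-Algebra.Elementary_Groups"
begin

section \<open>The Hilbert space of square-summable families and its operators\<close>

typedef 'a ell2 = "{f :: 'a \<Rightarrow> complex. (\<lambda>x. (cmod (f x))\<^sup>2) summable_on UNIV}"
  morphisms ell2_fun Abs_ell2
  by (rule exI[of _ "\<lambda>_. 0"]) simp

setup_lifting type_definition_ell2

lemma ell2_eqI: "(\<And>x. ell2_fun f x = ell2_fun g x) \<Longrightarrow> f = g"
  by (meson ell2_fun_inject ext)

lemma square_summable_scale:
  fixes c :: complex
  assumes "(\<lambda>x. (cmod (f x))\<^sup>2) summable_on A"
  shows "(\<lambda>x. (cmod (c * f x))\<^sup>2) summable_on A"
  using summable_on_cmult_right[OF assms, of "(cmod c)\<^sup>2"]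
  by (simp add: norm_mult power_mult_distrib)

lemma square_summable_add:
  assumes f: "(\<lambda>x. (cmod (f x))\<^sup>2) summable_on A"
    and g: "(\<lambda>x. (cmod (g x))\<^sup>2) summable_on A"
  shows "(\<lambda>x. (cmod (f x + g x))\<^sup>2) summable_on A"
proof (rule summable_on_comparison_test)
  show "(\<lambda>x. 2 * (cmod (f x))\<^sup>2 + 2 * (cmod (g x))\<^sup>2) summable_on A"
    by (intro summable_on_add summable_on_cmult_right f g)
  fix x
  have "(cmod (f x + g x))\<^sup>2 \<le> (cmod (f x) + cmod (g x))\<^sup>2"
    by (intro power_mono norm_triangle_ineq) simp
  also have "\<dots> \<le> 2 * (cmod (f x))\<^sup>2 + 2 * (cmod (g x))\<^sup>2"
    using sum_squares_bound[of "cmod (f x)" "cmod (g x)"] unfolding power2_sum by linarith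
  finally show "(cmod (f x + g x))\<^sup>2 \<le> 2 * (cmod (f x))\<^sup>2 + 2 * (cmod (g x))\<^sup>2" .
qed simp

lemma square_summable_mult:
  assumes f: "(\<lambda>x. (cmod (f x))\<^sup>2) summable_on A"
    and g: "(\<lambda>x. (cmod (g x))\<^sup>2) summable_on A"
  shows "(\<lambda>x. f x * g x) summable_on A"
proof (rule abs_summable_summable, rule abs_summable_product)
  show "(\<lambda>x. norm (f x * f x)) summable_on A" "(\<lambda>x. norm (g x * g x)) summable_on A"
    using f g by (simp_all only: norm_mult power2_eq_square)
qed

lemma square_summable_inner:
  assumes f: "(\<lambda>x. (cmod (f x))\<^sup>2) summable_on A"
    and g: "(\<lambda>x. (cmod (g x))\<^sup>2) summable_on A"
  shows "(\<lambda>x. f x \<bullet> g x) summable_on A"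
proof -
  have "(\<lambda>x. f x * cnj (g x)) summable_on A"
    by (rule square_summable_mult) (simp_all add: f g)
  then have "(\<lambda>x. Re (f x * cnj (g x))) summable_on A"
    by (rule summable_on_Re)
  moreover have "Re (f x * cnj (g x)) = f x \<bullet> g x" for x
    by (simp add: inner_complex_def)
  ultimately show ?thesis
    by (simp only:)
qed

instantiation ell2 :: (type) real_inner
begin

lift_definition zero_ell2 :: "'a ell2" is "\<lambda>_. 0" by simp
lift_definition plus_ell2 :: "'a ell2 \<Rightarrow> 'a ell2 \<Rightarrow> 'a ell2" is "\<lambda>f g x. f x + g x"
  by (rule square_summable_add)
lift_definition uminus_ell2 :: "'a ell2 \<Rightarrow> 'a ell2" is "\<lambda>f x. - f x" by simp
lift_definition minus_ell2 :: "'a ell2 \<Rightarrow> 'a ell2 \<Rightarrow> 'a ell2" is "\<lambda>f g x. f x - g x"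
  subgoal for f g using square_summable_add[of f UNIV "\<lambda>x. - g x"] by simp
  done
lift_definition scaleR_ell2 :: "real \<Rightarrow> 'a ell2 \<Rightarrow> 'a ell2" is "\<lambda>r f x. r *\<^sub>R f x"
  subgoal for r f using square_summable_scale[of f UNIV "of_real r"] by (simp add: scaleR_conv_of_real)
  done
lift_definition inner_ell2 :: "'a ell2 \<Rightarrow> 'a ell2 \<Rightarrow> real" is "\<lambda>f g. \<Sum>\<^sub>\<infinity>x. f x \<bullet> g x" .
definition "norm (f :: 'a ell2) = sqrt (f \<bullet> f)"
definition "dist (f :: 'a ell2) g = norm (f - g)"
definition "sgn (f :: 'a ell2) = inverse (norm f) *\<^sub>R f"
definition "uniformity = (INF e\<in>{0<..}. principal {(f :: 'a ell2, g). dist f g < e})"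
definition "open (U :: 'a ell2 set) \<longleftrightarrow>
  (\<forall>f\<in>U. \<forall>\<^sub>F (f', g) in uniformity. f' = f \<longrightarrow> g \<in> U)"

instance
proof
  fix f g h :: "'a ell2" and r s :: real
  show "f + g + h = f + (g + h)"
    by (rule ell2_eqI) (simp add: zero_ell2.rep_eq plus_ell2.rep_eq uminus_ell2.rep_eq
        minus_ell2.rep_eq scaleR_ell2.rep_eq algebra_simps)
  show "f + g = g + f"
    by (rule ell2_eqI) (simp add: zero_ell2.rep_eq plus_ell2.rep_eq uminus_ell2.rep_eq
        minus_ell2.rep_eq scaleR_ell2.rep_eq algebra_simps)
  show "0 + f = f"
    by (rule ell2_eqI) (simp add: zero_ell2.rep_eq plus_ell2.rep_eq uminus_ell2.rep_eq
        minus_ell2.rep_eq scaleR_ell2.rep_eq algebra_simps)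
  show "- f + f = 0"
    by (rule ell2_eqI) (simp add: zero_ell2.rep_eq plus_ell2.rep_eq uminus_ell2.rep_eq
        minus_ell2.rep_eq scaleR_ell2.rep_eq algebra_simps)
  show "f - g = f + - g"
    by (rule ell2_eqI) (simp add: zero_ell2.rep_eq plus_ell2.rep_eq uminus_ell2.rep_eq
        minus_ell2.rep_eq scaleR_ell2.rep_eq algebra_simps)
  show "r *\<^sub>R (f + g) = r *\<^sub>R f + r *\<^sub>R g"
    by (rule ell2_eqI) (simp add: zero_ell2.rep_eq plus_ell2.rep_eq uminus_ell2.rep_eq
        minus_ell2.rep_eq scaleR_ell2.rep_eq algebra_simps)
  show "(r + s) *\<^sub>R f = r *\<^sub>R f + s *\<^sub>R f"
    by (rule ell2_eqI) (simp add: zero_ell2.rep_eq plus_ell2.rep_eq uminus_ell2.rep_eq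
        minus_ell2.rep_eq scaleR_ell2.rep_eq algebra_simps)
  show "r *\<^sub>R s *\<^sub>R f = (r * s) *\<^sub>R f"
    by (rule ell2_eqI) (simp add: zero_ell2.rep_eq plus_ell2.rep_eq uminus_ell2.rep_eq
        minus_ell2.rep_eq scaleR_ell2.rep_eq algebra_simps)
  show "1 *\<^sub>R f = f"
    by (rule ell2_eqI) (simp add: zero_ell2.rep_eq plus_ell2.rep_eq uminus_ell2.rep_eq
        minus_ell2.rep_eq scaleR_ell2.rep_eq algebra_simps)
  show "sgn f = inverse (norm f) *\<^sub>R f" by (simp add: sgn_ell2_def)
  show "dist f g = norm (f - g)" by (simp add: dist_ell2_def)
  show "uniformity = (INF e\<in>{0<..}. principal {(f :: 'a ell2, g). dist f g < e})"
    by (simp add: uniformity_ell2_def)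
  show "open U \<longleftrightarrow> (\<forall>f\<in>U. \<forall>\<^sub>F (f', g) in uniformity. f' = f \<longrightarrow> g \<in> U)" for U :: "'a ell2 set"
    by (simp add: open_ell2_def)
  show "f \<bullet> g = g \<bullet> f" by transfer (simp add: inner_commute)
  show "(f + g) \<bullet> h = f \<bullet> h + g \<bullet> h"
    by transfer (simp add: inner_add_left infsum_add square_summable_inner)
  show "(r *\<^sub>R f) \<bullet> g = r * (f \<bullet> g)" by transfer (simp add: infsum_cmult_right')
  show "0 \<le> f \<bullet> f" by transfer (simp add: infsum_nonneg)
  show "f \<bullet> f = 0 \<longleftrightarrow> f = 0"
  proof
    assume "f \<bullet> f = 0"
    then show "f = 0"
    proof transfer
      fix f :: "'a \<Rightarrow> complex"
      assume "(\<lambda>x. (cmod (f x))\<^sup>2) summable_on UNIV" "(\<Sum>\<^sub>\<infinity>x. f x \<bullet> f x) = 0"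
      then have "f x \<bullet> f x = 0" for x
        by (intro nonneg_infsum_le_0D[of "\<lambda>x. f x \<bullet> f x" UNIV])
          (auto simp: power2_norm_eq_inner)
      then show "f = (\<lambda>_. 0)" by auto
    qed
  qed (transfer, simp)
  show "norm f = sqrt (f \<bullet> f)" by (simp add: norm_ell2_def)
qed

end

definition cinner_ell2 :: "'a ell2 \<Rightarrow> 'a ell2 \<Rightarrow> complex" where
  "cinner_ell2 f g = (\<Sum>\<^sub>\<infinity>x. ell2_fun f x * cnj (ell2_fun g x))"

lift_definition scaleC_ell2 :: "complex \<Rightarrow> 'a ell2 \<Rightarrow> 'a ell2" is "\<lambda>c f x. c * f x"
  by (rule square_summable_scale)

lemma norm_scaleC_ell2: "norm (scaleC_ell2 c f) = cmod c * norm f"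
proof -
  have "scaleC_ell2 c f \<bullet> scaleC_ell2 c f = (cmod c)\<^sup>2 * (f \<bullet> f)"
    by transfer (simp add: power2_norm_eq_inner[symmetric] norm_mult power_mult_distrib
        infsum_cmult_right')
  then show ?thesis
    by (simp add: norm_ell2_def real_sqrt_mult)
qed

text \<open>
  The type \<open>'a ell2 \<Rightarrow>\<^sub>L 'a ell2\<close> consists of the bounded real-linear operators, with the operator
  norm. The C*-algebras below are subsets of it which contain complex-linear operators only, so
  multiplication of an operator by a complex scalar is composition with \<open>scale_op\<close>.
\<close>

type_synonym 'a op = "'a ell2 \<Rightarrow>\<^sub>L 'a ell2"

lift_definition scale_op :: "complex \<Rightarrow> 'a op" is scaleC_ell2
proof (rule bounded_linear_intro)
  fix c :: complex and f g :: "'a ell2" and r :: real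
  show "scaleC_ell2 c (f + g) = scaleC_ell2 c f + scaleC_ell2 c g"
    by transfer (simp add: algebra_simps)
  show "scaleC_ell2 c (r *\<^sub>R f) = r *\<^sub>R scaleC_ell2 c f"
    by transfer simp
  show "norm (scaleC_ell2 c f) \<le> norm f * cmod c"
    by (simp add: norm_scaleC_ell2)
qed

definition adjoint_op :: "'a op \<Rightarrow> 'a op" where
  "adjoint_op A = (THE B. \<forall>f g. cinner_ell2 (blinfun_apply A f) g = cinner_ell2 f (blinfun_apply B g))"

definition star_isomorphism :: "'a op set \<Rightarrow> 'b op set \<Rightarrow> ('a op \<Rightarrow> 'b op) \<Rightarrow> bool" where
  "star_isomorphism \<A> \<B> \<phi> \<longleftrightarrow>
     bij_betw \<phi> \<A> \<B> \<and>
     (\<forall>A\<in>\<A>. \<forall>B\<in>\<A>. \<phi> (A + B) = \<phi> A + \<phi> B) \<and>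
     (\<forall>c. \<forall>A\<in>\<A>. \<phi> (scale_op c o\<^sub>L A) = scale_op c o\<^sub>L \<phi> A) \<and>
     (\<forall>A\<in>\<A>. \<forall>B\<in>\<A>. \<phi> (A o\<^sub>L B) = \<phi> A o\<^sub>L \<phi> B) \<and>
     (\<forall>A\<in>\<A>. \<phi> (adjoint_op A) = adjoint_op (\<phi> A))"


section \<open>Topological groupoids\<close>

text \<open>The arrows are the points of the topology; the product is used for \<open>gdom \<alpha> = gran \<beta>\<close> only.\<close>

record 'g top_groupoid =
  gtop :: "'g topology"
  gdom :: "'g \<Rightarrow> 'g"
  gran :: "'g \<Rightarrow> 'g"
  gmult :: "'g \<Rightarrow> 'g \<Rightarrow> 'g"
  ginv :: "'g \<Rightarrow> 'g"

abbreviation arrows :: "('g, 'm) top_groupoid_scheme \<Rightarrow> 'g set" where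
  "arrows G \<equiv> topspace (gtop G)"

definition unit_space :: "('g, 'm) top_groupoid_scheme \<Rightarrow> 'g topology" where
  "unit_space G = subtopology (gtop G) (gdom G ` arrows G)"

definition groupoid_isomorphism ::
  "('g, 'm) top_groupoid_scheme \<Rightarrow> ('h, 'n) top_groupoid_scheme \<Rightarrow> ('g \<Rightarrow> 'h) \<Rightarrow> bool" where
  "groupoid_isomorphism G H \<Phi> \<longleftrightarrow>
     homeomorphic_map (gtop G) (gtop H) \<Phi> \<and>
     (\<forall>\<alpha>\<in>arrows G. \<Phi> (gdom G \<alpha>) = gdom H (\<Phi> \<alpha>) \<and> \<Phi> (gran G \<alpha>) = gran H (\<Phi> \<alpha>)) \<and>
     (\<forall>\<alpha>\<in>arrows G. \<forall>\<beta>\<in>arrows G.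
        gdom G \<alpha> = gran G \<beta> \<longrightarrow> \<Phi> (gmult G \<alpha> \<beta>) = gmult H (\<Phi> \<alpha>) (\<Phi> \<beta>))"

definition isotropy_group :: "('g, 'm) top_groupoid_scheme \<Rightarrow> 'g \<Rightarrow> 'g set" where
  "isotropy_group G x = {\<alpha>\<in>arrows G. gdom G \<alpha> = x \<and> gran G \<alpha> = x}"

definition topologically_principal :: "('g, 'm) top_groupoid_scheme \<Rightarrow> bool" where
  "topologically_principal G \<longleftrightarrow>
     unit_space G closure_of {x\<in>topspace (unit_space G). isotropy_group G x = {x}}
       = topspace (unit_space G)"

definition topologically_transitive :: "('g, 'm) top_groupoid_scheme \<Rightarrow> bool" where
  "topologically_transitive G \<longleftrightarrow>
     (\<forall>U. openin (unit_space G) U \<and> U \<noteq> {} \<longrightarrow>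
        unit_space G closure_of (gran G ` {\<alpha>\<in>arrows G. gdom G \<alpha> \<in> U}) = topspace (unit_space G))"

definition restrict_groupoid ::
  "('g, 'm) top_groupoid_scheme \<Rightarrow> 'g set \<Rightarrow> ('g, 'm) top_groupoid_scheme" where
  "restrict_groupoid G S = G\<lparr>gtop := subtopology (gtop G) S\<rparr>"


section \<open>The reduced C*-algebra of a Hausdorff etale groupoid\<close>

text \<open>
  Functions on a space are extended by zero to the whole type. For an open subgroupoid \<open>H\<close> of \<open>G\<close>
  the inclusion of \<open>C_c (gtop H)\<close> into \<open>C_c (gtop G)\<close> is thus the identity.
\<close>

definition C_c :: "'x topology \<Rightarrow> ('x \<Rightarrow> complex) set" where
  "C_c X = {f. continuous_map X euclidean f \<and> (\<forall>x. x \<notin> topspace X \<longrightarrow> f x = 0) \<and>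
     compactin X (X closure_of {x\<in>topspace X. f x \<noteq> 0})}"

definition C_0 :: "'x topology \<Rightarrow> ('x \<Rightarrow> complex) set" where
  "C_0 X = {f. continuous_map X euclidean f \<and> (\<forall>x. x \<notin> topspace X \<longrightarrow> f x = 0) \<and>
     (\<forall>e>0. compactin X {x\<in>topspace X. cmod (f x) \<ge> e})}"

text \<open>
  Convolution, that is, \<open>(f * \<xi>)(\<gamma>)\<close> is the sum of \<open>f \<alpha> * \<xi> \<beta>\<close> over all factorizations
  \<open>\<gamma> = \<alpha>\<beta>\<close>. Only finitely many terms are nonzero if \<open>G\<close> is etale and \<open>f\<close> is compactly supported
  or vanishes outside the unit space.
\<close>

definition convolution ::
  "('g, 'm) top_groupoid_scheme \<Rightarrow> ('g \<Rightarrow> complex) \<Rightarrow> ('g \<Rightarrow> complex) \<Rightarrow> 'g \<Rightarrow> complex" where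
  "convolution G f \<xi> \<gamma> =
     (if \<gamma> \<in> arrows G
      then \<Sum>\<^sub>\<infinity>\<alpha>\<in>{\<alpha>\<in>arrows G. gran G \<alpha> = gran G \<gamma>}. f \<alpha> * \<xi> (gmult G (ginv G \<alpha>) \<gamma>)
      else 0)"

text \<open>
  \<open>left_regular G F\<close> is the image of a set \<open>F\<close> of functions under the direct sum, over all units
  \<open>x\<close>, of the left regular representations on \<open>\<ell>\<^sup>2({\<gamma>. gdom G \<gamma> = x})\<close>. The direct sum acts on
  \<open>\<ell>\<^sup>2(arrows G)\<close>; on its orthogonal complement in \<open>'g ell2\<close> the operators vanish. The operator
  norm of the image of \<open>f\<close> is therefore the reduced norm of \<open>f\<close>, and the closure of the image of
  \<open>C_c\<close> is the completion in the reduced norm.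
\<close>

definition left_regular :: "('g, 'm) top_groupoid_scheme \<Rightarrow> ('g \<Rightarrow> complex) set \<Rightarrow> 'g op set" where
  "left_regular G F =
     {A. \<exists>f\<in>F. \<forall>\<xi>. ell2_fun (blinfun_apply A \<xi>) = convolution G f (ell2_fun \<xi>)}"

definition Cstar_r :: "('g, 'm) top_groupoid_scheme \<Rightarrow> 'g op set" where
  "Cstar_r G = closure (left_regular G (C_c (gtop G)))"

definition Cstar_r_sub ::
  "('g, 'm) top_groupoid_scheme \<Rightarrow> ('g, 'm) top_groupoid_scheme \<Rightarrow> 'g op set" where
  "Cstar_r_sub G H = closure (left_regular G (C_c (gtop H)))"

definition diagonal_subalgebra :: "('g, 'm) top_groupoid_scheme \<Rightarrow> 'g op set" where
  "diagonal_subalgebra G = left_regular G (C_0 (unit_space G))"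


section \<open>Deaconu-Renault systems\<close>

definition local_homeomorphism :: "'a topology \<Rightarrow> 'b topology \<Rightarrow> ('a \<Rightarrow> 'b) \<Rightarrow> bool" where
  "local_homeomorphism X Y f \<longleftrightarrow>
     f ` topspace X \<subseteq> topspace Y \<and>
     (\<forall>x\<in>topspace X. \<exists>U. openin X U \<and> x \<in> U \<and> openin Y (f ` U) \<and>
        homeomorphic_map (subtopology X U) (subtopology Y (f ` U)) f)"

definition deaconu_renault_system :: "'a topology \<Rightarrow> ('a \<Rightarrow> 'a) \<Rightarrow> bool" where
  "deaconu_renault_system X T \<longleftrightarrow>
     locally_compact_space X \<and> Hausdorff_space X \<and> local_homeomorphism X X T"

definition DR_basic ::
  "'a topology \<Rightarrow> ('a \<Rightarrow> 'a) \<Rightarrow> 'a set \<Rightarrow> nat \<Rightarrow> nat \<Rightarrow> 'a set \<Rightarrow> ('a \<times> int \<times> 'a) set" where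
  "DR_basic X T U n m V =
     {(y, int n - int m, x) | y x.
        y \<in> topspace X \<inter> U \<and> x \<in> topspace X \<inter> V \<and> (T ^^ n) y = (T ^^ m) x}"

definition DR_groupoid :: "'a topology \<Rightarrow> ('a \<Rightarrow> 'a) \<Rightarrow> ('a \<times> int \<times> 'a) top_groupoid" where
  "DR_groupoid X T =
     \<lparr>gtop = topology_generated_by {DR_basic X T U n m V | U n m V. openin X U \<and> openin X V},
      gdom = (\<lambda>(y, n, x). (x, 0, x)),
      gran = (\<lambda>(y, n, x). (y, 0, y)),
      gmult = (\<lambda>(z, n, y) (y', m, x). (z, n + m, x)),
      ginv = (\<lambda>(y, n, x). (x, - n, y))\<rparr>"

lemma arrows_DR_groupoid:
  "arrows (DR_groupoid X T) =
     {(y, int n - int m, x) | y n m x.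
        y \<in> topspace X \<and> x \<in> topspace X \<and> (T ^^ n) y = (T ^^ m) x}"
proof -
  have "arrows (DR_groupoid X T) =
      \<Union> {DR_basic X T U n m V | U n m V. openin X U \<and> openin X V}"
    by (simp add: DR_groupoid_def)
  also have "\<dots> = (\<Union>n m. DR_basic X T (topspace X) n m (topspace X))" (is "?L = ?R")
  proof
    have *: "DR_basic X T U n m V \<subseteq> DR_basic X T (topspace X) n m (topspace X)" for U n m V
      unfolding DR_basic_def by blast
    show "?L \<subseteq> ?R"
    proof (rule Union_least)
      fix B
      assume "B \<in> {DR_basic X T U n m V | U n m V. openin X U \<and> openin X V}"
      then obtain U n m V where "B = DR_basic X T U n m V" by blast
      then show "B \<subseteq> ?R" using *[of U n m V] by blast
    qed
    show "?R \<subseteq> ?L"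
      by (intro UN_least Union_upper) (use openin_topspace[of X] in blast)
  qed
  also have "\<dots> = {(y, int n - int m, x) | y n m x.
      y \<in> topspace X \<and> x \<in> topspace X \<and> (T ^^ n) y = (T ^^ m) x}"
    by (auto simp: DR_basic_def)
  finally show ?thesis .
qed

definition DR_cocycle :: "'a \<times> int \<times> 'a \<Rightarrow> int" where
  "DR_cocycle = (\<lambda>(y, n, x). n)"

definition DR_kernel :: "'a topology \<Rightarrow> ('a \<Rightarrow> 'a) \<Rightarrow> ('a \<times> int \<times> 'a) top_groupoid" where
  "DR_kernel X T = restrict_groupoid (DR_groupoid X T) (DR_cocycle -` {0})"

definition topologically_free :: "'a topology \<Rightarrow> ('a \<Rightarrow> 'a) \<Rightarrow> bool" where
  "topologically_free X T \<longleftrightarrow> topologically_principal (DR_groupoid X T)"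

definition continuous_orbit_map ::
  "'a topology \<Rightarrow> ('a \<Rightarrow> 'a) \<Rightarrow> 'b topology \<Rightarrow> ('b \<Rightarrow> 'b) \<Rightarrow>
   ('a \<Rightarrow> nat) \<Rightarrow> ('a \<Rightarrow> nat) \<Rightarrow> ('a \<Rightarrow> 'b) \<Rightarrow> bool" where
  "continuous_orbit_map X T Y S l k h \<longleftrightarrow>
     continuous_map X (discrete_topology UNIV) l \<and>
     continuous_map X (discrete_topology UNIV) k \<and>
     continuous_map X Y h \<and>
     (\<forall>x\<in>topspace X. (S ^^ l x) (h x) = (S ^^ k x) (h (T x)))"

definition continuous_orbit_equivalence ::
  "'a topology \<Rightarrow> ('a \<Rightarrow> 'a) \<Rightarrow> 'b topology \<Rightarrow> ('b \<Rightarrow> 'b) \<Rightarrow>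
   ('a \<Rightarrow> nat) \<Rightarrow> ('a \<Rightarrow> nat) \<Rightarrow> ('b \<Rightarrow> nat) \<Rightarrow> ('b \<Rightarrow> nat) \<Rightarrow> ('a \<Rightarrow> 'b) \<Rightarrow> bool" where
  "continuous_orbit_equivalence X T Y S l k l' k' h \<longleftrightarrow>
     homeomorphic_map X Y h \<and>
     continuous_orbit_map X T Y S l k h \<and>
     continuous_orbit_map Y S X T l' k' (inv_into (topspace X) h)"

definition flip_eventually_conjugate ::
  "'a topology \<Rightarrow> ('a \<Rightarrow> 'a) \<Rightarrow> 'b topology \<Rightarrow> ('b \<Rightarrow> 'b) \<Rightarrow> bool" where
  "flip_eventually_conjugate X T Y S \<longleftrightarrow>
     (\<exists>l k l' k' h. continuous_orbit_equivalence X T Y S l k l' k' h \<and>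
        ((\<forall>x\<in>topspace X. int (l x) - int (k x) = 1) \<and>
         (\<forall>y\<in>topspace Y. int (l' y) - int (k' y) = 1) \<or>
         (\<forall>x\<in>topspace X. int (l x) - int (k x) = - 1) \<and>
         (\<forall>y\<in>topspace Y. int (l' y) - int (k' y) = - 1)))"

end

theory Submission
  imports Defs
begin

text \<open>
  Everything except the equivalence of (3) and (4) is about cocycles: near an arrow \<open>(y, n - m, x)\<close> the groupoid is
  described by the fixed exponents \<open>n\<close>, \<open>m\<close>, so orbit maps with constant \<open>l - k = e\<close> correspond to continuous
  homomorphisms multiplying the cocycle by \<open>e\<close>; and if the kernel is topologically transitive, an isomorphism
  preserving kernels changes the cocycle by a function that is constant on levels, because arrows of equal degree
  can be linked by an arrow of the kernel.

  For (4) implies (3) the groupoid is recovered from its diagonal, as in Renault's theory of Cartan subalgebras.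
  An element \<open>n\<close> of the reduced algebra is a function on the groupoid. If it normalizes the diagonal and the units with
  trivial isotropy are dense, then \<open>{n \<noteq> 0}\<close> is an open bisection. A *-isomorphism that preserves the diagonals induces a
  homeomorphism \<open>h\<close> of the unit spaces and maps normalizers to normalizers. An arrow \<open>\<gamma>\<close> is sent to the unique arrow
  \<open>\<beta>\<close> with source \<open>h (d \<gamma>)\<close> and \<open>\<phi>(n)(\<beta>) \<noteq> 0\<close>, for any normalizer \<open>n\<close> with \<open>n(\<gamma>) \<noteq> 0\<close>. This is
  independent of \<open>n\<close> because diagonal elements \<open>f n\<^sup>* n'\<close> detect whether two normalizers share an arrow.
  Operators are handled through their matrix coefficients with respect to the delta functions; those of a convolution
  operator depend on \<open>\<gamma> \<beta>\<^sup>-\<^sup>1\<close> only.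
\<close>

section \<open>Functions on locally compact Hausdorff spaces\<close>

text \<open>The obstacle in recovering the groupoid is that the reduced algebra is a norm closure:
  its elements are not given as functions, and the convolution of two of them is an infinite sum.
  The way out is \<open>conv_ops\<close>, the operators whose matrix comes from a single function.
  This set is norm closed and stable under products and adjoints, \<open>coef\<close> is injective
  on it, and the operator norm bounds every coefficient. Infinite sums are then handled in two ways:
  on a bisection at most one term survives, and the value of \<open>adjoint_op a\<close> times
  \<open>a\<close> at a unit is a squared norm, so it cannot vanish by cancellation. Arrows of a
  normalizer with equal sources and different ranges are excluded algebraically; topological
  freeness excludes those that share source and range. Maps are treated together with their inverses
  as instances of one symmetric locale, so continuity of inverses and reverse inclusions come from
  exchanging the roles. The integers have two automorphisms, the signs, which is where the two cases
  of flip eventual conjugacy come from.\<close>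

lemma continuous_map_euclidean_atin:
  "continuous_map X euclidean f \<longleftrightarrow> (\<forall>x\<in>topspace X. (f \<longlongrightarrow> f x) (atin X x))"
  by (simp add: continuous_map_atin)

lemma closedin_norm_ge:
  assumes "continuous_map X euclidean (f :: 'a \<Rightarrow> complex)"
  shows "closedin X {x\<in>topspace X. e \<le> cmod (f x)}"
proof -
  have "continuous_map X euclideanreal (\<lambda>x. cmod (f x))"
    using assms by (simp add: continuous_map_euclidean_atin tendsto_norm)
  then have "closedin X {x\<in>topspace X. cmod (f x) \<in> {e..}}"
    by (rule closedin_continuous_map_preimage) simp
  then show ?thesis by simp
qed

lemma openin_nonzero:
  assumes "continuous_map X euclidean (f :: 'a \<Rightarrow> complex)"
  shows "openin X {x\<in>topspace X. f x \<noteq> 0}"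
  using openin_continuous_map_preimage[OF assms, of "- {0}"] by (simp add: open_Compl)

text \<open>Preimages of sets containing \<open>0\<close> pick up the complement of
  \<open>K\<close>, which is open because \<open>K\<close> is closed in the whole space. Quotients
  and convolutions below are given by a formula on an open set only, and this extends them.\<close>

lemma continuous_map_extend_by_zero:
  fixes f :: "'a \<Rightarrow> 'b::{zero,topological_space}"
  assumes f: "continuous_map (subtopology X U) euclidean f"
    and U: "openin X U" and K: "closedin X K" "K \<subseteq> U" and z: "\<And>x. x \<notin> K \<Longrightarrow> f x = 0"
  shows "continuous_map X euclidean f"
proof (clarsimp simp: continuous_map)
  fix V :: "'b set"
  assume V: "open V"
  have "openin (subtopology X U) {x\<in>topspace (subtopology X U). f x \<in> V}"
    using openin_continuous_map_preimage[OF f] V by simp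
  then have W: "openin X {x\<in>U. f x \<in> V}"
    using U by (metis (no_types, lifting) Collect_cong openin_trans_full
        topspace_subtopology_subset openin_subset)
  have "openin X ({x\<in>U. f x \<in> V} \<union> (if 0 \<in> V then topspace X - K else {}))"
    using W K(1) by (auto intro: openin_Un openin_diff)
  moreover have "{x\<in>U. f x \<in> V} \<union> (if 0 \<in> V then topspace X - K else {})
      = {x\<in>topspace X. f x \<in> V}"
    using K z openin_subset[OF U] by (auto split: if_splits) (metis subsetD)
  ultimately show "openin X {x\<in>topspace X. f x \<in> V}" by simp
qed

text \<open>A compact set in a Hausdorff space is closed, so it contains the closure of the support
  once it contains the support. An arbitrary compact \<open>K\<close> avoids computing closures for
  sums, products and images.\<close>

lemma C_c_iff:
  assumes "Hausdorff_space X"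
  shows "f \<in> C_c X \<longleftrightarrow>
    continuous_map X euclidean f \<and> (\<exists>K. compactin X K \<and> (\<forall>x. x \<notin> K \<longrightarrow> f x = 0))"
proof
  assume f: "f \<in> C_c X"
  have "f x = 0" if "x \<notin> X closure_of {x\<in>topspace X. f x \<noteq> 0}" for x
    using f that in_closure_of[of x X] unfolding C_c_def by blast
  then show "continuous_map X euclidean f \<and> (\<exists>K. compactin X K \<and> (\<forall>x. x \<notin> K \<longrightarrow> f x = 0))"
    using f unfolding C_c_def by blast
next
  assume "continuous_map X euclidean f \<and> (\<exists>K. compactin X K \<and> (\<forall>x. x \<notin> K \<longrightarrow> f x = 0))"
  then obtain K where f: "continuous_map X euclidean f"
    and K: "compactin X K" "\<And>x. x \<notin> K \<Longrightarrow> f x = 0"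
    by blast
  have cl: "closedin X K" using assms K(1) by (rule compactin_imp_closedin)
  have "X closure_of {x\<in>topspace X. f x \<noteq> 0} \<subseteq> K"
    by (rule closure_of_minimal) (use K cl in auto)
  then have "compactin X (X closure_of {x\<in>topspace X. f x \<noteq> 0})"
    using closed_compactin[OF K(1)] closedin_closure_of by blast
  moreover have "f x = 0" if "x \<notin> topspace X" for x
    using K that compactin_subset_topspace[OF K(1)] by blast
  ultimately show "f \<in> C_c X"
    using f unfolding C_c_def by simp
qed

text \<open>A compact subset of \<open>U\<close> is closed in \<open>X\<close>, so extension by zero
  is continuous. It is applied to the unit space and to open subgroupoids.\<close>

lemma C_c_open_subtopology_iff:
  assumes H: "Hausdorff_space X" and U: "openin X U"
  shows "f \<in> C_c (subtopology X U) \<longleftrightarrow>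
    continuous_map X euclidean f \<and> (\<exists>K. compactin X K \<and> K \<subseteq> U \<and> (\<forall>x. x \<notin> K \<longrightarrow> f x = 0))"
    (is "?L \<longleftrightarrow> ?R")
proof
  assume ?L
  then obtain K where f: "continuous_map (subtopology X U) euclidean f"
    and K: "compactin X K" "K \<subseteq> U" "\<And>x. x \<notin> K \<Longrightarrow> f x = 0"
    using C_c_iff[OF Hausdorff_space_subtopology[OF H]] by (auto simp: compactin_subtopology)
  have "continuous_map X euclidean f"
    using continuous_map_extend_by_zero[OF f U compactin_imp_closedin[OF H K(1)] K(2,3)] .
  with K show ?R by blast
next
  assume ?R
  then show ?L
    unfolding C_c_iff[OF Hausdorff_space_subtopology[OF H]] compactin_subtopology
    using continuous_map_from_subtopology by blast
qed

lemma C_c_open_subtopology: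
  assumes "Hausdorff_space X" "openin X U"
  shows "C_c (subtopology X U) \<subseteq> C_c X"
  using C_c_open_subtopology_iff[OF assms] C_c_iff[OF assms(1)] by blast

section \<open>Algebraic operations on functions vanishing at infinity\<close>

lemma C_0_I:
  assumes f: "continuous_map X euclidean f" and z: "\<And>x. x \<notin> topspace X \<Longrightarrow> f x = 0"
    and K: "\<And>e. e > 0 \<Longrightarrow> \<exists>K. compactin X K \<and> {x\<in>topspace X. e \<le> cmod (f x)} \<subseteq> K"
  shows "f \<in> C_0 X"
proof -
  have "compactin X {x\<in>topspace X. cmod (f x) \<ge> e}" if "e > 0" for e
  proof -
    obtain K where "compactin X K" "{x\<in>topspace X. e \<le> cmod (f x)} \<subseteq> K" using K[OF \<open>e > 0\<close>] by blast
    then show ?thesis using closed_compactin closedin_norm_ge[OF f] by blast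
  qed
  then show ?thesis using f z unfolding C_0_def by simp
qed

lemma C_0_bounded:
  assumes f: "f \<in> C_0 X"
  obtains B where "\<And>x. cmod (f x) \<le> B" "B > 0"
proof -
  \<comment> \<open>The level \<open>1\<close> is arbitrary: compactness bounds \<open>f\<close> on
    \<open>?K\<close>, and off it \<open>f\<close> is already below \<open>1\<close>.\<close>
  let ?K = "{x\<in>topspace X. cmod (f x) \<ge> 1}"
  have c: "continuous_map X euclidean f" and K: "compactin X ?K"
    using f unfolding C_0_def by (blast intro: zero_less_one)+
  have "compactin euclidean (f ` ?K)" by (rule image_compactin[OF K c])
  then have "bounded (f ` ?K)" by (simp add: compact_imp_bounded)
  then obtain B where B: "\<And>x. x \<in> ?K \<Longrightarrow> cmod (f x) \<le> B" by (auto simp: bounded_iff)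
  have "cmod (f x) \<le> max B 1" for x
  proof (cases "x \<in> ?K")
    case True then show ?thesis using B by (simp add: le_max_iff_disj)
  next
    case False then show ?thesis using f unfolding C_0_def
      by (cases "x \<in> topspace X") (auto simp: le_max_iff_disj)
  qed
  then show thesis by (rule that) simp
qed

lemma C_c_subset_C_0:
  assumes "Hausdorff_space X" shows "C_c X \<subseteq> C_0 X"
proof
  fix f assume "f \<in> C_c X"
  then obtain K where f: "continuous_map X euclidean f" and K: "compactin X K" "\<And>x. x \<notin> K \<Longrightarrow> f x = 0"
    using C_c_iff[OF assms] by blast
  show "f \<in> C_0 X"
  proof (rule C_0_I[OF f])
    fix x assume "x \<notin> topspace X" then show "f x = 0"
      using K compactin_subset_topspace by blast
  next
    fix e :: real assume "e > 0"
    then have "{x\<in>topspace X. e \<le> cmod (f x)} \<subseteq> K" using K(2) by fastforce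
    with K(1) show "\<exists>K. compactin X K \<and> {x\<in>topspace X. e \<le> cmod (f x)} \<subseteq> K" by blast
  qed
qed

lemma C_0_add: assumes "f \<in> C_0 X" "g \<in> C_0 X" shows "(\<lambda>x. f x + g x) \<in> C_0 X"
proof (rule C_0_I)
  show "continuous_map X euclidean (\<lambda>x. f x + g x)"
    using assms unfolding C_0_def by (simp add: continuous_map_euclidean_atin tendsto_add)
  fix e :: real assume "e > 0"
  then have "e/2 > 0" by simp
  then have "compactin X ({x\<in>topspace X. e/2 \<le> cmod (f x)} \<union> {x\<in>topspace X. e/2 \<le> cmod (g x)})"
    using assms unfolding C_0_def by (intro compactin_Un) blast+
  moreover have "{x\<in>topspace X. e \<le> cmod (f x + g x)} \<subseteq> \<dots>"
    by (auto) (smt (verit) norm_triangle_ineq field_sum_of_halves)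
  ultimately show "\<exists>K. compactin X K \<and> {x\<in>topspace X. e \<le> cmod (f x + g x)} \<subseteq> K" by blast
qed (use assms in \<open>auto simp: C_0_def\<close>)

lemma C_0_mult_bounded:
  assumes f: "f \<in> C_0 X" and g: "continuous_map X euclidean g"
    and B: "\<And>x. x \<in> topspace X \<Longrightarrow> cmod (g x) \<le> B"
  shows "(\<lambda>x. f x * g x) \<in> C_0 X"
proof (rule C_0_I)
  show "continuous_map X euclidean (\<lambda>x. f x * g x)"
    using f g unfolding C_0_def by (simp add: continuous_map_euclidean_atin tendsto_mult)
  fix e :: real assume e: "e > 0"
  \<comment> \<open>\<open>B\<close> may be \<open>0\<close>, and on an empty space even negative;
    the maximum makes the divisor positive.\<close>
  let ?B = "max B 1"
  have "compactin X {x\<in>topspace X. e / ?B \<le> cmod (f x)}"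
    using f e unfolding C_0_def by (simp add: less_max_iff_disj)
  moreover have "{x\<in>topspace X. e \<le> cmod (f x * g x)} \<subseteq> \<dots>"
  proof clarsimp
    fix x assume x: "x \<in> topspace X" and "e \<le> cmod (f x * g x)"
    then have "e \<le> cmod (f x) * cmod (g x)" by (simp add: norm_mult)
    also have "\<dots> \<le> cmod (f x) * ?B"
      by (intro mult_left_mono) (use B[OF x] in auto)
    finally show "e / ?B \<le> cmod (f x)" by (simp add: divide_le_eq less_max_iff_disj)
  qed
  ultimately show "\<exists>K. compactin X K \<and> {x\<in>topspace X. e \<le> cmod (f x * g x)} \<subseteq> K" by blast
qed (use assms in \<open>auto simp: C_0_def\<close>)

lemma C_0_mult: assumes "f \<in> C_0 X" "g \<in> C_0 X" shows "(\<lambda>x. f x * g x) \<in> C_0 X"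
proof -
  obtain B where "\<And>x. cmod (g x) \<le> B" using C_0_bounded[OF assms(2)] by metis
  then show ?thesis
    by (intro C_0_mult_bounded[OF assms(1)]) (use assms(2) in \<open>auto simp: C_0_def\<close>)
qed

lemma C_0_scale: assumes "f \<in> C_0 X" shows "(\<lambda>x. c * f x) \<in> C_0 X"
  using C_0_mult_bounded[OF assms, of "\<lambda>_. c" "cmod c"] by (simp add: mult.commute)

lemma C_0_diff: assumes "f \<in> C_0 X" "g \<in> C_0 X" shows "(\<lambda>x. f x - g x) \<in> C_0 X"
  using C_0_add[OF assms(1) C_0_scale[OF assms(2), of "-1"]] by simp

lemma C_0_cnj: assumes "f \<in> C_0 X" shows "(\<lambda>x. cnj (f x)) \<in> C_0 X"
  using assms unfolding C_0_def
  by (auto simp: continuous_map_euclidean_atin intro: tendsto_cnj)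

lemma C_0_sum: assumes "finite I" "\<And>i. i \<in> I \<Longrightarrow> f i \<in> C_0 X"
  shows "(\<lambda>x. \<Sum>i\<in>I. f i x) \<in> C_0 X"
  using assms
proof (induction I rule: finite_induct)
  case empty then show ?case using C_0_def by fastforce
next
  case (insert i I)
  then show ?case using C_0_add[of "f i" X "\<lambda>x. \<Sum>i\<in>I. f i x"] by simp
qed

section \<open>Bump functions on locally compact Hausdorff spaces\<close>

lemma compact_open_neighbourhood:
  assumes lc: "locally_compact_space X" and H: "Hausdorff_space X"
    and K: "compactin X K" and U: "openin X U" "K \<subseteq> U"
  obtains W L where "openin X W" "compactin X L" "K \<subseteq> W" "W \<subseteq> L" "L \<subseteq> U"
proof -
  have "locally_compact_space (subtopology X U)"
    using locally_compact_space_open_subset[OF _ lc U(1)] H by blast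
  moreover have "compactin (subtopology X U) K"
    using K U(2) by (simp add: compactin_subtopology)
  ultimately obtain W L where "openin (subtopology X U) W" "compactin (subtopology X U) L" "K \<subseteq> W" "W \<subseteq> L"
    using locally_compact_space_compact_closed_compact[of "subtopology X U"]
      Hausdorff_space_subtopology[OF H] by metis
  with that U(1) show thesis
    by (metis compactin_subtopology openin_trans_full)
qed

text \<open>Two nested compact neighbourhoods are inserted between \<open>K\<close> and
  \<open>U\<close>: the bump is \<open>1\<close> on the inner one and \<open>0\<close> off the outer
  one. The open set \<open>W\<close> is part of the conclusion because splitting off a bump must
  leave a support that avoids a whole neighbourhood of \<open>K\<close>.\<close>

lemma bump_function:
  assumes lc: "locally_compact_space X" and H: "Hausdorff_space X"
    and K: "compactin X K" and U: "openin X U" "K \<subseteq> U"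
  obtains c :: "'a \<Rightarrow> real" and L W where "continuous_map X euclideanreal c" "\<And>x. 0 \<le> c x" "\<And>x. c x \<le> 1"
    "openin X W" "K \<subseteq> W" "\<And>x. x \<in> W \<Longrightarrow> c x = 1" "compactin X L" "L \<subseteq> U" "\<And>x. x \<notin> L \<Longrightarrow> c x = 0"
proof -
  obtain W L where W: "openin X W" "compactin X L" "K \<subseteq> W" "W \<subseteq> L" "L \<subseteq> U"
    using compact_open_neighbourhood[OF assms] .
  obtain W' L' where W': "openin X W'" "compactin X L'" "L \<subseteq> W'" "W' \<subseteq> L'" "L' \<subseteq> U"
    using compact_open_neighbourhood[OF lc H W(2) U(1) W(5)] .
  have "completely_regular_space X"
    using lc H locally_compact_Hausdorff_imp_regular_space locally_compact_regular_imp_completely_regular_space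
    by blast
  moreover have "closedin X (topspace X - W')" "disjnt (topspace X - W') L"
    using W' by (auto simp: disjnt_iff)
  ultimately obtain f where f: "continuous_map X (subtopology euclidean {0..1::real}) f"
      "f ` L \<subseteq> {1}" "f ` (topspace X - W') \<subseteq> {0}"
    using Urysohn_completely_regular_compact_closed[of 0 1 X L "topspace X - W'"] W(2)
    by (metis disjnt_sym zero_le_one)
  \<comment> \<open>Urysohn's function is uncontrolled outside the space, where the bump has to be
    \<open>0\<close>.\<close>
  define c where "c x = (if x \<in> topspace X then f x else 0)" for x
  have "continuous_map X euclideanreal f" and f01: "f \<in> topspace X \<rightarrow> {0..1}"
    using f(1) by (auto simp: continuous_map_in_subtopology)
  have "continuous_map X euclideanreal c"
    by (rule continuous_map_eq[OF \<open>continuous_map X euclideanreal f\<close>]) (simp add: c_def)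
  moreover have "0 \<le> c x" "c x \<le> 1" for x using f01 by (auto simp: c_def Pi_iff)
  moreover have "c x = 1" if "x \<in> W" for x
  proof -
    have "x \<in> topspace X" "x \<in> L" using that W openin_subset[OF W(1)] by auto
    then show ?thesis using f(2) by (auto simp: c_def)
  qed
  moreover have "c x = 0" if "x \<notin> L'" for x
  proof (cases "x \<in> topspace X")
    case True
    then have "x \<in> topspace X - W'" using that W' by blast
    then show ?thesis using f(3) True by (auto simp: c_def)
  qed (simp add: c_def)
  ultimately show thesis using W W' that by blast
qed

lemma bump_C_c:
  assumes "locally_compact_space X" "Hausdorff_space X" "x \<in> topspace X" "openin X U" "x \<in> U"
  obtains c K where "c \<in> C_c X" "c x = 1" "compactin X K" "K \<subseteq> U" "\<And>y. y \<notin> K \<Longrightarrow> c y = 0"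
proof -
  obtain c :: "'a \<Rightarrow> real" and L W where c: "continuous_map X euclideanreal c"
    "openin X W" "{x} \<subseteq> W" "\<And>x. x \<in> W \<Longrightarrow> c x = 1" "compactin X L" "L \<subseteq> U" "\<And>x. x \<notin> L \<Longrightarrow> c x = 0"
    using bump_function[of X "{x}" U] assms by (metis compactin_sing empty_subsetI insert_subset)
  have "continuous_map X euclidean (\<lambda>x. complex_of_real (c x))"
    using c(1) by (simp add: continuous_map_euclidean_atin tendsto_of_real)
  then have "(\<lambda>x. complex_of_real (c x)) \<in> C_c X"
    unfolding C_c_iff[OF assms(2)] using c by auto
  then show thesis using c that[of "\<lambda>x. complex_of_real (c x)" L] by auto
qed

text \<open>The bump is \<open>1\<close> where \<open>cmod (f x)\<close> is at least
  \<open>e\<close>; elsewhere the factor \<open>1 - c x\<close> can only decrease a value that is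
  already at most \<open>e\<close>.\<close>

lemma C_0_cutoff:
  assumes lc: "locally_compact_space X" and H: "Hausdorff_space X" and f: "f \<in> C_0 X" and e: "e > 0"
  obtains g where "g \<in> C_c X" "\<And>x. cmod (f x - g x) \<le> e"
proof -
  let ?K = "{x\<in>topspace X. cmod (f x) \<ge> e}"
  have K: "compactin X ?K" using f e unfolding C_0_def by blast
  obtain c :: "'a \<Rightarrow> real" and L W where c: "continuous_map X euclideanreal c" "\<And>x. 0 \<le> c x" "\<And>x. c x \<le> 1"
    "?K \<subseteq> W" "\<And>x. x \<in> W \<Longrightarrow> c x = 1" "compactin X L" "\<And>x. x \<notin> L \<Longrightarrow> c x = 0"
    using bump_function[OF lc H K openin_topspace] by (metis (no_types, lifting) mem_Collect_eq subsetI)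
  define g where "g x = f x * of_real (c x)" for x
  have "continuous_map X euclidean g"
    using f c(1) unfolding C_0_def g_def
    by (auto simp: continuous_map_euclidean_atin intro!: tendsto_mult tendsto_of_real)
  then have "g \<in> C_c X" unfolding C_c_iff[OF H] using c by (auto simp: g_def)
  moreover have "cmod (f x - g x) \<le> e" for x
  proof (cases "x \<in> ?K")
    case True then show ?thesis using c(4,5) e by (auto simp: g_def)
  next
    case False
    have "f x - g x = f x * of_real (1 - c x)" by (simp add: g_def algebra_simps)
    then have "cmod (f x - g x) = cmod (f x) * (1 - c x)"
      using c(2,3)[of x] by (simp add: norm_mult del: of_real_diff)
    also have "\<dots> \<le> cmod (f x) * 1" using c(2)[of x] by (intro mult_left_mono) auto
    also have "\<dots> \<le> e" using False f e by (cases "x \<in> topspace X") (auto simp: C_0_def)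
    finally show ?thesis .
  qed
  ultimately show thesis by (rule that)
qed

text \<open>No continuity is assumed: if the kernel had no common zero, it would contain \<open>C_c X\<close>, hence \<open>\<omega>\<close> would
  take the value 1 at some \<open>u\<close> with \<open>\<bar>u\<bar> \<le> 1/2\<close>, although \<open>v - u v = u\<close> for \<open>v = u / (1 - u)\<close>.\<close>

lemma C_0_character:
  assumes lc: "locally_compact_space X" and H: "Hausdorff_space X"
    and add: "\<And>f g. f \<in> C_0 X \<Longrightarrow> g \<in> C_0 X \<Longrightarrow> \<omega> (\<lambda>x. f x + g x) = \<omega> f + \<omega> g"
    and scale: "\<And>c f. f \<in> C_0 X \<Longrightarrow> \<omega> (\<lambda>x. c * f x) = c * \<omega> f"
    and mult: "\<And>f g. f \<in> C_0 X \<Longrightarrow> g \<in> C_0 X \<Longrightarrow> \<omega> (\<lambda>x. f x * g x) = \<omega> f * \<omega> g"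
    and nz: "f0 \<in> C_0 X" "\<omega> f0 \<noteq> (0::complex)"
  shows "\<exists>x\<in>topspace X. \<forall>f\<in>C_0 X. \<omega> f = f x"
proof -
  have diff: "\<omega> (\<lambda>x. f x - g x) = \<omega> f - \<omega> g" if "f \<in> C_0 X" "g \<in> C_0 X" for f g
    using add[OF that(1) C_0_scale[OF that(2), of "-1"]] scale[OF that(2), of "-1"] by simp
  \<comment> \<open>Normalised to \<open>\<omega> e = 1\<close>; at the end \<open>e x = 1\<close>
    turns proportionality to evaluation at \<open>x\<close> into equality.\<close>
  define e where "e x = inverse (\<omega> f0) * f0 x" for x
  have e: "e \<in> C_0 X" "\<omega> e = 1"
    using nz scale[OF nz(1), of "inverse (\<omega> f0)"] C_0_scale[OF nz(1)] unfolding e_def by auto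
  have "\<exists>x\<in>topspace X. \<forall>f\<in>C_0 X. \<omega> f = 0 \<longrightarrow> f x = 0"
  proof (rule ccontr)
    assume "\<not> ?thesis"
    then obtain k where k: "\<And>x. x \<in> topspace X \<Longrightarrow> k x \<in> C_0 X \<and> \<omega> (k x) = 0 \<and> k x x \<noteq> 0" by metis
    have zero: "\<omega> g = 0" if g: "continuous_map X euclidean g" and K: "compactin X K" "\<And>x. x \<notin> K \<Longrightarrow> g x = 0" for g K
    proof -
      let ?U = "\<lambda>x. {y\<in>topspace X. k x y \<noteq> 0}"
      have sub: "K \<subseteq> topspace X" using K(1) by (rule compactin_subset_topspace)
      have Uo: "openin X (?U x)" if "x \<in> K" for x
        using k[of x] that sub openin_nonzero[of X "k x"] unfolding C_0_def by blast
      have cov: "K \<subseteq> \<Union> (?U ` K)"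
      proof
        fix x assume x: "x \<in> K"
        then have "x \<in> ?U x" using k[of x] sub by auto
        with x show "x \<in> \<Union> (?U ` K)" by blast
      qed
      obtain \<V> where "finite \<V>" "\<V> \<subseteq> ?U ` K" "K \<subseteq> \<Union>\<V>"
        using compactinD[OF K(1) _ cov] Uo by (metis (no_types, lifting) imageE)
      then obtain F where F: "finite F" "F \<subseteq> K" "K \<subseteq> \<Union> (?U ` F)"
        using finite_subset_image[of \<V> ?U K] by blast
      \<comment> \<open>The sum of the squared absolute values stays in the kernel of
        \<open>\<omega>\<close>, an ideal, and is positive on \<open>K\<close> because at each point
        of \<open>K\<close> some \<open>k x\<close> does not vanish.\<close>
      define s where "s y = (\<Sum>x\<in>F. cnj (k x y) * k x y)" for y
      have sC: "s \<in> C_0 X"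
        unfolding s_def by (intro C_0_sum F C_0_mult C_0_cnj) (use F k sub in auto)
      have s0: "\<omega> s = 0" unfolding s_def using F(1,2)
      proof (induction F rule: finite_induct)
        case empty then show ?case using scale[OF nz(1), of 0] by simp
      next
        case (insert i I)
        have i: "k i \<in> C_0 X" "\<omega> (k i) = 0" using insert k sub by auto
        have "\<omega> (\<lambda>y. \<Sum>x\<in>insert i I. cnj (k x y) * k x y)
            = \<omega> (\<lambda>y. cnj (k i y) * k i y) + \<omega> (\<lambda>y. \<Sum>x\<in>I. cnj (k x y) * k x y)"
          using insert.hyps
          by (simp, intro add C_0_mult C_0_cnj i C_0_sum) (use insert k sub in auto)
        then show ?case using insert mult[OF C_0_cnj[OF i(1)] i(1)] i(2) by simp
      qed
      have s_re: "s y = of_real (\<Sum>x\<in>F. (cmod (k x y))\<^sup>2)" for y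
        unfolding s_def by (simp add: complex_norm_square[symmetric] mult.commute del: of_real_power)
      have snz: "s y \<noteq> 0" if "y \<in> K" for y
      proof -
        obtain x where "x \<in> F" "k x y \<noteq> 0" using F(3) \<open>y \<in> K\<close> by blast
        then have "(\<Sum>x\<in>F. (cmod (k x y))\<^sup>2) > 0" using F(1) by (intro sum_pos2[of F x]) auto
        then show ?thesis by (simp add: s_re del: of_real_sum)
      qed
      \<comment> \<open>\<open>s\<close> has no zero on \<open>K\<close>, so the quotient extends by
        zero and exhibits \<open>g\<close> as a multiple of \<open>s\<close>, whence
        \<open>\<omega> g = 0\<close>.\<close>
      define q where "q y = g y / s y" for y
      have Uo: "openin X {y\<in>topspace X. s y \<noteq> 0}" using sC openin_nonzero by (auto simp: C_0_def)
      have "continuous_map (subtopology X {y\<in>topspace X. s y \<noteq> 0}) euclidean q"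
      proof -
        have "continuous_map (subtopology X {y\<in>topspace X. s y \<noteq> 0}) euclidean g"
          "continuous_map (subtopology X {y\<in>topspace X. s y \<noteq> 0}) euclidean s"
          using g sC by (auto simp: C_0_def intro: continuous_map_from_subtopology)
        then show ?thesis unfolding q_def
          by (auto simp: continuous_map_euclidean_atin intro!: tendsto_divide)
      qed
      then have "continuous_map X euclidean q"
        by (rule continuous_map_extend_by_zero[OF _ Uo compactin_imp_closedin[OF H K(1)]])
          (use snz sub K in \<open>auto simp: q_def\<close>)
      then have "q \<in> C_c X" unfolding C_c_iff[OF H] using K by (auto simp: q_def)
      then have qC: "q \<in> C_0 X" using C_c_subset_C_0[OF H] by blast
      have "g = (\<lambda>y. q y * s y)" using snz K by (fastforce simp: q_def)
      then show ?thesis using mult[OF qC sC] s0 by simp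
    qed
    \<comment> \<open>Any bound below \<open>1\<close> would do; \<open>1/2\<close> keeps
      \<open>1 - u\<close> away from zero, with inverse at most \<open>2\<close>.\<close>
    obtain g where g: "g \<in> C_c X" "\<And>x. cmod (e x - g x) \<le> 1/2"
      using C_0_cutoff[OF lc H e(1), of "1/2"] by auto
    define u where "u x = e x - g x" for x
    have gC: "g \<in> C_0 X" using g(1) C_c_subset_C_0[OF H] by blast
    have uC: "u \<in> C_0 X" unfolding u_def by (intro C_0_diff e gC)
    have "\<omega> g = 0" using g(1) zero unfolding C_c_iff[OF H] by blast
    then have u1: "\<omega> u = 1" unfolding u_def using diff[OF e(1) gC] e(2) by simp
    have ub: "cmod (u x) \<le> 1/2" for x unfolding u_def by (rule g(2))
    have nz1: "1 - u x \<noteq> 0" for x using ub[of x] by auto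
    have inv: "continuous_map X euclidean (\<lambda>x. inverse (1 - u x))"
      using uC nz1 unfolding C_0_def
      by (auto simp: continuous_map_euclidean_atin intro!: tendsto_inverse tendsto_diff)
    have invb: "cmod (inverse (1 - u x)) \<le> 2" for x
    proof -
      have "cmod (1 - u x) \<ge> 1/2" using ub[of x] norm_triangle_ineq2[of 1 "u x"] by simp
      then have "inverse (cmod (1 - u x)) \<le> inverse (1/2)" by (intro le_imp_inverse_le) auto
      then show ?thesis by (simp add: norm_inverse)
    qed
    define v where "v x = u x * inverse (1 - u x)" for x
    have vC: "v \<in> C_0 X" unfolding v_def by (rule C_0_mult_bounded[OF uC inv invb])
    have "u = (\<lambda>x. v x - u x * v x)"
    proof
      fix x show "u x = v x - u x * v x"
      proof -
        have "v x - u x * v x = u x * (inverse (1 - u x) * (1 - u x))"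
          by (simp add: v_def algebra_simps)
        then show ?thesis using nz1[of x] by simp
      qed
    qed
    then have "\<omega> u = \<omega> v - \<omega> u * \<omega> v"
      using diff[OF vC C_0_mult[OF uC vC]] mult[OF uC vC] by simp
    with u1 show False by simp
  qed
  then obtain x where x: "x \<in> topspace X" "\<And>f. f \<in> C_0 X \<Longrightarrow> \<omega> f = 0 \<Longrightarrow> f x = 0" by blast
  \<comment> \<open>Subtracting \<open>\<omega> f\<close> times \<open>e\<close> from
    \<open>f\<close> gives an element of the kernel, which vanishes at \<open>x\<close>. For
    \<open>f = e * e\<close> this makes \<open>e x\<close> idempotent, and a bump at
    \<open>x\<close> shows that it is nonzero.\<close>
  have val: "f x = \<omega> f * e x" if f: "f \<in> C_0 X" for f
    using x(2)[OF C_0_diff[OF f C_0_scale[OF e(1)]], of "\<omega> f"]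
      diff[OF f C_0_scale[OF e(1)], of "\<omega> f"] scale[OF e(1), of "\<omega> f"] e(2) by simp
  obtain c where "c \<in> C_c X" "c x = 1" using bump_C_c[OF lc H x(1) openin_topspace x(1)] by metis
  then have "e x \<noteq> 0" using val C_c_subset_C_0[OF H] by fastforce
  moreover have "e x * e x = e x"
    using val[OF C_0_mult[OF e(1) e(1)]] mult[OF e(1) e(1)] e(2) by simp
  ultimately have "e x = 1" by simp
  with val x(1) show ?thesis by auto
qed

section \<open>Gelfand duality for isomorphisms between algebras of functions\<close>

lemma C_0_separates_points:
  assumes lc: "locally_compact_space X" and H: "Hausdorff_space X" and x: "x \<in> topspace X" "x' \<in> topspace X"
    and eq: "\<And>f. f \<in> C_0 X \<Longrightarrow> f x = f x'"
  shows "x = x'"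
proof (rule ccontr)
  assume "x \<noteq> x'"
  then have U: "openin X (topspace X - {x'})" "x \<in> topspace X - {x'}"
    using x closedin_Hausdorff_sing_eq[OF H] by auto
  obtain c K where c: "c \<in> C_c X" "c x = 1" "K \<subseteq> topspace X - {x'}" "\<And>y. y \<notin> K \<Longrightarrow> c y = 0"
    using bump_C_c[OF lc H x(1) U] by metis
  then have "c x' = 0" by blast
  with c show False using eq[of c] C_c_subset_C_0[OF H] by auto
qed

text \<open>The sets where a function in \<open>C_0 B\<close> is nonzero form a base of
  \<open>B\<close>, and the preimage of such a set under \<open>k\<close> is the set where a
  continuous function \<open>\<theta> c\<close> is nonzero.\<close>

lemma continuous_map_if_C_0_pullback:
  assumes lc: "locally_compact_space B" and H: "Hausdorff_space B"
    and k: "\<And>x. x \<in> topspace A \<Longrightarrow> k x \<in> topspace B"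
    and th: "\<And>f. f \<in> C_0 B \<Longrightarrow> \<theta> f \<in> C_0 A" "\<And>x f. x \<in> topspace A \<Longrightarrow> f \<in> C_0 B \<Longrightarrow> \<theta> f x = f (k x)"
  shows "continuous_map A B k"
  unfolding continuous_map_eq_topcontinuous_at topcontinuous_at_def
proof (intro ballI conjI allI impI)
  fix x assume x: "x \<in> topspace A"
  then show "x \<in> topspace A" "k \<in> topspace A \<rightarrow> topspace B" using k by auto
  fix V assume V: "openin B V \<and> k x \<in> V"
  obtain c K where c: "c \<in> C_c B" "c (k x) = 1" "K \<subseteq> V" "\<And>y. y \<notin> K \<Longrightarrow> c y = 0"
    using bump_C_c[OF lc H k[OF x]] V by metis
  have C: "c \<in> C_0 B" using c C_c_subset_C_0[OF H] by blast
  let ?U = "{y\<in>topspace A. \<theta> c y \<noteq> 0}"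
  have "openin A ?U" using openin_nonzero[of A "\<theta> c"] th(1)[OF C] unfolding C_0_def by blast
  moreover have "x \<in> ?U" using x c th(2)[OF x C] by simp
  moreover have "\<forall>y\<in>?U. k y \<in> V"
  proof
    fix y assume "y \<in> ?U"
    then have "c (k y) \<noteq> 0" using th(2)[OF _ C] by auto
    then show "k y \<in> V" using c by blast
  qed
  ultimately show "\<exists>U. openin A U \<and> x \<in> U \<and> (\<forall>y\<in>U. k y \<in> V)" by blast
qed

text \<open>Evaluation at \<open>y\<close> after \<open>\<theta>\<close> is a nonzero character of
  \<open>C_0 X\<close>, hence evaluation at a point \<open>g y\<close>. The inverse of
  \<open>\<theta>\<close> gives \<open>h\<close> in the same way; the two maps are mutually inverse
  because \<open>C_0\<close> separates points.\<close>

lemma C_0_isomorphism_induces_homeomorphism: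
  assumes lcX: "locally_compact_space X" and HX: "Hausdorff_space X"
    and lcY: "locally_compact_space Y" and HY: "Hausdorff_space Y"
    and bij: "bij_betw \<theta> (C_0 X) (C_0 Y)"
    and add: "\<And>f g. f \<in> C_0 X \<Longrightarrow> g \<in> C_0 X \<Longrightarrow> \<theta> (\<lambda>x. f x + g x) = (\<lambda>y. \<theta> f y + \<theta> g y)"
    and scale: "\<And>c f. f \<in> C_0 X \<Longrightarrow> \<theta> (\<lambda>x. c * f x) = (\<lambda>y. c * \<theta> f y)"
    and mult: "\<And>f g. f \<in> C_0 X \<Longrightarrow> g \<in> C_0 X \<Longrightarrow> \<theta> (\<lambda>x. f x * g x) = (\<lambda>y. \<theta> f y * \<theta> g y)"
  obtains h where "homeomorphic_map X Y h" "\<And>f x. f \<in> C_0 X \<Longrightarrow> x \<in> topspace X \<Longrightarrow> \<theta> f (h x) = f x"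
proof -
  have im: "\<theta> f \<in> C_0 Y" if "f \<in> C_0 X" for f using bij that bij_betwE by blast
  define \<iota> where "\<iota> = inv_into (C_0 X) \<theta>"
  have \<iota>: "\<iota> k \<in> C_0 X" "\<theta> (\<iota> k) = k" if "k \<in> C_0 Y" for k
    using bij that unfolding \<iota>_def bij_betw_def
    by (metis inv_into_into, metis f_inv_into_f)
  have \<iota>\<theta>: "\<iota> (\<theta> f) = f" if "f \<in> C_0 X" for f
    using bij that unfolding \<iota>_def bij_betw_def by auto
  have iadd: "\<iota> (\<lambda>y. f y + g y) = (\<lambda>x. \<iota> f x + \<iota> g x)" if "f \<in> C_0 Y" "g \<in> C_0 Y" for f g
    using \<iota>\<theta>[OF C_0_add[OF \<iota>(1)[OF that(1)] \<iota>(1)[OF that(2)]]] add[OF \<iota>(1)[OF that(1)] \<iota>(1)[OF that(2)]]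
      \<iota>(2) that by simp
  have imult: "\<iota> (\<lambda>y. f y * g y) = (\<lambda>x. \<iota> f x * \<iota> g x)" if "f \<in> C_0 Y" "g \<in> C_0 Y" for f g
    using \<iota>\<theta>[OF C_0_mult[OF \<iota>(1)[OF that(1)] \<iota>(1)[OF that(2)]]] mult[OF \<iota>(1)[OF that(1)] \<iota>(1)[OF that(2)]]
      \<iota>(2) that by simp
  have iscale: "\<iota> (\<lambda>y. c * f y) = (\<lambda>x. c * \<iota> f x)" if "f \<in> C_0 Y" for f c
    using \<iota>\<theta>[OF C_0_scale[OF \<iota>(1)[OF that(1)]]] scale[OF \<iota>(1)[OF that(1)]]
      \<iota>(2) that by simp
  \<comment> \<open>A function with value \<open>1\<close> at the point certifies that the character
    obtained there is not zero.\<close>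
  have one: "\<exists>f\<in>C_0 X. f x = 1" if "x \<in> topspace X" for x
    using bump_C_c[OF lcX HX that openin_topspace that] C_c_subset_C_0[OF HX] by (metis subsetD)
  have one': "\<exists>f\<in>C_0 Y. f x = 1" if "x \<in> topspace Y" for x
    using bump_C_c[OF lcY HY that openin_topspace that] C_c_subset_C_0[OF HY] by (metis subsetD)
  have "\<exists>x\<in>topspace X. \<forall>f\<in>C_0 X. \<theta> f y = f x" if y: "y \<in> topspace Y" for y
  proof -
    obtain k where k: "k \<in> C_0 Y" "k y = 1" using one'[OF y] by blast
    show ?thesis
      by (rule C_0_character[OF lcX HX, of "\<lambda>f. \<theta> f y" "\<iota> k"]) (use k \<iota> add scale mult in auto)
  qed
  then obtain g where g: "\<And>y. y \<in> topspace Y \<Longrightarrow> g y \<in> topspace X"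
    "\<And>y f. y \<in> topspace Y \<Longrightarrow> f \<in> C_0 X \<Longrightarrow> \<theta> f y = f (g y)" by metis
  have "\<exists>y\<in>topspace Y. \<forall>f\<in>C_0 Y. \<iota> f x = f y" if x: "x \<in> topspace X" for x
  proof -
    obtain k where k: "k \<in> C_0 X" "k x = 1" using one[OF x] by blast
    show ?thesis
      by (rule C_0_character[OF lcY HY, of "\<lambda>f. \<iota> f x" "\<theta> k"]) (use k im \<iota>\<theta> iadd iscale imult in auto)
  qed
  then obtain h where h: "\<And>x. x \<in> topspace X \<Longrightarrow> h x \<in> topspace Y"
    "\<And>x f. x \<in> topspace X \<Longrightarrow> f \<in> C_0 Y \<Longrightarrow> \<iota> f x = f (h x)" by metis
  have hg: "h (g y) = y" if y: "y \<in> topspace Y" for y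
  proof (rule C_0_separates_points[OF lcY HY _ y])
    show "h (g y) \<in> topspace Y" using h g y by blast
    fix f assume "f \<in> C_0 Y" then show "f (h (g y)) = f y"
      using h(2)[OF g(1)[OF y]] g(2)[OF y] \<iota> by metis
  qed
  have gh: "g (h x) = x" if x: "x \<in> topspace X" for x
  proof (rule C_0_separates_points[OF lcX HX _ x])
    show "g (h x) \<in> topspace X" using h g x by blast
    fix f assume "f \<in> C_0 X" then show "f (g (h x)) = f x"
      using h(2)[OF x] g(2)[OF h(1)[OF x]] im \<iota>\<theta> by metis
  qed
  have "homeomorphic_maps X Y h g"
    unfolding homeomorphic_maps_def
    using continuous_map_if_C_0_pullback[OF lcY HY, of X h \<iota>] continuous_map_if_C_0_pullback[OF lcX HX, of Y g \<theta>]
      h g \<iota>(1) im hg gh by blast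
  then have "homeomorphic_map X Y h" using homeomorphic_map_maps by blast
  moreover have "\<theta> f (h x) = f x" if "f \<in> C_0 X" "x \<in> topspace X" for f x
    using g(2)[OF h(1)[OF that(2)] that(1)] gh[OF that(2)] by simp
  ultimately show thesis using that by blast
qed

section \<open>Matrix coefficients of operators on square-summable families\<close>

lemma summable_ell2: "(\<lambda>x. (cmod (ell2_fun f x))\<^sup>2) summable_on UNIV"
  using ell2_fun[of f] by simp

lemma norm_ell2_square: "(norm f)\<^sup>2 = (\<Sum>\<^sub>\<infinity>x. (cmod (ell2_fun f x))\<^sup>2)"
proof -
  have "f \<bullet> f = (\<Sum>\<^sub>\<infinity>x. (cmod (ell2_fun f x))\<^sup>2)"
    by transfer (simp add: power2_norm_eq_inner)
  then show ?thesis by (simp add: power2_norm_eq_inner)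
qed

lemma sum_le_norm_ell2:
  assumes "finite F" shows "(\<Sum>x\<in>F. (cmod (ell2_fun f x))\<^sup>2) \<le> (norm f)\<^sup>2"
  unfolding norm_ell2_square
  by (rule finite_sum_le_infsum[OF summable_ell2 assms]) auto

lemma cmod_le_norm_ell2: "cmod (ell2_fun f x) \<le> norm f"
proof (rule power2_le_imp_le)
  show "(cmod (ell2_fun f x))\<^sup>2 \<le> (norm f)\<^sup>2" using sum_le_norm_ell2[of "{x}" f] by simp
qed simp

lemma summable_cinner_ell2: "(\<lambda>x. ell2_fun f x * cnj (ell2_fun g x)) summable_on UNIV"
  by (rule square_summable_mult) (simp_all add: summable_ell2)

lemma inner_ell2_conv: "f \<bullet> g = Re (cinner_ell2 f g)"
proof -
  have "Re (cinner_ell2 f g) = (\<Sum>\<^sub>\<infinity>x. Re (ell2_fun f x * cnj (ell2_fun g x)))"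
    unfolding cinner_ell2_def by (rule infsum_Re[symmetric]) (rule summable_cinner_ell2)
  also have "\<dots> = f \<bullet> g" unfolding inner_ell2.rep_eq by (simp add: inner_complex_def)
  finally show ?thesis by simp
qed

lemma cinner_ell2_scaleC_right: "cinner_ell2 f (scaleC_ell2 c g) = cnj c * cinner_ell2 f g"
  unfolding cinner_ell2_def scaleC_ell2.rep_eq by (simp add: infsum_cmult_right' mult.left_commute)

lemma cinner_ell2_scaleC_left: "cinner_ell2 (scaleC_ell2 c f) g = c * cinner_ell2 f g"
  unfolding cinner_ell2_def scaleC_ell2.rep_eq by (simp add: infsum_cmult_right' mult.assoc)

lemma cinner_ell2_cnj: "cnj (cinner_ell2 f g) = cinner_ell2 g f"
  unfolding cinner_ell2_def by (simp add: infsum_cnj[symmetric] mult.commute)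

text \<open>The class instance supplies only a real inner product. Multiplying \<open>g\<close> by
  \<open>\<i>\<close> recovers the imaginary part, so additivity and the Cauchy-Schwarz inequality
  carry over from the real one.\<close>

lemma cinner_ell2_conv: "cinner_ell2 f g = Complex (f \<bullet> g) (f \<bullet> scaleC_ell2 \<i> g)"
  by (simp add: inner_ell2_conv cinner_ell2_scaleC_right complex_eq_iff)

lemma cinner_ell2_self: "cinner_ell2 f f = of_real ((norm f)\<^sup>2)"
proof -
  have "cinner_ell2 f f = of_real (Re (cinner_ell2 f f))"
    using cinner_ell2_cnj[of f f] by (auto simp: complex_eq_iff)
  then show ?thesis by (simp add: inner_ell2_conv[symmetric] power2_norm_eq_inner)
qed

lemma bounded_linear_cinner_ell2: "bounded_linear (\<lambda>f. cinner_ell2 f g)"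
proof (rule bounded_linear_intro)
  fix f h :: "'a ell2" and r :: real
  show "cinner_ell2 (f + h) g = cinner_ell2 f g + cinner_ell2 h g"
    by (simp add: cinner_ell2_conv inner_add_left complex_eq_iff)
  show "cinner_ell2 (r *\<^sub>R f) g = r *\<^sub>R cinner_ell2 f g"
    by (simp add: cinner_ell2_conv complex_eq_iff)
  \<comment> \<open>Real and imaginary parts are bounded separately, which costs a factor
    \<open>2\<close> but uses only the real Cauchy-Schwarz inequality.\<close>
  have "cmod (cinner_ell2 f g) \<le> \<bar>f \<bullet> g\<bar> + \<bar>f \<bullet> scaleC_ell2 \<i> g\<bar>"
    using cmod_le[of "cinner_ell2 f g"] by (simp add: cinner_ell2_conv)
  also have "\<dots> \<le> norm f * norm g + norm f * norm (scaleC_ell2 \<i> g)"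
    by (intro add_mono Cauchy_Schwarz_ineq2)
  finally show "cmod (cinner_ell2 f g) \<le> norm f * (2 * norm g)" by (simp add: norm_scaleC_ell2)
qed

lemma bounded_linear_ell2_fun: "bounded_linear (\<lambda>f. ell2_fun f x)"
  by (rule bounded_linear_intro[of _ 1])
    (simp_all add: plus_ell2.rep_eq scaleR_ell2.rep_eq cmod_le_norm_ell2)

section \<open>Delta functions, expansions and matrix coefficients\<close>

lift_definition delta_ell2 :: "'a \<Rightarrow> 'a ell2" is "\<lambda>x y. if y = x then 1 else 0"
proof -
  fix x :: 'a
  have "(\<lambda>y. (cmod (if y = x then 1 else 0))\<^sup>2) summable_on {x}" by simp
  then show "(\<lambda>y. (cmod (if y = x then 1 else 0))\<^sup>2) summable_on UNIV"
    by (rule summable_on_cong_neutral[THEN iffD1, rotated -1]) auto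
qed

lemma ell2_fun_delta: "ell2_fun (delta_ell2 x) y = (if y = x then 1 else 0)"
  by (simp add: delta_ell2.rep_eq)

lemma cinner_ell2_delta_right: "cinner_ell2 f (delta_ell2 x) = ell2_fun f x"
proof -
  have "cinner_ell2 f (delta_ell2 x) = (\<Sum>\<^sub>\<infinity>y\<in>{x}. ell2_fun f y)"
    unfolding cinner_ell2_def by (rule infsum_cong_neutral) (auto simp: ell2_fun_delta)
  then show ?thesis by simp
qed

lemma cinner_ell2_delta_left: "cinner_ell2 (delta_ell2 x) f = cnj (ell2_fun f x)"
  using cinner_ell2_cnj[of f "delta_ell2 x"] cinner_ell2_delta_right[of f x] by simp

lemma norm_delta_ell2: "norm (delta_ell2 x) = 1"
proof -
  have "complex_of_real ((norm (delta_ell2 x))\<^sup>2) = 1"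
    by (simp only: cinner_ell2_self[symmetric] cinner_ell2_delta_right ell2_fun_delta if_True refl)
  then have "(norm (delta_ell2 x))\<^sup>2 = 1" by (simp only: of_real_eq_1_iff)
  then show ?thesis by (simp add: power2_eq_1_iff) (metis norm_ge_zero le_minus_one_simps(3))
qed

definition restrict_ell2 :: "'a set \<Rightarrow> 'a ell2 \<Rightarrow> 'a ell2" where
  "restrict_ell2 F f = (\<Sum>x\<in>F. scaleC_ell2 (ell2_fun f x) (delta_ell2 x))"

lemma ell2_fun_sum: "ell2_fun (\<Sum>i\<in>I. f i) x = (\<Sum>i\<in>I. ell2_fun (f i) x)"
  by (induction I rule: infinite_finite_induct) (auto simp: zero_ell2.rep_eq plus_ell2.rep_eq)

lemma ell2_fun_restrict:
  assumes "finite F"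
  shows "ell2_fun (restrict_ell2 F f) x = (if x \<in> F then ell2_fun f x else 0)"
  using assms by (simp add: restrict_ell2_def ell2_fun_sum scaleC_ell2.rep_eq ell2_fun_delta if_distrib
      cong: if_cong)

text \<open>Pythagoras: the squared distance from \<open>f\<close> to its truncation is the full sum
  of squares minus the partial sum over \<open>F\<close>.\<close>

lemma restrict_ell2_tendsto: "((\<lambda>F. restrict_ell2 F f) \<longlongrightarrow> f) (finite_subsets_at_top UNIV)"
proof -
  let ?g = "\<lambda>x. (cmod (ell2_fun f x))\<^sup>2"
  have "(sum ?g \<longlongrightarrow> (norm f)\<^sup>2) (finite_subsets_at_top UNIV)"
    unfolding norm_ell2_square by (rule infsum_tendsto[OF summable_ell2])
  then have "((\<lambda>F. sqrt ((norm f)\<^sup>2 - sum ?g F)) \<longlongrightarrow> sqrt ((norm f)\<^sup>2 - (norm f)\<^sup>2)) (finite_subsets_at_top UNIV)"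
    by (intro tendsto_intros)
  moreover have "\<forall>\<^sub>F F in finite_subsets_at_top UNIV. sqrt ((norm f)\<^sup>2 - sum ?g F) = norm (restrict_ell2 F f - f)"
  proof (rule eventually_finite_subsets_at_top_weakI)
    fix F :: "'a set" assume F: "finite F"
    have "(norm (restrict_ell2 F f - f))\<^sup>2 = (\<Sum>\<^sub>\<infinity>x\<in>UNIV - F. ?g x)"
      unfolding norm_ell2_square by (rule infsum_cong_neutral)
        (auto simp: minus_ell2.rep_eq ell2_fun_restrict[OF F])
    also have "\<dots> = (norm f)\<^sup>2 - sum ?g F"
      unfolding norm_ell2_square
      using infsum_Diff[OF summable_ell2[of f] summable_on_finite[OF F]] F by simp
    finally show "sqrt ((norm f)\<^sup>2 - sum ?g F) = norm (restrict_ell2 F f - f)"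
      using real_sqrt_unique by fastforce
  qed
  ultimately have "((\<lambda>F. norm (restrict_ell2 F f - f)) \<longlongrightarrow> 0) (finite_subsets_at_top UNIV)"
    using tendsto_cong by fastforce
  then show ?thesis by (simp add: tendsto_norm_zero_iff LIM_zero_iff)
qed

text \<open>Truncations converge in norm, so a bounded functional is determined by its values on
  delta functions. \<open>bounded_linear\<close> means linearity over the reals; complex homogeneity
  is a separate assumption.\<close>

lemma functional_has_sum:
  fixes l :: "'a ell2 \<Rightarrow> complex"
  assumes l: "bounded_linear l" and hom: "\<And>c f. l (scaleC_ell2 c f) = c * l f"
  shows "((\<lambda>x. ell2_fun f x * l (delta_ell2 x)) has_sum l f) UNIV"
proof -
  interpret bounded_linear l by fact
  have "((\<lambda>F. l (restrict_ell2 F f)) \<longlongrightarrow> l f) (finite_subsets_at_top UNIV)"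
    by (rule tendsto[OF restrict_ell2_tendsto])
  moreover have "(\<lambda>F. l (restrict_ell2 F f)) = sum (\<lambda>x. ell2_fun f x * l (delta_ell2 x))"
    by (simp add: restrict_ell2_def sum hom fun_eq_iff)
  ultimately show ?thesis by (simp add: has_sum_def)
qed

text \<open>Bounded operators here are linear over the reals, so complex linearity is recorded
  separately. Domain and codomain may differ because groupoid isomorphisms later give operators
  between different spaces.\<close>

definition complex_linear :: "('a ell2 \<Rightarrow>\<^sub>L 'b ell2) \<Rightarrow> bool" where
  "complex_linear A \<longleftrightarrow> (\<forall>c \<xi>. blinfun_apply A (scaleC_ell2 c \<xi>) = scaleC_ell2 c (blinfun_apply A \<xi>))"

definition mcoef :: "('a ell2 \<Rightarrow>\<^sub>L 'b ell2) \<Rightarrow> 'b \<Rightarrow> 'a \<Rightarrow> complex" where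
  "mcoef A \<gamma> \<beta> = ell2_fun (blinfun_apply A (delta_ell2 \<beta>)) \<gamma>"

lemma bounded_linear_mcoef: "bounded_linear (\<lambda>A. mcoef A \<gamma> \<beta>)"
  unfolding mcoef_def
  by (rule bounded_linear_compose[OF bounded_linear_ell2_fun blinfun.bounded_linear_left])

lemma mcoef_add: "mcoef (A + B) \<gamma> \<beta> = mcoef A \<gamma> \<beta> + mcoef B \<gamma> \<beta>"
  by (simp add: mcoef_def blinfun.add_left plus_ell2.rep_eq)

lemma mcoef_diff: "mcoef (A - B) \<gamma> \<beta> = mcoef A \<gamma> \<beta> - mcoef B \<gamma> \<beta>"
  by (simp add: mcoef_def blinfun.diff_left minus_ell2.rep_eq)

lemma mcoef_scale_op: "mcoef (scale_op c o\<^sub>L A) \<gamma> \<beta> = c * mcoef A \<gamma> \<beta>"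
  by (simp add: mcoef_def scale_op.rep_eq scaleC_ell2.rep_eq)

lemma mcoef_bound: "cmod (mcoef A \<gamma> \<beta>) \<le> norm A"
proof -
  have "cmod (mcoef A \<gamma> \<beta>) \<le> norm (blinfun_apply A (delta_ell2 \<beta>))"
    unfolding mcoef_def by (rule cmod_le_norm_ell2)
  also have "\<dots> \<le> norm A" using norm_blinfun[of A "delta_ell2 \<beta>"] by (simp add: norm_delta_ell2)
  finally show ?thesis .
qed

lemma apply_has_sum:
  assumes "complex_linear A"
  shows "((\<lambda>\<beta>. ell2_fun \<xi> \<beta> * mcoef A \<gamma> \<beta>) has_sum ell2_fun (blinfun_apply A \<xi>) \<gamma>) UNIV"
  unfolding mcoef_def
proof (rule functional_has_sum)
  show "bounded_linear (\<lambda>\<xi>. ell2_fun (blinfun_apply A \<xi>) \<gamma>)"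
    by (rule bounded_linear_compose[OF bounded_linear_ell2_fun blinfun.bounded_linear_right])
qed (use assms in \<open>simp add: complex_linear_def scaleC_ell2.rep_eq\<close>)

lemma complex_linear_eqI:
  assumes "complex_linear A" "complex_linear B" "\<And>\<gamma> \<beta>. mcoef A \<gamma> \<beta> = mcoef B \<gamma> \<beta>"
  shows "A = B"
proof (rule blinfun_eqI, rule ell2_eqI)
  fix \<xi> \<gamma>
  show "ell2_fun (blinfun_apply A \<xi>) \<gamma> = ell2_fun (blinfun_apply B \<xi>) \<gamma>"
    using apply_has_sum[OF assms(1), of \<xi> \<gamma>] apply_has_sum[OF assms(2), of \<xi> \<gamma>]
    by (simp add: assms(3) has_sum_unique)
qed

lemma complex_linear_compose:
  "complex_linear A \<Longrightarrow> complex_linear B \<Longrightarrow> complex_linear (A o\<^sub>L B)"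
  by (simp add: complex_linear_def)

lemma scaleC_ell2_add: "scaleC_ell2 c (f + g) = scaleC_ell2 c f + scaleC_ell2 c g"
  by transfer (simp add: algebra_simps)

lemma complex_linear_add: "complex_linear A \<Longrightarrow> complex_linear B \<Longrightarrow> complex_linear (A + B)"
  by (simp add: complex_linear_def blinfun.add_left scaleC_ell2_add)

lemma complex_linear_scale_op: "complex_linear (scale_op c)"
  unfolding complex_linear_def scale_op.rep_eq by transfer (simp add: mult.left_commute)

lemma complex_linear_uminus: "complex_linear A \<Longrightarrow> complex_linear (- A)"
  by (simp add: complex_linear_def blinfun.minus_left) (metis scaleC_ell2.rep_eq uminus_ell2.rep_eq ell2_eqI mult_minus_right)

lemma complex_linear_diff: "complex_linear A \<Longrightarrow> complex_linear B \<Longrightarrow> complex_linear (A - B)"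
  using complex_linear_add[OF _ complex_linear_uminus] by fastforce

text \<open>The condition is an intersection of equalizers of continuous maps of \<open>A\<close>;
  hence complex linearity survives the closures in the definitions of the algebras.\<close>

lemma closed_complex_linear: "closed {A :: 'a ell2 \<Rightarrow>\<^sub>L 'b ell2. complex_linear A}"
proof -
  have cl: "closed {A :: 'a ell2 \<Rightarrow>\<^sub>L 'b ell2. blinfun_apply A (scaleC_ell2 c \<xi>) = blinfun_apply (scale_op c) (blinfun_apply A \<xi>)}"
    for c and \<xi> :: "'a ell2"
    by (intro closed_Collect_eq continuous_intros)
  have "closed (\<Inter>c. \<Inter>\<xi>. {A :: 'a ell2 \<Rightarrow>\<^sub>L 'b ell2. blinfun_apply A (scaleC_ell2 c \<xi>) = blinfun_apply (scale_op c) (blinfun_apply A \<xi>)})"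
    by (intro closed_INT ballI cl)
  moreover have "{A :: 'a ell2 \<Rightarrow>\<^sub>L 'b ell2. complex_linear A} = (\<Inter>c. \<Inter>\<xi>. {A :: 'a ell2 \<Rightarrow>\<^sub>L 'b ell2. blinfun_apply A (scaleC_ell2 c \<xi>) = blinfun_apply (scale_op c) (blinfun_apply A \<xi>)})"
    by (auto simp: complex_linear_def scale_op.rep_eq)
  ultimately show ?thesis by simp
qed

lemma mcoef_compose_has_sum:
  assumes "complex_linear A"
  shows "((\<lambda>\<alpha>. mcoef A \<gamma> \<alpha> * mcoef B \<alpha> \<beta>) has_sum mcoef (A o\<^sub>L B) \<gamma> \<beta>) UNIV"
  using apply_has_sum[OF assms, of "blinfun_apply B (delta_ell2 \<beta>)" \<gamma>]
  by (simp add: mcoef_def mult.commute)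

text \<open>The adjoint is written down by its coordinates: the image of \<open>g\<close> must have
  the value \<open>b g x\<close> at \<open>x\<close>. The work lies in showing that this family is
  square-summable.\<close>

lemma adjoint_exists:
  assumes A: "complex_linear (A :: 'a op)"
  obtains B where "\<And>f g. cinner_ell2 (blinfun_apply A f) g = cinner_ell2 f (blinfun_apply B g)"
proof -
  define b where "b g x = cinner_ell2 g (blinfun_apply A (delta_ell2 x))" for g x
  have bsum: "(\<Sum>x\<in>F. (cmod (b g x))\<^sup>2) \<le> (2 * norm A * norm g)\<^sup>2" if F: "finite F" for F g
  proof -
    \<comment> \<open>Testing \<open>A\<close> on the finite vector with coordinates
      \<open>b g x\<close> produces the square of \<open>norm \<xi>\<close>; Cauchy-Schwarz bounds
      it by a multiple of \<open>norm \<xi>\<close>, and one factor cancels.\<close>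
    define \<xi> where "\<xi> = (\<Sum>x\<in>F. scaleC_ell2 (b g x) (delta_ell2 x))"
    have xi: "ell2_fun \<xi> x = (if x \<in> F then b g x else 0)" for x
      using F by (simp add: \<xi>_def ell2_fun_sum scaleC_ell2.rep_eq ell2_fun_delta if_distrib cong: if_cong)
    have "(norm \<xi>)\<^sup>2 = (\<Sum>\<^sub>\<infinity>x\<in>F. (cmod (b g x))\<^sup>2)"
      unfolding norm_ell2_square by (rule infsum_cong_neutral) (auto simp: xi)
    then have n: "(norm \<xi>)\<^sup>2 = (\<Sum>x\<in>F. (cmod (b g x))\<^sup>2)" using F by simp
    interpret c: bounded_linear "\<lambda>f. cinner_ell2 f g" by (rule bounded_linear_cinner_ell2)
    have "cinner_ell2 (blinfun_apply A \<xi>) g = (\<Sum>x\<in>F. b g x * cinner_ell2 (blinfun_apply A (delta_ell2 x)) g)"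
      using A by (simp add: \<xi>_def blinfun.sum_right c.sum complex_linear_def cinner_ell2_scaleC_left)
    also have "\<dots> = (\<Sum>x\<in>F. of_real ((cmod (b g x))\<^sup>2))"
    proof (rule sum.cong[OF refl])
      fix x
      have "cinner_ell2 (blinfun_apply A (delta_ell2 x)) g = cnj (b g x)"
        unfolding b_def by (simp add: cinner_ell2_cnj)
      then show "b g x * cinner_ell2 (blinfun_apply A (delta_ell2 x)) g = of_real ((cmod (b g x))\<^sup>2)"
        using complex_norm_square[of "b g x"] by simp
    qed
    finally have "of_real ((norm \<xi>)\<^sup>2) = cinner_ell2 (blinfun_apply A \<xi>) g" by (simp add: n)
    then have "(norm \<xi>)\<^sup>2 = blinfun_apply A \<xi> \<bullet> g" unfolding inner_ell2_conv by (metis Re_complex_of_real)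
    also have "\<dots> \<le> norm (blinfun_apply A \<xi>) * norm g" by (rule norm_cauchy_schwarz)
    also have "\<dots> \<le> (norm A * norm \<xi>) * norm g" by (intro mult_right_mono norm_blinfun) simp
    finally have "norm \<xi> * norm \<xi> \<le> norm \<xi> * (norm A * norm g)" by (simp add: power2_eq_square algebra_simps)
    then have "norm \<xi> \<le> norm A * norm g" by (cases "norm \<xi> = 0") (auto simp: zero_le_mult_iff)
    also have "\<dots> \<le> 2 * norm A * norm g" by simp
    finally show ?thesis using n by (metis norm_ge_zero power_mono)
  qed
  have bsummable: "(\<lambda>x. (cmod (b g x))\<^sup>2) summable_on UNIV" for g
    by (rule nonneg_bdd_above_summable_on) (auto intro!: bdd_aboveI2 bsum)
  have bfun: "ell2_fun (Abs_ell2 (b g)) = b g" for g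
    by (rule Abs_ell2_inverse) (simp add: bsummable)
  have "bounded_linear (\<lambda>g. Abs_ell2 (b g))"
  proof (rule bounded_linear_intro[of _ "2 * norm A"])
    fix g h :: "'a ell2" and r :: real
    show "Abs_ell2 (b (g + h)) = Abs_ell2 (b g) + Abs_ell2 (b h)"
      using bounded_linear_cinner_ell2[THEN bounded_linear.linear, THEN linear_add]
      by (intro ell2_eqI) (simp add: plus_ell2.rep_eq bfun, simp add: b_def)
    show "Abs_ell2 (b (r *\<^sub>R g)) = r *\<^sub>R Abs_ell2 (b g)"
      using bounded_linear_cinner_ell2[THEN bounded_linear.linear, THEN linear_scale]
      by (intro ell2_eqI) (simp add: scaleR_ell2.rep_eq bfun, simp add: b_def)
    have "(norm (Abs_ell2 (b g)))\<^sup>2 \<le> (2 * norm A * norm g)\<^sup>2"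
      unfolding norm_ell2_square bfun by (rule infsum_le_finite_sums[OF bsummable]) (rule bsum)
    then have "norm (Abs_ell2 (b g)) \<le> 2 * norm A * norm g" by (rule power2_le_imp_le) simp
    then show "norm (Abs_ell2 (b g)) \<le> norm g * (2 * norm A)" by (simp add: mult.commute)
  qed
  then obtain B where B: "blinfun_apply B = (\<lambda>g. Abs_ell2 (b g))"
    using bounded_linear_Blinfun_apply by blast
  have "cinner_ell2 (blinfun_apply A f) g = cinner_ell2 f (blinfun_apply B g)" for f g
  proof -
    have "((\<lambda>x. ell2_fun f x * cinner_ell2 (blinfun_apply A (delta_ell2 x)) g) has_sum cinner_ell2 (blinfun_apply A f) g) UNIV"
      by (rule functional_has_sum[OF bounded_linear_compose[OF bounded_linear_cinner_ell2 blinfun.bounded_linear_right]])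
        (use A in \<open>simp add: complex_linear_def cinner_ell2_scaleC_left\<close>)
    then have "cinner_ell2 (blinfun_apply A f) g = (\<Sum>\<^sub>\<infinity>x. ell2_fun f x * cinner_ell2 (blinfun_apply A (delta_ell2 x)) g)"
      by (simp add: infsumI)
    also have "\<dots> = cinner_ell2 f (blinfun_apply B g)"
      unfolding cinner_ell2_def[of f] B bfun b_def by (simp add: cinner_ell2_cnj)
    finally show ?thesis .
  qed
  then show thesis by (rule that)
qed

text \<open>\<open>adjoint_op\<close> is a definite description. Testing against delta functions
  shows that at most one operator satisfies the adjoint relation, so exhibiting one computes
  it.\<close>

lemma adjoint_op_unique:
  assumes "\<And>f g. cinner_ell2 (blinfun_apply A f) g = cinner_ell2 f (blinfun_apply B g)"
  shows "adjoint_op A = B"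
  unfolding adjoint_op_def
proof (rule the_equality)
  fix C assume C: "\<forall>f g. cinner_ell2 (blinfun_apply A f) g = cinner_ell2 f (blinfun_apply C g)"
  show "C = B"
  proof (rule blinfun_eqI, rule ell2_eqI)
    fix g x
    have "cinner_ell2 (delta_ell2 x) (blinfun_apply C g) = cinner_ell2 (delta_ell2 x) (blinfun_apply B g)"
      using C assms by metis
    then show "ell2_fun (blinfun_apply C g) x = ell2_fun (blinfun_apply B g) x"
      by (simp add: cinner_ell2_delta_left)
  qed
qed (use assms in blast)

lemma cinner_adjoint_op:
  assumes "complex_linear A"
  shows "cinner_ell2 (blinfun_apply A f) g = cinner_ell2 f (blinfun_apply (adjoint_op A) g)"
  using adjoint_exists[OF assms] adjoint_op_unique by metis

lemma mcoef_adjoint_op: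
  assumes "complex_linear A" shows "mcoef (adjoint_op A) \<gamma> \<beta> = cnj (mcoef A \<beta> \<gamma>)"
  using cinner_adjoint_op[OF assms, of "delta_ell2 \<gamma>" "delta_ell2 \<beta>"]
  by (simp add: mcoef_def cinner_ell2_delta_left cinner_ell2_delta_right)

lemma complex_linear_adjoint_op:
  assumes A: "complex_linear A" shows "complex_linear (adjoint_op A)"
  unfolding complex_linear_def
proof (intro allI ell2_eqI)
  fix c \<xi> x
  have "cinner_ell2 (delta_ell2 x) (blinfun_apply (adjoint_op A) (scaleC_ell2 c \<xi>))
     = cinner_ell2 (delta_ell2 x) (scaleC_ell2 c (blinfun_apply (adjoint_op A) \<xi>))"
    by (simp add: cinner_adjoint_op[OF A, symmetric] cinner_ell2_scaleC_right)
  then show "ell2_fun (blinfun_apply (adjoint_op A) (scaleC_ell2 c \<xi>)) x = ell2_fun (scaleC_ell2 c (blinfun_apply (adjoint_op A) \<xi>)) x"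
    by (simp add: cinner_ell2_delta_left)
qed

text \<open>With \<open>v\<close> the image of \<open>g\<close>, the square of \<open>norm v\<close>
  is the inner product of \<open>A v\<close> with \<open>g\<close>, and one factor
  \<open>norm v\<close> cancels. This makes the adjoint continuous, so it passes to norm
  limits.\<close>

lemma norm_adjoint_op_le:
  assumes A: "complex_linear A" shows "norm (adjoint_op A) \<le> norm A"
proof (rule norm_blinfun_bound)
  fix g
  let ?v = "blinfun_apply (adjoint_op A) g"
  have "norm ?v * norm ?v = ?v \<bullet> ?v" by (simp add: power2_norm_eq_inner[symmetric] power2_eq_square)
  also have "\<dots> = blinfun_apply A ?v \<bullet> g" by (simp add: inner_ell2_conv cinner_adjoint_op[OF A])
  also have "\<dots> \<le> norm (blinfun_apply A ?v) * norm g" by (rule norm_cauchy_schwarz)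
  also have "\<dots> \<le> (norm A * norm ?v) * norm g" by (intro mult_right_mono norm_blinfun) simp
  finally have "norm ?v * norm ?v \<le> norm ?v * (norm A * norm g)" by (simp add: algebra_simps)
  then show "norm ?v \<le> norm A * norm g" by (cases "norm ?v = 0") auto
qed simp

lemma adjoint_op_diff:
  assumes "complex_linear A" "complex_linear B"
  shows "adjoint_op (A - B) = adjoint_op A - adjoint_op B"
  by (rule complex_linear_eqI)
    (simp_all add: assms complex_linear_diff complex_linear_adjoint_op mcoef_adjoint_op mcoef_diff)

lemma adjoint_op_adjoint_op:
  assumes "complex_linear A" shows "adjoint_op (adjoint_op A) = A"
  by (rule complex_linear_eqI) (simp_all add: assms complex_linear_adjoint_op mcoef_adjoint_op)

lemma adjoint_op_compose:
  assumes "complex_linear A" "complex_linear B"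
  shows "adjoint_op (A o\<^sub>L B) = adjoint_op B o\<^sub>L adjoint_op A"
  by (rule adjoint_op_unique) (simp add: cinner_adjoint_op assms)

text \<open>The entries are inner products of columns; for \<open>B = A\<close> those on the
  diagonal are squared norms.\<close>

lemma mcoef_adjoint_compose:
  assumes "complex_linear A"
  shows "mcoef (adjoint_op A o\<^sub>L B) \<gamma> \<beta> = cinner_ell2 (blinfun_apply B (delta_ell2 \<beta>)) (blinfun_apply A (delta_ell2 \<gamma>))"
proof -
  have "mcoef (adjoint_op A o\<^sub>L B) \<gamma> \<beta>
      = cnj (cinner_ell2 (delta_ell2 \<gamma>) (blinfun_apply (adjoint_op A) (blinfun_apply B (delta_ell2 \<beta>))))"
    by (simp add: mcoef_def cinner_ell2_delta_left)
  then show ?thesis by (simp add: cinner_adjoint_op[OF assms, symmetric] cinner_ell2_cnj)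
qed

text \<open>The basic operators below, from functions on bisections and from groupoid isomorphisms,
  have this form. Since \<open>p\<close> is injective where \<open>w\<close> does not vanish, each
  input coordinate is used at most once, so the bound on the weight bounds the norm.\<close>

lemma weighted_composition_operator:
  fixes p :: "'b \<Rightarrow> 'a" and w :: "'b \<Rightarrow> complex"
  assumes inj: "inj_on p {\<gamma>. w \<gamma> \<noteq> 0}" and B: "\<And>\<gamma>. cmod (w \<gamma>) \<le> B"
  obtains A :: "'a ell2 \<Rightarrow>\<^sub>L 'b ell2" where "complex_linear A" "norm A \<le> B"
    "\<And>\<xi> \<gamma>. ell2_fun (blinfun_apply A \<xi>) \<gamma> = w \<gamma> * ell2_fun \<xi> (p \<gamma>)"
proof -
  let ?S = "{\<gamma>. w \<gamma> \<noteq> 0}"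
  define a where "a \<xi> \<gamma> = w \<gamma> * ell2_fun \<xi> (p \<gamma>)" for \<xi> \<gamma>
  have B0: "B \<ge> 0" using B norm_ge_zero order_trans by blast
  have sum_p: "(\<lambda>\<gamma>. (cmod (ell2_fun \<xi> (p \<gamma>)))\<^sup>2) summable_on ?S" for \<xi>
    using summable_on_reindex[OF inj, of "\<lambda>x. (cmod (ell2_fun \<xi> x))\<^sup>2"]
      summable_on_subset_banach[OF summable_ell2, of "p ` ?S" \<xi>] by (simp add: o_def)
  have bound: "(cmod (a \<xi> \<gamma>))\<^sup>2 \<le> B\<^sup>2 * (cmod (ell2_fun \<xi> (p \<gamma>)))\<^sup>2" for \<xi> \<gamma>
    unfolding a_def norm_mult power_mult_distrib
    by (intro mult_right_mono power_mono B) auto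
  have "(\<lambda>\<gamma>. (cmod (a \<xi> \<gamma>))\<^sup>2) summable_on ?S" for \<xi>
    by (rule summable_on_comparison_test[OF summable_on_cmult_right[OF sum_p, of "B\<^sup>2"]]) (use bound in auto)
  then have summ: "(\<lambda>\<gamma>. (cmod (a \<xi> \<gamma>))\<^sup>2) summable_on UNIV" for \<xi>
    by (rule summable_on_cong_neutral[THEN iffD1, rotated -1]) (auto simp: a_def)
  have afun: "ell2_fun (Abs_ell2 (a \<xi>)) = a \<xi>" for \<xi>
    by (rule Abs_ell2_inverse) (simp add: summ)
  have nb: "norm (Abs_ell2 (a \<xi>)) \<le> norm \<xi> * B" for \<xi>
  proof -
    have "(norm (Abs_ell2 (a \<xi>)))\<^sup>2 = (\<Sum>\<^sub>\<infinity>\<gamma>\<in>?S. (cmod (a \<xi> \<gamma>))\<^sup>2)"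
      unfolding norm_ell2_square afun by (rule infsum_cong_neutral) (auto simp: a_def)
    also have "\<dots> \<le> (\<Sum>\<^sub>\<infinity>\<gamma>\<in>?S. B\<^sup>2 * (cmod (ell2_fun \<xi> (p \<gamma>)))\<^sup>2)"
      by (rule infsum_mono[OF _ summable_on_cmult_right[OF sum_p]])
        (use summable_on_subset_banach[OF summ] bound in auto)
    also have "\<dots> = B\<^sup>2 * (\<Sum>\<^sub>\<infinity>\<gamma>\<in>?S. (cmod (ell2_fun \<xi> (p \<gamma>)))\<^sup>2)" by (rule infsum_cmult_right')
    finally have 1: "(norm (Abs_ell2 (a \<xi>)))\<^sup>2 \<le> B\<^sup>2 * (\<Sum>\<^sub>\<infinity>\<gamma>\<in>?S. (cmod (ell2_fun \<xi> (p \<gamma>)))\<^sup>2)" .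
    have "(\<Sum>\<^sub>\<infinity>\<gamma>\<in>?S. (cmod (ell2_fun \<xi> (p \<gamma>)))\<^sup>2) = (\<Sum>\<^sub>\<infinity>x\<in>p ` ?S. (cmod (ell2_fun \<xi> x))\<^sup>2)"
      by (simp add: infsum_reindex[OF inj] o_def)
    also have "\<dots> \<le> (norm \<xi>)\<^sup>2"
      unfolding norm_ell2_square
      by (rule infsum_mono_neutral) (use summable_ell2[of \<xi>] in \<open>auto intro: summable_on_subset_banach\<close>)
    finally have "B\<^sup>2 * (\<Sum>\<^sub>\<infinity>\<gamma>\<in>?S. (cmod (ell2_fun \<xi> (p \<gamma>)))\<^sup>2) \<le> B\<^sup>2 * (norm \<xi>)\<^sup>2"
      by (rule mult_left_mono) simp
    with 1 have "(norm (Abs_ell2 (a \<xi>)))\<^sup>2 \<le> (norm \<xi> * B)\<^sup>2"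
      by (simp add: power_mult_distrib mult.commute)
    then show ?thesis by (rule power2_le_imp_le) (simp add: B0)
  qed
  have "bounded_linear (\<lambda>\<xi>. Abs_ell2 (a \<xi>))"
  proof (rule bounded_linear_intro[OF _ _ nb])
    show "Abs_ell2 (a (\<xi> + \<eta>)) = Abs_ell2 (a \<xi>) + Abs_ell2 (a \<eta>)" for \<xi> \<eta>
      by (rule ell2_eqI) (simp add: plus_ell2.rep_eq afun, simp add: a_def plus_ell2.rep_eq algebra_simps)
    show "Abs_ell2 (a (r *\<^sub>R \<xi>)) = r *\<^sub>R Abs_ell2 (a \<xi>)" for r \<xi>
      by (rule ell2_eqI) (simp add: scaleR_ell2.rep_eq afun, simp add: a_def scaleR_ell2.rep_eq)
  qed
  then obtain A where A: "blinfun_apply A = (\<lambda>\<xi>. Abs_ell2 (a \<xi>))"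
    using bounded_linear_Blinfun_apply by blast
  show thesis
  proof (rule that)
    show "ell2_fun (blinfun_apply A \<xi>) \<gamma> = w \<gamma> * ell2_fun \<xi> (p \<gamma>)" for \<xi> \<gamma>
      by (simp add: A afun a_def)
    then show "complex_linear A" unfolding complex_linear_def
      by (auto intro!: ell2_eqI simp: scaleC_ell2.rep_eq mult.left_commute)
    show "norm A \<le> B" by (rule norm_blinfun_bound[OF B0]) (metis A nb mult.commute)
  qed
qed

section \<open>Etale groupoids and their convolution operators\<close>

text \<open>Openness of \<open>q\<close> makes the local inverse continuous. This provides local
  sections of the source, of the range, and of the projection to the base space.\<close>

lemma continuous_map_section:
  assumes c: "continuous_map X Y q" and o: "open_map X Y q" and U: "openin X U" and inj: "inj_on q U"
  shows "continuous_map (subtopology Y (q ` U)) X (inv_into U q)"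
  unfolding continuous_map
proof (intro conjI allI impI)
  have UX: "U \<subseteq> topspace X" using U by (rule openin_subset)
  then show "inv_into U q ` topspace (subtopology Y (q ` U)) \<subseteq> topspace X"
    using inv_into_into[of _ q U] by auto
  fix V assume V: "openin X V"
  have qU: "q ` U \<subseteq> topspace Y" using o U open_map_def openin_subset by metis
  have "openin Y (q ` (U \<inter> V))" using o U V unfolding open_map_def by (blast intro: openin_Int)
  moreover have "{y \<in> topspace (subtopology Y (q ` U)). inv_into U q y \<in> V} = q ` (U \<inter> V)"
    using qU inj by auto
  ultimately show "openin (subtopology Y (q ` U)) {y \<in> topspace (subtopology Y (q ` U)). inv_into U q y \<in> V}"
    unfolding openin_subtopology by (intro exI[of _ "q ` (U \<inter> V)"]) auto
qed

text \<open>Continuity of multiplication is phrased with neighbourhoods of the two factors, which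
  avoids a topology on the set of composable pairs. The source is a local homeomorphism in the form
  continuous, open and locally injective; the range inherits this through inversion.\<close>

locale etale_groupoid =
  fixes G :: "('g, 'm) top_groupoid_scheme"
  assumes Hausdorff: "Hausdorff_space (gtop G)"
    and locally_compact: "locally_compact_space (gtop G)"
    and dom_closed: "\<gamma> \<in> arrows G \<Longrightarrow> gdom G \<gamma> \<in> arrows G"
    and ran_closed: "\<gamma> \<in> arrows G \<Longrightarrow> gran G \<gamma> \<in> arrows G"
    and dom_dom: "\<gamma> \<in> arrows G \<Longrightarrow> gdom G (gdom G \<gamma>) = gdom G \<gamma>"
    and ran_dom: "\<gamma> \<in> arrows G \<Longrightarrow> gran G (gdom G \<gamma>) = gdom G \<gamma>"
    and dom_ran: "\<gamma> \<in> arrows G \<Longrightarrow> gdom G (gran G \<gamma>) = gran G \<gamma>"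
    and ran_ran: "\<gamma> \<in> arrows G \<Longrightarrow> gran G (gran G \<gamma>) = gran G \<gamma>"
    and mult_closed: "\<lbrakk>\<alpha> \<in> arrows G; \<beta> \<in> arrows G; gdom G \<alpha> = gran G \<beta>\<rbrakk> \<Longrightarrow> gmult G \<alpha> \<beta> \<in> arrows G"
    and dom_mult: "\<lbrakk>\<alpha> \<in> arrows G; \<beta> \<in> arrows G; gdom G \<alpha> = gran G \<beta>\<rbrakk> \<Longrightarrow> gdom G (gmult G \<alpha> \<beta>) = gdom G \<beta>"
    and ran_mult: "\<lbrakk>\<alpha> \<in> arrows G; \<beta> \<in> arrows G; gdom G \<alpha> = gran G \<beta>\<rbrakk> \<Longrightarrow> gran G (gmult G \<alpha> \<beta>) = gran G \<alpha>"
    and assoc: "\<lbrakk>\<alpha> \<in> arrows G; \<beta> \<in> arrows G; \<gamma> \<in> arrows G; gdom G \<alpha> = gran G \<beta>; gdom G \<beta> = gran G \<gamma>\<rbrakk>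
        \<Longrightarrow> gmult G (gmult G \<alpha> \<beta>) \<gamma> = gmult G \<alpha> (gmult G \<beta> \<gamma>)"
    and mult_dom: "\<gamma> \<in> arrows G \<Longrightarrow> gmult G \<gamma> (gdom G \<gamma>) = \<gamma>"
    and ran_mult_self: "\<gamma> \<in> arrows G \<Longrightarrow> gmult G (gran G \<gamma>) \<gamma> = \<gamma>"
    and inv_closed: "\<gamma> \<in> arrows G \<Longrightarrow> ginv G \<gamma> \<in> arrows G"
    and dom_inv: "\<gamma> \<in> arrows G \<Longrightarrow> gdom G (ginv G \<gamma>) = gran G \<gamma>"
    and ran_inv: "\<gamma> \<in> arrows G \<Longrightarrow> gran G (ginv G \<gamma>) = gdom G \<gamma>"
    and inv_mult: "\<gamma> \<in> arrows G \<Longrightarrow> gmult G (ginv G \<gamma>) \<gamma> = gdom G \<gamma>"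
    and mult_inv: "\<gamma> \<in> arrows G \<Longrightarrow> gmult G \<gamma> (ginv G \<gamma>) = gran G \<gamma>"
    and continuous_dom: "continuous_map (gtop G) (gtop G) (gdom G)"
    and open_map_dom: "open_map (gtop G) (gtop G) (gdom G)"
    and dom_locally_injective: "\<gamma> \<in> arrows G \<Longrightarrow> \<exists>U. openin (gtop G) U \<and> \<gamma> \<in> U \<and> inj_on (gdom G) U"
    and continuous_inv: "continuous_map (gtop G) (gtop G) (ginv G)"
    and mult_neighbourhood:
      "\<lbrakk>\<alpha> \<in> arrows G; \<beta> \<in> arrows G; gdom G \<alpha> = gran G \<beta>; openin (gtop G) W; gmult G \<alpha> \<beta> \<in> W\<rbrakk> \<Longrightarrow>
        \<exists>U V. openin (gtop G) U \<and> openin (gtop G) V \<and> \<alpha> \<in> U \<and> \<beta> \<in> V \<and>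
          (\<forall>\<alpha>'\<in>U. \<forall>\<beta>'\<in>V. gdom G \<alpha>' = gran G \<beta>' \<longrightarrow> gmult G \<alpha>' \<beta>' \<in> W)"
begin

abbreviation "d \<equiv> gdom G"
abbreviation "r \<equiv> gran G"
abbreviation "iv \<equiv> ginv G"
abbreviation "Ar \<equiv> arrows G"
abbreviation mult (infixl "\<cdot>" 70) where "\<alpha> \<cdot> \<beta> \<equiv> gmult G \<alpha> \<beta>"

lemmas closed_simps = dom_closed ran_closed dom_dom ran_dom dom_ran ran_ran mult_closed dom_mult ran_mult
  mult_dom ran_mult_self inv_closed dom_inv ran_inv inv_mult mult_inv

lemma inv_mult_cancel: "\<lbrakk>\<alpha> \<in> Ar; \<beta> \<in> Ar; d \<alpha> = r \<beta>\<rbrakk> \<Longrightarrow> iv \<alpha> \<cdot> (\<alpha> \<cdot> \<beta>) = \<beta>"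
  using assoc[of "iv \<alpha>" \<alpha> \<beta>] by (simp add: closed_simps)

lemma mult_inv_cancel: "\<lbrakk>\<alpha> \<in> Ar; \<beta> \<in> Ar; r \<alpha> = r \<beta>\<rbrakk> \<Longrightarrow> \<alpha> \<cdot> (iv \<alpha> \<cdot> \<beta>) = \<beta>"
  using assoc[of \<alpha> "iv \<alpha>" \<beta>] by (simp add: closed_simps)

lemma mult_mult_inv: "\<lbrakk>\<alpha> \<in> Ar; \<beta> \<in> Ar; d \<alpha> = r \<beta>\<rbrakk> \<Longrightarrow> \<alpha> \<cdot> \<beta> \<cdot> iv \<beta> = \<alpha>"
  using assoc[of \<alpha> \<beta> "iv \<beta>"] by (simp add: closed_simps) (metis mult_dom)

lemma mult_inv_mult: "\<lbrakk>\<alpha> \<in> Ar; \<beta> \<in> Ar; d \<alpha> = d \<beta>\<rbrakk> \<Longrightarrow> \<alpha> \<cdot> iv \<beta> \<cdot> \<beta> = \<alpha>"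
  using assoc[of \<alpha> "iv \<beta>" \<beta>] by (simp add: closed_simps) (metis mult_dom)

lemma inv_inv: "\<gamma> \<in> Ar \<Longrightarrow> iv (iv \<gamma>) = \<gamma>"
  using inv_mult_cancel[of "iv \<gamma>" \<gamma>] mult_dom[of "iv (iv \<gamma>)"] by (simp add: closed_simps)

lemma inv_mult_distrib: "\<lbrakk>\<alpha> \<in> Ar; \<beta> \<in> Ar; d \<alpha> = r \<beta>\<rbrakk> \<Longrightarrow> iv (\<alpha> \<cdot> \<beta>) = iv \<beta> \<cdot> iv \<alpha>"
proof -
  assume a: "\<alpha> \<in> Ar" "\<beta> \<in> Ar" "d \<alpha> = r \<beta>"
  have "iv \<beta> \<cdot> iv \<alpha> = iv \<beta> \<cdot> iv \<alpha> \<cdot> ((\<alpha> \<cdot> \<beta>) \<cdot> iv (\<alpha> \<cdot> \<beta>))"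
    using a mult_dom[of "iv \<beta> \<cdot> iv \<alpha>"] by (simp add: closed_simps)
  also have "\<dots> = (iv \<beta> \<cdot> iv \<alpha> \<cdot> (\<alpha> \<cdot> \<beta>)) \<cdot> iv (\<alpha> \<cdot> \<beta>)"
    using a by (intro assoc[symmetric]) (simp_all add: closed_simps)
  also have "iv \<beta> \<cdot> iv \<alpha> \<cdot> (\<alpha> \<cdot> \<beta>) = d \<beta>"
    using a assoc[of "iv \<beta>" "iv \<alpha>" "\<alpha> \<cdot> \<beta>"] inv_mult_cancel[of \<alpha> \<beta>] by (simp add: closed_simps)
  also have "d \<beta> \<cdot> iv (\<alpha> \<cdot> \<beta>) = iv (\<alpha> \<cdot> \<beta>)"
    using a ran_mult_self[of "iv (\<alpha> \<cdot> \<beta>)"] by (simp add: closed_simps)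
  finally show ?thesis by simp
qed

definition units :: "'g set" where "units = d ` Ar"

lemma units_arrow: "x \<in> units \<Longrightarrow> x \<in> Ar"
  and units_dom: "x \<in> units \<Longrightarrow> d x = x"
  and units_ran: "x \<in> units \<Longrightarrow> r x = x"
  by (auto simp: units_def closed_simps)

lemma units_inv: "x \<in> units \<Longrightarrow> iv x = x"
  using ran_mult_self[of "iv x"] mult_inv[of x] units_arrow[of x] units_dom[of x] units_ran[of x]
  by (simp add: closed_simps)

lemma dom_in_units: "\<gamma> \<in> Ar \<Longrightarrow> d \<gamma> \<in> units" by (simp add: units_def)
lemma ran_in_units: "\<gamma> \<in> Ar \<Longrightarrow> r \<gamma> \<in> units"
  by (metis dom_in_units dom_ran ran_closed)

lemma openin_units: "openin (gtop G) units"
  using open_map_dom unfolding open_map_def units_def by blast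

lemma unit_space_eq: "unit_space G = subtopology (gtop G) units"
  by (simp add: unit_space_def units_def)

lemma topspace_unit_space: "topspace (unit_space G) = units"
  using openin_units openin_subset by (auto simp: unit_space_eq)

lemma Hausdorff_unit_space: "Hausdorff_space (unit_space G)"
  unfolding unit_space_eq by (rule Hausdorff_space_subtopology[OF Hausdorff])

lemma locally_compact_unit_space: "locally_compact_space (unit_space G)"
  unfolding unit_space_eq using locally_compact_space_open_subset Hausdorff locally_compact openin_units by blast

lemma homeomorphic_inv: "homeomorphic_map (gtop G) (gtop G) iv"
proof -
  have "homeomorphic_maps (gtop G) (gtop G) iv iv"
    unfolding homeomorphic_maps_def using continuous_inv inv_inv by blast
  then show ?thesis using homeomorphic_map_maps by blast
qed

lemma ran_eq: "\<gamma> \<in> Ar \<Longrightarrow> r \<gamma> = d (iv \<gamma>)" by (simp add: closed_simps)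

lemma continuous_ran: "continuous_map (gtop G) (gtop G) r"
  by (rule continuous_map_eq[OF continuous_map_compose[OF continuous_inv continuous_dom]])
    (simp add: ran_eq)

lemma open_map_ran: "open_map (gtop G) (gtop G) r"
proof -
  have "open_map (gtop G) (gtop G) (d \<circ> iv)"
    by (rule open_map_compose[OF homeomorphic_imp_open_map[OF homeomorphic_inv] open_map_dom])
  then show ?thesis
    by (rule open_map_eq) (simp add: ran_eq)
qed

definition bisection :: "'g set \<Rightarrow> bool" where
  "bisection U \<longleftrightarrow> openin (gtop G) U \<and> inj_on d U \<and> inj_on r U"

text \<open>Local injectivity is an axiom for the source; for the range it follows by passing to
  inverse arrows.\<close>

lemma bisection_neighbourhood:
  assumes g: "\<gamma> \<in> Ar" and W: "openin (gtop G) W" "\<gamma> \<in> W"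
  obtains U where "bisection U" "\<gamma> \<in> U" "U \<subseteq> W"
proof -
  obtain U where U: "openin (gtop G) U" "\<gamma> \<in> U" "inj_on d U" using dom_locally_injective[OF g] by blast
  obtain V where V: "openin (gtop G) V" "iv \<gamma> \<in> V" "inj_on d V"
    using dom_locally_injective[OF inv_closed[OF g]] by blast
  let ?V = "{\<gamma>\<in>Ar. iv \<gamma> \<in> V}"
  have "openin (gtop G) ?V" using continuous_inv V(1) by (rule openin_continuous_map_preimage)
  then have "openin (gtop G) (U \<inter> ?V \<inter> W)" using U W by (simp add: openin_Int)
  moreover have "inj_on r ?V"
  proof (rule inj_onI)
    fix a b assume ab: "a \<in> ?V" "b \<in> ?V" "r a = r b"
    then have "iv a = iv b" using V(3) by (auto simp: ran_eq inj_on_def)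
    then show "a = b" using ab by (metis (no_types, lifting) inv_inv mem_Collect_eq)
  qed
  ultimately have "bisection (U \<inter> ?V \<inter> W)"
    unfolding bisection_def using U(3) by (auto intro: inj_on_subset)
  then show thesis using that U V W g by blast
qed

text \<open>Bridge from the neighbourhood axiom to composed maps, such as a local section times the
  identity.\<close>

lemma continuous_map_mult:
  assumes a: "continuous_map Z (gtop G) a" and b: "continuous_map Z (gtop G) b"
    and ab: "\<And>z. z \<in> topspace Z \<Longrightarrow> d (a z) = r (b z)"
  shows "continuous_map Z (gtop G) (\<lambda>z. a z \<cdot> b z)"
  unfolding continuous_map_eq_topcontinuous_at topcontinuous_at_def
proof (intro ballI conjI allI impI)
  fix z assume z: "z \<in> topspace Z"
  have in_Ar: "a z \<in> Ar" "b z \<in> Ar" if "z \<in> topspace Z" for z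
    using that a b by (auto simp: continuous_map_def Pi_iff)
  show "z \<in> topspace Z" by fact
  show "(\<lambda>z. a z \<cdot> b z) \<in> topspace Z \<rightarrow> Ar" using in_Ar ab by (auto simp: closed_simps)
  fix W assume W: "openin (gtop G) W \<and> a z \<cdot> b z \<in> W"
  obtain U V where UV: "openin (gtop G) U" "openin (gtop G) V" "a z \<in> U" "b z \<in> V"
    "\<And>\<alpha> \<beta>. \<alpha> \<in> U \<Longrightarrow> \<beta> \<in> V \<Longrightarrow> d \<alpha> = r \<beta> \<Longrightarrow> \<alpha> \<cdot> \<beta> \<in> W"
    using mult_neighbourhood[OF in_Ar[OF z] ab[OF z]] W by metis
  let ?N = "{z\<in>topspace Z. a z \<in> U} \<inter> {z\<in>topspace Z. b z \<in> V}"
  have "openin Z ?N" using a b UV by (intro openin_Int openin_continuous_map_preimage)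
  then show "\<exists>N. openin Z N \<and> z \<in> N \<and> (\<forall>z\<in>N. a z \<cdot> b z \<in> W)"
    using z UV ab by (intro exI[of _ ?N]) auto
qed

section \<open>Convolution operators and their coefficients\<close>

definition conv_kernel :: "('g \<Rightarrow> complex) \<Rightarrow> 'g \<Rightarrow> 'g \<Rightarrow> complex" where
  "conv_kernel f \<gamma> \<beta> = (if \<gamma> \<in> Ar \<and> \<beta> \<in> Ar \<and> d \<gamma> = d \<beta> then f (\<gamma> \<cdot> iv \<beta>) else 0)"

text \<open>The substitution that passes between the convolution sum over arrows with the range of
  \<open>\<gamma>\<close> and the matrix product over arrows with its source.\<close>

lemma bij_betw_ran_fibre_dom_fibre:
  assumes "\<gamma> \<in> Ar"
  shows "bij_betw (\<lambda>\<alpha>. iv \<alpha> \<cdot> \<gamma>) {\<alpha>\<in>Ar. r \<alpha> = r \<gamma>} {\<beta>\<in>Ar. d \<beta> = d \<gamma>}"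
proof (rule bij_betw_byWitness[where f' = "\<lambda>\<beta>. \<gamma> \<cdot> iv \<beta>"])
  show "\<forall>a\<in>{\<alpha>\<in>Ar. r \<alpha> = r \<gamma>}. \<gamma> \<cdot> iv (iv a \<cdot> \<gamma>) = a"
    using assms by (auto simp: inv_mult_distrib closed_simps inv_inv mult_inv_cancel)
  show "\<forall>a'\<in>{\<beta>\<in>Ar. d \<beta> = d \<gamma>}. iv (\<gamma> \<cdot> iv a') \<cdot> \<gamma> = a'"
    using assms by (auto simp: inv_mult_distrib closed_simps inv_inv mult_inv_mult)
qed (use assms in \<open>auto simp: closed_simps\<close>)

lemma convolution_delta:
  "convolution G f (ell2_fun (delta_ell2 \<beta>)) \<gamma> = conv_kernel f \<gamma> \<beta>"
proof (cases "\<gamma> \<in> Ar \<and> \<beta> \<in> Ar \<and> d \<gamma> = d \<beta>")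
  case True
  have "convolution G f (ell2_fun (delta_ell2 \<beta>)) \<gamma>
      = (\<Sum>\<^sub>\<infinity>\<alpha>\<in>{\<gamma> \<cdot> iv \<beta>}. f \<alpha> * ell2_fun (delta_ell2 \<beta>) (iv \<alpha> \<cdot> \<gamma>))"
    unfolding convolution_def using True
    by (simp del: infsum_finite, intro infsum_cong_neutral)
      (auto simp: closed_simps ell2_fun_delta inv_mult_distrib inv_inv mult_inv_cancel)
  then show ?thesis using True
    by (simp add: conv_kernel_def ell2_fun_delta inv_mult_distrib closed_simps inv_inv mult_inv_mult)
next
  case False
  then show ?thesis unfolding convolution_def conv_kernel_def
    by (auto simp: ell2_fun_delta closed_simps intro!: infsum_0)
qed

lemma convolution_scale: "convolution G f (\<lambda>x. c * \<xi> x) \<gamma> = c * convolution G f \<xi> \<gamma>"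
  unfolding convolution_def by (simp add: infsum_cmult_right' mult.left_commute)

text \<open>The expansion in delta functions turns the matrix product into the convolution sum, so
  the matrix alone decides whether a bounded operator is convolution by \<open>f\<close>.\<close>

lemma left_regular_iff:
  "A \<in> left_regular G F \<longleftrightarrow> complex_linear A \<and> (\<exists>f\<in>F. \<forall>\<gamma> \<beta>. mcoef A \<gamma> \<beta> = conv_kernel f \<gamma> \<beta>)"
proof
  assume "A \<in> left_regular G F"
  then obtain f where f: "f \<in> F" and A: "\<And>\<xi>. ell2_fun (blinfun_apply A \<xi>) = convolution G f (ell2_fun \<xi>)"
    unfolding left_regular_def by blast
  have "complex_linear A" unfolding complex_linear_def
    by (intro allI ell2_eqI) (simp add: scaleC_ell2.rep_eq A convolution_scale)
  moreover have "mcoef A \<gamma> \<beta> = conv_kernel f \<gamma> \<beta>" for \<gamma> \<beta>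
    unfolding mcoef_def A by (rule convolution_delta)
  ultimately show "complex_linear A \<and> (\<exists>f\<in>F. \<forall>\<gamma> \<beta>. mcoef A \<gamma> \<beta> = conv_kernel f \<gamma> \<beta>)" using f by blast
next
  assume "complex_linear A \<and> (\<exists>f\<in>F. \<forall>\<gamma> \<beta>. mcoef A \<gamma> \<beta> = conv_kernel f \<gamma> \<beta>)"
  then obtain f where A: "complex_linear A" and f: "f \<in> F" and m: "\<And>\<gamma> \<beta>. mcoef A \<gamma> \<beta> = conv_kernel f \<gamma> \<beta>" by blast
  have "ell2_fun (blinfun_apply A \<xi>) \<gamma> = convolution G f (ell2_fun \<xi>) \<gamma>" for \<xi> \<gamma>
  proof -
    have eq: "ell2_fun (blinfun_apply A \<xi>) \<gamma> = (\<Sum>\<^sub>\<infinity>\<beta>. ell2_fun \<xi> \<beta> * conv_kernel f \<gamma> \<beta>)"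
      using apply_has_sum[OF A, of \<xi> \<gamma>] by (simp add: m infsumI)
    show ?thesis
    proof (cases "\<gamma> \<in> Ar")
      case False
      then show ?thesis unfolding eq by (simp add: conv_kernel_def convolution_def)
    next
      case True
      have "ell2_fun (blinfun_apply A \<xi>) \<gamma> = (\<Sum>\<^sub>\<infinity>\<beta>\<in>{\<beta>\<in>Ar. d \<beta> = d \<gamma>}. f (\<gamma> \<cdot> iv \<beta>) * ell2_fun \<xi> \<beta>)"
        unfolding eq by (rule infsum_cong_neutral) (use True in \<open>auto simp: conv_kernel_def\<close>)
      also have "\<dots> = (\<Sum>\<^sub>\<infinity>\<alpha>\<in>{\<alpha>\<in>Ar. r \<alpha> = r \<gamma>}. f (\<gamma> \<cdot> iv (iv \<alpha> \<cdot> \<gamma>)) * ell2_fun \<xi> (iv \<alpha> \<cdot> \<gamma>))"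
        by (rule infsum_reindex_bij_betw[OF bij_betw_ran_fibre_dom_fibre[OF True], symmetric])
      also have "\<dots> = convolution G f (ell2_fun \<xi>) \<gamma>"
        unfolding convolution_def using True
        by (auto simp: closed_simps inv_mult_distrib inv_inv mult_inv_cancel intro!: infsum_cong)
      finally show ?thesis .
    qed
  qed
  then show "A \<in> left_regular G F" unfolding left_regular_def using f by blast
qed

text \<open>The columns at units carry the function that an operator convolves with. The formula
  makes sense for every operator, in particular for norm limits.\<close>

definition coef :: "'g op \<Rightarrow> 'g \<Rightarrow> complex" where
  "coef A \<gamma> = (if \<gamma> \<in> Ar then mcoef A \<gamma> (d \<gamma>) else 0)"

text \<open>A closed set containing the reduced algebra, on which an operator is determined by its
  \<open>coef\<close>. Arguments about the completion become statements about functions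
  here.\<close>

definition conv_ops :: "'g op set" where
  "conv_ops = {A. complex_linear A \<and> (\<forall>\<gamma> \<beta>. mcoef A \<gamma> \<beta> = conv_kernel (coef A) \<gamma> \<beta>)}"

lemma conv_ops_linear: "A \<in> conv_ops \<Longrightarrow> complex_linear A"
  and conv_ops_mcoef: "A \<in> conv_ops \<Longrightarrow> mcoef A \<gamma> \<beta> = conv_kernel (coef A) \<gamma> \<beta>"
  by (auto simp: conv_ops_def)

lemma coef_outside: "\<gamma> \<notin> Ar \<Longrightarrow> coef A \<gamma> = 0" by (simp add: coef_def)

lemma coef_bound: "cmod (coef A \<gamma>) \<le> norm A"
  by (simp add: coef_def mcoef_bound)

lemma coef_diff: "coef (A - B) \<gamma> = coef A \<gamma> - coef B \<gamma>"
  by (simp add: coef_def mcoef_diff)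

lemma coef_add: "coef (A + B) = (\<lambda>\<gamma>. coef A \<gamma> + coef B \<gamma>)"
  by (simp add: coef_def mcoef_add fun_eq_iff)

lemma coef_scale_op: "coef (scale_op c o\<^sub>L A) = (\<lambda>\<gamma>. c * coef A \<gamma>)"
  by (simp add: coef_def mcoef_scale_op fun_eq_iff)

lemma conv_ops_eqI: "A \<in> conv_ops \<Longrightarrow> B \<in> conv_ops \<Longrightarrow> coef A = coef B \<Longrightarrow> A = B"
  by (rule complex_linear_eqI) (auto simp: conv_ops_def)

lemma conv_kernel_dom: "\<gamma> \<in> Ar \<Longrightarrow> conv_kernel f \<gamma> (d \<gamma>) = f \<gamma>"
  by (simp add: conv_kernel_def closed_simps units_inv dom_in_units)

lemma conv_opsI:
  assumes "complex_linear A" "\<And>\<gamma> \<beta>. mcoef A \<gamma> \<beta> = conv_kernel f \<gamma> \<beta>" "\<And>\<gamma>. \<gamma> \<notin> Ar \<Longrightarrow> f \<gamma> = 0"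
  shows "A \<in> conv_ops" "coef A = f"
proof -
  show c: "coef A = f" using assms by (auto simp: coef_def conv_kernel_dom fun_eq_iff)
  show "A \<in> conv_ops" using assms c by (simp add: conv_ops_def)
qed

lemma left_regular_eq:
  assumes "\<And>f \<gamma>. f \<in> F \<Longrightarrow> \<gamma> \<notin> Ar \<Longrightarrow> f \<gamma> = 0"
  shows "left_regular G F = {A\<in>conv_ops. coef A \<in> F}"
proof (intro Set.set_eqI iffI)
  fix A assume "A \<in> left_regular G F"
  then obtain f where "complex_linear A" "f \<in> F" "\<And>\<gamma> \<beta>. mcoef A \<gamma> \<beta> = conv_kernel f \<gamma> \<beta>"
    unfolding left_regular_iff by blast
  then show "A \<in> {A\<in>conv_ops. coef A \<in> F}" using conv_opsI assms by (metis (mono_tags, lifting) mem_Collect_eq)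
next
  fix A assume "A \<in> {A\<in>conv_ops. coef A \<in> F}"
  then show "A \<in> left_regular G F" unfolding left_regular_iff conv_ops_def by blast
qed

lemma left_regular_C_c: "left_regular G (C_c (gtop G)) = {A\<in>conv_ops. coef A \<in> C_c (gtop G)}"
  by (rule left_regular_eq) (simp add: C_c_def)

lemma diagonal_subalgebra_eq: "diagonal_subalgebra G = {A\<in>conv_ops. coef A \<in> C_0 (unit_space G)}"
  unfolding diagonal_subalgebra_def
  by (rule left_regular_eq) (auto simp: C_0_def topspace_unit_space dest: units_arrow)

text \<open>The condition equates matrix entries of \<open>A\<close> with one another or with
  \<open>0\<close>, and entries depend continuously on \<open>A\<close>.\<close>

lemma closed_conv_ops: "closed conv_ops"
proof -
  have eq: "conv_ops = {A. complex_linear A} \<inter> (\<Inter>\<gamma>. \<Inter>\<beta>. {A. mcoef A \<gamma> \<beta> =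
      (if \<gamma> \<in> Ar \<and> \<beta> \<in> Ar \<and> d \<gamma> = d \<beta> then mcoef A (\<gamma> \<cdot> iv \<beta>) (d (\<gamma> \<cdot> iv \<beta>)) else 0)})"
    by (auto simp: conv_ops_def conv_kernel_def coef_def closed_simps split: if_splits)
  have c: "continuous_on UNIV (\<lambda>A. mcoef A \<gamma> \<beta>)" for \<gamma> \<beta> :: 'g
    by (rule linear_continuous_on[OF bounded_linear_mcoef])
  have "closed {A. mcoef A \<gamma> \<beta> =
      (if \<gamma> \<in> Ar \<and> \<beta> \<in> Ar \<and> d \<gamma> = d \<beta> then mcoef A (\<gamma> \<cdot> iv \<beta>) (d (\<gamma> \<cdot> iv \<beta>)) else 0)}" for \<gamma> \<beta>
    by (cases "\<gamma> \<in> Ar \<and> \<beta> \<in> Ar \<and> d \<gamma> = d \<beta>") (auto intro!: closed_Collect_eq c continuous_on_const)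
  then show ?thesis unfolding eq by (intro closed_Int closed_complex_linear closed_INT ballI)
qed

lemma conv_ops_add: "A \<in> conv_ops \<Longrightarrow> B \<in> conv_ops \<Longrightarrow> A + B \<in> conv_ops"
  by (simp add: conv_ops_def complex_linear_add mcoef_add conv_kernel_def coef_add)

lemma conv_ops_scale_op: "A \<in> conv_ops \<Longrightarrow> scale_op c o\<^sub>L A \<in> conv_ops"
  by (simp add: conv_ops_def complex_linear_compose complex_linear_scale_op mcoef_scale_op conv_kernel_def coef_scale_op)

lemma coef_adjoint_op:
  assumes A: "A \<in> conv_ops" and g: "\<gamma> \<in> Ar" shows "coef (adjoint_op A) \<gamma> = cnj (coef A (iv \<gamma>))"
proof -
  have "coef (adjoint_op A) \<gamma> = cnj (mcoef A (d \<gamma>) \<gamma>)"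
    using g by (simp add: coef_def mcoef_adjoint_op conv_ops_linear[OF A])
  also have "mcoef A (d \<gamma>) \<gamma> = coef A (d \<gamma> \<cdot> iv \<gamma>)"
    using g by (simp add: conv_ops_mcoef[OF A] conv_kernel_def closed_simps)
  also have "d \<gamma> \<cdot> iv \<gamma> = iv \<gamma>" using ran_mult_self[of "iv \<gamma>"] g by (simp add: closed_simps)
  finally show ?thesis .
qed

lemma conv_ops_adjoint_op: assumes A: "A \<in> conv_ops" shows "adjoint_op A \<in> conv_ops"
proof -
  have "mcoef (adjoint_op A) \<gamma> \<beta> = conv_kernel (coef (adjoint_op A)) \<gamma> \<beta>" for \<gamma> \<beta>
    by (auto simp: mcoef_adjoint_op conv_ops_linear[OF A] conv_ops_mcoef[OF A] conv_kernel_def coef_adjoint_op[OF A]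
        closed_simps inv_mult_distrib inv_inv)
  then show ?thesis by (simp add: conv_ops_def complex_linear_adjoint_op conv_ops_linear[OF A])
qed

text \<open>The column of \<open>B\<close> at the unit \<open>d \<gamma>\<close> holds its
  coefficients, and a factorization of \<open>\<gamma>\<close> is determined by its right factor.
  The sum may be infinite.\<close>

lemma coef_compose_has_sum:
  assumes A: "A \<in> conv_ops" and B: "B \<in> conv_ops" and g: "\<gamma> \<in> Ar"
  shows "((\<lambda>\<beta>. coef A (\<gamma> \<cdot> iv \<beta>) * coef B \<beta>) has_sum coef (A o\<^sub>L B) \<gamma>) {\<beta>\<in>Ar. d \<beta> = d \<gamma>}"
proof -
  have "((\<lambda>\<beta>. mcoef A \<gamma> \<beta> * mcoef B \<beta> (d \<gamma>)) has_sum coef (A o\<^sub>L B) \<gamma>) UNIV"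
    using mcoef_compose_has_sum[OF conv_ops_linear[OF A], of \<gamma> B "d \<gamma>"] g by (simp add: coef_def)
  moreover have "((\<lambda>\<beta>. mcoef A \<gamma> \<beta> * mcoef B \<beta> (d \<gamma>)) has_sum s) UNIV
      \<longleftrightarrow> ((\<lambda>\<beta>. coef A (\<gamma> \<cdot> iv \<beta>) * coef B \<beta>) has_sum s) {\<beta>\<in>Ar. d \<beta> = d \<gamma>}" for s
    by (rule has_sum_cong_neutral)
      (use g in \<open>auto simp: conv_ops_mcoef[OF A] conv_ops_mcoef[OF B] conv_kernel_def coef_outside closed_simps units_inv dom_in_units,
        metis mult_dom\<close>)
  ultimately show ?thesis by simp
qed

lemma conv_ops_compose:
  assumes A: "A \<in> conv_ops" and B: "B \<in> conv_ops" shows "A o\<^sub>L B \<in> conv_ops"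
proof -
  have "mcoef (A o\<^sub>L B) \<gamma> \<beta> = conv_kernel (coef (A o\<^sub>L B)) \<gamma> \<beta>" for \<gamma> \<beta>
  proof -
    have s: "((\<lambda>\<alpha>. mcoef A \<gamma> \<alpha> * mcoef B \<alpha> \<beta>) has_sum mcoef (A o\<^sub>L B) \<gamma> \<beta>) UNIV"
      by (rule mcoef_compose_has_sum[OF conv_ops_linear[OF A]])
    show ?thesis
    proof (cases "\<gamma> \<in> Ar \<and> \<beta> \<in> Ar \<and> d \<gamma> = d \<beta>")
      case False
      then have "(\<lambda>\<alpha>. mcoef A \<gamma> \<alpha> * mcoef B \<alpha> \<beta>) = (\<lambda>_. 0)"
        by (auto simp: conv_ops_mcoef[OF A] conv_ops_mcoef[OF B] conv_kernel_def fun_eq_iff)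
      then have "mcoef (A o\<^sub>L B) \<gamma> \<beta> = 0" using s by (metis has_sum_0 has_sum_unique)
      then show ?thesis using False by (auto simp: conv_kernel_def)
    next
      case True
      then have gb: "\<gamma> \<cdot> iv \<beta> \<in> Ar" "d (\<gamma> \<cdot> iv \<beta>) = r \<beta>" by (simp_all add: closed_simps)
      \<comment> \<open>Right multiplication by \<open>\<beta>\<close> matches the factorizations of
        \<open>\<gamma> \<cdot> iv \<beta>\<close> with the indices of the matrix product at
        \<open>\<gamma>\<close> and \<open>\<beta>\<close>.\<close>
      have bij: "bij_betw (\<lambda>\<alpha>. \<alpha> \<cdot> \<beta>) {\<alpha>\<in>Ar. d \<alpha> = r \<beta>} {\<alpha>\<in>Ar. d \<alpha> = d \<beta>}"
        by (rule bij_betw_byWitness[where f' = "\<lambda>\<alpha>. \<alpha> \<cdot> iv \<beta>"])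
          (use True in \<open>auto simp: closed_simps mult_inv_mult mult_mult_inv\<close>)
      have "((\<lambda>\<alpha>. mcoef A \<gamma> \<alpha> * mcoef B \<alpha> \<beta>) has_sum s) UNIV
          \<longleftrightarrow> ((\<lambda>\<alpha>. coef A (\<gamma> \<cdot> iv \<alpha>) * coef B (\<alpha> \<cdot> iv \<beta>)) has_sum s) {\<alpha>\<in>Ar. d \<alpha> = d \<beta>}" for s
        by (rule has_sum_cong_neutral)
          (use True in \<open>auto simp: conv_ops_mcoef[OF A] conv_ops_mcoef[OF B] conv_kernel_def\<close>)
      with s have "((\<lambda>\<alpha>. coef A (\<gamma> \<cdot> iv \<alpha>) * coef B (\<alpha> \<cdot> iv \<beta>)) has_sum mcoef (A o\<^sub>L B) \<gamma> \<beta>) {\<alpha>\<in>Ar. d \<alpha> = d \<beta>}"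
        by simp
      then have "((\<lambda>\<alpha>. coef A (\<gamma> \<cdot> iv (\<alpha> \<cdot> \<beta>)) * coef B (\<alpha> \<cdot> \<beta> \<cdot> iv \<beta>)) has_sum mcoef (A o\<^sub>L B) \<gamma> \<beta>) {\<alpha>\<in>Ar. d \<alpha> = r \<beta>}"
        by (subst has_sum_reindex_bij_betw[OF bij])
      moreover have "((\<lambda>\<alpha>. coef A (\<gamma> \<cdot> iv (\<alpha> \<cdot> \<beta>)) * coef B (\<alpha> \<cdot> \<beta> \<cdot> iv \<beta>)) has_sum s) {\<alpha>\<in>Ar. d \<alpha> = r \<beta>}
         \<longleftrightarrow> ((\<lambda>\<alpha>. coef A (\<gamma> \<cdot> iv \<beta> \<cdot> iv \<alpha>) * coef B \<alpha>) has_sum s) {\<alpha>\<in>Ar. d \<alpha> = r \<beta>}" for s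
      proof (rule has_sum_cong)
        fix \<alpha> assume "\<alpha> \<in> {\<alpha>\<in>Ar. d \<alpha> = r \<beta>}"
        then show "coef A (\<gamma> \<cdot> iv (\<alpha> \<cdot> \<beta>)) * coef B (\<alpha> \<cdot> \<beta> \<cdot> iv \<beta>) = coef A (\<gamma> \<cdot> iv \<beta> \<cdot> iv \<alpha>) * coef B \<alpha>"
          using True assoc[of \<gamma> "iv \<beta>" "iv \<alpha>"] by (simp add: inv_mult_distrib mult_mult_inv closed_simps)
      qed
      ultimately have "((\<lambda>\<alpha>. coef A (\<gamma> \<cdot> iv \<beta> \<cdot> iv \<alpha>) * coef B \<alpha>) has_sum mcoef (A o\<^sub>L B) \<gamma> \<beta>) {\<alpha>\<in>Ar. d \<alpha> = r \<beta>}"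
        by simp
      then have "mcoef (A o\<^sub>L B) \<gamma> \<beta> = coef (A o\<^sub>L B) (\<gamma> \<cdot> iv \<beta>)"
        using coef_compose_has_sum[OF A B gb(1)] unfolding gb(2) by (rule has_sum_unique)
      then show ?thesis using True by (simp add: conv_kernel_def)
    qed
  qed
  then show ?thesis by (simp add: conv_ops_def complex_linear_compose conv_ops_linear[OF A] conv_ops_linear[OF B])
qed

text \<open>The case in which convolution sums get evaluated: a factor supported on a bisection, or
  on units, leaves a single term.\<close>

lemma coef_compose_eq_single:
  assumes A: "A \<in> conv_ops" and B: "B \<in> conv_ops" and g: "\<gamma> \<in> Ar" and b: "\<beta> \<in> Ar" "d \<beta> = d \<gamma>"
    and z: "\<And>\<alpha>. \<alpha> \<in> Ar \<Longrightarrow> d \<alpha> = d \<gamma> \<Longrightarrow> \<alpha> \<noteq> \<beta> \<Longrightarrow> coef A (\<gamma> \<cdot> iv \<alpha>) * coef B \<alpha> = 0"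
  shows "coef (A o\<^sub>L B) \<gamma> = coef A (\<gamma> \<cdot> iv \<beta>) * coef B \<beta>"
proof -
  have "((\<lambda>\<beta>. coef A (\<gamma> \<cdot> iv \<beta>) * coef B \<beta>) has_sum s) {\<beta>\<in>Ar. d \<beta> = d \<gamma>}
      \<longleftrightarrow> ((\<lambda>\<beta>. coef A (\<gamma> \<cdot> iv \<beta>) * coef B \<beta>) has_sum s) {\<beta>}" for s
    by (rule has_sum_cong_neutral) (use b z in auto)
  then have "((\<lambda>\<beta>. coef A (\<gamma> \<cdot> iv \<beta>) * coef B \<beta>) has_sum coef (A o\<^sub>L B) \<gamma>) {\<beta>}"
    using coef_compose_has_sum[OF A B g] by simp
  then show ?thesis using has_sum_unique[OF _ has_sum_finite[of "{\<beta>}"]] by fastforce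
qed

lemma coef_compose_nonzeroD:
  assumes A: "A \<in> conv_ops" and B: "B \<in> conv_ops" and nz: "coef (A o\<^sub>L B) \<gamma> \<noteq> 0"
  shows "\<exists>\<alpha> \<beta>. \<alpha> \<in> Ar \<and> \<beta> \<in> Ar \<and> d \<alpha> = r \<beta> \<and> \<gamma> = \<alpha> \<cdot> \<beta> \<and> coef A \<alpha> \<noteq> 0 \<and> coef B \<beta> \<noteq> 0"
proof (rule ccontr)
  assume no: "\<not> ?thesis"
  have g: "\<gamma> \<in> Ar" using nz coef_outside by blast
  have z: "coef A (\<gamma> \<cdot> iv \<beta>) * coef B \<beta> = 0" if "\<beta> \<in> Ar" "d \<beta> = d \<gamma>" for \<beta>
  proof -
    have "\<gamma> \<cdot> iv \<beta> \<in> Ar" "d (\<gamma> \<cdot> iv \<beta>) = r \<beta>" "\<gamma> = \<gamma> \<cdot> iv \<beta> \<cdot> \<beta>"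
      using that g by (simp_all add: closed_simps mult_inv_mult)
    then show ?thesis using no that(1) mult_eq_0_iff by blast
  qed
  \<comment> \<open>All terms vanish, so any one of them may serve as the single remaining
    term.\<close>
  have "coef (A o\<^sub>L B) \<gamma> = coef A (\<gamma> \<cdot> iv \<gamma>) * coef B \<gamma>"
    by (intro coef_compose_eq_single[OF A B g g refl] z)
  with z[OF g refl] nz show False by simp
qed

end

context etale_groupoid
begin

section \<open>Compactly supported functions as sums of functions on bisections\<close>

lemma C_c_iff': "f \<in> C_c (gtop G) \<longleftrightarrow>
    continuous_map (gtop G) euclidean f \<and> (\<exists>K. compactin (gtop G) K \<and> (\<forall>x. x \<notin> K \<longrightarrow> f x = 0))"
  by (rule C_c_iff[OF Hausdorff])

lemma C_c_add: "f \<in> C_c (gtop G) \<Longrightarrow> g \<in> C_c (gtop G) \<Longrightarrow> (\<lambda>x. f x + g x) \<in> C_c (gtop G)"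
proof -
  assume "f \<in> C_c (gtop G)" "g \<in> C_c (gtop G)"
  then obtain K L where f: "continuous_map (gtop G) euclidean f" "compactin (gtop G) K" "\<And>x. x \<notin> K \<Longrightarrow> f x = 0"
    and g: "continuous_map (gtop G) euclidean g" "compactin (gtop G) L" "\<And>x. x \<notin> L \<Longrightarrow> g x = 0"
    unfolding C_c_iff' by blast
  have "continuous_map (gtop G) euclidean (\<lambda>x. f x + g x)"
    using f(1) g(1) by (simp add: continuous_map_euclidean_atin tendsto_add)
  moreover have "compactin (gtop G) (K \<union> L)" using f(2) g(2) by (rule compactin_Un)
  ultimately show ?thesis unfolding C_c_iff' using f(3) g(3) by fastforce
qed

lemma C_c_mult_continuous:
  assumes f: "f \<in> C_c (gtop G)" and g: "continuous_map (gtop G) euclidean g"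
  shows "(\<lambda>x. f x * g x) \<in> C_c (gtop G)"
proof -
  have "continuous_map (gtop G) euclidean (\<lambda>x. f x * g x)"
    using f g unfolding C_c_def by (simp add: continuous_map_euclidean_atin tendsto_mult)
  then show ?thesis using f unfolding C_c_iff' by fastforce
qed

lemma C_c_scale: "f \<in> C_c (gtop G) \<Longrightarrow> (\<lambda>x. c * f x) \<in> C_c (gtop G)"
  using C_c_mult_continuous[of f "\<lambda>_. c"] by (simp add: mult.commute)

definition bisection_function :: "('g \<Rightarrow> complex) \<Rightarrow> 'g set \<Rightarrow> 'g set \<Rightarrow> bool" where
  "bisection_function f U K \<longleftrightarrow> continuous_map (gtop G) euclidean f \<and> bisection U \<and>
     compactin (gtop G) K \<and> K \<subseteq> U \<and> (\<forall>x. x \<notin> K \<longrightarrow> f x = 0)"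

lemma bisection_function_C_c: "bisection_function f U K \<Longrightarrow> f \<in> C_c (gtop G)"
  unfolding bisection_function_def C_c_iff' by blast

text \<open>Finitely many open bisections cover the support. Splitting them off one at a time with
  bumps replaces a partition of unity.\<close>

lemma C_c_bisection_induct:
  assumes f: "f \<in> C_c (gtop G)"
    and bis: "\<And>f U K. bisection_function f U K \<Longrightarrow> P f"
    and add: "\<And>f g. f \<in> C_c (gtop G) \<Longrightarrow> g \<in> C_c (gtop G) \<Longrightarrow> P f \<Longrightarrow> P g \<Longrightarrow> P (\<lambda>x. f x + g x)"
  shows "P f"
proof -
  have *: "P f" if "finite \<U>" "\<And>U. U \<in> \<U> \<Longrightarrow> bisection U" "continuous_map (gtop G) euclidean f"
    "compactin (gtop G) K" "K \<subseteq> \<Union>\<U>" "\<And>x. x \<notin> K \<Longrightarrow> f x = 0" for \<U> K f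
    using that
  proof (induction \<U> arbitrary: f K rule: finite_induct)
    case empty
    have "K = {}" using empty.prems(4) by simp
    then have "bisection_function f {} {}"
      unfolding bisection_function_def bisection_def
      by (intro conjI \<open>continuous_map (gtop G) euclidean f\<close>) (use empty.prems(5) in simp_all)
    then show ?case by (rule bis)
  next
    case (insert U \<U>)
    have U: "bisection U" and Uo: "openin (gtop G) U" and \<U>o: "openin (gtop G) (\<Union>\<U>)"
      using insert.prems(1) unfolding bisection_def by auto
    have K: "compactin (gtop G) K" "closedin (gtop G) K"
      using insert.prems compactin_imp_closedin[OF Hausdorff] by blast+
    \<comment> \<open>The part of \<open>K\<close> covered by \<open>U\<close> alone. A bump equal
      to \<open>1\<close> on a neighbourhood \<open>W\<close> of it leaves a remainder supported in
      \<open>K - W\<close>, which the other bisections cover.\<close>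
    have K': "compactin (gtop G) (K - \<Union>\<U>)"
      by (rule closed_compactin[OF K(1)]) (use K(2) \<U>o closedin_diff in auto)
    have "K - \<Union>\<U> \<subseteq> U" using insert.prems by auto
    then obtain c :: "'g \<Rightarrow> real" and L W where c: "continuous_map (gtop G) euclideanreal c"
      "openin (gtop G) W" "K - \<Union>\<U> \<subseteq> W" "\<And>x. x \<in> W \<Longrightarrow> c x = 1" "compactin (gtop G) L" "L \<subseteq> U" "\<And>x. x \<notin> L \<Longrightarrow> c x = 0"
      using bump_function[OF locally_compact Hausdorff K' Uo] by metis
    define f1 where "f1 x = f x * of_real (c x)" for x
    define f2 where "f2 x = f x * of_real (1 - c x)" for x
    have c1: "continuous_map (gtop G) euclidean f1" and c2: "continuous_map (gtop G) euclidean f2"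
      using insert.prems(2) c(1) unfolding f1_def f2_def
      by (auto simp: continuous_map_euclidean_atin intro!: tendsto_intros)
    have b1: "bisection_function f1 U L"
      unfolding bisection_function_def using c c1 U by (auto simp: f1_def)
    have K2: "compactin (gtop G) (K - W)"
      by (rule closed_compactin[OF K(1)]) (use K(2) c(2) closedin_diff in auto)
    have z2: "f2 x = 0" if "x \<notin> K - W" for x
      using that c(4) insert.prems(5) by (auto simp: f2_def)
    have P2: "P f2" by (rule insert.IH[OF _ c2 K2 _ z2]) (use insert.prems(1) c(3) in auto)
    have "P (\<lambda>x. f1 x + f2 x)"
      by (rule add[OF bisection_function_C_c[OF b1] _ bis[OF b1] P2]) (use c2 K2 z2 in \<open>auto simp: C_c_iff'\<close>)
    moreover have "f = (\<lambda>x. f1 x + f2 x)" by (simp add: f1_def f2_def fun_eq_iff algebra_simps)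
    ultimately show ?case by simp
  qed
  obtain K where K: "continuous_map (gtop G) euclidean f" "compactin (gtop G) K" "\<And>x. x \<notin> K \<Longrightarrow> f x = 0"
    using f unfolding C_c_iff' by blast
  have "\<exists>U. bisection U \<and> x \<in> U" if "x \<in> K" for x
    using bisection_neighbourhood[of x Ar] that compactin_subset_topspace[OF K(2)] by blast
  then obtain N where N: "\<And>x. x \<in> K \<Longrightarrow> bisection (N x)" "\<And>x. x \<in> K \<Longrightarrow> x \<in> N x" by metis
  have "\<And>V. V \<in> N ` K \<Longrightarrow> openin (gtop G) V" "K \<subseteq> \<Union> (N ` K)" using N unfolding bisection_def by blast+
  then obtain \<V> where "finite \<V>" "\<V> \<subseteq> N ` K" "K \<subseteq> \<Union>\<V>" using compactinD[OF K(2)] by metis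
  then show ?thesis using *[of \<V> f K] K N by blast
qed

text \<open>Convolution by such an \<open>f\<close> is a weighted composition operator: each output
  coordinate is a multiple of one input coordinate. The resulting norm bound is also what controls
  the diagonal.\<close>

lemma injective_support_operator:
  assumes out: "\<And>\<gamma>. \<gamma> \<notin> Ar \<Longrightarrow> f \<gamma> = 0" and B: "\<And>\<gamma>. cmod (f \<gamma>) \<le> B"
    and inj: "inj_on d {\<gamma>. f \<gamma> \<noteq> 0}" "inj_on r {\<gamma>. f \<gamma> \<noteq> 0}"
  obtains A where "A \<in> conv_ops" "coef A = f" "norm A \<le> B"
proof -
  let ?S = "{\<gamma>. f \<gamma> \<noteq> 0}"
  have SA: "?S \<subseteq> Ar" using out by blast
  \<comment> \<open>The arrow of the support with a given range is the only possible left factor; it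
    determines the weight \<open>w\<close> and the coordinate \<open>p\<close> that is read.\<close>
  define s where "s = inv_into ?S r"
  have s: "s (r \<sigma>) = \<sigma>" if "f \<sigma> \<noteq> 0" for \<sigma> unfolding s_def using inj(2) that by simp
  define w where "w \<gamma> = (if \<gamma> \<in> Ar \<and> r \<gamma> \<in> r ` ?S then f (s (r \<gamma>)) else 0)" for \<gamma>
  define p where "p \<gamma> = iv (s (r \<gamma>)) \<cdot> \<gamma>" for \<gamma>
  have wD: "\<exists>\<sigma>. \<sigma> \<in> Ar \<and> f \<sigma> \<noteq> 0 \<and> r \<sigma> = r \<gamma> \<and> \<gamma> \<in> Ar \<and> p \<gamma> = iv \<sigma> \<cdot> \<gamma> \<and> w \<gamma> = f \<sigma>" if "w \<gamma> \<noteq> 0" for \<gamma>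
  proof -
    have g: "\<gamma> \<in> Ar" "r \<gamma> \<in> r ` ?S" using that unfolding w_def by (auto split: if_splits)
    then obtain \<sigma> where "f \<sigma> \<noteq> 0" "r \<sigma> = r \<gamma>" by auto
    then show ?thesis using s[of \<sigma>] SA g by (auto simp: p_def w_def intro!: exI[of _ \<sigma>])
  qed
  have "inj_on p {\<gamma>. w \<gamma> \<noteq> 0}"
  proof (rule inj_onI, clarsimp)
    fix \<gamma> \<gamma>' assume w: "w \<gamma> \<noteq> 0" "w \<gamma>' \<noteq> 0" and p: "p \<gamma> = p \<gamma>'"
    obtain \<sigma> \<sigma>' where \<sigma>: "\<sigma> \<in> Ar" "f \<sigma> \<noteq> 0" "r \<sigma> = r \<gamma>" "\<gamma> \<in> Ar" "p \<gamma> = iv \<sigma> \<cdot> \<gamma>"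
      and \<sigma>': "\<sigma>' \<in> Ar" "f \<sigma>' \<noteq> 0" "r \<sigma>' = r \<gamma>'" "\<gamma>' \<in> Ar" "p \<gamma>' = iv \<sigma>' \<cdot> \<gamma>'"
      using wD[OF w(1)] wD[OF w(2)] by blast
    \<comment> \<open>A common value of \<open>p\<close> gives the two support arrows the same
      source, so injectivity of \<open>d\<close> identifies them; multiplying back then recovers
      \<open>\<gamma>\<close>.\<close>
    have "d \<sigma> = r (p \<gamma>)" "d \<sigma>' = r (p \<gamma>')" using \<sigma> \<sigma>' by (simp_all add: closed_simps)
    then have "\<sigma> = \<sigma>'" using p inj(1) \<sigma> \<sigma>' by (simp add: inj_on_def)
    then show "\<gamma> = \<gamma>'" using p \<sigma> \<sigma>' mult_inv_cancel by metis
  qed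
  moreover have "cmod (w \<gamma>) \<le> B" for \<gamma>
    using B B[of \<gamma>] order_trans[OF norm_ge_zero B[of \<gamma>]] by (simp add: w_def)
  ultimately obtain A where A: "complex_linear A" "norm A \<le> B"
    "\<And>\<xi> \<gamma>. ell2_fun (blinfun_apply A \<xi>) \<gamma> = w \<gamma> * ell2_fun \<xi> (p \<gamma>)"
    using weighted_composition_operator[of p w B] by metis
  have m: "mcoef A \<gamma> \<beta> = conv_kernel f \<gamma> \<beta>" for \<gamma> \<beta>
  proof (cases "\<gamma> \<in> Ar \<and> \<beta> \<in> Ar \<and> d \<gamma> = d \<beta> \<and> f (\<gamma> \<cdot> iv \<beta>) \<noteq> 0")
    case True
    let ?\<sigma> = "\<gamma> \<cdot> iv \<beta>"
    have r: "r ?\<sigma> = r \<gamma>" using True by (simp add: closed_simps)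
    then have "s (r \<gamma>) = ?\<sigma>" using s[of ?\<sigma>] True by simp
    moreover have "r \<gamma> \<in> r ` ?S" using True r by (metis (mono_tags, lifting) imageI mem_Collect_eq)
    moreover have "iv ?\<sigma> \<cdot> \<gamma> = \<beta>" using True by (simp add: inv_mult_distrib inv_inv closed_simps mult_inv_mult)
    ultimately show ?thesis using True by (simp add: mcoef_def A(3) w_def p_def ell2_fun_delta conv_kernel_def)
  next
    case False
    have "w \<gamma> = 0 \<or> p \<gamma> \<noteq> \<beta>"
    proof (rule ccontr)
      assume "\<not> ?thesis"
      then obtain \<sigma> where \<sigma>: "\<sigma> \<in> Ar" "f \<sigma> \<noteq> 0" "r \<sigma> = r \<gamma>" "\<gamma> \<in> Ar" "\<beta> = iv \<sigma> \<cdot> \<gamma>"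
        using wD[of \<gamma>] by blast
      then have "\<beta> \<in> Ar" "d \<gamma> = d \<beta>" "\<gamma> \<cdot> iv \<beta> = \<sigma>"
        by (simp_all add: closed_simps inv_mult_distrib inv_inv mult_inv_cancel)
      then show False using False \<sigma> by simp
    qed
    moreover have "conv_kernel f \<gamma> \<beta> = 0" using False by (auto simp: conv_kernel_def)
    ultimately show ?thesis by (auto simp: mcoef_def A(3) ell2_fun_delta)
  qed
  show thesis using that[OF conv_opsI(1)[OF A(1) m out] conv_opsI(2)[OF A(1) m out] A(2)] .
qed

lemma bisection_function_operator:
  assumes f: "bisection_function f U K"
  obtains A where "A \<in> conv_ops" "coef A = f"
proof -
  have "f \<in> C_0 (gtop G)" using C_c_subset_C_0[OF Hausdorff] bisection_function_C_c[OF f] by blast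
  then obtain B where "\<And>x. cmod (f x) \<le> B" using C_0_bounded by metis
  moreover have "{\<gamma>. f \<gamma> \<noteq> 0} \<subseteq> U" and "\<And>\<gamma>. \<gamma> \<notin> Ar \<Longrightarrow> f \<gamma> = 0"
    using f compactin_subset_topspace unfolding bisection_function_def by blast+
  moreover have "inj_on d U" "inj_on r U" using f unfolding bisection_function_def bisection_def by auto
  ultimately show thesis using injective_support_operator[of f B] inj_on_subset that by metis
qed

text \<open>With the left factor on a bisection the product at \<open>\<gamma>\<close> has one term,
  expressed through a local section of \<open>r\<close>. Continuity and compactness of the support
  are read off such formulas.\<close>

lemma bisection_function_compose:
  assumes f: "bisection_function f U K" and A: "A \<in> conv_ops" "coef A = f"
    and B: "B \<in> conv_ops" "coef B \<in> C_c (gtop G)"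
  shows "coef (A o\<^sub>L B) \<in> C_c (gtop G)"
proof -
  let ?k = "coef (A o\<^sub>L B)" and ?g = "coef B"
  have fc: "continuous_map (gtop G) euclidean f" and U: "openin (gtop G) U" "inj_on d U" "inj_on r U"
    and K: "compactin (gtop G) K" "K \<subseteq> U" "\<And>x. x \<notin> K \<Longrightarrow> f x = 0"
    using f unfolding bisection_function_def bisection_def by auto
  have UA: "U \<subseteq> Ar" using openin_subset[OF U(1)] .
  obtain L where gc: "continuous_map (gtop G) euclidean ?g" and L: "compactin (gtop G) L" "\<And>x. x \<notin> L \<Longrightarrow> ?g x = 0"
    using B(2) unfolding C_c_iff' by blast
  define s where "s = inv_into U r"
  define t where "t = inv_into U d"
  have s: "\<sigma> \<in> U \<Longrightarrow> s (r \<sigma>) = \<sigma>" and t: "\<sigma> \<in> U \<Longrightarrow> t (d \<sigma>) = \<sigma>" for \<sigma>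
    using U(2,3) by (simp_all add: s_def t_def)
  let ?V = "{\<gamma>\<in>Ar. r \<gamma> \<in> r ` U}"
  have rU: "openin (gtop G) (r ` U)" using open_map_ran U(1) unfolding open_map_def by blast
  have dU: "openin (gtop G) (d ` U)" using open_map_dom U(1) unfolding open_map_def by blast
  have V: "openin (gtop G) ?V" by (rule openin_continuous_map_preimage[OF continuous_ran rU])
  have sc: "continuous_map (subtopology (gtop G) (r ` U)) (gtop G) s"
    unfolding s_def by (rule continuous_map_section[OF continuous_ran open_map_ran U(1,3)])
  have tc: "continuous_map (subtopology (gtop G) (d ` U)) (gtop G) t"
    unfolding t_def by (rule continuous_map_section[OF continuous_dom open_map_dom U(1,2)])
  \<comment> \<open>Only the arrow of \<open>U\<close> with the range of \<open>\<gamma>\<close> can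
    be a left factor of \<open>\<gamma>\<close>.\<close>
  have k_eq: "?k \<gamma> = f (s (r \<gamma>)) * ?g (iv (s (r \<gamma>)) \<cdot> \<gamma>)" if g: "\<gamma> \<in> ?V" for \<gamma>
  proof -
    obtain \<sigma> where \<sigma>: "\<sigma> \<in> U" "r \<sigma> = r \<gamma>" using g by auto
    have \<sigma>A: "\<sigma> \<in> Ar" using \<sigma> UA by blast
    have "?k \<gamma> = coef A (\<gamma> \<cdot> iv (iv \<sigma> \<cdot> \<gamma>)) * ?g (iv \<sigma> \<cdot> \<gamma>)"
    proof (rule coef_compose_eq_single[OF A(1) B(1)])
      fix \<alpha> assume \<alpha>: "\<alpha> \<in> Ar" "d \<alpha> = d \<gamma>" "\<alpha> \<noteq> iv \<sigma> \<cdot> \<gamma>"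
      have "f (\<gamma> \<cdot> iv \<alpha>) = 0"
      proof (rule ccontr)
        assume "f (\<gamma> \<cdot> iv \<alpha>) \<noteq> 0"
        then have "\<gamma> \<cdot> iv \<alpha> \<in> U" using K by blast
        moreover have "r (\<gamma> \<cdot> iv \<alpha>) = r \<sigma>" using \<alpha> g \<sigma> by (simp add: closed_simps)
        ultimately have "\<gamma> \<cdot> iv \<alpha> = \<sigma>" using U(3) \<sigma>(1) by (simp add: inj_on_def)
        then have "iv \<sigma> \<cdot> \<gamma> = \<alpha>" using \<alpha> g by (auto simp: inv_mult_distrib inv_inv closed_simps mult_inv_mult)
        then show False using \<alpha> by simp
      qed
      then show "coef A (\<gamma> \<cdot> iv \<alpha>) * ?g \<alpha> = 0" by (simp add: A(2))
    qed (use g \<sigma> \<sigma>A in \<open>auto simp: closed_simps\<close>)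
    also have "\<gamma> \<cdot> iv (iv \<sigma> \<cdot> \<gamma>) = \<sigma>" using g \<sigma> \<sigma>A by (simp add: inv_mult_distrib inv_inv closed_simps mult_inv_cancel)
    finally show ?thesis using s[OF \<sigma>(1)] \<sigma>(2) A(2) by simp
  qed
  have nzD: "\<exists>\<sigma> \<tau>. \<sigma> \<in> K \<and> \<tau> \<in> L \<and> d \<sigma> = r \<tau> \<and> \<gamma> = \<sigma> \<cdot> \<tau> \<and> \<tau> \<in> Ar \<and> \<sigma> \<in> Ar" if "?k \<gamma> \<noteq> 0" for \<gamma>
    using coef_compose_nonzeroD[OF A(1) B(1) that] A(2) K(3) L(2) by metis
  have c1: "continuous_map (subtopology (gtop G) ?V) (gtop G) (\<lambda>\<gamma>. s (r \<gamma>))"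
  proof -
    have "continuous_map (subtopology (gtop G) ?V) (subtopology (gtop G) (r ` U)) r"
      using continuous_map_from_subtopology[OF continuous_ran] by (auto simp: continuous_map_in_subtopology)
    from continuous_map_compose[OF this sc] show ?thesis by (simp add: o_def)
  qed
  have c2: "continuous_map (subtopology (gtop G) ?V) (gtop G) (\<lambda>\<gamma>. iv (s (r \<gamma>)) \<cdot> \<gamma>)"
  proof (rule continuous_map_mult)
    show "continuous_map (subtopology (gtop G) ?V) (gtop G) (\<lambda>\<gamma>. iv (s (r \<gamma>)))"
      using continuous_map_compose[OF c1 continuous_inv] by (simp add: o_def)
    show "continuous_map (subtopology (gtop G) ?V) (gtop G) (\<lambda>\<gamma>. \<gamma>)"
      using continuous_map_from_subtopology[OF continuous_map_id] by (simp add: id_def)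
    fix \<gamma> assume "\<gamma> \<in> topspace (subtopology (gtop G) ?V)"
    then obtain \<sigma> where "\<sigma> \<in> U" "r \<sigma> = r \<gamma>" by auto
    then show "d (iv (s (r \<gamma>))) = r \<gamma>" using s[of \<sigma>] UA by (auto simp: closed_simps)
  qed
  have "continuous_map (subtopology (gtop G) ?V) euclidean (\<lambda>\<gamma>. f (s (r \<gamma>)) * ?g (iv (s (r \<gamma>)) \<cdot> \<gamma>))"
    using continuous_map_compose[OF c1 fc] continuous_map_compose[OF c2 gc]
    by (auto simp: continuous_map_euclidean_atin o_def intro!: tendsto_mult)
  then have kc': "continuous_map (subtopology (gtop G) ?V) euclidean ?k"
    by (rule continuous_map_eq) (use k_eq in auto)
  have rK: "closedin (gtop G) (r ` K)"
    by (rule compactin_imp_closedin[OF Hausdorff image_compactin[OF K(1) continuous_ran]])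
  have dK: "closedin (gtop G) (d ` K)"
    by (rule compactin_imp_closedin[OF Hausdorff image_compactin[OF K(1) continuous_dom]])
  \<comment> \<open>The ranges of the support lie in the compact set of ranges of \<open>K\<close>.
    It is closed and lies inside the open set of ranges for which the formula is valid.\<close>
  have kc: "continuous_map (gtop G) euclidean ?k"
  proof (rule continuous_map_extend_by_zero[OF kc' V])
    show "closedin (gtop G) {\<gamma>\<in>Ar. r \<gamma> \<in> r ` K}" by (rule closedin_continuous_map_preimage[OF continuous_ran rK])
    show "{\<gamma>\<in>Ar. r \<gamma> \<in> r ` K} \<subseteq> ?V" using K(2) by auto
    fix \<gamma> assume n: "\<gamma> \<notin> {\<gamma>\<in>Ar. r \<gamma> \<in> r ` K}"
    show "?k \<gamma> = 0"
    proof (rule ccontr)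
      assume "?k \<gamma> \<noteq> 0"
      from nzD[OF this] obtain \<sigma> \<tau> where "\<sigma> \<in> K" "\<tau> \<in> Ar" "\<sigma> \<in> Ar" "d \<sigma> = r \<tau>" "\<gamma> = \<sigma> \<cdot> \<tau>" by blast
      then show False using n by (auto simp: closed_simps)
    qed
  qed
  \<comment> \<open>Dually, in a product \<open>\<sigma> \<cdot> \<tau>\<close> with
    \<open>\<sigma>\<close> in \<open>K\<close>, the factor \<open>\<sigma>\<close> is determined by
    \<open>r \<tau>\<close>. Hence the support lies in the continuous image of a compact set of
    right factors.\<close>
  let ?W = "{\<tau>\<in>Ar. r \<tau> \<in> d ` U}"
  have e1: "continuous_map (subtopology (gtop G) ?W) (gtop G) (\<lambda>\<tau>. t (r \<tau>))"
  proof -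
    have "continuous_map (subtopology (gtop G) ?W) (subtopology (gtop G) (d ` U)) r"
      using continuous_map_from_subtopology[OF continuous_ran] by (auto simp: continuous_map_in_subtopology)
    from continuous_map_compose[OF this tc] show ?thesis by (simp add: o_def)
  qed
  have e2: "continuous_map (subtopology (gtop G) ?W) (gtop G) (\<lambda>\<tau>. t (r \<tau>) \<cdot> \<tau>)"
  proof (rule continuous_map_mult[OF e1])
    show "continuous_map (subtopology (gtop G) ?W) (gtop G) (\<lambda>\<gamma>. \<gamma>)"
      using continuous_map_from_subtopology[OF continuous_map_id] by (simp add: id_def)
    fix \<tau> assume "\<tau> \<in> topspace (subtopology (gtop G) ?W)"
    then show "d (t (r \<tau>)) = r \<tau>" using t by auto
  qed
  let ?L = "L \<inter> {\<tau>\<in>Ar. r \<tau> \<in> d ` K}"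
  have "compactin (gtop G) ?L"
    by (rule compact_Int_closedin[OF L(1) closedin_continuous_map_preimage[OF continuous_ran dK]])
  then have "compactin (subtopology (gtop G) ?W) ?L" using K(2) by (auto simp: compactin_subtopology)
  then have M: "compactin (gtop G) ((\<lambda>\<tau>. t (r \<tau>) \<cdot> \<tau>) ` ?L)" by (rule image_compactin[OF _ e2])
  have "?k \<gamma> = 0" if n: "\<gamma> \<notin> (\<lambda>\<tau>. t (r \<tau>) \<cdot> \<tau>) ` ?L" for \<gamma>
  proof (rule ccontr)
    assume "?k \<gamma> \<noteq> 0"
    from nzD[OF this] obtain \<sigma> \<tau> where "\<sigma> \<in> K" "\<tau> \<in> L" "\<tau> \<in> Ar" "d \<sigma> = r \<tau>" "\<gamma> = \<sigma> \<cdot> \<tau>" by blast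
    moreover from this have "t (r \<tau>) = \<sigma>" "\<tau> \<in> ?L"
      using t[of \<sigma>] K(2) imageI[of \<sigma> K d] by auto
    ultimately show False using n by (metis (no_types, lifting) imageI)
  qed
  then show ?thesis unfolding C_c_iff' using kc M by blast
qed

text \<open>Preservation of compact supports under left multiplication is part of the statement so
  that existence and this property, both additive in \<open>f\<close>, go through the same
  induction.\<close>

lemma C_c_operator:
  assumes "f \<in> C_c (gtop G)"
  shows "\<exists>A. A \<in> conv_ops \<and> coef A = f \<and>
    (\<forall>B. B \<in> conv_ops \<longrightarrow> coef B \<in> C_c (gtop G) \<longrightarrow> coef (A o\<^sub>L B) \<in> C_c (gtop G))"
proof (rule C_c_bisection_induct[OF assms])
  fix f U K assume f: "bisection_function f U K"
  show "\<exists>A. A \<in> conv_ops \<and> coef A = f \<and>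
    (\<forall>B. B \<in> conv_ops \<longrightarrow> coef B \<in> C_c (gtop G) \<longrightarrow> coef (A o\<^sub>L B) \<in> C_c (gtop G))"
    using bisection_function_operator[OF f] bisection_function_compose[OF f] by metis
next
  fix f g
  assume "\<exists>A. A \<in> conv_ops \<and> coef A = f \<and>
    (\<forall>B. B \<in> conv_ops \<longrightarrow> coef B \<in> C_c (gtop G) \<longrightarrow> coef (A o\<^sub>L B) \<in> C_c (gtop G))"
    and "\<exists>A. A \<in> conv_ops \<and> coef A = g \<and>
    (\<forall>B. B \<in> conv_ops \<longrightarrow> coef B \<in> C_c (gtop G) \<longrightarrow> coef (A o\<^sub>L B) \<in> C_c (gtop G))"
  then obtain A A' where "A \<in> conv_ops" "coef A = f" "A' \<in> conv_ops" "coef A' = g"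
    "\<And>B. B \<in> conv_ops \<Longrightarrow> coef B \<in> C_c (gtop G) \<Longrightarrow> coef (A o\<^sub>L B) \<in> C_c (gtop G)"
    "\<And>B. B \<in> conv_ops \<Longrightarrow> coef B \<in> C_c (gtop G) \<Longrightarrow> coef (A' o\<^sub>L B) \<in> C_c (gtop G)" by metis
  moreover have "(A + A') o\<^sub>L B = (A o\<^sub>L B) + (A' o\<^sub>L B)" for B :: "'g op"
    by (rule blinfun_eqI) (simp add: blinfun.add_left)
  ultimately show "\<exists>A. A \<in> conv_ops \<and> coef A = (\<lambda>x. f x + g x) \<and>
    (\<forall>B. B \<in> conv_ops \<longrightarrow> coef B \<in> C_c (gtop G) \<longrightarrow> coef (A o\<^sub>L B) \<in> C_c (gtop G))"
    by (intro exI[of _ "A + A'"]) (simp add: conv_ops_add coef_add C_c_add)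
qed

section \<open>The reduced algebra as a norm closure\<close>

definition Creg :: "'g op set" where
  "Creg = {A\<in>conv_ops. coef A \<in> C_c (gtop G)}"

lemma Cstar_r_eq: "Cstar_r G = closure Creg"
  unfolding Cstar_r_def Creg_def left_regular_C_c ..

lemma Creg_subset: "Creg \<subseteq> Cstar_r G" unfolding Cstar_r_eq by (rule closure_subset)

lemma Creg_add: "A \<in> Creg \<Longrightarrow> B \<in> Creg \<Longrightarrow> A + B \<in> Creg"
  by (simp add: Creg_def conv_ops_add coef_add C_c_add)

lemma Creg_scale_op: "A \<in> Creg \<Longrightarrow> scale_op c o\<^sub>L A \<in> Creg"
  by (simp add: Creg_def conv_ops_scale_op coef_scale_op C_c_scale)

lemma Creg_compose: assumes "A \<in> Creg" "B \<in> Creg" shows "A o\<^sub>L B \<in> Creg"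
proof -
  have A: "A \<in> conv_ops" "coef A \<in> C_c (gtop G)" and B: "B \<in> conv_ops" "coef B \<in> C_c (gtop G)"
    using assms by (auto simp: Creg_def)
  obtain A' where A': "A' \<in> conv_ops" "coef A' = coef A"
    "\<And>B. B \<in> conv_ops \<Longrightarrow> coef B \<in> C_c (gtop G) \<Longrightarrow> coef (A' o\<^sub>L B) \<in> C_c (gtop G)"
    using C_c_operator[OF A(2)] by blast
  \<comment> \<open>The operator produced for \<open>coef A\<close> is \<open>A\<close> itself,
    since \<open>coef\<close> is injective on \<open>conv_ops\<close>.\<close>
  have "A' = A" by (rule conv_ops_eqI[OF A'(1) A(1) A'(2)])
  then show ?thesis using A'(3)[OF B] conv_ops_compose[OF A(1) B(1)] by (simp add: Creg_def)
qed

lemma Creg_adjoint_op: assumes A: "A \<in> Creg" shows "adjoint_op A \<in> Creg"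
proof -
  have Ac: "A \<in> conv_ops" and "coef A \<in> C_c (gtop G)" using A unfolding Creg_def by auto
  then obtain K where c: "continuous_map (gtop G) euclidean (coef A)" and K: "compactin (gtop G) K" "\<And>x. x \<notin> K \<Longrightarrow> coef A x = 0"
    unfolding C_c_iff' by blast
  have "continuous_map (gtop G) euclidean (\<lambda>\<gamma>. cnj (coef A (iv \<gamma>)))"
    using continuous_map_compose[OF continuous_inv c]
    by (auto simp: continuous_map_euclidean_atin o_def intro!: tendsto_cnj)
  then have "continuous_map (gtop G) euclidean (coef (adjoint_op A))"
    by (rule continuous_map_eq) (simp add: coef_adjoint_op[OF Ac])
  moreover have "compactin (gtop G) (iv ` K)" by (rule image_compactin[OF K(1) continuous_inv])
  moreover have "coef (adjoint_op A) \<gamma> = 0" if "\<gamma> \<notin> iv ` K" for \<gamma>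
  proof (cases "\<gamma> \<in> Ar")
    case True
    then have "iv \<gamma> \<notin> K" using that by (metis imageI inv_inv)
    then show ?thesis using True K(2) by (simp add: coef_adjoint_op[OF Ac])
  qed (rule coef_outside)
  ultimately show ?thesis unfolding Creg_def C_c_iff' using conv_ops_adjoint_op[OF Ac] by blast
qed

lemma Cstar_r_conv_ops: "A \<in> Cstar_r G \<Longrightarrow> A \<in> conv_ops"
proof -
  have "Cstar_r G \<subseteq> conv_ops"
    unfolding Cstar_r_eq by (rule closure_minimal[OF _ closed_conv_ops]) (auto simp: Creg_def)
  then show "A \<in> Cstar_r G \<Longrightarrow> A \<in> conv_ops" by blast
qed

lemma Cstar_r_add: assumes "A \<in> Cstar_r G" "B \<in> Cstar_r G" shows "A + B \<in> Cstar_r G"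
proof -
  obtain a b where "\<And>n. a n \<in> Creg" "a \<longlonglongrightarrow> A" "\<And>n. b n \<in> Creg" "b \<longlonglongrightarrow> B"
    using assms unfolding Cstar_r_eq closure_sequential by blast
  then have "\<And>n. a n + b n \<in> Creg" "(\<lambda>n. a n + b n) \<longlonglongrightarrow> A + B" by (auto intro: Creg_add tendsto_add)
  then show ?thesis unfolding Cstar_r_eq closure_sequential by (intro exI[of _ "\<lambda>n. a n + b n"]) simp
qed

lemma Cstar_r_compose: assumes "A \<in> Cstar_r G" "B \<in> Cstar_r G" shows "A o\<^sub>L B \<in> Cstar_r G"
proof -
  obtain a b where "\<And>n. a n \<in> Creg" "a \<longlonglongrightarrow> A" "\<And>n. b n \<in> Creg" "b \<longlonglongrightarrow> B"
    using assms unfolding Cstar_r_eq closure_sequential by blast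
  then have "\<And>n. a n o\<^sub>L b n \<in> Creg" "(\<lambda>n. a n o\<^sub>L b n) \<longlonglongrightarrow> (A o\<^sub>L B)"
    by (auto intro: Creg_compose bounded_bilinear.tendsto[OF bounded_bilinear_blinfun_compose])
  then show ?thesis unfolding Cstar_r_eq closure_sequential by (intro exI[of _ "\<lambda>n. a n o\<^sub>L b n"]) simp
qed

lemma Cstar_r_scale_op: assumes "A \<in> Cstar_r G" shows "scale_op c o\<^sub>L A \<in> Cstar_r G"
proof -
  obtain a where "\<And>n. a n \<in> Creg" "a \<longlonglongrightarrow> A"
    using assms unfolding Cstar_r_eq closure_sequential by blast
  then have "\<And>n. scale_op c o\<^sub>L a n \<in> Creg" "(\<lambda>n. scale_op c o\<^sub>L a n) \<longlonglongrightarrow> (scale_op c o\<^sub>L A)"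
    by (auto intro: Creg_scale_op bounded_bilinear.tendsto[OF bounded_bilinear_blinfun_compose])
  then show ?thesis unfolding Cstar_r_eq closure_sequential by (intro exI[of _ "\<lambda>n. scale_op c o\<^sub>L a n"]) simp
qed

lemma Cstar_r_adjoint_op: assumes A: "A \<in> Cstar_r G" shows "adjoint_op A \<in> Cstar_r G"
proof -
  obtain a where a: "\<And>n. a n \<in> Creg" "a \<longlonglongrightarrow> A"
    using assms unfolding Cstar_r_eq closure_sequential by blast
  have lin: "complex_linear A" "complex_linear (a n)" for n
    using Cstar_r_conv_ops A a(1) Creg_subset conv_ops_linear by blast+
  have "(\<lambda>n. adjoint_op (a n)) \<longlonglongrightarrow> adjoint_op A"
  proof (rule LIM_zero_cancel, rule Lim_null_comparison)
    show "\<forall>\<^sub>F n in sequentially. norm (adjoint_op (a n) - adjoint_op A) \<le> norm (a n - A)"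
      using norm_adjoint_op_le[OF complex_linear_diff[OF lin(2,1)]] by (simp add: adjoint_op_diff lin)
    show "(\<lambda>n. norm (a n - A)) \<longlonglongrightarrow> 0" using a(2) by (simp add: tendsto_norm_zero LIM_zero)
  qed
  then show ?thesis unfolding Cstar_r_eq closure_sequential using Creg_adjoint_op[OF a(1)]
    by (intro exI[of _ "\<lambda>n. adjoint_op (a n)"]) simp
qed

text \<open>The operator norm dominates every coefficient, so norm convergence is uniform
  convergence of the functions \<open>coef (a n)\<close>.\<close>

lemma Cstar_r_coef_continuous:
  assumes A: "A \<in> Cstar_r G" shows "continuous_map (gtop G) euclidean (coef A)"
proof -
  obtain a where a: "\<And>n. a n \<in> Creg" "a \<longlonglongrightarrow> A"
    using assms unfolding Cstar_r_eq closure_sequential by blast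
  have ca: "continuous_map (gtop G) Met_TC.mtopology (coef (a n))" for n
    using a(1)[of n] by (simp add: Creg_def C_c_def)
  have "continuous_map (gtop G) Met_TC.mtopology (coef A)"
  proof (rule Met_TC.continuous_map_uniform_limit[where f = "\<lambda>n. coef (a n)" and F = sequentially])
    fix e :: real assume "e > 0"
    then have "\<forall>\<^sub>F n in sequentially. dist (a n) A < e" using a(2) by (rule tendstoD[rotated])
    then show "\<forall>\<^sub>F n in sequentially. \<forall>x\<in>Ar. coef A x \<in> UNIV \<and> dist (coef (a n) x) (coef A x) < e"
      by (rule eventually_mono)
        (use coef_bound in \<open>auto simp: dist_norm coef_diff[symmetric] intro: le_less_trans\<close>)
  qed (use ca in auto)
  then show ?thesis by simp
qed

end

section \<open>The diagonal and its normalizers\<close>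

context etale_groupoid
begin

abbreviation "Diag \<equiv> diagonal_subalgebra G"

lemma Diag_conv_ops: "E \<in> Diag \<Longrightarrow> E \<in> conv_ops" and Diag_coef: "E \<in> Diag \<Longrightarrow> coef E \<in> C_0 (unit_space G)"
  by (simp_all add: diagonal_subalgebra_eq)

lemma DiagI: "E \<in> conv_ops \<Longrightarrow> coef E \<in> C_0 (unit_space G) \<Longrightarrow> E \<in> Diag"
  by (simp add: diagonal_subalgebra_eq)

lemma C_0_units_outside: "f \<in> C_0 (unit_space G) \<Longrightarrow> x \<notin> units \<Longrightarrow> f x = 0"
  by (simp add: C_0_def topspace_unit_space)

lemma Diag_coef_outside: "E \<in> Diag \<Longrightarrow> x \<notin> units \<Longrightarrow> coef E x = 0"
  by (rule C_0_units_outside[OF Diag_coef])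

text \<open>Selects the single surviving term when one factor of a product is supported on
  units.\<close>

lemma mult_inv_unit_iff:
  assumes "\<gamma> \<in> Ar" "\<beta> \<in> Ar" "d \<gamma> = d \<beta>"
  shows "\<gamma> \<cdot> iv \<beta> \<in> units \<longleftrightarrow> \<gamma> = \<beta>"
proof
  assume u: "\<gamma> \<cdot> iv \<beta> \<in> units"
  then have "\<gamma> \<cdot> iv \<beta> = d (\<gamma> \<cdot> iv \<beta>)" by (simp add: units_dom)
  also have "\<dots> = r \<beta>" using assms by (simp add: closed_simps)
  finally have "\<gamma> \<cdot> iv \<beta> \<cdot> \<beta> = r \<beta> \<cdot> \<beta>" by simp
  then show "\<gamma> = \<beta>" using assms by (simp add: mult_inv_mult closed_simps)
qed (use assms in \<open>simp add: mult_inv ran_in_units\<close>)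

lemma coef_Diag_compose:
  assumes E: "E \<in> Diag" and A: "A \<in> conv_ops" and g: "\<gamma> \<in> Ar"
  shows "coef (E o\<^sub>L A) \<gamma> = coef E (r \<gamma>) * coef A \<gamma>"
proof -
  have "coef (E o\<^sub>L A) \<gamma> = coef E (\<gamma> \<cdot> iv \<gamma>) * coef A \<gamma>"
    by (rule coef_compose_eq_single[OF Diag_conv_ops[OF E] A g g refl])
      (use g mult_inv_unit_iff Diag_coef_outside[OF E] in auto)
  then show ?thesis using g by (simp add: mult_inv)
qed

lemma diag_operator:
  assumes f: "f \<in> C_0 (unit_space G)" and B: "\<And>x. cmod (f x) \<le> B"
  obtains E where "E \<in> conv_ops" "coef E = f" "norm E \<le> B"
proof (rule injective_support_operator[of f B])
  have sub: "{\<gamma>. f \<gamma> \<noteq> 0} \<subseteq> units" using C_0_units_outside[OF f] by blast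
  show "f \<gamma> = 0" if "\<gamma> \<notin> Ar" for \<gamma> using that sub units_arrow by blast
  show "inj_on d {\<gamma>. f \<gamma> \<noteq> 0}" "inj_on r {\<gamma>. f \<gamma> \<noteq> 0}"
    using sub units_dom units_ran by (auto simp: inj_on_def) (metis (mono_tags, lifting) mem_Collect_eq subsetD)+
qed (use B that in auto)

text \<open>Inverse of \<open>coef\<close> on the diagonal; the description is unique because
  \<open>coef\<close> is injective on \<open>conv_ops\<close>.\<close>

definition diag_op :: "('g \<Rightarrow> complex) \<Rightarrow> 'g op" where
  "diag_op f = (THE E. E \<in> conv_ops \<and> coef E = f)"

lemma diag_op_coef: "E \<in> conv_ops \<Longrightarrow> diag_op (coef E) = E"
  unfolding diag_op_def by (rule the_equality) (auto intro: conv_ops_eqI)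

lemma diag_op:
  assumes "f \<in> C_0 (unit_space G)" shows "diag_op f \<in> Diag" "coef (diag_op f) = f"
proof -
  obtain B where "\<And>x. cmod (f x) \<le> B" using C_0_bounded[OF assms] by metis
  then obtain E where "E \<in> conv_ops" "coef E = f" using diag_operator[OF assms] by metis
  then show "diag_op f \<in> Diag" "coef (diag_op f) = f"
    using diag_op_coef[of E] assms by (auto intro: DiagI)
qed

lemma coef_Diag_Diag: "E \<in> Diag \<Longrightarrow> F \<in> Diag \<Longrightarrow> coef (E o\<^sub>L F) = (\<lambda>x. coef E x * coef F x)"
proof
  fix x assume E: "E \<in> Diag" and F: "F \<in> Diag"
  show "coef (E o\<^sub>L F) x = coef E x * coef F x"
  proof (cases "x \<in> Ar")
    case True
    then show ?thesis using coef_Diag_compose[OF E Diag_conv_ops[OF F] True] Diag_coef_outside[OF F]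
      by (cases "x \<in> units") (auto simp: units_ran)
  next
    case False
    from coef_outside[OF this] show ?thesis by simp
  qed
qed

lemma Diag_compose: assumes "E \<in> Diag" "F \<in> Diag" shows "E o\<^sub>L F \<in> Diag"
proof (rule DiagI)
  show "E o\<^sub>L F \<in> conv_ops" using assms by (intro conv_ops_compose Diag_conv_ops)
  show "coef (E o\<^sub>L F) \<in> C_0 (unit_space G)"
    unfolding coef_Diag_Diag[OF assms] using assms by (intro C_0_mult Diag_coef)
qed

lemma coef_Diag_adjoint: assumes E: "E \<in> Diag" shows "coef (adjoint_op E) = (\<lambda>x. cnj (coef E x))"
proof
  fix x
  show "coef (adjoint_op E) x = cnj (coef E x)"
  proof (cases "x \<in> Ar")
    case True
    have "coef E (iv x) = coef E x"
    proof (cases "x \<in> units")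
      case True
      then show ?thesis by (simp only: units_inv)
    next
      case False
      then have "iv x \<notin> units" using units_inv inv_inv True by metis
      then show ?thesis using False Diag_coef_outside[OF E] by metis
    qed
    with coef_adjoint_op[OF Diag_conv_ops[OF E] True] show ?thesis by (simp only:)
  next
    case False
    from coef_outside[OF this] show ?thesis by simp
  qed
qed

lemma Diag_adjoint: assumes "E \<in> Diag" shows "adjoint_op E \<in> Diag"
proof (rule DiagI)
  show "adjoint_op E \<in> conv_ops" using assms by (intro conv_ops_adjoint_op Diag_conv_ops)
  show "coef (adjoint_op E) \<in> C_0 (unit_space G)"
    unfolding coef_Diag_adjoint[OF assms] using assms by (intro C_0_cnj Diag_coef)
qed

lemma C_c_unit_space: "C_c (unit_space G) \<subseteq> C_c (gtop G)"
  unfolding unit_space_eq by (rule C_c_open_subtopology[OF Hausdorff openin_units])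

text \<open>The diagonal uses functions vanishing at infinity, the algebra compactly supported ones.
  For functions on units the supremum bounds the operator norm, so a cutoff approximates in
  norm.\<close>

lemma Diag_subset_Cstar_r: "Diag \<subseteq> Cstar_r G"
proof
  fix E assume E: "E \<in> Diag"
  let ?f = "coef E"
  have f: "?f \<in> C_0 (unit_space G)" by (rule Diag_coef[OF E])
  have "\<exists>E'\<in>Creg. dist E' E < e" if e: "e > 0" for e
  proof -
    obtain g where gc: "g \<in> C_c (unit_space G)" and fg: "\<And>x. cmod (?f x - g x) \<le> e/2"
      by (rule C_0_cutoff[OF locally_compact_unit_space Hausdorff_unit_space f half_gt_zero[OF e]]) (rule that)
    define k where "k x = ?f x - g x" for x
    have g0: "g \<in> C_0 (unit_space G)" using gc C_c_subset_C_0[OF Hausdorff_unit_space] by blast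
    have k0: "k \<in> C_0 (unit_space G)" unfolding k_def by (rule C_0_diff[OF f g0])
    have kb: "cmod (k x) \<le> e/2" for x unfolding k_def by (rule fg)
    obtain E2 where E2: "E2 \<in> conv_ops" "coef E2 = k" "norm E2 \<le> e/2" using diag_operator[OF k0 kb] by metis
    let ?E1 = "diag_op g"
    have E1: "?E1 \<in> conv_ops" "coef ?E1 = g" using diag_op[OF g0] Diag_conv_ops by auto
    have "E = ?E1 + E2"
      by (rule conv_ops_eqI[OF Diag_conv_ops[OF E] conv_ops_add[OF E1(1) E2(1)]])
        (simp add: coef_add E1 E2 k_def fun_eq_iff)
    then have "dist ?E1 E = norm E2" by (simp add: dist_norm)
    also have "\<dots> < e" using E2(3) e by simp
    finally have "dist ?E1 E < e" .
    moreover have "?E1 \<in> Creg" unfolding Creg_def using E1 gc C_c_unit_space by auto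
    ultimately show ?thesis by blast
  qed
  then show "E \<in> Cstar_r G" unfolding Cstar_r_eq closure_approachable by blast
qed

text \<open>Membership test for products: continuity is automatic in the reduced algebra, so only
  the support has to be located.\<close>

lemma Diag_if_compact_support:
  assumes E: "E \<in> Cstar_r G" and K: "compactin (gtop G) K" "K \<subseteq> units" "\<And>x. x \<notin> K \<Longrightarrow> coef E x = 0"
  shows "E \<in> Diag"
proof -
  have "coef E \<in> C_c (unit_space G)"
    unfolding unit_space_eq C_c_open_subtopology_iff[OF Hausdorff openin_units]
    using Cstar_r_coef_continuous[OF E] K by blast
  then show ?thesis using C_c_subset_C_0[OF Hausdorff_unit_space] Cstar_r_conv_ops[OF E] by (blast intro: DiagI)
qed

lemma C_0_unit_bump:
  assumes x: "x \<in> units" and W: "openin (gtop G) W" "x \<in> W"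
  obtains f where "f \<in> C_0 (unit_space G)" "f x = 1" "\<And>y. y \<notin> W \<Longrightarrow> f y = 0"
proof -
  have "openin (unit_space G) (W \<inter> units)" unfolding unit_space_eq using W by (auto simp: openin_subtopology)
  then obtain c K where "c \<in> C_c (unit_space G)" "c x = 1" "K \<subseteq> W \<inter> units" "\<And>y. y \<notin> K \<Longrightarrow> c y = 0"
    using bump_C_c[OF locally_compact_unit_space Hausdorff_unit_space, of x "W \<inter> units"] x W
    by (metis IntI topspace_unit_space)
  then show thesis using that[of c] C_c_subset_C_0[OF Hausdorff_unit_space] by blast
qed

section \<open>Normalizers of the diagonal\<close>

definition normalizers :: "'g op set" where
  "normalizers = {n\<in>Cstar_r G. \<forall>f\<in>Diag. adjoint_op n o\<^sub>L (f o\<^sub>L n) \<in> Diag \<and> n o\<^sub>L (f o\<^sub>L adjoint_op n) \<in> Diag}"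

lemma normalizers_Cstar_r: "n \<in> normalizers \<Longrightarrow> n \<in> Cstar_r G"
  and normalizers_conv_ops: "n \<in> normalizers \<Longrightarrow> n \<in> conv_ops"
  by (simp_all add: normalizers_def Cstar_r_conv_ops)

lemma normalizers_adjoint: assumes "n \<in> normalizers" shows "adjoint_op n \<in> normalizers"
  using assms adjoint_op_adjoint_op[OF conv_ops_linear[OF normalizers_conv_ops[OF assms]]]
  by (simp add: normalizers_def Cstar_r_adjoint_op)

lemma Diag_normalizers: "E \<in> Diag \<Longrightarrow> E \<in> normalizers"
  using Diag_subset_Cstar_r by (auto simp: normalizers_def Diag_compose Diag_adjoint)

lemma coef_adjoint_nonzeroD:
  assumes "A \<in> conv_ops" "coef (adjoint_op A) \<gamma> \<noteq> 0" shows "coef A (iv \<gamma>) \<noteq> 0"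
  using assms coef_adjoint_op[OF assms(1), of \<gamma>] coef_outside by (cases "\<gamma> \<in> Ar") auto

lemma normalizers_compose:
  assumes n: "n \<in> normalizers" and m: "m \<in> normalizers" shows "n o\<^sub>L m \<in> normalizers"
  unfolding normalizers_def
proof (intro CollectI conjI ballI)
  show "n o\<^sub>L m \<in> Cstar_r G" using n m by (simp add: normalizers_Cstar_r Cstar_r_compose)
  have a: "adjoint_op (n o\<^sub>L m) = adjoint_op m o\<^sub>L adjoint_op n"
    using n m by (simp add: adjoint_op_compose conv_ops_linear normalizers_conv_ops)
  fix f assume f: "f \<in> Diag"
  have "adjoint_op (n o\<^sub>L m) o\<^sub>L (f o\<^sub>L (n o\<^sub>L m)) = adjoint_op m o\<^sub>L ((adjoint_op n o\<^sub>L (f o\<^sub>L n)) o\<^sub>L m)"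
    unfolding a by (rule blinfun_eqI) simp
  then show "adjoint_op (n o\<^sub>L m) o\<^sub>L (f o\<^sub>L (n o\<^sub>L m)) \<in> Diag" using n m f by (simp add: normalizers_def)
  have "n o\<^sub>L m o\<^sub>L (f o\<^sub>L adjoint_op (n o\<^sub>L m)) = n o\<^sub>L ((m o\<^sub>L (f o\<^sub>L adjoint_op m)) o\<^sub>L adjoint_op n)"
    unfolding a by (rule blinfun_eqI) simp
  then show "n o\<^sub>L m o\<^sub>L (f o\<^sub>L adjoint_op (n o\<^sub>L m)) \<in> Diag" using n m f by (simp add: normalizers_def)
qed

text \<open>In each product two arrows of the bisection meet that share a range, or a source. They
  coincide, so only units survive, and these lie in the compact image of \<open>K\<close>.\<close>

lemma bisection_function_normalizer:
  assumes f: "bisection_function f U K" and n: "n \<in> conv_ops" "coef n = f"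
  shows "n \<in> normalizers"
  unfolding normalizers_def
proof (intro CollectI conjI ballI)
  have U: "inj_on d U" "inj_on r U" and K: "compactin (gtop G) K" "K \<subseteq> U" "\<And>x. x \<notin> K \<Longrightarrow> f x = 0"
    using f unfolding bisection_function_def bisection_def by auto
  have KA: "K \<subseteq> Ar" by (rule compactin_subset_topspace[OF K(1)])
  have nK: "\<gamma> \<in> K" if "coef n \<gamma> \<noteq> 0" for \<gamma> using that n K(3) by metis
  show nC: "n \<in> Cstar_r G" using Creg_subset n bisection_function_C_c[OF f] by (auto simp: Creg_def)
  fix g assume g: "g \<in> Diag"
  have gC: "g \<in> Cstar_r G" using g Diag_subset_Cstar_r by blast
  note cl = nC gC Cstar_r_adjoint_op[OF nC] Cstar_r_compose
  note ops = cl(1-3)[THEN Cstar_r_conv_ops]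
  show "adjoint_op n o\<^sub>L (g o\<^sub>L n) \<in> Diag"
  proof (rule Diag_if_compact_support)
    show "compactin (gtop G) (d ` K)" by (rule image_compactin[OF K(1) continuous_dom])
    show "d ` K \<subseteq> units" using KA dom_in_units by blast
    fix x assume x: "x \<notin> d ` K"
    show "coef (adjoint_op n o\<^sub>L (g o\<^sub>L n)) x = 0"
    proof (rule ccontr)
      assume "coef (adjoint_op n o\<^sub>L (g o\<^sub>L n)) x \<noteq> 0"
      from coef_compose_nonzeroD[OF ops(3) conv_ops_compose[OF ops(2,1)] this]
      obtain \<alpha> \<beta> where ab: "\<alpha> \<in> Ar" "\<beta> \<in> Ar" "d \<alpha> = r \<beta>" "x = \<alpha> \<cdot> \<beta>"
        "coef (adjoint_op n) \<alpha> \<noteq> 0" "coef (g o\<^sub>L n) \<beta> \<noteq> 0" by blast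
      then have K2: "iv \<alpha> \<in> K" "\<beta> \<in> K"
        using coef_adjoint_nonzeroD[OF ops(1)] nK coef_Diag_compose[OF g ops(1) ab(2)] by auto
      then have "iv \<alpha> \<in> U" "\<beta> \<in> U" "r (iv \<alpha>) = r \<beta>" using K(2) ab by (auto simp: ran_inv)
      then have "iv \<alpha> = \<beta>" using U(2) by (auto simp: inj_on_def)
      then have "x = d \<beta>" using ab by (metis inv_inv inv_mult)
      with K2 x show False by blast
    qed
  qed (use cl in blast)
  show "n o\<^sub>L (g o\<^sub>L adjoint_op n) \<in> Diag"
  proof (rule Diag_if_compact_support)
    show "compactin (gtop G) (r ` K)" by (rule image_compactin[OF K(1) continuous_ran])
    show "r ` K \<subseteq> units" using KA ran_in_units by blast
    fix x assume x: "x \<notin> r ` K"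
    show "coef (n o\<^sub>L (g o\<^sub>L adjoint_op n)) x = 0"
    proof (rule ccontr)
      assume "coef (n o\<^sub>L (g o\<^sub>L adjoint_op n)) x \<noteq> 0"
      from coef_compose_nonzeroD[OF ops(1) conv_ops_compose[OF ops(2,3)] this]
      obtain \<alpha> \<beta> where ab: "\<alpha> \<in> Ar" "\<beta> \<in> Ar" "d \<alpha> = r \<beta>" "x = \<alpha> \<cdot> \<beta>"
        "coef n \<alpha> \<noteq> 0" "coef (g o\<^sub>L adjoint_op n) \<beta> \<noteq> 0" by blast
      then have K2: "\<alpha> \<in> K" "iv \<beta> \<in> K"
        using coef_adjoint_nonzeroD[OF ops(1)] nK coef_Diag_compose[OF g ops(3) ab(2)] by auto
      then have "iv \<beta> \<in> U" "\<alpha> \<in> U" "d (iv \<beta>) = d \<alpha>" using K(2) ab by (auto simp: dom_inv)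
      then have "iv \<beta> = \<alpha>" using U(1) by (auto simp: inj_on_def)
      then have "x = r \<alpha>" using ab by (metis inv_inv mult_inv)
      with K2 x show False by blast
    qed
  qed (use cl in blast)
qed

text \<open>A bump on a bisection inside \<open>W\<close>. Keeping the support inside
  \<open>W\<close> later places \<open>n\<close> in the algebra of an open subgroupoid.\<close>

lemma normalizer_exists:
  assumes g: "\<gamma> \<in> Ar" and W: "openin (gtop G) W" "\<gamma> \<in> W"
  obtains n K where "n \<in> normalizers" "coef n \<in> C_c (gtop G)" "coef n \<gamma> = 1"
    "compactin (gtop G) K" "K \<subseteq> W" "\<And>x. x \<notin> K \<Longrightarrow> coef n x = 0"
proof -
  obtain U where U: "bisection U" "\<gamma> \<in> U" "U \<subseteq> W" using bisection_neighbourhood[OF g W] .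
  then obtain c K where c: "c \<in> C_c (gtop G)" "c \<gamma> = 1" "compactin (gtop G) K" "K \<subseteq> U" "\<And>y. y \<notin> K \<Longrightarrow> c y = 0"
    using bump_C_c[OF locally_compact Hausdorff g, of U] unfolding bisection_def by metis
  have b: "bisection_function c U K" unfolding bisection_function_def using c U by (auto simp: C_c_def)
  obtain n where "n \<in> conv_ops" "coef n = c" using bisection_function_operator[OF b] .
  then show thesis using that[of n K] bisection_function_normalizer[OF b, of n] c U(3) by auto
qed

text \<open>At a unit \<open>x\<close> the product is the sum of
  \<open>cnj (coef a \<gamma>) * coef b \<gamma>\<close> over the arrows \<open>\<gamma>\<close>
  with source \<open>x\<close>, so a nonzero value needs a common arrow.\<close>

lemma coef_adjoint_compose_nonzeroD:
  assumes a: "a \<in> conv_ops" and b: "b \<in> conv_ops" and x: "x \<in> units" and nz: "coef (adjoint_op a o\<^sub>L b) x \<noteq> 0"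
  shows "\<exists>\<gamma>\<in>Ar. d \<gamma> = x \<and> coef a \<gamma> \<noteq> 0 \<and> coef b \<gamma> \<noteq> 0"
proof -
  obtain \<alpha> \<beta> where ab: "\<alpha> \<in> Ar" "\<beta> \<in> Ar" "d \<alpha> = r \<beta>" "x = \<alpha> \<cdot> \<beta>"
    "coef (adjoint_op a) \<alpha> \<noteq> 0" "coef b \<beta> \<noteq> 0"
    using coef_compose_nonzeroD[OF conv_ops_adjoint_op[OF a] b nz] by blast
  have dx: "d \<beta> = x" using ab x units_dom[of x] by (simp add: closed_simps)
  have "iv \<alpha> = \<beta> \<cdot> iv x"
    using ab inv_mult_distrib[of \<alpha> \<beta>] mult_inv_cancel[of \<beta> "iv \<alpha>"] by (simp add: closed_simps)
  also have "\<dots> = \<beta>" using dx x mult_dom[OF ab(2)] by (simp add: units_inv)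
  finally have "coef a \<beta> \<noteq> 0" using coef_adjoint_nonzeroD[OF a ab(5)] by simp
  then show ?thesis using ab dx by blast
qed

text \<open>The value is the squared norm of the column of \<open>a\<close> at
  \<open>d \<gamma>\<close>, so the arrows with this source cannot cancel.\<close>

lemma coef_adjoint_compose_self:
  assumes a: "a \<in> conv_ops" and g: "\<gamma> \<in> Ar" and nz: "coef a \<gamma> \<noteq> 0"
  shows "coef (adjoint_op a o\<^sub>L a) (d \<gamma>) \<noteq> 0"
proof -
  let ?v = "blinfun_apply a (delta_ell2 (d \<gamma>))"
  have "ell2_fun ?v \<gamma> = coef a \<gamma>" using g by (simp add: coef_def mcoef_def)
  then have "?v \<noteq> 0" using nz by (auto simp: zero_ell2.rep_eq)
  moreover have "coef (adjoint_op a o\<^sub>L a) (d \<gamma>) = of_real ((norm ?v)\<^sup>2)"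
    using g by (simp add: coef_def closed_simps mcoef_adjoint_compose[OF conv_ops_linear[OF a]] cinner_ell2_self)
  ultimately show ?thesis by simp
qed

lemma zero_conv_ops: "0 \<in> conv_ops" and coef_zero: "coef 0 = (\<lambda>_. 0)"
proof -
  have m: "mcoef 0 \<gamma> \<beta> = 0" for \<gamma> \<beta> :: 'g by (simp add: mcoef_def zero_ell2.rep_eq)
  show c: "coef 0 = (\<lambda>_. 0)" by (simp add: coef_def m fun_eq_iff)
  have "complex_linear (0 :: 'g op)"
    unfolding complex_linear_def by (intro allI ell2_eqI) (simp add: scaleC_ell2.rep_eq zero_ell2.rep_eq)
  then show "0 \<in> conv_ops" by (simp add: conv_ops_def m c conv_kernel_def)
qed

text \<open>Regrouping puts the diagonal element \<open>adjoint_op F o\<^sub>L F\<close> between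
  \<open>adjoint_op n\<close> and \<open>n\<close>. The weight \<open>F\<close> makes the result
  sensitive to the ranges of arrows.\<close>

lemma normalizer_square_Diag:
  assumes n: "n \<in> normalizers" and F: "F \<in> Diag"
  shows "adjoint_op (F o\<^sub>L n) o\<^sub>L (F o\<^sub>L n) \<in> Diag"
proof -
  have "adjoint_op (F o\<^sub>L n) = adjoint_op n o\<^sub>L adjoint_op F"
    using n F by (simp add: adjoint_op_compose conv_ops_linear normalizers_conv_ops Diag_conv_ops)
  then have "adjoint_op (F o\<^sub>L n) o\<^sub>L (F o\<^sub>L n) = adjoint_op n o\<^sub>L ((adjoint_op F o\<^sub>L F) o\<^sub>L n)"
    by (simp add: blinfun_eqI)
  then show ?thesis using n Diag_compose[OF Diag_adjoint[OF F] F] by (simp add: normalizers_def)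
qed

text \<open>If \<open>f\<close> and \<open>f'\<close> are bumps with disjoint supports at two ranges, then \<open>(f n)\<^sup>* (f n) e (f' n)\<^sup>* (f' n)\<close> vanishes,
  since the diagonal element \<open>n e n\<^sup>*\<close> commutes with \<open>f\<close>; but its value at the common source is the product of two
  positive numbers.\<close>

lemma normalizer_ran_unique:
  assumes n: "n \<in> normalizers" and g: "\<gamma> \<in> Ar" "\<gamma>' \<in> Ar" "d \<gamma> = d \<gamma>'" and nz: "coef n \<gamma> \<noteq> 0" "coef n \<gamma>' \<noteq> 0"
  shows "r \<gamma> = r \<gamma>'"
proof (rule ccontr)
  assume ne: "r \<gamma> \<noteq> r \<gamma>'"
  obtain V V' where V: "openin (gtop G) V" "openin (gtop G) V'" "r \<gamma> \<in> V" "r \<gamma>' \<in> V'" "disjnt V V'"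
    using Hausdorff ne g ran_closed unfolding Hausdorff_space_def by metis
  obtain f where f: "f \<in> C_0 (unit_space G)" "f (r \<gamma>) = 1" "\<And>y. y \<notin> V \<Longrightarrow> f y = 0"
    using C_0_unit_bump[OF ran_in_units[OF g(1)] V(1,3)] by metis
  obtain f' where f': "f' \<in> C_0 (unit_space G)" "f' (r \<gamma>') = 1" "\<And>y. y \<notin> V' \<Longrightarrow> f' y = 0"
    using C_0_unit_bump[OF ran_in_units[OF g(2)] V(2,4)] by metis
  obtain e where e: "e \<in> C_0 (unit_space G)" "e (d \<gamma>) = 1"
    using C_0_unit_bump[OF dom_in_units[OF g(1)] openin_topspace dom_closed[OF g(1)]] by metis
  let ?F = "diag_op f" and ?F' = "diag_op f'" and ?E = "diag_op e"
  note D = diag_op(1)[OF f(1)] diag_op(1)[OF f'(1)] diag_op(1)[OF e(1)]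
  note c = diag_op(2)[OF f(1)] diag_op(2)[OF f'(1)] diag_op(2)[OF e(1)]
  have nC: "n \<in> conv_ops" by (rule normalizers_conv_ops[OF n])
  let ?a = "?F o\<^sub>L n" and ?b = "?F' o\<^sub>L n"
  have ab: "?a \<in> conv_ops" "?b \<in> conv_ops" using D nC by (auto intro: conv_ops_compose Diag_conv_ops)
  have "coef ?a \<gamma> \<noteq> 0" "coef ?b \<gamma>' \<noteq> 0"
    using coef_Diag_compose[OF D(1) nC g(1)] coef_Diag_compose[OF D(2) nC g(2)] c nz f f' by auto
  then have nz2: "coef (adjoint_op ?a o\<^sub>L ?a) (d \<gamma>) \<noteq> 0" "coef (adjoint_op ?b o\<^sub>L ?b) (d \<gamma>) \<noteq> 0"
    using coef_adjoint_compose_self ab g by metis+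
  note sq = normalizer_square_Diag[OF n D(1)] normalizer_square_Diag[OF n D(2)]
  \<comment> \<open>A product of diagonal elements, hence evaluated pointwise. \<open>?E\<close> is
    inserted so that, after regrouping, \<open>n\<close> and its adjoint form the diagonal element
    \<open>?M\<close> in the middle.\<close>
  let ?P = "(adjoint_op ?a o\<^sub>L ?a) o\<^sub>L (?E o\<^sub>L (adjoint_op ?b o\<^sub>L ?b))"
  have "coef ?P (d \<gamma>) \<noteq> 0"
    using nz2 e by (simp add: coef_Diag_Diag sq D Diag_compose c)
  let ?M = "n o\<^sub>L (?E o\<^sub>L adjoint_op n)"
  have M: "?M \<in> Diag" using n D by (simp add: normalizers_def)
  let ?Z = "?F o\<^sub>L (?M o\<^sub>L adjoint_op ?F')"
  have "coef ?Z = (\<lambda>_. 0)"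
    using f(3) f'(3) V(5) by (auto simp: coef_Diag_Diag D M Diag_compose Diag_adjoint coef_Diag_adjoint c disjnt_iff fun_eq_iff)
  then have "?Z = 0"
    by (intro conv_ops_eqI zero_conv_ops) (simp_all add: coef_zero Diag_conv_ops Diag_compose D M Diag_adjoint)
  have adj_b: "adjoint_op ?b = adjoint_op n o\<^sub>L adjoint_op ?F'"
    using nC D by (simp add: adjoint_op_compose conv_ops_linear Diag_conv_ops)
  have "?P = adjoint_op ?a o\<^sub>L (?Z o\<^sub>L ?b)"
    unfolding adj_b by (rule blinfun_eqI) simp
  also have "\<dots> = 0" using \<open>?Z = 0\<close> by (simp add: blinfun_eqI)
  finally have "coef ?P (d \<gamma>) = 0" by (simp add: coef_zero)
  with \<open>coef ?P (d \<gamma>) \<noteq> 0\<close> show False by simp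
qed

text \<open>The open support of a normalizer is a bisection: the range of an arrow in it is determined by the
  source, and two arrows with equal sources and ranges would persist nearby over a unit with trivial isotropy.\<close>

lemma normalizer_dom_injective:
  assumes tp: "topologically_principal G" and n: "n \<in> normalizers"
    and g: "\<gamma> \<in> Ar" "\<gamma>' \<in> Ar" "d \<gamma> = d \<gamma>'" and nz: "coef n \<gamma> \<noteq> 0" "coef n \<gamma>' \<noteq> 0"
  shows "\<gamma> = \<gamma>'"
proof (rule ccontr)
  assume ne: "\<gamma> \<noteq> \<gamma>'"
  obtain U V where UV: "openin (gtop G) U" "openin (gtop G) V" "\<gamma> \<in> U" "\<gamma>' \<in> V" "disjnt U V"
    using Hausdorff ne g unfolding Hausdorff_space_def by metis
  let ?S = "{\<gamma>\<in>Ar. coef n \<gamma> \<noteq> 0}"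
  have S: "openin (gtop G) ?S"
    by (rule openin_nonzero[OF Cstar_r_coef_continuous[OF normalizers_Cstar_r[OF n]]])
  \<comment> \<open>Sources of two different arrows of the support, one near \<open>\<gamma>\<close>
    and one near \<open>\<gamma>'\<close>. This set of units is open and nonempty, so it contains
    one with trivial isotropy.\<close>
  let ?W = "d ` (U \<inter> ?S) \<inter> d ` (V \<inter> ?S)"
  have "openin (gtop G) ?W"
    using open_map_dom UV S unfolding open_map_def by (blast intro: openin_Int)
  then have "openin (unit_space G) ?W"
    unfolding unit_space_eq openin_subtopology by (intro exI[of _ ?W]) (auto simp: units_def)
  moreover have "d \<gamma> \<in> ?W"
  proof
    show "d \<gamma> \<in> d ` (U \<inter> ?S)" using g nz UV by blast
    show "d \<gamma> \<in> d ` (V \<inter> ?S)" unfolding g(3) using g nz UV by blast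
  qed
  moreover have "d \<gamma> \<in> unit_space G closure_of {x\<in>topspace (unit_space G). isotropy_group G x = {x}}"
    using tp g unfolding topologically_principal_def by (simp add: topspace_unit_space dom_in_units)
  ultimately have "\<exists>x. x \<in> {x\<in>topspace (unit_space G). isotropy_group G x = {x}} \<and> x \<in> ?W"
    unfolding in_closure_of by meson
  then obtain x where x: "x \<in> ?W" "isotropy_group G x = {x}" by auto
  obtain \<alpha> \<beta> where ab: "\<alpha> \<in> U" "\<alpha> \<in> Ar" "coef n \<alpha> \<noteq> 0" "d \<alpha> = x" "\<beta> \<in> V" "\<beta> \<in> Ar" "coef n \<beta> \<noteq> 0" "d \<beta> = x"
    using x(1) by auto
  have rr: "r \<alpha> = r \<beta>" by (rule normalizer_ran_unique[OF n ab(2,6) _ ab(3,7)]) (simp add: ab)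
  \<comment> \<open>The ranges agree, so the quotient of the two arrows is an isotropy element and
    therefore a unit.\<close>
  have "iv \<beta> \<cdot> \<alpha> \<in> isotropy_group G x" using ab rr by (auto simp: isotropy_group_def closed_simps)
  then have "iv \<beta> \<cdot> \<alpha> = d \<beta>" using x ab by simp
  then have "\<alpha> = \<beta>" using ab rr mult_inv_cancel[of \<beta> \<alpha>] mult_dom[of \<beta>] by metis
  then show False using ab UV by (auto simp: disjnt_iff)
qed

text \<open>Inverse arrows reduce this to the statement about sources for
  \<open>adjoint_op n\<close>.\<close>

lemma normalizer_ran_injective:
  assumes tp: "topologically_principal G" and n: "n \<in> normalizers"
    and g: "\<gamma> \<in> Ar" "\<gamma>' \<in> Ar" "r \<gamma> = r \<gamma>'" and nz: "coef n \<gamma> \<noteq> 0" "coef n \<gamma>' \<noteq> 0"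
  shows "\<gamma> = \<gamma>'"
proof -
  have "iv \<gamma> = iv \<gamma>'"
  proof (rule normalizer_dom_injective[OF tp normalizers_adjoint[OF n]])
    show "iv \<gamma> \<in> Ar" "iv \<gamma>' \<in> Ar" "d (iv \<gamma>) = d (iv \<gamma>')" using g by (simp_all add: closed_simps)
    show "coef (adjoint_op n) (iv \<gamma>) \<noteq> 0" "coef (adjoint_op n) (iv \<gamma>') \<noteq> 0"
      using g nz by (simp_all add: coef_adjoint_op normalizers_conv_ops[OF n] inv_closed inv_inv)
  qed
  then show ?thesis using g by (metis inv_inv)
qed

text \<open>Over a given source the support of \<open>m\<close> has a single arrow, so the
  convolution sum has one term.\<close>

lemma normalizers_compose_coef:
  assumes tp: "topologically_principal G" and n: "n \<in> normalizers" and m: "m \<in> normalizers"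
    and g: "\<alpha> \<in> Ar" "\<beta> \<in> Ar" "d \<alpha> = r \<beta>" and nz: "coef n \<alpha> \<noteq> 0" "coef m \<beta> \<noteq> 0"
  shows "coef (n o\<^sub>L m) (\<alpha> \<cdot> \<beta>) \<noteq> 0"
proof -
  have "coef (n o\<^sub>L m) (\<alpha> \<cdot> \<beta>) = coef n (\<alpha> \<cdot> \<beta> \<cdot> iv \<beta>) * coef m \<beta>"
  proof (rule coef_compose_eq_single[OF normalizers_conv_ops[OF n] normalizers_conv_ops[OF m]])
    fix \<tau> assume t: "\<tau> \<in> Ar" "d \<tau> = d (\<alpha> \<cdot> \<beta>)" "\<tau> \<noteq> \<beta>"
    then have "coef m \<tau> = 0"
      using normalizer_dom_injective[OF tp m t(1) g(2) _ _ nz(2)] g by (auto simp: closed_simps)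
    then show "coef n (\<alpha> \<cdot> \<beta> \<cdot> iv \<tau>) * coef m \<tau> = 0" by simp
  qed (use g in \<open>simp_all add: closed_simps\<close>)
  then show ?thesis using g nz by (simp add: mult_mult_inv)
qed

text \<open>Evaluation of \<open>coef\<close> at a point is continuous, so vanishing off
  \<open>P\<close> passes from compactly supported functions to the closure.\<close>

lemma Cstar_r_sub_coef:
  assumes P: "openin (gtop G) P" and A: "A \<in> Cstar_r_sub G (restrict_groupoid G P)" and g: "\<gamma> \<notin> P"
  shows "coef A \<gamma> = 0"
proof -
  let ?C = "C_c (subtopology (gtop G) P)"
  have z: "f \<gamma> = 0" if "f \<in> ?C" "\<gamma> \<notin> P" for f \<gamma>
    using that by (simp add: C_c_def)
  have "left_regular G ?C \<subseteq> {A. coef A \<gamma> = 0}"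
  proof -
    have "left_regular G ?C = {A\<in>conv_ops. coef A \<in> ?C}"
      by (rule left_regular_eq) (use z openin_subset[OF P] in blast)
    then show ?thesis using z g by auto
  qed
  moreover have "closed {A. coef A \<gamma> = 0}"
    unfolding coef_def
    by (cases "\<gamma> \<in> Ar") (auto intro!: closed_Collect_eq linear_continuous_on[OF bounded_linear_mcoef] continuous_on_const)
  ultimately have "closure (left_regular G ?C) \<subseteq> {A. coef A \<gamma> = 0}" by (rule closure_minimal)
  then show ?thesis using A by (auto simp: Cstar_r_sub_def restrict_groupoid_def)
qed

lemma Cstar_r_subI:
  assumes P: "openin (gtop G) P" and A: "A \<in> conv_ops" "coef A \<in> C_c (gtop G)"
    and K: "compactin (gtop G) K" "K \<subseteq> P" "\<And>x. x \<notin> K \<Longrightarrow> coef A x = 0"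
  shows "A \<in> Cstar_r_sub G (restrict_groupoid G P)"
proof -
  have "coef A \<in> C_c (subtopology (gtop G) P)"
    unfolding C_c_open_subtopology_iff[OF Hausdorff P] using A K by (auto simp: C_c_def)
  then have "A \<in> left_regular G (C_c (subtopology (gtop G) P))"
    unfolding left_regular_iff using A by (auto simp: conv_ops_linear conv_ops_mcoef)
  then show ?thesis
    using closure_subset by (auto simp: Cstar_r_sub_def restrict_groupoid_def)
qed

end

section \<open>Reconstruction of the groupoid from the diagonal\<close>

text \<open>The homeomorphism of unit spaces is a parameter, so that the inverse of
  \<open>\<phi>\<close> together with the inverse of \<open>h\<close> is again an instance and every
  lemma holds in both directions.\<close>

locale diagonal_isomorphism = G: etale_groupoid G + H: etale_groupoid H
  for G :: "('g, 'm) top_groupoid_scheme" and H :: "('h, 'n) top_groupoid_scheme" +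
  fixes \<phi> :: "'g op \<Rightarrow> 'h op" and h :: "'g \<Rightarrow> 'h"
  assumes principal_G: "topologically_principal G" and principal_H: "topologically_principal H"
    and iso: "star_isomorphism (Cstar_r G) (Cstar_r H) \<phi>"
    and Diag: "\<phi> ` diagonal_subalgebra G = diagonal_subalgebra H"
    and h: "homeomorphic_map (unit_space G) (unit_space H) h"
    and coef_h: "E \<in> diagonal_subalgebra G \<Longrightarrow> x \<in> G.units \<Longrightarrow> H.coef (\<phi> E) (h x) = G.coef E x"
begin

lemma phi_Cstar_r: "A \<in> Cstar_r G \<Longrightarrow> \<phi> A \<in> Cstar_r H"
  using iso unfolding star_isomorphism_def bij_betw_def by blast

lemma phi_compose: "A \<in> Cstar_r G \<Longrightarrow> B \<in> Cstar_r G \<Longrightarrow> \<phi> (A o\<^sub>L B) = \<phi> A o\<^sub>L \<phi> B"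
  using iso unfolding star_isomorphism_def by blast

lemma phi_adjoint: "A \<in> Cstar_r G \<Longrightarrow> \<phi> (adjoint_op A) = adjoint_op (\<phi> A)"
  using iso unfolding star_isomorphism_def by blast

lemma phi_Diag: "E \<in> diagonal_subalgebra G \<Longrightarrow> \<phi> E \<in> diagonal_subalgebra H"
  using Diag by blast

lemma Diag_Cstar_r: "E \<in> diagonal_subalgebra G \<Longrightarrow> E \<in> Cstar_r G"
  using G.Diag_subset_Cstar_r by blast

lemma h_units: "x \<in> G.units \<Longrightarrow> h x \<in> H.units"
  using homeomorphic_imp_surjective_map[OF h] by (auto simp: G.topspace_unit_space H.topspace_unit_space)

lemma h_inj: "x \<in> G.units \<Longrightarrow> y \<in> G.units \<Longrightarrow> h x = h y \<Longrightarrow> x = y"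
  using homeomorphic_imp_injective_map[OF h] by (auto simp: G.topspace_unit_space inj_on_def)

lemma h_surj: "y \<in> H.units \<Longrightarrow> \<exists>x\<in>G.units. h x = y"
  using homeomorphic_imp_surjective_map[OF h] unfolding G.topspace_unit_space H.topspace_unit_space
  by (metis imageE)

lemma phi_normalizers:
  assumes n: "n \<in> G.normalizers" shows "\<phi> n \<in> H.normalizers"
  unfolding H.normalizers_def
proof (intro CollectI conjI ballI)
  have nC: "n \<in> Cstar_r G" by (rule G.normalizers_Cstar_r[OF n])
  show "\<phi> n \<in> Cstar_r H" by (rule phi_Cstar_r[OF nC])
  fix f assume "f \<in> diagonal_subalgebra H"
  then obtain g where g: "g \<in> diagonal_subalgebra G" "f = \<phi> g"
    unfolding Diag[symmetric] by (metis imageE)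
  note C = nC Diag_Cstar_r[OF g(1)] G.Cstar_r_adjoint_op[OF nC]
  have "\<phi> (adjoint_op n o\<^sub>L (g o\<^sub>L n)) = adjoint_op (\<phi> n) o\<^sub>L (f o\<^sub>L \<phi> n)"
    using C by (simp add: phi_compose phi_adjoint G.Cstar_r_compose g)
  then show "adjoint_op (\<phi> n) o\<^sub>L (f o\<^sub>L \<phi> n) \<in> diagonal_subalgebra H"
    using phi_Diag n g by (metis (no_types, lifting) G.normalizers_def mem_Collect_eq)
  have "\<phi> (n o\<^sub>L (g o\<^sub>L adjoint_op n)) = \<phi> n o\<^sub>L (f o\<^sub>L adjoint_op (\<phi> n))"
    using C by (simp add: phi_compose phi_adjoint G.Cstar_r_compose g)
  then show "\<phi> n o\<^sub>L (f o\<^sub>L adjoint_op (\<phi> n)) \<in> diagonal_subalgebra H"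
    using phi_Diag n g by (metis (no_types, lifting) G.normalizers_def mem_Collect_eq)
qed

lemma phi_normalizer_conv_ops: "n \<in> G.normalizers \<Longrightarrow> \<phi> n \<in> H.conv_ops"
  by (rule H.normalizers_conv_ops[OF phi_normalizers])

text \<open>The diagonal element formed from \<open>F o\<^sub>L n\<close> is nonzero at the source
  of \<open>\<gamma>\<close>, so its image is nonzero at \<open>h (gdom G \<gamma>)\<close>, which
  must be the source of an arrow in the image's support. The weight \<open>F\<close> survives as
  information about the range.\<close>

lemma transfer_weighted:
  assumes n: "n \<in> G.normalizers" and g: "\<gamma> \<in> arrows G" "G.coef n \<gamma> \<noteq> 0"
    and F: "F \<in> diagonal_subalgebra G" "G.coef F (gran G \<gamma>) \<noteq> 0"
  shows "\<exists>\<beta>\<in>arrows H. gdom H \<beta> = h (gdom G \<gamma>) \<and> H.coef (\<phi> n) \<beta> \<noteq> 0 \<and> H.coef (\<phi> F) (gran H \<beta>) \<noteq> 0"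
proof -
  have nC: "n \<in> Cstar_r G" "n \<in> G.conv_ops" using n by (simp_all add: G.normalizers_Cstar_r G.normalizers_conv_ops)
  let ?a = "F o\<^sub>L n"
  have aC: "?a \<in> Cstar_r G" using nC F Diag_Cstar_r G.Cstar_r_compose by blast
  have "G.coef ?a \<gamma> \<noteq> 0" using G.coef_Diag_compose[OF F(1) nC(2) g(1)] g F by simp
  then have nz: "G.coef (adjoint_op ?a o\<^sub>L ?a) (gdom G \<gamma>) \<noteq> 0"
    by (rule G.coef_adjoint_compose_self[OF G.Cstar_r_conv_ops[OF aC] g(1)])
  have pa: "\<phi> ?a = \<phi> F o\<^sub>L \<phi> n" using nC F Diag_Cstar_r phi_compose by blast
  have "\<phi> (adjoint_op ?a o\<^sub>L ?a) = adjoint_op (\<phi> ?a) o\<^sub>L \<phi> ?a"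
    using aC by (simp add: phi_compose phi_adjoint G.Cstar_r_adjoint_op)
  then have "H.coef (adjoint_op (\<phi> ?a) o\<^sub>L \<phi> ?a) (h (gdom G \<gamma>)) \<noteq> 0"
    using nz coef_h[OF G.normalizer_square_Diag[OF n F(1)] G.dom_in_units[OF g(1)]] by simp
  then obtain \<beta> where b: "\<beta> \<in> arrows H" "gdom H \<beta> = h (gdom G \<gamma>)" "H.coef (\<phi> ?a) \<beta> \<noteq> 0"
    using H.coef_adjoint_compose_nonzeroD H.Cstar_r_conv_ops[OF phi_Cstar_r[OF aC]] h_units G.dom_in_units[OF g(1)]
    by metis
  then have "H.coef (\<phi> F) (gran H \<beta>) \<noteq> 0" "H.coef (\<phi> n) \<beta> \<noteq> 0"
    using H.coef_Diag_compose[OF phi_Diag[OF F(1)] phi_normalizer_conv_ops[OF n] b(1)] by (auto simp: pa)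
  with b show ?thesis by blast
qed

text \<open>The source comes from the weighted version. For the range, a weight that is
  \<open>1\<close> at \<open>gran G \<gamma>\<close> and vanishes at the preimage of a wrong
  \<open>gran H \<beta>\<close> would have to be nonzero at that preimage.\<close>

lemma transfer:
  assumes n: "n \<in> G.normalizers" and g: "\<gamma> \<in> arrows G" "G.coef n \<gamma> \<noteq> 0"
  shows "\<exists>\<beta>\<in>arrows H. gdom H \<beta> = h (gdom G \<gamma>) \<and> gran H \<beta> = h (gran G \<gamma>) \<and> H.coef (\<phi> n) \<beta> \<noteq> 0"
proof -
  have ry: "gran G \<gamma> \<in> G.units" by (rule G.ran_in_units[OF g(1)])
  obtain f where f: "f \<in> C_0 (unit_space G)" "f (gran G \<gamma>) = 1"
    using G.C_0_unit_bump[OF ry openin_topspace G.ran_closed[OF g(1)]] by metis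
  obtain \<beta> where b: "\<beta> \<in> arrows H" "gdom H \<beta> = h (gdom G \<gamma>)" "H.coef (\<phi> n) \<beta> \<noteq> 0"
    using transfer_weighted[OF n g, of "G.diag_op f"] G.diag_op[OF f(1)] f(2) by auto
  have "gran H \<beta> = h (gran G \<gamma>)"
  proof (rule ccontr)
    assume ne: "gran H \<beta> \<noteq> h (gran G \<gamma>)"
    obtain y where y: "y \<in> G.units" "h y = gran H \<beta>" using h_surj H.ran_in_units[OF b(1)] by blast
    have "openin (gtop G) (arrows G - {y})" "gran G \<gamma> \<in> arrows G - {y}"
      using ne y closedin_Hausdorff_sing_eq[OF G.Hausdorff] G.units_arrow[OF y(1)] G.ran_closed[OF g(1)] by auto
    then obtain f where f: "f \<in> C_0 (unit_space G)" "f (gran G \<gamma>) = 1" "\<And>z. z \<notin> arrows G - {y} \<Longrightarrow> f z = 0"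
      using G.C_0_unit_bump[OF ry] by metis
    let ?F = "G.diag_op f"
    have F: "?F \<in> diagonal_subalgebra G" "G.coef ?F = f" using G.diag_op[OF f(1)] by auto
    obtain \<beta>' where b': "\<beta>' \<in> arrows H" "gdom H \<beta>' = h (gdom G \<gamma>)" "H.coef (\<phi> n) \<beta>' \<noteq> 0" "H.coef (\<phi> ?F) (gran H \<beta>') \<noteq> 0"
      using transfer_weighted[OF n g F(1)] F(2) f(2) by auto
    \<comment> \<open>The new weight might produce a new arrow, but the support of
      \<open>\<phi> n\<close> has one arrow over each source.\<close>
    have "\<beta>' = \<beta>"
      using H.normalizer_dom_injective[OF principal_H phi_normalizers[OF n] b'(1) b(1)] b b' by simp
    then have "H.coef (\<phi> ?F) (h y) \<noteq> 0" using b' y by simp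
    then have "f y \<noteq> 0" using coef_h[OF F(1) y(1)] F(2) by simp
    then show False using f(3) by blast
  qed
  with b show ?thesis by blast
qed

text \<open>If the bump \<open>f\<close> is supported where both open supports contain a common arrow, then \<open>f n\<^sup>* n'\<close> lies in the
  diagonal and does not vanish at the source of \<open>\<gamma>\<close>; its image \<open>\<phi>(f) \<phi>(n)\<^sup>* \<phi>(n')\<close> detects an arrow common to
  \<open>\<phi>(n)\<close> and \<open>\<phi>(n')\<close>.\<close>

lemma transfer_common:
  assumes n: "n \<in> G.normalizers" "n' \<in> G.normalizers"
    and g: "\<gamma> \<in> arrows G" "G.coef n \<gamma> \<noteq> 0" "G.coef n' \<gamma> \<noteq> 0"
  shows "\<exists>\<beta>\<in>arrows H. gdom H \<beta> = h (gdom G \<gamma>) \<and> H.coef (\<phi> n) \<beta> \<noteq> 0 \<and> H.coef (\<phi> n') \<beta> \<noteq> 0"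
proof -
  have nC: "n \<in> Cstar_r G" "n \<in> G.conv_ops" "n' \<in> Cstar_r G" "n' \<in> G.conv_ops"
    using n by (simp_all add: G.normalizers_Cstar_r G.normalizers_conv_ops)
  let ?W = "{\<gamma>\<in>arrows G. G.coef n \<gamma> \<noteq> 0} \<inter> {\<gamma>\<in>arrows G. G.coef n' \<gamma> \<noteq> 0}"
  let ?x = "gdom G \<gamma>"
  have x: "?x \<in> G.units" by (rule G.dom_in_units[OF g(1)])
  have W: "openin (gtop G) ?W"
    by (intro openin_Int openin_nonzero G.Cstar_r_coef_continuous nC)
  have dW: "openin (gtop G) (gdom G ` ?W)" using G.open_map_dom W unfolding open_map_def by blast
  have "?x \<in> gdom G ` ?W" using g by blast
  then have "openin (unit_space G) (gdom G ` ?W)"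
    unfolding G.unit_space_eq openin_subtopology
    by (intro exI[of _ "gdom G ` ?W"] conjI dW) (auto simp: G.dom_in_units)
  then obtain f K where f: "f \<in> C_c (unit_space G)" "f ?x = 1" "compactin (unit_space G) K" "K \<subseteq> gdom G ` ?W" "\<And>y. y \<notin> K \<Longrightarrow> f y = 0"
    using bump_C_c[OF G.locally_compact_unit_space G.Hausdorff_unit_space
        x[folded G.topspace_unit_space] _ \<open>?x \<in> gdom G ` ?W\<close>] by blast
  have f0: "f \<in> C_0 (unit_space G)" using f(1) C_c_subset_C_0[OF G.Hausdorff_unit_space] by blast
  let ?F = "G.diag_op f"
  have F: "?F \<in> diagonal_subalgebra G" "G.coef ?F = f" using G.diag_op[OF f0] by auto
  have mC: "adjoint_op n \<in> Cstar_r G" "adjoint_op n o\<^sub>L n' \<in> Cstar_r G"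
    using nC G.Cstar_r_adjoint_op G.Cstar_r_compose by blast+
  let ?e = "?F o\<^sub>L (adjoint_op n o\<^sub>L n')"
  have ce: "G.coef ?e \<eta> = f (gran G \<eta>) * G.coef (adjoint_op n o\<^sub>L n') \<eta>" if "\<eta> \<in> arrows G" for \<eta>
    using G.coef_Diag_compose[OF F(1) G.Cstar_r_conv_ops[OF mC(2)] that] F(2) by simp
  have K: "compactin (gtop G) K" "K \<subseteq> G.units"
    using f(3) by (simp_all add: G.unit_space_eq compactin_subtopology)
  \<comment> \<open>The bump admits only products whose left factor has the source of a common arrow
    \<open>\<sigma>\<close> as its range. Injectivity of source and then of range identifies both
    factors with \<open>\<sigma>\<close>, up to inversion, and the product is a unit.\<close>
  have "?e \<in> diagonal_subalgebra G"
  proof (rule G.Diag_if_compact_support[OF _ K])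
    show "?e \<in> Cstar_r G" by (rule G.Cstar_r_compose[OF Diag_Cstar_r[OF F(1)] mC(2)])
    fix \<eta> assume eta: "\<eta> \<notin> K"
    show "G.coef ?e \<eta> = 0"
    proof (rule ccontr)
      assume nz: "G.coef ?e \<eta> \<noteq> 0"
      then have eA: "\<eta> \<in> arrows G" using G.coef_outside by blast
      then have "f (gran G \<eta>) \<noteq> 0" and nz2: "G.coef (adjoint_op n o\<^sub>L n') \<eta> \<noteq> 0" using nz ce by auto
      then have rK: "gran G \<eta> \<in> K" using f(5) by blast
      then obtain \<sigma> where s: "\<sigma> \<in> arrows G" "G.coef n \<sigma> \<noteq> 0" "G.coef n' \<sigma> \<noteq> 0" "gdom G \<sigma> = gran G \<eta>"
        using f(4) by auto
      obtain \<alpha> \<beta> where ab: "\<alpha> \<in> arrows G" "\<beta> \<in> arrows G" "gdom G \<alpha> = gran G \<beta>" "\<eta> = gmult G \<alpha> \<beta>"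
        "G.coef (adjoint_op n) \<alpha> \<noteq> 0" "G.coef n' \<beta> \<noteq> 0"
        using G.coef_compose_nonzeroD[OF G.Cstar_r_conv_ops[OF mC(1)] nC(4) nz2] by blast
      have na: "G.coef n (ginv G \<alpha>) \<noteq> 0" by (rule G.coef_adjoint_nonzeroD[OF nC(2) ab(5)])
      have "ginv G \<alpha> = \<sigma>"
        by (rule G.normalizer_dom_injective[OF principal_G n(1) _ s(1) _ na s(2)])
          (use ab s in \<open>simp_all add: G.closed_simps\<close>)
      moreover from this have "\<sigma> = \<beta>"
        using ab by (intro G.normalizer_ran_injective[OF principal_G n(2) s(1) ab(2) _ s(3) ab(6)])
          (metis G.ran_inv)
      ultimately have "\<eta> = gdom G \<beta>" using ab by (metis G.inv_inv G.inv_mult)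
      then have "gran G \<eta> = \<eta>" using ab by (simp add: G.closed_simps)
      then show False using rK eta by simp
    qed
  qed
  then have "H.coef (\<phi> ?e) (h ?x) = G.coef ?e ?x" by (rule coef_h[OF _ x])
  moreover have "G.coef ?e ?x \<noteq> 0"
  proof -
    \<comment> \<open>One term remains, since \<open>\<gamma>\<close> is the only arrow of the
      support of \<open>n'\<close> with its source.\<close>
    have "G.coef (adjoint_op n o\<^sub>L n') ?x = G.coef (adjoint_op n) (gmult G ?x (ginv G \<gamma>)) * G.coef n' \<gamma>"
    proof (rule G.coef_compose_eq_single[OF G.Cstar_r_conv_ops[OF mC(1)] nC(4)])
      fix \<alpha> assume a: "\<alpha> \<in> arrows G" "gdom G \<alpha> = gdom G ?x" "\<alpha> \<noteq> \<gamma>"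
      then have "G.coef n' \<alpha> = 0"
        using G.normalizer_dom_injective[OF principal_G n(2) a(1) g(1) _ _ g(3)] g(1) by (auto simp: G.closed_simps)
      then show "G.coef (adjoint_op n) (gmult G ?x (ginv G \<alpha>)) * G.coef n' \<alpha> = 0" by simp
    qed (use g in \<open>simp_all add: G.closed_simps\<close>)
    also have "gmult G ?x (ginv G \<gamma>) = ginv G \<gamma>"
      using G.ran_mult_self[of "ginv G \<gamma>"] g(1) by (simp add: G.closed_simps)
    also have "G.coef (adjoint_op n) (ginv G \<gamma>) = cnj (G.coef n \<gamma>)"
      using g(1) by (simp add: G.coef_adjoint_op[OF nC(2)] G.closed_simps G.inv_inv)
    finally show ?thesis using ce[of ?x] f(2) g by (simp add: G.closed_simps)
  qed
  moreover have "\<phi> ?e = \<phi> ?F o\<^sub>L (adjoint_op (\<phi> n) o\<^sub>L \<phi> n')"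
    using nC mC F Diag_Cstar_r by (simp add: phi_compose phi_adjoint)
  moreover have hx: "h ?x \<in> H.units" by (rule h_units[OF x])
  moreover have co: "adjoint_op (\<phi> n) o\<^sub>L \<phi> n' \<in> H.conv_ops"
    using n by (intro H.conv_ops_compose H.conv_ops_adjoint_op phi_normalizer_conv_ops)
  ultimately have "H.coef (adjoint_op (\<phi> n) o\<^sub>L \<phi> n') (h ?x) \<noteq> 0"
    using H.coef_Diag_compose[OF phi_Diag[OF F(1)] co H.units_arrow[OF hx]] by auto
  then show ?thesis
    using H.coef_adjoint_compose_nonzeroD[OF phi_normalizer_conv_ops[OF n(1)] phi_normalizer_conv_ops[OF n(2)] hx] by blast
qed

text \<open>As a relation, without a choice of \<open>n\<close>, it can be recognised as the
  converse of the relation for the inverse isomorphism.\<close>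

definition related :: "'g \<Rightarrow> 'h \<Rightarrow> bool" where
  "related \<gamma> \<beta> \<longleftrightarrow> (\<exists>n\<in>G.normalizers. G.coef n \<gamma> \<noteq> 0 \<and> H.coef (\<phi> n) \<beta> \<noteq> 0 \<and> h (gdom G \<gamma>) = gdom H \<beta>)"

lemma related_arrows: "related \<gamma> \<beta> \<Longrightarrow> \<gamma> \<in> arrows G \<and> \<beta> \<in> arrows H"
  unfolding related_def using G.coef_outside H.coef_outside by blast

lemma related_dom: "related \<gamma> \<beta> \<Longrightarrow> gdom H \<beta> = h (gdom G \<gamma>)"
  unfolding related_def by auto

lemma related_unique:
  assumes "related \<gamma> \<beta>" "related \<gamma> \<beta>'" shows "\<beta> = \<beta>'"
proof -
  obtain n where n: "n \<in> G.normalizers" "G.coef n \<gamma> \<noteq> 0" "H.coef (\<phi> n) \<beta> \<noteq> 0" "h (gdom G \<gamma>) = gdom H \<beta>"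
    using assms(1) unfolding related_def by blast
  obtain n' where n': "n' \<in> G.normalizers" "G.coef n' \<gamma> \<noteq> 0" "H.coef (\<phi> n') \<beta>' \<noteq> 0" "h (gdom G \<gamma>) = gdom H \<beta>'"
    using assms(2) unfolding related_def by blast
  have A: "\<gamma> \<in> arrows G" "\<beta> \<in> arrows H" "\<beta>' \<in> arrows H" using assms related_arrows by blast+
  \<comment> \<open>An arrow common to both images, over the source shared by \<open>\<beta>\<close>
    and \<open>\<beta>'\<close>; each image has only one arrow there.\<close>
  obtain \<eta> where e: "\<eta> \<in> arrows H" "gdom H \<eta> = h (gdom G \<gamma>)" "H.coef (\<phi> n) \<eta> \<noteq> 0" "H.coef (\<phi> n') \<eta> \<noteq> 0"
    using transfer_common[OF n(1) n'(1) A(1) n(2) n'(2)] by blast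
  have "\<eta> = \<beta>"
    using H.normalizer_dom_injective[OF principal_H phi_normalizers[OF n(1)] e(1) A(2) _ e(3) n(3)] e(2) n(4) by simp
  moreover have "\<eta> = \<beta>'"
    using H.normalizer_dom_injective[OF principal_H phi_normalizers[OF n'(1)] e(1) A(3) _ e(4) n'(3)] e(2) n'(4) by simp
  ultimately show ?thesis by simp
qed

lemma related_normalizer:
  assumes n: "n \<in> G.normalizers" and g: "G.coef n \<gamma> \<noteq> 0"
  shows "\<exists>\<beta>. related \<gamma> \<beta> \<and> H.coef (\<phi> n) \<beta> \<noteq> 0 \<and> gran H \<beta> = h (gran G \<gamma>)"
proof -
  have "\<gamma> \<in> arrows G" using g G.coef_outside by blast
  from transfer[OF n this g] show ?thesis unfolding related_def using n g by metis
qed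

lemma related_exists: "\<gamma> \<in> arrows G \<Longrightarrow> \<exists>\<beta>. related \<gamma> \<beta>"
  using G.normalizer_exists[OF _ openin_topspace] related_normalizer by (metis zero_neq_one)

lemma related_ran: assumes "related \<gamma> \<beta>" shows "gran H \<beta> = h (gran G \<gamma>)"
proof -
  obtain n where "n \<in> G.normalizers" "G.coef n \<gamma> \<noteq> 0" using assms unfolding related_def by blast
  from related_normalizer[OF this] related_unique[OF assms] show ?thesis by blast
qed

text \<open>Diagonal elements are normalizers too, and their images are known through
  \<open>h\<close>.\<close>

lemma related_unit: assumes x: "x \<in> G.units" shows "related x (h x)"
proof -
  obtain f where f: "f \<in> C_0 (unit_space G)" "f x = 1"
    using G.C_0_unit_bump[OF x openin_topspace G.units_arrow[OF x]] by metis
  have F: "G.diag_op f \<in> diagonal_subalgebra G" "G.coef (G.diag_op f) = f" using G.diag_op[OF f(1)] by auto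
  show ?thesis unfolding related_def
    using G.Diag_normalizers[OF F(1)] F(2) f(2) coef_h[OF F(1) x] x
    by (intro bexI[of _ "G.diag_op f"]) (simp_all add: G.units_dom H.units_dom h_units)
qed

text \<open>The product of the two normalizers is a normalizer and, without cancellation, nonzero at
  the product arrow on both sides.\<close>

lemma related_mult:
  assumes r: "related \<gamma>1 \<beta>1" "related \<gamma>2 \<beta>2" and c: "gdom G \<gamma>1 = gran G \<gamma>2"
  shows "related (gmult G \<gamma>1 \<gamma>2) (gmult H \<beta>1 \<beta>2)"
proof -
  obtain n where n: "n \<in> G.normalizers" "G.coef n \<gamma>1 \<noteq> 0" "H.coef (\<phi> n) \<beta>1 \<noteq> 0"
    using r(1) unfolding related_def by blast
  obtain m where m: "m \<in> G.normalizers" "G.coef m \<gamma>2 \<noteq> 0" "H.coef (\<phi> m) \<beta>2 \<noteq> 0"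
    using r(2) unfolding related_def by blast
  have A: "\<gamma>1 \<in> arrows G" "\<gamma>2 \<in> arrows G" "\<beta>1 \<in> arrows H" "\<beta>2 \<in> arrows H" using r related_arrows by blast+
  have c': "gdom H \<beta>1 = gran H \<beta>2" using related_dom[OF r(1)] related_ran[OF r(2)] c by simp
  have "G.coef (n o\<^sub>L m) (gmult G \<gamma>1 \<gamma>2) \<noteq> 0"
    by (rule G.normalizers_compose_coef[OF principal_G n(1) m(1) A(1,2) c n(2) m(2)])
  moreover have "H.coef (\<phi> n o\<^sub>L \<phi> m) (gmult H \<beta>1 \<beta>2) \<noteq> 0"
    by (rule H.normalizers_compose_coef[OF principal_H phi_normalizers[OF n(1)]
          phi_normalizers[OF m(1)] A(3,4) c' n(3) m(3)])
  moreover have "\<phi> (n o\<^sub>L m) = \<phi> n o\<^sub>L \<phi> m"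
    using n m by (intro phi_compose G.normalizers_Cstar_r)
  moreover have "h (gdom G (gmult G \<gamma>1 \<gamma>2)) = gdom H (gmult H \<beta>1 \<beta>2)"
    using A c c' related_dom[OF r(2)] by (simp add: G.closed_simps H.closed_simps)
  ultimately show ?thesis unfolding related_def
    using G.normalizers_compose[OF n(1) m(1)] by (intro bexI[of _ "n o\<^sub>L m"]) simp_all
qed

definition recon :: "'g \<Rightarrow> 'h" where "recon \<gamma> = (THE \<beta>. related \<gamma> \<beta>)"

lemma related_recon: "\<gamma> \<in> arrows G \<Longrightarrow> related \<gamma> (recon \<gamma>)"
  unfolding recon_def by (rule theI') (use related_exists related_unique in blast)

lemma recon_eq: "related \<gamma> \<beta> \<Longrightarrow> recon \<gamma> = \<beta>"
  unfolding recon_def by (rule the_equality) (auto intro: related_unique)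

text \<open>For a fixed normalizer \<open>n\<close> the map is locally the source map, followed by
  \<open>h\<close>, followed by the inverse of the source map on the support of
  \<open>\<phi> n\<close>.\<close>

lemma continuous_recon: "continuous_map (gtop G) (gtop H) recon"
  unfolding continuous_map_eq_topcontinuous_at topcontinuous_at_def
proof (intro ballI conjI allI impI)
  fix \<gamma> assume g: "\<gamma> \<in> arrows G"
  show "\<gamma> \<in> arrows G" by fact
  show "recon \<in> arrows G \<rightarrow> arrows H" using related_recon related_arrows by blast
  fix V assume V: "openin (gtop H) V \<and> recon \<gamma> \<in> V"
  obtain n where n: "n \<in> G.normalizers" "G.coef n \<gamma> \<noteq> 0" "H.coef (\<phi> n) (recon \<gamma>) \<noteq> 0"
    using related_recon[OF g] unfolding related_def by blast
  let ?V = "V \<inter> {\<beta>\<in>arrows H. H.coef (\<phi> n) \<beta> \<noteq> 0}"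
  let ?W = "{\<gamma>\<in>arrows G. G.coef n \<gamma> \<noteq> 0}"
  have "openin (gtop H) ?V"
    using V n(1) by (intro openin_Int openin_nonzero H.Cstar_r_coef_continuous phi_Cstar_r G.normalizers_Cstar_r) auto
  then have "openin (gtop H) (gdom H ` ?V)" using H.open_map_dom unfolding open_map_def by blast
  then have dV: "openin (unit_space H) (gdom H ` ?V)"
    unfolding H.unit_space_eq openin_subtopology
    by (intro exI[of _ "gdom H ` ?V"]) (auto simp: H.dom_in_units)
  have "continuous_map (gtop G) (unit_space G) (gdom G)"
    unfolding G.unit_space_eq continuous_map_in_subtopology using G.continuous_dom G.dom_in_units by auto
  then have hd: "continuous_map (gtop G) (unit_space H) (h \<circ> gdom G)"
    using homeomorphic_imp_continuous_map[OF h] continuous_map_compose by blast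
  let ?N = "?W \<inter> {\<eta>\<in>arrows G. (h \<circ> gdom G) \<eta> \<in> gdom H ` ?V}"
  have "openin (gtop G) ?N"
    using n(1) by (intro openin_Int openin_nonzero G.Cstar_r_coef_continuous G.normalizers_Cstar_r
        openin_continuous_map_preimage[OF hd dV])
  moreover have "\<gamma> \<in> ?N"
    using g n V related_dom[OF related_recon[OF g]] related_arrows[OF related_recon[OF g]] by force
  moreover have "recon \<eta> \<in> V" if "\<eta> \<in> ?N" for \<eta>
  proof -
    have "h (gdom G \<eta>) \<in> gdom H ` ?V" using that by simp
    then obtain \<beta> where "\<beta> \<in> ?V" "gdom H \<beta> = h (gdom G \<eta>)" by (metis (no_types, lifting) imageE)
    then have "related \<eta> \<beta>" unfolding related_def using that n(1) by auto
    then show ?thesis using recon_eq \<open>\<beta> \<in> ?V\<close> by blast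
  qed
  ultimately show "\<exists>U. openin (gtop G) U \<and> \<gamma> \<in> U \<and> (\<forall>\<eta>\<in>U. recon \<eta> \<in> V)" by blast
qed

text \<open>A normalizer supported in \<open>P\<close> detects \<open>\<gamma>\<close>; the
  coefficients of its image vanish off \<open>Q\<close>, yet one is nonzero at
  \<open>recon \<gamma>\<close>.\<close>

lemma recon_subgroupoid:
  assumes P: "openin (gtop G) P" and Q: "openin (gtop H) Q"
    and sub: "\<phi> ` Cstar_r_sub G (restrict_groupoid G P) \<subseteq> Cstar_r_sub H (restrict_groupoid H Q)"
    and g: "\<gamma> \<in> P"
  shows "recon \<gamma> \<in> Q"
proof (rule ccontr)
  assume nQ: "recon \<gamma> \<notin> Q"
  have gA: "\<gamma> \<in> arrows G" using g openin_subset[OF P] by blast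
  obtain n K where n: "n \<in> G.normalizers" "G.coef n \<in> C_c (gtop G)" "G.coef n \<gamma> = 1"
    "compactin (gtop G) K" "K \<subseteq> P" "\<And>x. x \<notin> K \<Longrightarrow> G.coef n x = 0"
    using G.normalizer_exists[OF gA P g] by metis
  obtain \<beta> where b: "related \<gamma> \<beta>" "H.coef (\<phi> n) \<beta> \<noteq> 0" using related_normalizer[OF n(1), of \<gamma>] n(3) by auto
  have "n \<in> Cstar_r_sub G (restrict_groupoid G P)"
    by (rule G.Cstar_r_subI[OF P G.normalizers_conv_ops[OF n(1)] n(2) n(4) n(5) n(6)])
  then have "\<phi> n \<in> Cstar_r_sub H (restrict_groupoid H Q)" using sub by blast
  then have "H.coef (\<phi> n) (recon \<gamma>) = 0" using H.Cstar_r_sub_coef[OF Q _ nQ] by blast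
  then show False using b recon_eq[OF b(1)] by simp
qed

text \<open>Running the construction for the inverse yields the inverse map, its continuity, and the
  reverse inclusion for subgroupoids.\<close>

lemma inverse_isomorphism:
  "diagonal_isomorphism H G (inv_into (Cstar_r G) \<phi>) (inv_into G.units h)"
proof -
  let ?\<psi> = "inv_into (Cstar_r G) \<phi>"
  have bij: "bij_betw \<phi> (Cstar_r G) (Cstar_r H)" using iso unfolding star_isomorphism_def by blast
  have \<psi>\<phi>: "?\<psi> (\<phi> A) = A" if "A \<in> Cstar_r G" for A using bij that by (simp add: bij_betw_def)
  have \<psi>C: "?\<psi> B \<in> Cstar_r G" "\<phi> (?\<psi> B) = B" if "B \<in> Cstar_r H" for B
    using bij that by (auto simp: bij_betw_def inv_into_into f_inv_into_f)
  have eqI: "?\<psi> B = A" if "A \<in> Cstar_r G" "\<phi> A = B" for A B using \<psi>\<phi> that by blast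
  show ?thesis
  proof (unfold_locales)
    show "topologically_principal H" "topologically_principal G" by (fact principal_H principal_G)+
    show "star_isomorphism (Cstar_r H) (Cstar_r G) ?\<psi>"
      unfolding star_isomorphism_def
    proof (intro conjI ballI allI)
      show "bij_betw ?\<psi> (Cstar_r H) (Cstar_r G)" by (rule bij_betw_inv_into[OF bij])
      fix A assume A: "A \<in> Cstar_r H"
      show "?\<psi> (scale_op c o\<^sub>L A) = scale_op c o\<^sub>L ?\<psi> A" for c
        using iso \<psi>C[OF A] by (intro eqI G.Cstar_r_scale_op) (auto simp: star_isomorphism_def)
      show "?\<psi> (adjoint_op A) = adjoint_op (?\<psi> A)"
        using \<psi>C[OF A] by (intro eqI G.Cstar_r_adjoint_op) (auto simp: phi_adjoint)
      fix B assume B: "B \<in> Cstar_r H"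
      show "?\<psi> (A + B) = ?\<psi> A + ?\<psi> B"
        using iso \<psi>C[OF A] \<psi>C[OF B] by (intro eqI G.Cstar_r_add) (auto simp: star_isomorphism_def)
      show "?\<psi> (A o\<^sub>L B) = ?\<psi> A o\<^sub>L ?\<psi> B"
        using \<psi>C[OF A] \<psi>C[OF B] by (intro eqI G.Cstar_r_compose) (auto simp: phi_compose)
    qed
    have "?\<psi> ` \<phi> ` diagonal_subalgebra G = diagonal_subalgebra G"
      using \<psi>\<phi> Diag_Cstar_r by (force simp: image_image)
    then show "?\<psi> ` diagonal_subalgebra H = diagonal_subalgebra G" using Diag by simp
    show "homeomorphic_map (unit_space H) (unit_space G) (inv_into G.units h)"
    proof -
      \<comment> \<open>\<open>inv_into\<close> agrees with the inverse homeomorphism on the unit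
        space, which is enough for a homeomorphism of topologies.\<close>
      obtain g where g: "homeomorphic_maps (unit_space G) (unit_space H) h g" using h homeomorphic_map_maps by blast
      have "g y = inv_into G.units h y" if y: "y \<in> H.units" for y
      proof -
        obtain x where "x \<in> G.units" "y = h x" using h_surj[OF y] by blast
        then show ?thesis using g h_inj by (auto simp: homeomorphic_maps_def G.topspace_unit_space inj_on_def intro!: inv_into_f_eq[symmetric])
      qed
      then have "g y = inv_into G.units h y" if "y \<in> topspace (unit_space H)" for y
        using that unfolding H.topspace_unit_space by blast
      moreover have "homeomorphic_map (unit_space H) (unit_space G) g"
        using g unfolding homeomorphic_maps_map by simp
      ultimately show ?thesis by (rule homeomorphic_map_eq[rotated])
    qed
    fix E x assume E: "E \<in> diagonal_subalgebra H" and x: "x \<in> H.units"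
    obtain y where y: "y \<in> G.units" "h y = x" using h_surj[OF x] by blast
    obtain F where F: "F \<in> diagonal_subalgebra G" "\<phi> F = E"
      using E unfolding Diag[symmetric] by (metis imageE)
    have "inv_into G.units h x = y" using y h_inj by (intro inv_into_f_eq) (auto simp: inj_on_def)
    then show "G.coef (?\<psi> E) (inv_into G.units h x) = H.coef E x"
      using coef_h[OF F(1) y(1)] \<psi>\<phi>[OF Diag_Cstar_r[OF F(1)]] F(2) y(2) by simp
  qed
qed

end

section \<open>From star-isomorphisms to groupoid isomorphisms\<close>

lemma (in etale_groupoid) Cstar_r_sub_subset:
  assumes P: "openin (gtop G) P" shows "Cstar_r_sub G (restrict_groupoid G P) \<subseteq> Cstar_r G"
proof -
  have "C_c (subtopology (gtop G) P) \<subseteq> C_c (gtop G)" by (rule C_c_open_subtopology[OF Hausdorff P])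
  then have "left_regular G (C_c (subtopology (gtop G) P)) \<subseteq> left_regular G (C_c (gtop G))"
    unfolding left_regular_def by blast
  then show ?thesis by (simp add: Cstar_r_sub_def Cstar_r_def restrict_groupoid_def closure_mono)
qed

lemma (in etale_groupoid) diag_op_add:
  assumes "f \<in> C_0 (unit_space G)" "g \<in> C_0 (unit_space G)"
  shows "diag_op (\<lambda>x. f x + g x) = diag_op f + diag_op g"
  using diag_op_coef[of "diag_op f + diag_op g"] diag_op[OF assms(1)] diag_op[OF assms(2)]
  by (simp add: conv_ops_add Diag_conv_ops coef_add)

lemma (in etale_groupoid) diag_op_scale:
  assumes "f \<in> C_0 (unit_space G)" shows "diag_op (\<lambda>x. c * f x) = scale_op c o\<^sub>L diag_op f"
  using diag_op_coef[of "scale_op c o\<^sub>L diag_op f"] diag_op[OF assms]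
  by (simp add: conv_ops_scale_op Diag_conv_ops coef_scale_op)

lemma (in etale_groupoid) diag_op_mult:
  assumes "f \<in> C_0 (unit_space G)" "g \<in> C_0 (unit_space G)"
  shows "diag_op (\<lambda>x. f x * g x) = diag_op f o\<^sub>L diag_op g"
  using diag_op_coef[of "diag_op f o\<^sub>L diag_op g"] diag_op[OF assms(1)] diag_op[OF assms(2)]
  by (simp add: conv_ops_compose Diag_conv_ops coef_Diag_Diag)

lemma (in etale_groupoid) bij_betw_coef: "bij_betw coef Diag (C_0 (unit_space G))"
  by (rule bij_betw_byWitness[where f' = diag_op])
    (use diag_op Diag_coef diag_op_coef[OF Diag_conv_ops] in auto)

lemma (in etale_groupoid) bij_betw_diag_op: "bij_betw diag_op (C_0 (unit_space G)) Diag"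
  by (rule bij_betw_byWitness[where f' = coef])
    (use diag_op Diag_coef diag_op_coef[OF Diag_conv_ops] in auto)

text \<open>Through \<open>diag_op\<close> and \<open>coef\<close>, \<open>\<phi>\<close> becomes an
  isomorphism between the function algebras of the unit spaces, to which Gelfand duality
  applies.\<close>

lemma diagonal_isomorphism_exists:
  assumes G: "etale_groupoid G" and H: "etale_groupoid H"
    and tp: "topologically_principal G" "topologically_principal H"
    and iso: "star_isomorphism (Cstar_r G) (Cstar_r H) \<phi>"
    and Diag: "\<phi> ` diagonal_subalgebra G = diagonal_subalgebra H"
  obtains h where "diagonal_isomorphism G H \<phi> h"
proof -
  interpret G: etale_groupoid G by fact
  interpret H: etale_groupoid H by fact
  define \<theta> where "\<theta> f = H.coef (\<phi> (G.diag_op f))" for f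
  have C: "G.diag_op f \<in> Cstar_r G" "\<phi> (G.diag_op f) \<in> diagonal_subalgebra H" if "f \<in> C_0 (unit_space G)" for f
    using G.diag_op(1)[OF that] G.Diag_subset_Cstar_r Diag by blast+
  have "bij_betw \<phi> (diagonal_subalgebra G) (diagonal_subalgebra H)"
    using iso Diag G.Diag_subset_Cstar_r unfolding star_isomorphism_def bij_betw_def by (blast intro: inj_on_subset)
  then have "bij_betw (H.coef \<circ> (\<phi> \<circ> G.diag_op)) (C_0 (unit_space G)) (C_0 (unit_space H))"
    using G.bij_betw_diag_op H.bij_betw_coef by (blast intro: bij_betw_trans)
  then have bij: "bij_betw \<theta> (C_0 (unit_space G)) (C_0 (unit_space H))" by (simp add: \<theta>_def[abs_def] o_def)
  obtain h where h: "homeomorphic_map (unit_space G) (unit_space H) h"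
    "\<And>f x. f \<in> C_0 (unit_space G) \<Longrightarrow> x \<in> topspace (unit_space G) \<Longrightarrow> \<theta> f (h x) = f x"
  proof (rule C_0_isomorphism_induces_homeomorphism[OF G.locally_compact_unit_space G.Hausdorff_unit_space
        H.locally_compact_unit_space H.Hausdorff_unit_space bij])
    fix f g assume f: "f \<in> C_0 (unit_space G)" and g: "g \<in> C_0 (unit_space G)"
    show "\<theta> (\<lambda>x. f x + g x) = (\<lambda>y. \<theta> f y + \<theta> g y)"
      using iso C[OF f] C[OF g] unfolding star_isomorphism_def
      by (simp add: \<theta>_def G.diag_op_add f g H.coef_add)
    show "\<theta> (\<lambda>x. f x * g x) = (\<lambda>y. \<theta> f y * \<theta> g y)"
      using iso C[OF f] C[OF g] unfolding star_isomorphism_def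
      by (simp add: \<theta>_def G.diag_op_mult f g H.coef_Diag_Diag)
    show "\<theta> (\<lambda>x. c * f x) = (\<lambda>y. c * \<theta> f y)" for c
      using iso C[OF f] unfolding star_isomorphism_def
      by (simp add: \<theta>_def G.diag_op_scale f H.coef_scale_op)
  qed blast
  have "diagonal_isomorphism G H \<phi> h"
  proof (unfold_locales)
    fix E x assume E: "E \<in> diagonal_subalgebra G" and x: "x \<in> G.units"
    show "H.coef (\<phi> E) (h x) = G.coef E x"
      using h(2)[OF G.Diag_coef[OF E]] x G.diag_op_coef[OF G.Diag_conv_ops[OF E]]
      by (simp add: \<theta>_def G.topspace_unit_space)
  qed (fact tp iso Diag h(1))+
  then show thesis by (rule that)
qed

text \<open>\<open>P\<close> and \<open>Q\<close> will be the kernels of the cocycles. The relations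
  for \<open>\<phi>\<close> and for its inverse are converse to each other, so the two reconstructed
  maps are mutually inverse.\<close>

theorem groupoid_reconstruction:
  assumes G: "etale_groupoid G" and H: "etale_groupoid H"
    and tp: "topologically_principal G" "topologically_principal H"
    and iso: "star_isomorphism (Cstar_r G) (Cstar_r H) \<phi>"
    and Diag: "\<phi> ` diagonal_subalgebra G = diagonal_subalgebra H"
    and P: "openin (gtop G) P" and Q: "openin (gtop H) Q"
    and sub: "\<phi> ` Cstar_r_sub G (restrict_groupoid G P) = Cstar_r_sub H (restrict_groupoid H Q)"
  shows "\<exists>\<Phi>. groupoid_isomorphism G H \<Phi> \<and> \<Phi> ` P = Q"
proof -
  obtain h where "diagonal_isomorphism G H \<phi> h" using diagonal_isomorphism_exists[OF G H tp iso Diag] .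
  then interpret I: diagonal_isomorphism G H \<phi> h .
  let ?\<psi> = "inv_into (Cstar_r G) \<phi>" and ?k = "inv_into I.G.units h"
  interpret J: diagonal_isomorphism H G ?\<psi> ?k by (rule I.inverse_isomorphism)
  have bij: "bij_betw \<phi> (Cstar_r G) (Cstar_r H)" using iso unfolding star_isomorphism_def by blast
  have \<psi>\<phi>: "?\<psi> (\<phi> A) = A" if "A \<in> Cstar_r G" for A using bij that by (simp add: bij_betw_def)
  have \<phi>\<psi>: "\<phi> (?\<psi> B) = B" if "B \<in> Cstar_r H" for B using bij that by (auto simp: bij_betw_def f_inv_into_f)
  have kh: "?k (h x) = x" if "x \<in> I.G.units" for x
    using that I.h_inj by (intro inv_into_f_eq) (auto simp: inj_on_def)
  have hk: "h (?k y) = y" if "y \<in> I.H.units" for y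
    using I.h_surj[OF that] by (auto intro: f_inv_into_f)
  have IJ: "J.related \<beta> \<gamma>" if r: "I.related \<gamma> \<beta>" for \<gamma> \<beta>
  proof -
    obtain n where n: "n \<in> I.G.normalizers" "I.G.coef n \<gamma> \<noteq> 0" "I.H.coef (\<phi> n) \<beta> \<noteq> 0" "h (gdom G \<gamma>) = gdom H \<beta>"
      using r unfolding I.related_def by blast
    have "gdom G \<gamma> \<in> I.G.units" using I.related_arrows[OF r] I.G.dom_in_units by blast
    then have "?k (gdom H \<beta>) = gdom G \<gamma>" using n(4) kh by metis
    then show ?thesis unfolding J.related_def
      using n \<psi>\<phi>[OF I.G.normalizers_Cstar_r[OF n(1)]] I.phi_normalizers[OF n(1)] by (intro bexI[of _ "\<phi> n"]) simp_all
  qed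
  have JI: "I.related \<gamma> \<beta>" if r: "J.related \<beta> \<gamma>" for \<gamma> \<beta>
  proof -
    obtain m where m: "m \<in> I.H.normalizers" "I.H.coef m \<beta> \<noteq> 0" "I.G.coef (?\<psi> m) \<gamma> \<noteq> 0" "?k (gdom H \<beta>) = gdom G \<gamma>"
      using r unfolding J.related_def by blast
    have "gdom H \<beta> \<in> I.H.units" using J.related_arrows[OF r] I.H.dom_in_units by blast
    then have "h (gdom G \<gamma>) = gdom H \<beta>" using m(4) hk by metis
    then show ?thesis unfolding I.related_def
      using m \<phi>\<psi>[OF I.H.normalizers_Cstar_r[OF m(1)]] J.phi_normalizers[OF m(1)] by (intro bexI[of _ "?\<psi> m"]) simp_all
  qed
  have JI_id: "J.recon (I.recon \<gamma>) = \<gamma>" if "\<gamma> \<in> arrows G" for \<gamma>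
    by (rule J.recon_eq[OF IJ[OF I.related_recon[OF that]]])
  have IJ_id: "I.recon (J.recon \<beta>) = \<beta>" if "\<beta> \<in> arrows H" for \<beta>
    by (rule I.recon_eq[OF JI[OF J.related_recon[OF that]]])
  have "homeomorphic_maps (gtop G) (gtop H) I.recon J.recon"
    unfolding homeomorphic_maps_def using I.continuous_recon J.continuous_recon JI_id IJ_id by blast
  then have homeo: "homeomorphic_map (gtop G) (gtop H) I.recon" using homeomorphic_map_maps by blast
  have unit: "I.recon x = h x" if "x \<in> I.G.units" for x by (rule I.recon_eq[OF I.related_unit[OF that]])
  have "groupoid_isomorphism G H I.recon"
    unfolding groupoid_isomorphism_def
  proof (intro conjI ballI impI)
    fix \<alpha> assume a: "\<alpha> \<in> arrows G"
    note R = I.related_recon[OF a]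
    show "I.recon (gdom G \<alpha>) = gdom H (I.recon \<alpha>)" "I.recon (gran G \<alpha>) = gran H (I.recon \<alpha>)"
      using unit I.related_dom[OF R] I.related_ran[OF R] a by (simp_all add: I.G.dom_in_units I.G.ran_in_units)
    fix \<beta> assume b: "\<beta> \<in> arrows G" "gdom G \<alpha> = gran G \<beta>"
    show "I.recon (gmult G \<alpha> \<beta>) = gmult H (I.recon \<alpha>) (I.recon \<beta>)"
      by (rule I.recon_eq[OF I.related_mult[OF R I.related_recon[OF b(1)] b(2)]])
  qed (fact homeo)
  moreover have "I.recon ` P = Q"
  proof
    show "I.recon ` P \<subseteq> Q" using I.recon_subgroupoid[OF P Q equalityD1[OF sub]] by auto
    have "?\<psi> ` Cstar_r_sub H (restrict_groupoid H Q) \<subseteq> Cstar_r_sub G (restrict_groupoid G P)"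
      unfolding sub[symmetric] using \<psi>\<phi> I.G.Cstar_r_sub_subset[OF P] by auto
    then have J: "J.recon \<beta> \<in> P" if "\<beta> \<in> Q" for \<beta> using that by (rule J.recon_subgroupoid[OF Q P])
    show "Q \<subseteq> I.recon ` P"
    proof
      fix \<beta> assume b: "\<beta> \<in> Q"
      then have "\<beta> = I.recon (J.recon \<beta>)" using IJ_id openin_subset[OF Q] by auto
      with J[OF b] show "\<beta> \<in> I.recon ` P" by (rule image_eqI[rotated])
    qed
  qed
  ultimately show ?thesis by blast
qed

section \<open>Functoriality of the reduced C*-algebra\<close>

text \<open>The inverse \<open>\<Psi>\<close> is a parameter to keep the situation symmetric. Both
  maps are controlled on arrows only, which is why functions and operators built from them are cut
  off outside.\<close>

locale etale_groupoid_isomorphism = G: etale_groupoid G + H: etale_groupoid H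
  for G :: "('g, 'm) top_groupoid_scheme" and H :: "('h, 'n) top_groupoid_scheme" +
  fixes \<Phi> :: "'g \<Rightarrow> 'h" and \<Psi> :: "'h \<Rightarrow> 'g"
  assumes homeo: "homeomorphic_maps (gtop G) (gtop H) \<Phi> \<Psi>"
    and Phi_dom: "\<gamma> \<in> arrows G \<Longrightarrow> \<Phi> (gdom G \<gamma>) = gdom H (\<Phi> \<gamma>)"
    and Phi_ran: "\<gamma> \<in> arrows G \<Longrightarrow> \<Phi> (gran G \<gamma>) = gran H (\<Phi> \<gamma>)"
    and Phi_mult: "\<alpha> \<in> arrows G \<Longrightarrow> \<beta> \<in> arrows G \<Longrightarrow> gdom G \<alpha> = gran G \<beta> \<Longrightarrow>
      \<Phi> (gmult G \<alpha> \<beta>) = gmult H (\<Phi> \<alpha>) (\<Phi> \<beta>)"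
begin

lemma Phi_arrow: "\<gamma> \<in> arrows G \<Longrightarrow> \<Phi> \<gamma> \<in> arrows H"
  and Psi_arrow: "\<beta> \<in> arrows H \<Longrightarrow> \<Psi> \<beta> \<in> arrows G"
  and Psi_Phi: "\<gamma> \<in> arrows G \<Longrightarrow> \<Psi> (\<Phi> \<gamma>) = \<gamma>"
  and Phi_Psi: "\<beta> \<in> arrows H \<Longrightarrow> \<Phi> (\<Psi> \<beta>) = \<beta>"
  and continuous_Phi: "continuous_map (gtop G) (gtop H) \<Phi>"
  and continuous_Psi: "continuous_map (gtop H) (gtop G) \<Psi>"
  using homeo by (auto simp: homeomorphic_maps_def continuous_map_def Pi_iff)

lemma Psi_dom: "\<beta> \<in> arrows H \<Longrightarrow> \<Psi> (gdom H \<beta>) = gdom G (\<Psi> \<beta>)"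
  by (metis Phi_Psi Phi_dom Psi_Phi Psi_arrow G.dom_closed)

lemma Psi_ran: "\<beta> \<in> arrows H \<Longrightarrow> \<Psi> (gran H \<beta>) = gran G (\<Psi> \<beta>)"
  by (metis Phi_Psi Phi_ran Psi_Phi Psi_arrow G.ran_closed)

lemma Psi_mult:
  assumes "\<alpha> \<in> arrows H" "\<beta> \<in> arrows H" "gdom H \<alpha> = gran H \<beta>"
  shows "\<Psi> (gmult H \<alpha> \<beta>) = gmult G (\<Psi> \<alpha>) (\<Psi> \<beta>)"
proof -
  have c: "gdom G (\<Psi> \<alpha>) = gran G (\<Psi> \<beta>)" using assms by (simp add: Psi_dom[symmetric] Psi_ran[symmetric])
  have "\<Phi> (gmult G (\<Psi> \<alpha>) (\<Psi> \<beta>)) = gmult H \<alpha> \<beta>"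
    using Phi_mult[OF Psi_arrow[OF assms(1)] Psi_arrow[OF assms(2)] c] assms by (simp add: Phi_Psi)
  then show ?thesis
    using Psi_Phi[OF G.mult_closed[OF Psi_arrow[OF assms(1)] Psi_arrow[OF assms(2)] c]] by simp
qed

lemma inverse: "etale_groupoid_isomorphism H G \<Psi> \<Phi>"
  by unfold_locales (use homeo homeomorphic_maps_sym Psi_dom Psi_ran Psi_mult in blast)+

lemma Psi_inv: assumes b: "\<beta> \<in> arrows H" shows "\<Psi> (ginv H \<beta>) = ginv G (\<Psi> \<beta>)"
proof -
  let ?c = "\<Psi> (ginv H \<beta>)"
  have c: "?c \<in> arrows G" "gdom G ?c = gran G (\<Psi> \<beta>)" "gmult G ?c (\<Psi> \<beta>) = gdom G (\<Psi> \<beta>)"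
    using b H.inv_closed[OF b] by (simp_all add: Psi_arrow Psi_dom[symmetric] Psi_ran[symmetric] Psi_mult[symmetric] H.closed_simps)
  have "?c = gmult G (gmult G ?c (\<Psi> \<beta>)) (ginv G (\<Psi> \<beta>))"
    using G.mult_mult_inv[OF c(1) Psi_arrow[OF b] c(2)] by simp
  also have "\<dots> = ginv G (\<Psi> \<beta>)"
    unfolding c(3) using G.ran_mult_self[of "ginv G (\<Psi> \<beta>)"] Psi_arrow[OF b] by (simp add: G.closed_simps)
  finally show ?thesis .
qed

lemma Psi_dom_iff:
  assumes "\<beta> \<in> arrows H" "\<beta>' \<in> arrows H"
  shows "gdom G (\<Psi> \<beta>) = gdom G (\<Psi> \<beta>') \<longleftrightarrow> gdom H \<beta> = gdom H \<beta>'"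
  using assms by (metis Psi_dom Phi_Psi H.dom_closed)

text \<open>Moves delta functions along \<open>\<Phi>\<close> and kills those outside the arrows; it
  exists as a weighted composition operator with weight \<open>1\<close> on the arrows of
  \<open>H\<close>.\<close>

definition forward :: "'g ell2 \<Rightarrow>\<^sub>L 'h ell2" where
  "forward = (SOME W. complex_linear W \<and>
     (\<forall>\<xi> \<beta>. ell2_fun (blinfun_apply W \<xi>) \<beta> = (if \<beta> \<in> arrows H then ell2_fun \<xi> (\<Psi> \<beta>) else 0)))"

definition backward :: "'h ell2 \<Rightarrow>\<^sub>L 'g ell2" where
  "backward = (SOME V. complex_linear V \<and>
     (\<forall>\<xi> \<gamma>. ell2_fun (blinfun_apply V \<xi>) \<gamma> = (if \<gamma> \<in> arrows G then ell2_fun \<xi> (\<Phi> \<gamma>) else 0)))"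

lemma forward: "complex_linear forward"
    "ell2_fun (blinfun_apply forward \<xi>) \<beta> = (if \<beta> \<in> arrows H then ell2_fun \<xi> (\<Psi> \<beta>) else 0)"
proof -
  obtain W :: "'g ell2 \<Rightarrow>\<^sub>L 'h ell2" where "complex_linear W"
    "\<And>\<xi> \<beta>. ell2_fun (blinfun_apply W \<xi>) \<beta> = (if \<beta> \<in> arrows H then 1 else 0) * ell2_fun \<xi> (\<Psi> \<beta>)"
  proof (rule weighted_composition_operator[of \<Psi> "\<lambda>\<beta>. if \<beta> \<in> arrows H then 1 else 0" 1])
    show "inj_on \<Psi> {\<beta>. (if \<beta> \<in> arrows H then 1 else 0) \<noteq> (0::complex)}"
      by (rule inj_on_inverseI[where g = \<Phi>]) (simp add: Phi_Psi split: if_splits)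
  qed auto
  then have "\<exists>W :: 'g ell2 \<Rightarrow>\<^sub>L 'h ell2. complex_linear W \<and>
     (\<forall>\<xi> \<beta>. ell2_fun (blinfun_apply W \<xi>) \<beta> = (if \<beta> \<in> arrows H then ell2_fun \<xi> (\<Psi> \<beta>) else 0))" by auto
  note * = someI_ex[OF this, folded forward_def]
  show "complex_linear forward" by (rule conjunct1[OF *])
  show "ell2_fun (blinfun_apply forward \<xi>) \<beta> = (if \<beta> \<in> arrows H then ell2_fun \<xi> (\<Psi> \<beta>) else 0)"
    by (rule conjunct2[OF *, THEN spec, THEN spec])
qed

lemma backward: "complex_linear backward"
    "ell2_fun (blinfun_apply backward \<xi>) \<gamma> = (if \<gamma> \<in> arrows G then ell2_fun \<xi> (\<Phi> \<gamma>) else 0)"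
proof -
  obtain V :: "'h ell2 \<Rightarrow>\<^sub>L 'g ell2" where "complex_linear V"
    "\<And>\<xi> \<gamma>. ell2_fun (blinfun_apply V \<xi>) \<gamma> = (if \<gamma> \<in> arrows G then 1 else 0) * ell2_fun \<xi> (\<Phi> \<gamma>)"
  proof (rule weighted_composition_operator[of \<Phi> "\<lambda>\<gamma>. if \<gamma> \<in> arrows G then 1 else 0" 1])
    show "inj_on \<Phi> {\<gamma>. (if \<gamma> \<in> arrows G then 1 else 0) \<noteq> (0::complex)}"
      by (rule inj_on_inverseI[where g = \<Psi>]) (simp add: Psi_Phi split: if_splits)
  qed auto
  then have "\<exists>V :: 'h ell2 \<Rightarrow>\<^sub>L 'g ell2. complex_linear V \<and>
     (\<forall>\<xi> \<gamma>. ell2_fun (blinfun_apply V \<xi>) \<gamma> = (if \<gamma> \<in> arrows G then ell2_fun \<xi> (\<Phi> \<gamma>) else 0))" by auto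
  note * = someI_ex[OF this, folded backward_def]
  show "complex_linear backward" by (rule conjunct1[OF *])
  show "ell2_fun (blinfun_apply backward \<xi>) \<gamma> = (if \<gamma> \<in> arrows G then ell2_fun \<xi> (\<Phi> \<gamma>) else 0)"
    by (rule conjunct2[OF *, THEN spec, THEN spec])
qed

text \<open>Conjugation by a partial isometry; on operators living on the arrows it acts like
  conjugation by a unitary.\<close>

definition transport :: "'g op \<Rightarrow> 'h op" where
  "transport A = forward o\<^sub>L (A o\<^sub>L backward)"

lemma complex_linear_transport: "complex_linear A \<Longrightarrow> complex_linear (transport A)"
  by (simp add: transport_def complex_linear_compose forward(1) backward(1))

lemma backward_delta:
  "blinfun_apply backward (delta_ell2 \<beta>) = (if \<beta> \<in> arrows H then delta_ell2 (\<Psi> \<beta>) else 0)"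
  by (rule ell2_eqI) (auto simp: backward(2) ell2_fun_delta zero_ell2.rep_eq Psi_Phi Phi_Psi Psi_arrow
      dest: Phi_arrow)

lemma mcoef_transport:
  "mcoef (transport A) \<beta> \<beta>' = (if \<beta> \<in> arrows H \<and> \<beta>' \<in> arrows H then mcoef A (\<Psi> \<beta>) (\<Psi> \<beta>') else 0)"
  by (simp add: mcoef_def transport_def forward(2) backward_delta blinfun.zero_right zero_ell2.rep_eq)

lemma transport_conv_ops:
  assumes A: "A \<in> G.conv_ops"
  shows "transport A \<in> H.conv_ops" "H.coef (transport A) = (\<lambda>\<beta>. if \<beta> \<in> arrows H then G.coef A (\<Psi> \<beta>) else 0)"
proof -
  let ?f = "\<lambda>\<beta>. if \<beta> \<in> arrows H then G.coef A (\<Psi> \<beta>) else 0"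
  have m: "mcoef (transport A) \<beta> \<beta>' = H.conv_kernel ?f \<beta> \<beta>'" for \<beta> \<beta>'
  proof (cases "\<beta> \<in> arrows H \<and> \<beta>' \<in> arrows H")
    case True
    then have "gdom H \<beta> = gdom H \<beta>' \<Longrightarrow> \<Psi> (gmult H \<beta> (ginv H \<beta>')) = gmult G (\<Psi> \<beta>) (ginv G (\<Psi> \<beta>'))"
      by (simp add: Psi_mult Psi_inv H.closed_simps)
    then show ?thesis using True
      by (simp add: mcoef_transport G.conv_ops_mcoef[OF A] G.conv_kernel_def H.conv_kernel_def Psi_dom_iff Psi_arrow H.closed_simps)
  qed (auto simp: mcoef_transport H.conv_kernel_def)
  note * = complex_linear_transport[OF G.conv_ops_linear[OF A]] m
  show "transport A \<in> H.conv_ops" "H.coef (transport A) = ?f"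
    by (rule H.conv_opsI[OF *], simp)+
qed

lemma bounded_linear_transport: "bounded_linear transport"
  unfolding transport_def[abs_def]
  by (rule bounded_linear_compose[OF bounded_bilinear.bounded_linear_right[OF bounded_bilinear_blinfun_compose]
        bounded_bilinear.bounded_linear_left[OF bounded_bilinear_blinfun_compose]])

text \<open>One statement for open subgroupoids and for the diagonal; \<open>transport\<close> is
  bounded linear, so it respects closures.\<close>

lemma transport_closure:
  assumes F: "\<And>f \<gamma>. f \<in> F \<Longrightarrow> \<gamma> \<notin> arrows G \<Longrightarrow> f \<gamma> = 0"
    and FF': "\<And>f. f \<in> F \<Longrightarrow> (\<lambda>\<beta>. if \<beta> \<in> arrows H then f (\<Psi> \<beta>) else 0) \<in> F'"
  shows "transport ` left_regular G F \<subseteq> left_regular H F'"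
    and "transport ` closure (left_regular G F) \<subseteq> closure (left_regular H F')"
proof -
  have "transport A \<in> left_regular H F'" if "A \<in> left_regular G F" for A
  proof -
    have A: "A \<in> G.conv_ops" "G.coef A \<in> F" using that G.left_regular_eq[of F] F by auto
    show ?thesis unfolding H.left_regular_iff
      using transport_conv_ops[OF A(1)] FF'[OF A(2)] H.conv_ops_linear H.conv_ops_mcoef by metis
  qed
  then show 1: "transport ` left_regular G F \<subseteq> left_regular H F'" by blast
  show "transport ` closure (left_regular G F) \<subseteq> closure (left_regular H F')"
    using closure_bounded_linear_image_subset[OF bounded_linear_transport] closure_mono[OF 1] by (rule order_trans)
qed

lemma transport_C_c:
  assumes P: "openin (gtop G) P" and Q: "openin (gtop H) Q" "\<Phi> ` P = Q"
    and f: "f \<in> C_c (subtopology (gtop G) P)"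
  shows "(\<lambda>\<beta>. if \<beta> \<in> arrows H then f (\<Psi> \<beta>) else 0) \<in> C_c (subtopology (gtop H) Q)"
proof -
  let ?k = "\<lambda>\<beta>. if \<beta> \<in> arrows H then f (\<Psi> \<beta>) else 0"
  obtain K where c: "continuous_map (gtop G) euclidean f" and K: "compactin (gtop G) K" "K \<subseteq> P" "\<And>x. x \<notin> K \<Longrightarrow> f x = 0"
    using f unfolding C_c_open_subtopology_iff[OF G.Hausdorff P] by blast
  have "continuous_map (gtop H) euclidean ?k"
    by (rule continuous_map_eq[OF continuous_map_compose[OF continuous_Psi c]]) simp
  moreover have "compactin (gtop H) (\<Phi> ` K)" by (rule image_compactin[OF K(1) continuous_Phi])
  moreover have "?k \<beta> = 0" if n: "\<beta> \<notin> \<Phi> ` K" for \<beta>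
  proof (cases "\<beta> \<in> arrows H")
    case True
    then have "\<Psi> \<beta> \<notin> K" using n Phi_Psi[OF True] by (metis imageI)
    then show ?thesis using K(3) by simp
  qed simp
  ultimately show ?thesis
    unfolding C_c_open_subtopology_iff[OF H.Hausdorff Q(1)] using K(2) Q(2) by (intro conjI exI[of _ "\<Phi> ` K"]) auto
qed

lemma Phi_units: "x \<in> G.units \<Longrightarrow> \<Phi> x \<in> H.units"
  using Phi_dom Phi_arrow by (auto simp: G.units_def H.units_def)

lemma Psi_units: "x \<in> H.units \<Longrightarrow> \<Psi> x \<in> G.units"
  using Psi_dom Psi_arrow by (auto simp: G.units_def H.units_def)

lemma transport_C_0:
  assumes f: "f \<in> C_0 (unit_space G)"
  shows "(\<lambda>\<beta>. if \<beta> \<in> arrows H then f (\<Psi> \<beta>) else 0) \<in> C_0 (unit_space H)"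
proof (rule C_0_I)
  let ?k = "\<lambda>\<beta>. if \<beta> \<in> arrows H then f (\<Psi> \<beta>) else 0"
  have cP: "continuous_map (unit_space H) (unit_space G) \<Psi>"
    unfolding G.unit_space_eq H.unit_space_eq continuous_map_in_subtopology
    using continuous_map_from_subtopology[OF continuous_Psi] Psi_units by auto
  have cP': "continuous_map (unit_space G) (unit_space H) \<Phi>"
    unfolding G.unit_space_eq H.unit_space_eq continuous_map_in_subtopology
    using continuous_map_from_subtopology[OF continuous_Phi] Phi_units by auto
  have "continuous_map (unit_space G) euclidean f" using f by (simp add: C_0_def)
  from continuous_map_compose[OF cP this] show "continuous_map (unit_space H) euclidean ?k"
    by (rule continuous_map_eq) (auto simp: H.topspace_unit_space H.units_arrow)
  show "?k x = 0" if x: "x \<notin> topspace (unit_space H)" for x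
  proof (cases "x \<in> arrows H")
    case True
    then have "\<Psi> x \<notin> G.units" using x Phi_units[of "\<Psi> x"] Phi_Psi[OF True] by (auto simp: H.topspace_unit_space)
    then show ?thesis using G.C_0_units_outside[OF f] by simp
  qed simp
  fix e :: real assume e: "e > 0"
  let ?K = "{x\<in>topspace (unit_space G). e \<le> cmod (f x)}"
  have "compactin (unit_space G) ?K" using f e unfolding C_0_def by blast
  then have "compactin (unit_space H) (\<Phi> ` ?K)" by (rule image_compactin[OF _ cP'])
  moreover have "{x\<in>topspace (unit_space H). e \<le> cmod (?k x)} \<subseteq> \<Phi> ` ?K"
  proof clarify
    fix x assume x: "x \<in> topspace (unit_space H)" "e \<le> cmod (?k x)"
    then have xA: "x \<in> arrows H" by (simp add: H.topspace_unit_space H.units_arrow)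
    have "\<Psi> x \<in> ?K" using x xA Psi_units by (simp add: G.topspace_unit_space H.topspace_unit_space)
    then show "x \<in> \<Phi> ` ?K" using Phi_Psi[OF xA] by (metis (no_types, lifting) imageI)
  qed
  ultimately show "\<exists>K. compactin (unit_space H) K \<and> {x\<in>topspace (unit_space H). e \<le> cmod (?k x)} \<subseteq> K" by blast
qed

lemma transport_Cstar_r_sub:
  assumes "openin (gtop G) P" "openin (gtop H) Q" "\<Phi> ` P = Q"
  shows "transport ` Cstar_r_sub G (restrict_groupoid G P) \<subseteq> Cstar_r_sub H (restrict_groupoid H Q)"
proof -
  have z: "f \<gamma> = 0" if "f \<in> C_c (subtopology (gtop G) P)" "\<gamma> \<notin> arrows G" for f \<gamma>
    using that by (simp add: C_c_def)
  show ?thesis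
    unfolding Cstar_r_sub_def restrict_groupoid_def
    using transport_closure(2)[of "C_c (subtopology (gtop G) P)" "C_c (subtopology (gtop H) Q)"] z transport_C_c[OF assms]
    by simp
qed

lemma Phi_image: "\<Phi> ` arrows G = arrows H"
  using Phi_arrow Psi_arrow Phi_Psi by (auto intro!: image_eqI[of _ \<Phi> "\<Psi> _"])

text \<open>Makes the full algebra the case of the subgroupoid of all arrows.\<close>

lemma restrict_all: "Cstar_r_sub G (restrict_groupoid G (arrows G)) = Cstar_r G"
  by (simp add: Cstar_r_sub_def restrict_groupoid_def Cstar_r_def)

lemma transport_diagonal: "transport ` diagonal_subalgebra G \<subseteq> diagonal_subalgebra H"
proof -
  have z: "f \<gamma> = 0" if "f \<in> C_0 (unit_space G)" "\<gamma> \<notin> arrows G" for f \<gamma>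
    using that G.C_0_units_outside G.units_arrow by blast
  show ?thesis
    unfolding diagonal_subalgebra_def by (rule transport_closure(1)) (use z transport_C_0 in auto)
qed

text \<open>\<open>backward\<close> after \<open>forward\<close> is the projection onto the arrows,
  which fixes the range of a convolution operator.\<close>

lemma transport_compose:
  assumes B: "B \<in> G.conv_ops" shows "transport (A o\<^sub>L B) = transport A o\<^sub>L transport B"
proof -
  have "backward o\<^sub>L (forward o\<^sub>L B) = B"
  proof (rule complex_linear_eqI)
    show "complex_linear (backward o\<^sub>L (forward o\<^sub>L B))"
      by (intro complex_linear_compose forward backward G.conv_ops_linear[OF B])
    show "mcoef (backward o\<^sub>L (forward o\<^sub>L B)) \<gamma> \<beta> = mcoef B \<gamma> \<beta>" for \<gamma> \<beta>
    proof (cases "\<gamma> \<in> arrows G")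
      case True
      then show ?thesis by (simp add: mcoef_def backward(2) forward(2) Phi_arrow Psi_Phi)
    next
      case False
      then have "mcoef B \<gamma> \<beta> = 0" by (simp add: G.conv_ops_mcoef[OF B] G.conv_kernel_def)
      then show ?thesis using False by (simp add: mcoef_def backward(2))
    qed
  qed (rule G.conv_ops_linear[OF B])
  then have *: "blinfun_apply backward (blinfun_apply forward (blinfun_apply B x)) = blinfun_apply B x" for x
    by (metis blinfun_apply_blinfun_compose)
  show ?thesis by (rule blinfun_eqI) (simp add: transport_def *)
qed

lemma transport_adjoint:
  assumes A: "complex_linear A" shows "transport (adjoint_op A) = adjoint_op (transport A)"
  by (rule complex_linear_eqI)
    (auto simp: complex_linear_transport complex_linear_adjoint_op A mcoef_transport mcoef_adjoint_op)

lemma transport_scale_op: "transport (scale_op c o\<^sub>L A) = scale_op c o\<^sub>L transport A"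
proof (rule blinfun_eqI)
  fix \<xi>
  show "blinfun_apply (transport (scale_op c o\<^sub>L A)) \<xi> = blinfun_apply (scale_op c o\<^sub>L transport A) \<xi>"
    using forward(1) by (simp add: transport_def complex_linear_def scale_op.rep_eq)
qed

end

theorem reduced_algebra_isomorphism:
  assumes G: "etale_groupoid G" and H: "etale_groupoid H"
    and iso: "groupoid_isomorphism G H \<Phi>"
    and P: "openin (gtop G) P" and Q: "openin (gtop H) Q" "\<Phi> ` P = Q"
  shows "\<exists>\<phi>. star_isomorphism (Cstar_r G) (Cstar_r H) \<phi> \<and>
    \<phi> ` Cstar_r_sub G (restrict_groupoid G P) = Cstar_r_sub H (restrict_groupoid H Q) \<and>
    \<phi> ` diagonal_subalgebra G = diagonal_subalgebra H"
proof -
  interpret G: etale_groupoid G by fact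
  interpret H: etale_groupoid H by fact
  obtain \<Psi> where homeo: "homeomorphic_maps (gtop G) (gtop H) \<Phi> \<Psi>"
    using iso unfolding groupoid_isomorphism_def homeomorphic_map_maps by blast
  interpret I: etale_groupoid_isomorphism G H \<Phi> \<Psi>
    by unfold_locales (use homeo iso in \<open>auto simp: groupoid_isomorphism_def\<close>)
  interpret J: etale_groupoid_isomorphism H G \<Psi> \<Phi> by (rule I.inverse)
  have QP: "\<Psi> ` Q = P"
    using Q(2) I.Psi_Phi openin_subset[OF P] by (force simp: image_image)
  \<comment> \<open>Coefficients decide equality in \<open>conv_ops\<close>; they are composed with
    \<open>\<Psi>\<close> and then with \<open>\<Phi>\<close>.\<close>
  have JI: "J.transport (I.transport A) = A" if A: "A \<in> Cstar_r G" for A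
  proof -
    note A = G.Cstar_r_conv_ops[OF A]
    note B = I.transport_conv_ops[OF A]
    note C = J.transport_conv_ops[OF B(1)]
    show ?thesis
      by (rule G.conv_ops_eqI[OF C(1) A]) (auto simp: C(2) B(2) I.Phi_arrow I.Psi_Phi G.coef_outside fun_eq_iff)
  qed
  have IJ: "I.transport (J.transport B) = B" if B: "B \<in> Cstar_r H" for B
  proof -
    note A = H.Cstar_r_conv_ops[OF B]
    note B = J.transport_conv_ops[OF A]
    note C = I.transport_conv_ops[OF B(1)]
    show ?thesis
      by (rule H.conv_ops_eqI[OF C(1) A]) (auto simp: C(2) B(2) I.Psi_arrow I.Phi_Psi H.coef_outside fun_eq_iff)
  qed
  have I_im: "I.transport ` Cstar_r G \<subseteq> Cstar_r H"
    using I.transport_Cstar_r_sub[OF openin_topspace openin_topspace I.Phi_image] unfolding I.restrict_all J.restrict_all .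
  have J_im: "J.transport ` Cstar_r H \<subseteq> Cstar_r G"
    using J.transport_Cstar_r_sub[OF openin_topspace openin_topspace J.Phi_image] unfolding I.restrict_all J.restrict_all .
  have "bij_betw I.transport (Cstar_r G) (Cstar_r H)"
    by (rule bij_betw_byWitness[where f' = J.transport]) (use JI IJ I_im J_im in auto)
  then have "star_isomorphism (Cstar_r G) (Cstar_r H) I.transport"
    unfolding star_isomorphism_def
    by (auto simp: I.transport_scale_op I.transport_compose I.transport_adjoint G.Cstar_r_conv_ops G.conv_ops_linear
        bounded_linear.linear[OF I.bounded_linear_transport, THEN linear_add])
  moreover have im: "I.transport ` A = B" if "I.transport ` A \<subseteq> B" "J.transport ` B \<subseteq> A" "B \<subseteq> Cstar_r H" for A B
  proof
    show "B \<subseteq> I.transport ` A"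
    proof
      fix b assume b: "b \<in> B"
      then have "I.transport (J.transport b) = b" using IJ that(3) by blast
      moreover have "J.transport b \<in> A" using b that(2) by blast
      ultimately show "b \<in> I.transport ` A" by (metis imageI)
    qed
  qed (rule that(1))
  ultimately show ?thesis
    using im[OF I.transport_Cstar_r_sub[OF P Q] J.transport_Cstar_r_sub[OF Q(1) P QP] H.Cstar_r_sub_subset[OF Q(1)]]
      im[OF I.transport_diagonal J.transport_diagonal H.Diag_subset_Cstar_r] by blast
qed

section \<open>The groupoid of a Deaconu-Renault system\<close>

text \<open>A form of local homeomorphism that is directly stable under composition, hence under
  powers of \<open>T\<close>.\<close>

definition etale_map :: "'a topology \<Rightarrow> ('a \<Rightarrow> 'a) \<Rightarrow> bool" where
  "etale_map X f \<longleftrightarrow> continuous_map X X f \<and> open_map X X f \<and>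
     (\<forall>x\<in>topspace X. \<exists>U. openin X U \<and> x \<in> U \<and> inj_on f U)"

lemma local_homeomorphism_etale_map:
  assumes T: "local_homeomorphism X X T" shows "etale_map X T"
proof -
  obtain N where N: "\<And>x. x \<in> topspace X \<Longrightarrow> openin X (N x) \<and> x \<in> N x \<and> openin X (T ` N x) \<and>
      homeomorphic_map (subtopology X (N x)) (subtopology X (T ` N x)) T"
    using T unfolding local_homeomorphism_def by metis
  have TX: "T ` topspace X \<subseteq> topspace X" using T unfolding local_homeomorphism_def by blast
  have image_open: "openin X (T ` (V \<inter> N x))" if "openin X V" "x \<in> topspace X" for V x
  proof -
    have "openin (subtopology X (N x)) (V \<inter> N x)" using that(1) by (auto simp: openin_subtopology)
    then have "openin (subtopology X (T ` N x)) (T ` (V \<inter> N x))"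
      using homeomorphic_imp_open_map[of "subtopology X (N x)" "subtopology X (T ` N x)" T] N[OF that(2)]
      unfolding open_map_def by blast
    then show ?thesis using N[OF that(2)] openin_trans_full by blast
  qed
  have "open_map X X T"
    unfolding open_map_def
  proof (intro allI impI)
    fix V assume V: "openin X V"
    have "T ` V = (\<Union>x\<in>V. T ` (V \<inter> N x))" using N openin_subset[OF V] by blast
    moreover have "openin X (\<Union>x\<in>V. T ` (V \<inter> N x))"
      using image_open[OF V] openin_subset[OF V] by (intro openin_Union) blast
    ultimately show "openin X (T ` V)" by simp
  qed
  moreover have "continuous_map X X T"
    unfolding continuous_map_eq_topcontinuous_at topcontinuous_at_def
  proof (intro ballI conjI allI impI)
    fix x assume x: "x \<in> topspace X"
    show "x \<in> topspace X" by fact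
    show "T \<in> topspace X \<rightarrow> topspace X" using TX by blast
    fix V assume V: "openin X V \<and> T x \<in> V"
    have "continuous_map (subtopology X (N x)) (subtopology X (T ` N x)) T"
      using N[OF x] homeomorphic_imp_continuous_map by blast
    then have "continuous_map (subtopology X (N x)) X T" using continuous_map_in_subtopology by blast
    then have "openin (subtopology X (N x)) {y\<in>topspace (subtopology X (N x)). T y \<in> V}"
      using V openin_continuous_map_preimage by blast
    then have "openin X {y\<in>topspace (subtopology X (N x)). T y \<in> V}" using N[OF x] openin_trans_full by blast
    then show "\<exists>U. openin X U \<and> x \<in> U \<and> (\<forall>y\<in>U. T y \<in> V)"
      using x V N[OF x] by (intro exI[of _ "{y\<in>topspace (subtopology X (N x)). T y \<in> V}"]) auto
  qed
  moreover have "inj_on T (N x)" if "x \<in> topspace X" for x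
  proof -
    have "topspace (subtopology X (N x)) = N x" using N[OF that] openin_subset by auto
    then show ?thesis using N[OF that] homeomorphic_imp_injective_map by metis
  qed
  ultimately show ?thesis unfolding etale_map_def using N by blast
qed

lemma etale_map_compose:
  assumes f: "etale_map X f" and g: "etale_map X g" shows "etale_map X (g \<circ> f)"
  unfolding etale_map_def
proof (intro conjI ballI)
  show "continuous_map X X (g \<circ> f)" "open_map X X (g \<circ> f)"
    using f g unfolding etale_map_def by (auto intro: continuous_map_compose open_map_compose)
  fix x assume x: "x \<in> topspace X"
  have c: "continuous_map X X f" using f unfolding etale_map_def by blast
  obtain U where U: "openin X U" "x \<in> U" "inj_on f U" using f x unfolding etale_map_def by blast
  have "f x \<in> topspace X" using c x by (auto simp: continuous_map_def)
  then obtain V where V: "openin X V" "f x \<in> V" "inj_on g V" using g unfolding etale_map_def by blast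
  let ?W = "U \<inter> {y\<in>topspace X. f y \<in> V}"
  have "openin X ?W" using U V c by (intro openin_Int openin_continuous_map_preimage)
  moreover have "inj_on (g \<circ> f) ?W"
    using U(3) V(3) unfolding inj_on_def by auto
  ultimately show "\<exists>U. openin X U \<and> x \<in> U \<and> inj_on (g \<circ> f) U" using U V x by blast
qed

lemma etale_map_funpow: "etale_map X T \<Longrightarrow> etale_map X (T ^^ n)"
proof (induction n)
  case 0
  then show ?case unfolding etale_map_def by (auto simp: open_map_def intro!: exI[of _ "topspace X"])
next
  case (Suc n)
  then show ?case using etale_map_compose[of X "T ^^ n" T] by (simp add: o_def)
qed

locale deaconu_renault =
  fixes X :: "'a topology" and T :: "'a \<Rightarrow> 'a"
  assumes system: "deaconu_renault_system X T"
begin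

abbreviation "G \<equiv> DR_groupoid X T"

lemma locally_compact_X: "locally_compact_space X" and Hausdorff_X: "Hausdorff_space X"
  using system by (auto simp: deaconu_renault_system_def)

lemma etale_T: "etale_map X (T ^^ n)"
  using system local_homeomorphism_etale_map etale_map_funpow unfolding deaconu_renault_system_def by blast

lemma continuous_T: "continuous_map X X (T ^^ n)" and open_T: "open_map X X (T ^^ n)"
  using etale_T[of n] by (simp_all add: etale_map_def)

lemma T_closed: "x \<in> topspace X \<Longrightarrow> (T ^^ n) x \<in> topspace X"
  using continuous_T[of n] by (auto simp: continuous_map_def)

lemma T_closed1: "x \<in> topspace X \<Longrightarrow> T x \<in> topspace X"
  using T_closed[of x 1] by simp

lemma T_injective_near: "x \<in> topspace X \<Longrightarrow> \<exists>U. openin X U \<and> x \<in> U \<and> inj_on (T ^^ n) U"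
  using etale_T[of n] by (simp add: etale_map_def)

lemma arrow_iff:
  "(y, k, x) \<in> arrows G \<longleftrightarrow> y \<in> topspace X \<and> x \<in> topspace X \<and>
     (\<exists>n m. k = int n - int m \<and> (T ^^ n) y = (T ^^ m) x)"
  unfolding arrows_DR_groupoid by blast

lemma arrowE:
  assumes "\<alpha> \<in> arrows G"
  obtains y n m x where "\<alpha> = (y, int n - int m, x)" "y \<in> topspace X" "x \<in> topspace X" "(T ^^ n) y = (T ^^ m) x"
  using assms unfolding arrows_DR_groupoid by blast

lemma groupoid_ops:
  "gdom G (y, k, x) = (x, 0, x)" "gran G (y, k, x) = (y, 0, y)"
  "gmult G (z, k, y) (y', l, x) = (z, k + l, x)" "ginv G (y, k, x) = (x, - k, y)"
  by (simp_all add: DR_groupoid_def)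

lemma basic_iff:
  "(y, k, x) \<in> DR_basic X T U n m V \<longleftrightarrow> k = int n - int m \<and> y \<in> topspace X \<and> y \<in> U \<and>
     x \<in> topspace X \<and> x \<in> V \<and> (T ^^ n) y = (T ^^ m) x"
  unfolding DR_basic_def by auto

lemma openin_basic: "openin X U \<Longrightarrow> openin X V \<Longrightarrow> openin (gtop G) (DR_basic X T U n m V)"
  unfolding DR_groupoid_def by (simp, intro topology_generated_by_Basis) blast

text \<open>For fixed \<open>n\<close> and \<open>m\<close> with \<open>(T ^^ n) y = (T ^^ m) x\<close> the basic sets with these exponents already form a
  neighbourhood base: raising both exponents by \<open>j\<close> does not change the set where \<open>T ^^ j\<close> is injective.\<close>

lemma basic_neighbourhood:
  assumes W: "openin (gtop G) W" and a: "(y, int n - int m, x) \<in> W"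
    and y: "y \<in> topspace X" and x: "x \<in> topspace X" and e: "(T ^^ n) y = (T ^^ m) x"
  obtains U V where "openin X U" "openin X V" "y \<in> U" "x \<in> V" "DR_basic X T U n m V \<subseteq> W"
proof -
  have "generate_topology_on {DR_basic X T U n m V | U n m V. openin X U \<and> openin X V} W"
    using W by (simp add: DR_groupoid_def openin_topology_generated_by_iff)
  then have "(y, int n - int m, x) \<in> W \<longrightarrow>
    (\<exists>U V. openin X U \<and> openin X V \<and> y \<in> U \<and> x \<in> V \<and> DR_basic X T U n m V \<subseteq> W)"
  proof (induction W rule: generate_topology_on.induct)
    case Empty then show ?case by simp
  next
    case (Int A B)
    show ?case
    proof
      assume "(y, int n - int m, x) \<in> A \<inter> B"
      then obtain U V U' V' where "openin X U" "openin X V" "y \<in> U" "x \<in> V" "DR_basic X T U n m V \<subseteq> A"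
        "openin X U'" "openin X V'" "y \<in> U'" "x \<in> V'" "DR_basic X T U' n m V' \<subseteq> B"
        using Int.IH by auto
      moreover have "DR_basic X T (U \<inter> U') n m (V \<inter> V') \<subseteq> DR_basic X T U n m V"
        "DR_basic X T (U \<inter> U') n m (V \<inter> V') \<subseteq> DR_basic X T U' n m V'" unfolding DR_basic_def by blast+
      ultimately show "\<exists>U V. openin X U \<and> openin X V \<and> y \<in> U \<and> x \<in> V \<and> DR_basic X T U n m V \<subseteq> A \<inter> B"
        by (intro exI[of _ "U \<inter> U'"] exI[of _ "V \<inter> V'"]) auto
    qed
  next
    case (UN K)
    show ?case
    proof
      assume "(y, int n - int m, x) \<in> \<Union>K"
      then obtain k where k: "k \<in> K" "(y, int n - int m, x) \<in> k" by blast
      then obtain U V where "openin X U" "openin X V" "y \<in> U" "x \<in> V" "DR_basic X T U n m V \<subseteq> k"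
        using UN.IH[OF k(1)] by auto
      then show "\<exists>U V. openin X U \<and> openin X V \<and> y \<in> U \<and> x \<in> V \<and> DR_basic X T U n m V \<subseteq> \<Union>K"
        using k(1) by (intro exI[of _ U] exI[of _ V]) auto
    qed
  next
    case (Basis s)
    show ?case
    proof
      assume s: "(y, int n - int m, x) \<in> s"
      obtain U' n' m' V' where s_eq: "s = DR_basic X T U' n' m' V'" and UV': "openin X U'" "openin X V'" using Basis by blast
      have k: "int n - int m = int n' - int m'" and mem: "y \<in> U'" "x \<in> V'" "(T ^^ n') y = (T ^^ m') x"
        using s unfolding s_eq basic_iff by auto
      show "\<exists>U V. openin X U \<and> openin X V \<and> y \<in> U \<and> x \<in> V \<and> DR_basic X T U n m V \<subseteq> s"
      proof (cases "n \<le> n'")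
        case True
        define j where "j = n' - n"
        have j: "n' = j + n" "m' = j + m" using True k by (auto simp: j_def)
        \<comment> \<open>Applying \<open>T ^^ j\<close> to the equation with smaller exponents
          gives the one with larger exponents.\<close>
        have "DR_basic X T U' n m V' \<subseteq> s"
          unfolding s_eq DR_basic_def j by (auto simp: funpow_add)
        then show ?thesis using UV' mem by blast
      next
        case False
        define j where "j = n - n'"
        have j: "n = j + n'" "m = j + m'" using False k by (auto simp: j_def)
        \<comment> \<open>Near the common value of \<open>(T ^^ n') y\<close> and
          \<open>(T ^^ m') x\<close> the map \<open>T ^^ j\<close> is injective, so it can be
          cancelled from the equation with larger exponents.\<close>
        obtain N where N: "openin X N" "(T ^^ n') y \<in> N" "inj_on (T ^^ j) N"
          using T_injective_near[OF T_closed[OF y]] by blast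
        let ?U = "U' \<inter> {y\<in>topspace X. (T ^^ n') y \<in> N}" and ?V = "V' \<inter> {x\<in>topspace X. (T ^^ m') x \<in> N}"
        have "openin X ?U" "openin X ?V"
          using UV' N(1) by (auto intro!: openin_Int openin_continuous_map_preimage[OF continuous_T])
        moreover have "DR_basic X T ?U n m ?V \<subseteq> s"
        proof clarify
          fix a b c assume "(a, b, c) \<in> DR_basic X T ?U n m ?V"
          then have h: "b = int n - int m" "a \<in> topspace X" "c \<in> topspace X" "a \<in> U'" "c \<in> V'"
            "(T ^^ n') a \<in> N" "(T ^^ m') c \<in> N" "(T ^^ j) ((T ^^ n') a) = (T ^^ j) ((T ^^ m') c)"
            unfolding basic_iff by (auto simp: j funpow_add)
          then have "(T ^^ n') a = (T ^^ m') c" using N(3) by (auto simp: inj_on_def)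
          then show "(a, b, c) \<in> s" unfolding s_eq basic_iff using h k by simp
        qed
        moreover have "y \<in> ?U" "x \<in> ?V" using mem N x y by auto
        ultimately show ?thesis by blast
      qed
    qed
  qed
  then show thesis using a that by blast
qed

text \<open>Coordinates for units: the source map is \<open>unit\<close> after \<open>proj\<close>,
  so its continuity and openness reduce to these two maps from and to \<open>X\<close>.\<close>

definition proj :: "'a \<times> int \<times> 'a \<Rightarrow> 'a" where "proj = (\<lambda>(y, k, x). x)"
definition unit :: "'a \<Rightarrow> 'a \<times> int \<times> 'a" where "unit x = (x, 0, x)"

lemma unit_arrow: "x \<in> topspace X \<Longrightarrow> unit x \<in> arrows G"
  unfolding unit_def arrow_iff by (auto intro!: exI[of _ 0])

lemma continuous_proj: "continuous_map (gtop G) X proj"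
  unfolding continuous_map_eq_topcontinuous_at topcontinuous_at_def
proof (intro ballI conjI allI impI)
  fix \<alpha> assume a: "\<alpha> \<in> arrows G"
  show "\<alpha> \<in> arrows G" by fact
  show "proj \<in> arrows G \<rightarrow> topspace X" by (auto simp: proj_def elim!: arrowE)
  fix V assume V: "openin X V \<and> proj \<alpha> \<in> V"
  obtain y n m x where al: "\<alpha> = (y, int n - int m, x)" "y \<in> topspace X" "x \<in> topspace X" "(T ^^ n) y = (T ^^ m) x"
    using a by (rule arrowE)
  show "\<exists>U. openin (gtop G) U \<and> \<alpha> \<in> U \<and> (\<forall>\<beta>\<in>U. proj \<beta> \<in> V)"
    by (rule exI[of _ "DR_basic X T (topspace X) n m V"])
      (use V al in \<open>auto simp: proj_def basic_iff intro!: openin_basic\<close>)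
qed

text \<open>The description exhibits openness: \<open>T ^^ n\<close> is open and
  \<open>T ^^ m\<close> is continuous.\<close>

lemma proj_basic: "proj ` DR_basic X T U n m V = {x \<in> topspace X. (T ^^ m) x \<in> (T ^^ n) ` (topspace X \<inter> U)} \<inter> (topspace X \<inter> V)"
proof (intro equalityI subsetI)
  fix x assume "x \<in> {x \<in> topspace X. (T ^^ m) x \<in> (T ^^ n) ` (topspace X \<inter> U)} \<inter> (topspace X \<inter> V)"
  then obtain y where "y \<in> topspace X" "y \<in> U" "(T ^^ n) y = (T ^^ m) x" "x \<in> topspace X" "x \<in> V" by auto
  then have "(y, int n - int m, x) \<in> DR_basic X T U n m V" by (simp add: basic_iff)
  then show "x \<in> proj ` DR_basic X T U n m V" by (force simp: proj_def)
next
  fix x assume "x \<in> proj ` DR_basic X T U n m V"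
  then obtain y k where "(y, k, x) \<in> DR_basic X T U n m V" by (auto simp: proj_def)
  then have h: "y \<in> topspace X \<inter> U" "x \<in> topspace X" "x \<in> V" "(T ^^ n) y = (T ^^ m) x"
    by (auto simp: basic_iff)
  from h(1) have "(T ^^ n) y \<in> (T ^^ n) ` (topspace X \<inter> U)" by (rule imageI)
  then show "x \<in> {x \<in> topspace X. (T ^^ m) x \<in> (T ^^ n) ` (topspace X \<inter> U)} \<inter> (topspace X \<inter> V)"
    using h by simp
qed

lemma openin_proj_basic: assumes "openin X U" "openin X V" shows "openin X (proj ` DR_basic X T U n m V)"
proof -
  have "openin X ((T ^^ n) ` (topspace X \<inter> U))" using open_T[of n] assms unfolding open_map_def by (simp add: openin_Int)
  then show ?thesis unfolding proj_basic
    using assms by (intro openin_Int openin_continuous_map_preimage[OF continuous_T]) auto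
qed

lemma open_map_proj: "open_map (gtop G) X proj"
  unfolding open_map_def
proof (intro allI impI)
  fix W assume W: "openin (gtop G) W"
  show "openin X (proj ` W)"
  proof (subst openin_subopen, intro ballI)
    fix x assume "x \<in> proj ` W"
    then obtain \<alpha> where a: "\<alpha> \<in> W" "proj \<alpha> = x" by blast
    have "\<alpha> \<in> arrows G" using a openin_subset[OF W] by blast
    then obtain y n m x' where al: "\<alpha> = (y, int n - int m, x')" "y \<in> topspace X" "x' \<in> topspace X" "(T ^^ n) y = (T ^^ m) x'"
      by (rule arrowE)
    have x': "x' = x" using a al by (simp add: proj_def)
    obtain U V where UV: "openin X U" "openin X V" "y \<in> U" "x \<in> V" "DR_basic X T U n m V \<subseteq> W"
      by (rule basic_neighbourhood[OF W, of y n m x]) (use a(1) al x' in simp_all)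
    have "\<alpha> \<in> DR_basic X T U n m V" using al UV x' by (simp add: basic_iff)
    then have "x \<in> proj ` DR_basic X T U n m V" using a(2) by blast
    then show "\<exists>V. openin X V \<and> x \<in> V \<and> V \<subseteq> proj ` W"
      using openin_proj_basic[OF UV(1,2)] UV(5) image_mono by meson
  qed
qed

lemma continuous_unit: "continuous_map X (gtop G) unit"
  unfolding continuous_map_eq_topcontinuous_at topcontinuous_at_def
proof (intro ballI conjI allI impI)
  fix x assume x: "x \<in> topspace X"
  show "x \<in> topspace X" by fact
  show "unit \<in> topspace X \<rightarrow> arrows G" using unit_arrow by blast
  fix W assume W: "openin (gtop G) W \<and> unit x \<in> W"
  then obtain U V where UV: "openin X U" "openin X V" "x \<in> U" "x \<in> V" "DR_basic X T U 0 0 V \<subseteq> W"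
    using basic_neighbourhood[of W x 0 0 x] x by (auto simp: unit_def)
  have "unit z \<in> W" if "z \<in> U \<inter> V" for z
  proof -
    have "unit z \<in> DR_basic X T U 0 0 V" using that openin_subset[OF UV(1)] by (auto simp: unit_def basic_iff)
    then show ?thesis using UV by blast
  qed
  then show "\<exists>U. openin X U \<and> x \<in> U \<and> (\<forall>z\<in>U. unit z \<in> W)"
    using UV by (intro exI[of _ "U \<inter> V"]) auto
qed

lemma open_map_unit: "open_map X (gtop G) unit"
  unfolding open_map_def
proof (intro allI impI)
  fix U assume U: "openin X U"
  have "unit ` U = DR_basic X T U 0 0 U"
  proof (intro equalityI subsetI)
    fix a assume a: "a \<in> DR_basic X T U 0 0 U"
    obtain y k x where "a = (y, k, x)" by (cases a)
    then show "a \<in> unit ` U" using a by (auto simp: unit_def basic_iff)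
  qed (use openin_subset[OF U] in \<open>auto simp: unit_def basic_iff\<close>)
  then show "openin (gtop G) (unit ` U)" using openin_basic[OF U U] by simp
qed

lemma dom_eq: "gdom G \<alpha> = unit (proj \<alpha>)"
  by (cases \<alpha>) (simp add: groupoid_ops unit_def proj_def)

text \<open>The degree is constant on each basic set, so the cocycle is locally constant.\<close>

lemma openin_level: "openin (gtop G) {\<alpha>\<in>arrows G. DR_cocycle \<alpha> = k}"
proof (subst openin_subopen, intro ballI)
  fix \<alpha> assume a: "\<alpha> \<in> {\<alpha>\<in>arrows G. DR_cocycle \<alpha> = k}"
  then obtain y n m x where al: "\<alpha> = (y, int n - int m, x)" "y \<in> topspace X" "x \<in> topspace X" "(T ^^ n) y = (T ^^ m) x"
    using arrowE by blast
  let ?B = "DR_basic X T (topspace X) n m (topspace X)"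
  have o: "openin (gtop G) ?B" by (simp add: openin_basic)
  moreover have "\<alpha> \<in> ?B" using al by (simp add: basic_iff)
  moreover have "?B \<subseteq> {\<alpha>\<in>arrows G. DR_cocycle \<alpha> = k}"
    using openin_subset[OF o] a al by (auto simp: basic_iff DR_cocycle_def)
  ultimately show "\<exists>U. openin (gtop G) U \<and> \<alpha> \<in> U \<and> U \<subseteq> {\<alpha>\<in>arrows G. DR_cocycle \<alpha> = k}" by blast
qed

text \<open>Where \<open>T ^^ n\<close> is injective, the defining equation determines the range of
  an arrow from its source.\<close>

lemma proj_injective_near:
  assumes a: "\<alpha> \<in> arrows G"
  obtains B where "openin (gtop G) B" "\<alpha> \<in> B" "inj_on proj B"
proof -
  obtain y n m x where al: "\<alpha> = (y, int n - int m, x)" "y \<in> topspace X" "x \<in> topspace X" "(T ^^ n) y = (T ^^ m) x"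
    using a by (rule arrowE)
  obtain U where U: "openin X U" "y \<in> U" "inj_on (T ^^ n) U" using T_injective_near[OF al(2)] by blast
  show thesis
  proof (rule that)
    show "openin (gtop G) (DR_basic X T U n m (topspace X))" using U by (simp add: openin_basic)
    show "\<alpha> \<in> DR_basic X T U n m (topspace X)" using al U by (simp add: basic_iff)
    show "inj_on proj (DR_basic X T U n m (topspace X))"
      using U(3) by (intro inj_onI) (auto simp: basic_iff proj_def inj_on_def)
  qed
qed

text \<open>One choice of exponents at each point suffices, because basic sets with these exponents
  form a neighbourhood base at the value.\<close>

lemma continuous_into_groupoid:
  assumes f: "\<And>z. z \<in> topspace Z \<Longrightarrow> f z \<in> arrows G"
    and loc: "\<And>z. z \<in> topspace Z \<Longrightarrow> \<exists>y n m x. f z = (y, int n - int m, x) \<and> (T ^^ n) y = (T ^^ m) x \<and>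
      (\<forall>U V. openin X U \<and> openin X V \<and> y \<in> U \<and> x \<in> V \<longrightarrow>
        (\<exists>N. openin Z N \<and> z \<in> N \<and> (\<forall>z'\<in>N. f z' \<in> DR_basic X T U n m V)))"
  shows "continuous_map Z (gtop G) f"
  unfolding continuous_map_eq_topcontinuous_at topcontinuous_at_def
proof (intro ballI conjI allI impI)
  fix z assume z: "z \<in> topspace Z"
  show "z \<in> topspace Z" by fact
  show "f \<in> topspace Z \<rightarrow> arrows G" using f by blast
  fix W assume W: "openin (gtop G) W \<and> f z \<in> W"
  obtain y n m x where h: "f z = (y, int n - int m, x)" "(T ^^ n) y = (T ^^ m) x"
    "\<And>U V. openin X U \<and> openin X V \<and> y \<in> U \<and> x \<in> V \<Longrightarrow>
        \<exists>N. openin Z N \<and> z \<in> N \<and> (\<forall>z'\<in>N. f z' \<in> DR_basic X T U n m V)"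
    using loc[OF z] by metis
  have yx: "y \<in> topspace X" "x \<in> topspace X" using f[OF z] h(1) by (auto simp: arrow_iff)
  obtain U V where UV: "openin X U" "openin X V" "y \<in> U" "x \<in> V" "DR_basic X T U n m V \<subseteq> W"
    by (rule basic_neighbourhood[of W y n m x]) (use W h yx in simp_all)
  then show "\<exists>N. openin Z N \<and> z \<in> N \<and> (\<forall>z'\<in>N. f z' \<in> W)" using h(3)[of U V] by blast
qed

lemma continuous_inv: "continuous_map (gtop G) (gtop G) (ginv G)"
proof (rule continuous_into_groupoid)
  fix \<alpha> assume a: "\<alpha> \<in> arrows G"
  then obtain y n m x where al: "\<alpha> = (y, int n - int m, x)" "y \<in> topspace X" "x \<in> topspace X" "(T ^^ n) y = (T ^^ m) x"
    by (rule arrowE)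
  show "ginv G \<alpha> \<in> arrows G"
    unfolding al(1) groupoid_ops arrow_iff using al by (intro conjI exI[of _ m] exI[of _ n]) simp_all
  show "\<exists>y n m x. ginv G \<alpha> = (y, int n - int m, x) \<and> (T ^^ n) y = (T ^^ m) x \<and>
      (\<forall>U V. openin X U \<and> openin X V \<and> y \<in> U \<and> x \<in> V \<longrightarrow>
        (\<exists>N. openin (gtop G) N \<and> \<alpha> \<in> N \<and> (\<forall>z'\<in>N. ginv G z' \<in> DR_basic X T U n m V)))"
  proof (rule exI[of _ x], rule exI[of _ m], rule exI[of _ n], rule exI[of _ y], intro conjI allI impI)
    show "ginv G \<alpha> = (x, int m - int n, y)" "(T ^^ m) x = (T ^^ n) y" using al by (simp_all add: groupoid_ops)
    fix U V assume UV: "openin X U \<and> openin X V \<and> x \<in> U \<and> y \<in> V"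
    show "\<exists>N. openin (gtop G) N \<and> \<alpha> \<in> N \<and> (\<forall>z'\<in>N. ginv G z' \<in> DR_basic X T U m n V)"
      by (rule exI[of _ "DR_basic X T V n m U"])
        (use UV al in \<open>auto simp: basic_iff groupoid_ops intro!: openin_basic\<close>)
  qed
qed

lemma etale_groupoid: "etale_groupoid G"
proof
  show "Hausdorff_space (gtop G)"
    unfolding Hausdorff_space_def
  proof (intro allI impI)
    fix \<alpha> \<beta> assume ab: "\<alpha> \<in> arrows G \<and> \<beta> \<in> arrows G \<and> \<alpha> \<noteq> \<beta>"
    have sep: "\<exists>U V. openin (gtop G) U \<and> openin (gtop G) V \<and> \<alpha> \<in> U \<and> \<beta> \<in> V \<and> disjnt U V"
      if q: "continuous_map (gtop G) Z q" "Hausdorff_space Z" "q \<alpha> \<noteq> q \<beta>" for Z and q :: "'a \<times> int \<times> 'a \<Rightarrow> 'a"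
    proof -
      have "q \<alpha> \<in> topspace Z" "q \<beta> \<in> topspace Z" using q(1) ab by (auto simp: continuous_map_def)
      then obtain U V where UV: "openin Z U" "openin Z V" "q \<alpha> \<in> U" "q \<beta> \<in> V" "disjnt U V"
        using q(2,3) unfolding Hausdorff_space_def by metis
      then show ?thesis
        using openin_continuous_map_preimage[OF q(1)] ab
        by (intro exI[of _ "{z\<in>arrows G. q z \<in> U}"] exI[of _ "{z\<in>arrows G. q z \<in> V}"]) (auto simp: disjnt_iff)
    qed
    have c: "continuous_map (gtop G) X (proj \<circ> ginv G)" by (rule continuous_map_compose[OF continuous_inv continuous_proj])
    \<comment> \<open>An arrow is its source, range and degree; the first two are separated in
      \<open>X\<close>, the last by the open levels.\<close>
    consider "proj \<alpha> \<noteq> proj \<beta>" | "(proj \<circ> ginv G) \<alpha> \<noteq> (proj \<circ> ginv G) \<beta>" | "DR_cocycle \<alpha> \<noteq> DR_cocycle \<beta>"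
      using ab by (cases \<alpha>; cases \<beta>) (auto simp: proj_def groupoid_ops DR_cocycle_def)
    then show "\<exists>U V. openin (gtop G) U \<and> openin (gtop G) V \<and> \<alpha> \<in> U \<and> \<beta> \<in> V \<and> disjnt U V"
    proof cases
      case 1 then show ?thesis by (rule sep[OF continuous_proj Hausdorff_X])
    next
      case 2 then show ?thesis by (rule sep[OF c Hausdorff_X])
    next
      case 3
      then show ?thesis using ab openin_level
        by (intro exI[of _ "{z\<in>arrows G. DR_cocycle z = DR_cocycle \<alpha>}"] exI[of _ "{z\<in>arrows G. DR_cocycle z = DR_cocycle \<beta>}"])
          (auto simp: disjnt_iff)
    qed
  qed
  show "locally_compact_space (gtop G)"
    unfolding locally_compact_space_def
  proof
    fix \<alpha> assume a: "\<alpha> \<in> arrows G"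
    then obtain B where B: "openin (gtop G) B" "\<alpha> \<in> B" "inj_on proj B" by (rule proj_injective_near)
    have pB: "openin X (proj ` B)" using open_map_proj B unfolding open_map_def by blast
    have "compactin X {proj \<alpha>}" using pB B openin_subset by (intro compactin_sing[THEN iffD2]) blast
    then obtain W L where WL: "openin X W" "compactin X L" "{proj \<alpha>} \<subseteq> W" "W \<subseteq> L" "L \<subseteq> proj ` B"
      using compact_open_neighbourhood[OF locally_compact_X Hausdorff_X _ pB, of "{proj \<alpha>}"] B by blast
    \<comment> \<open>A compact neighbourhood of the source in \<open>X\<close> is lifted along this
      local section of \<open>proj\<close>.\<close>
    let ?s = "inv_into B proj"
    have s: "continuous_map (subtopology X (proj ` B)) (gtop G) ?s"
      by (rule continuous_map_section[OF continuous_proj open_map_proj B(1,3)])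
    have "compactin (gtop G) (?s ` L)"
      by (rule image_compactin[OF _ s]) (use WL in \<open>simp add: compactin_subtopology\<close>)
    moreover have "openin (gtop G) (B \<inter> {z\<in>arrows G. proj z \<in> W})"
      using B WL by (intro openin_Int openin_continuous_map_preimage[OF continuous_proj])
    moreover have "B \<inter> {z\<in>arrows G. proj z \<in> W} \<subseteq> ?s ` L"
    proof
      fix z assume z: "z \<in> B \<inter> {z\<in>arrows G. proj z \<in> W}"
      then have "?s (proj z) = z" "proj z \<in> L" using B(3) WL by auto
      then show "z \<in> ?s ` L" by (metis imageI)
    qed
    ultimately show "\<exists>U K. openin (gtop G) U \<and> compactin (gtop G) K \<and> \<alpha> \<in> U \<and> U \<subseteq> K"
      using a B WL by (intro exI[of _ "B \<inter> {z\<in>arrows G. proj z \<in> W}"] exI[of _ "?s ` L"]) auto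
  qed
  have dom_comp: "gdom G = unit \<circ> proj" by (simp add: dom_eq fun_eq_iff)
  show "continuous_map (gtop G) (gtop G) (gdom G)"
    unfolding dom_comp by (rule continuous_map_compose[OF continuous_proj continuous_unit])
  show "open_map (gtop G) (gtop G) (gdom G)"
    unfolding dom_comp by (rule open_map_compose[OF open_map_proj open_map_unit])
  show "continuous_map (gtop G) (gtop G) (ginv G)" by (rule continuous_inv)
  fix \<gamma> assume g: "\<gamma> \<in> arrows G"
  obtain y n m x where ga: "\<gamma> = (y, int n - int m, x)" "y \<in> topspace X" "x \<in> topspace X" "(T ^^ n) y = (T ^^ m) x"
    using g by (rule arrowE)
  show "gdom G \<gamma> \<in> arrows G" "gran G \<gamma> \<in> arrows G"
    using unit_arrow[OF ga(2)] unit_arrow[OF ga(3)] by (simp_all add: ga(1) groupoid_ops unit_def)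
  show "gdom G (gdom G \<gamma>) = gdom G \<gamma>" "gran G (gdom G \<gamma>) = gdom G \<gamma>" "gdom G (gran G \<gamma>) = gran G \<gamma>"
    "gran G (gran G \<gamma>) = gran G \<gamma>" "gmult G \<gamma> (gdom G \<gamma>) = \<gamma>" "gmult G (gran G \<gamma>) \<gamma> = \<gamma>"
    "gdom G (ginv G \<gamma>) = gran G \<gamma>" "gran G (ginv G \<gamma>) = gdom G \<gamma>" "gmult G (ginv G \<gamma>) \<gamma> = gdom G \<gamma>"
    "gmult G \<gamma> (ginv G \<gamma>) = gran G \<gamma>"
    by (simp_all add: ga(1) groupoid_ops)
  show "ginv G \<gamma> \<in> arrows G" using continuous_inv g by (auto simp: continuous_map_def)
  obtain B where B: "openin (gtop G) B" "\<gamma> \<in> B" "inj_on proj B" using g by (rule proj_injective_near)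
  have "inj_on (gdom G) B" using B(3) by (auto simp: dom_eq unit_def inj_on_def)
  then show "\<exists>U. openin (gtop G) U \<and> \<gamma> \<in> U \<and> inj_on (gdom G) U" using B by blast
next
  fix \<alpha> \<beta> assume a: "\<alpha> \<in> arrows G" and b: "\<beta> \<in> arrows G" and c: "gdom G \<alpha> = gran G \<beta>"
  obtain z n m y where al: "\<alpha> = (z, int n - int m, y)" "z \<in> topspace X" "y \<in> topspace X" "(T ^^ n) z = (T ^^ m) y"
    using a by (rule arrowE)
  obtain y' n' m' x where be: "\<beta> = (y', int n' - int m', x)" "y' \<in> topspace X" "x \<in> topspace X" "(T ^^ n') y' = (T ^^ m') x"
    using b by (rule arrowE)
  have y': "y' = y" using c by (simp add: al be groupoid_ops)
  have prod: "gmult G \<alpha> \<beta> = (z, int (n' + n) - int (m + m'), x)" by (simp add: al be groupoid_ops)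
  \<comment> \<open>Apply \<open>T ^^ n'\<close> to the first equation and \<open>T ^^ m\<close> to
    the second; both meet in the same iterate of the middle point. The difference of the new
    exponents is the sum of the degrees.\<close>
  have comp: "(T ^^ (n' + n)) z' = (T ^^ (m + m')) x'" if "(T ^^ n) z' = (T ^^ m) w" "(T ^^ n') w = (T ^^ m') x'" for z' w x'
  proof -
    have "(T ^^ (n' + n)) z' = (T ^^ n') ((T ^^ m) w)" using that by (simp add: funpow_add)
    also have "\<dots> = (T ^^ m) ((T ^^ n') w)" by (metis add.commute comp_apply funpow_add)
    finally show ?thesis using that by (simp add: funpow_add)
  qed
  show "gmult G \<alpha> \<beta> \<in> arrows G"
    unfolding prod arrow_iff using al be comp y' by blast
  show "gdom G (gmult G \<alpha> \<beta>) = gdom G \<beta>" "gran G (gmult G \<alpha> \<beta>) = gran G \<alpha>"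
    by (simp_all add: al be groupoid_ops)
  show "gmult G (gmult G \<alpha> \<beta>) \<gamma> = gmult G \<alpha> (gmult G \<beta> \<gamma>)" if "\<gamma> \<in> arrows G" for \<gamma>
    by (cases \<gamma>) (simp add: al be groupoid_ops)
  fix W assume W: "openin (gtop G) W" "gmult G \<alpha> \<beta> \<in> W"
  have e: "(T ^^ (n' + n)) z = (T ^^ (m + m')) x" using comp al be y' by blast
  obtain U V where UV: "openin X U" "openin X V" "z \<in> U" "x \<in> V" "DR_basic X T U (n' + n) (m + m') V \<subseteq> W"
    by (rule basic_neighbourhood[OF W(1), of z "n' + n" "m + m'" x]) (use W(2)[unfolded prod] al(2) be(3) e in simp_all)
  show "\<exists>U V. openin (gtop G) U \<and> openin (gtop G) V \<and> \<alpha> \<in> U \<and> \<beta> \<in> V \<and>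
      (\<forall>\<alpha>'\<in>U. \<forall>\<beta>'\<in>V. gdom G \<alpha>' = gran G \<beta>' \<longrightarrow> gmult G \<alpha>' \<beta>' \<in> W)"
  proof (rule exI[of _ "DR_basic X T U n m (topspace X)"], rule exI[of _ "DR_basic X T (topspace X) n' m' V"],
      intro conjI ballI impI)
    show "openin (gtop G) (DR_basic X T U n m (topspace X))" "openin (gtop G) (DR_basic X T (topspace X) n' m' V)"
      using UV by (simp_all add: openin_basic)
    show "\<alpha> \<in> DR_basic X T U n m (topspace X)" "\<beta> \<in> DR_basic X T (topspace X) n' m' V"
      using al be UV by (simp_all add: basic_iff)
    fix \<alpha>' \<beta>' assume ab: "\<alpha>' \<in> DR_basic X T U n m (topspace X)" "\<beta>' \<in> DR_basic X T (topspace X) n' m' V" "gdom G \<alpha>' = gran G \<beta>'"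
    obtain z1 k1 y1 y2 k2 x2 where e: "\<alpha>' = (z1, k1, y1)" "\<beta>' = (y2, k2, x2)" by (cases \<alpha>'; cases \<beta>')
    have y2: "y2 = y1" using ab(3) by (simp add: e groupoid_ops)
    have "(z1, k1 + k2, x2) \<in> DR_basic X T U (n' + n) (m + m') V"
      using ab(1,2) comp[of z1 y1 x2] unfolding e y2 basic_iff by auto
    then show "gmult G \<alpha>' \<beta>' \<in> W" using UV(5) by (auto simp: e groupoid_ops)
  qed
qed

end

section \<open>Eventual conjugacy and the canonical cocycle\<close>

text \<open>An additive map of the integers is multiplication by \<open>\<tau> 1\<close>, and
  surjectivity makes \<open>\<tau> 1\<close> a divisor of \<open>1\<close>.\<close>

lemma integer_group_auto_iff:
  "\<tau> \<in> auto integer_group \<longleftrightarrow> (\<exists>e. \<bar>e\<bar> = 1 \<and> \<tau> = (\<lambda>n. e * n))"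
proof
  assume t: "\<tau> \<in> auto integer_group"
  then have add: "\<tau> (a + b) = \<tau> a + \<tau> b" for a b
    by (simp add: auto_def hom_def)
  have bij: "bij_betw \<tau> UNIV UNIV" using t by (simp add: auto_def Bij_def)
  have z: "\<tau> 0 = 0" using add[of 0 0] by simp
  have "\<tau> n = \<tau> 1 * n" for n
  proof (induction n rule: int_induct[where k = 0])
    case (step1 i) then show ?case using add[of i 1] by (simp add: algebra_simps)
  next
    case (step2 i) then show ?case using add[of "i - 1" 1] by (simp add: algebra_simps)
  qed (simp add: z)
  moreover obtain n where "\<tau> n = 1" using bij by (metis bij_betw_imp_surj_on rangeE UNIV_I)
  ultimately have "\<tau> 1 * n = 1" by metis
  then have "\<bar>\<tau> 1\<bar> = 1" by (auto simp: zmult_eq_1_iff)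
  with \<open>\<And>n. \<tau> n = \<tau> 1 * n\<close> show "\<exists>e. \<bar>e\<bar> = 1 \<and> \<tau> = (\<lambda>n. e * n)" by blast
next
  assume "\<exists>e. \<bar>e\<bar> = 1 \<and> \<tau> = (\<lambda>n. e * n)"
  then obtain e :: int where e: "\<bar>e\<bar> = 1" "\<tau> = (\<lambda>n. e * n)" by blast
  have ee: "e * (e * n) = n" for n using e(1) by (auto simp: abs_if split: if_splits)
  have "bij_betw \<tau> UNIV UNIV"
    by (rule bij_betw_byWitness[where f' = \<tau>]) (auto simp: e(2) ee)
  then show "\<tau> \<in> auto integer_group" by (simp add: auto_def Bij_def hom_def e(2) algebra_simps)
qed

lemma continuous_map_discrete_iff:
  "continuous_map X (discrete_topology UNIV) f \<longleftrightarrow>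
    (\<forall>x\<in>topspace X. \<exists>U. openin X U \<and> x \<in> U \<and> (\<forall>y\<in>U. f y = f x))"
proof
  assume f: "continuous_map X (discrete_topology UNIV) f"
  show "\<forall>x\<in>topspace X. \<exists>U. openin X U \<and> x \<in> U \<and> (\<forall>y\<in>U. f y = f x)"
  proof
    fix x assume "x \<in> topspace X"
    then show "\<exists>U. openin X U \<and> x \<in> U \<and> (\<forall>y\<in>U. f y = f x)"
      using openin_continuous_map_preimage[OF f, of "{f x}"]
      by (intro exI[of _ "{y\<in>topspace X. f y \<in> {f x}}"]) auto
  qed
next
  assume r: "\<forall>x\<in>topspace X. \<exists>U. openin X U \<and> x \<in> U \<and> (\<forall>y\<in>U. f y = f x)"
  show "continuous_map X (discrete_topology UNIV) f"
    unfolding continuous_map_eq_topcontinuous_at topcontinuous_at_def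
  proof (intro ballI conjI allI impI)
    fix x V assume x: "x \<in> topspace X" and V: "openin (discrete_topology UNIV) V \<and> f x \<in> V"
    obtain U where U: "openin X U" "x \<in> U" "\<And>y. y \<in> U \<Longrightarrow> f y = f x"
      using bspec[OF r x]
      by (elim exE conjE) (rule that, assumption+, drule (1) bspec, assumption)
    have "f y \<in> V" if "y \<in> U" for y unfolding U(3)[OF that] using V by simp
    then show "\<exists>U. openin X U \<and> x \<in> U \<and> (\<forall>y\<in>U. f y \<in> V)" using U(1,2) by blast
  qed simp_all
qed

lemma funpow_commute: "(f ^^ a) ((f ^^ b) x) = (f ^^ b) ((f ^^ a) x)"
proof -
  have "(f ^^ (a + b)) x = (f ^^ (b + a)) x" by (simp only: add.commute)
  then show ?thesis by (simp only: funpow_add o_apply)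
qed

text \<open>Chaining the orbit relations along \<open>x, T x, ...\<close> adds the differences
  \<open>l - k = e\<close>. The exponents depend on the point, but continuity of \<open>l\<close>
  and \<open>k\<close> fixes them near \<open>x\<close>, as continuity of the groupoid map
  requires.\<close>

lemma orbit_map_iterate:
  assumes X: "deaconu_renault X T" and lk: "continuous_orbit_map X T Y S l k h"
    and e: "\<And>x. x \<in> topspace X \<Longrightarrow> int (l x) - int (k x) = e" and x: "x \<in> topspace X"
  shows "\<exists>a b U. openin X U \<and> x \<in> U \<and> int a - int b = e * int n \<and>
    (\<forall>x'\<in>U. (S ^^ a) (h x') = (S ^^ b) (h ((T ^^ n) x')))"
proof (induction n)
  case 0
  then show ?case using x by (intro exI[of _ 0] exI[of _ "topspace X"]) auto
next
  case (Suc n)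
  interpret deaconu_renault X T by fact
  obtain a b U where U: "openin X U" "x \<in> U" "int a - int b = e * int n"
    "\<And>x'. x' \<in> U \<Longrightarrow> (S ^^ a) (h x') = (S ^^ b) (h ((T ^^ n) x'))"
    using Suc.IH
    by (elim exE conjE) (rule that, assumption+, drule (1) bspec, assumption)
  let ?z = "(T ^^ n) x"
  have z: "?z \<in> topspace X" using T_closed x by blast
  have l: "continuous_map X (discrete_topology UNIV) l" and k: "continuous_map X (discrete_topology UNIV) k"
    and eq: "\<And>x. x \<in> topspace X \<Longrightarrow> (S ^^ l x) (h x) = (S ^^ k x) (h (T x))"
    using lk by (auto simp: continuous_orbit_map_def)
  obtain V where V: "openin X V" "?z \<in> V" "\<And>y. y \<in> V \<Longrightarrow> l y = l ?z"
    using bspec[OF l[unfolded continuous_map_discrete_iff] z]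
    by (elim exE conjE) (rule that, assumption+, drule (1) bspec, assumption)
  obtain V' where V': "openin X V'" "?z \<in> V'" "\<And>y. y \<in> V' \<Longrightarrow> k y = k ?z"
    using bspec[OF k[unfolded continuous_map_discrete_iff] z]
    by (elim exE conjE) (rule that, assumption+, drule (1) bspec, assumption)
  let ?W = "U \<inter> {y\<in>topspace X. (T ^^ n) y \<in> V \<inter> V'}"
  have W1: "openin X ?W"
    by (intro openin_Int openin_continuous_map_preimage[OF continuous_T] U(1) V(1) V'(1))
  \<comment> \<open>At \<open>(T ^^ n) x'\<close> the functions \<open>l\<close> and
    \<open>k\<close> have the same values as at \<open>?z\<close>, so the relations to be chained
    have fixed exponents.\<close>
  have W2: "(S ^^ (l ?z + a)) (h x') = (S ^^ (b + k ?z)) (h ((T ^^ Suc n) x'))" if x': "x' \<in> ?W" for x'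
  proof -
    let ?y = "(T ^^ n) x'"
    have "x' \<in> topspace X" "?y \<in> V" "?y \<in> V'" using x' by simp_all
    then have y: "?y \<in> topspace X" "l ?y = l ?z" "k ?y = k ?z"
      using T_closed V(3)[of ?y] V'(3)[of ?y] by simp_all
    have "(S ^^ (l ?z + a)) (h x') = (S ^^ l ?z) ((S ^^ b) (h ?y))" using U x' by (simp add: funpow_add)
    also have "\<dots> = (S ^^ b) ((S ^^ l ?z) (h ?y))" by (rule funpow_commute)
    also have "(S ^^ l ?z) (h ?y) = (S ^^ k ?z) (h (T ?y))" using eq[OF y(1)] y by simp
    finally show ?thesis by (simp add: funpow_add)
  qed
  have W3: "int (l ?z + a) - int (b + k ?z) = e * int (Suc n)"
    using U(3) e[OF z] by (simp add: algebra_simps)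
  have W4: "x \<in> ?W" using U(2) V(2) V'(2) x by simp
  show ?case
    by (rule exI[of _ "l ?z + a"], rule exI[of _ "b + k ?z"], rule exI[of _ ?W])
      (intro conjI ballI W1 W2 W3 W4)
qed

definition DR_map :: "('a \<Rightarrow> 'b) \<Rightarrow> int \<Rightarrow> 'a \<times> int \<times> 'a \<Rightarrow> 'b \<times> int \<times> 'b" where
  "DR_map h e = (\<lambda>(y, n, x). (h y, e * n, h x))"

text \<open>An arrow equates \<open>(T ^^ n) y\<close> with \<open>(T ^^ m) x\<close>. Iterating the
  orbit relation from both ends yields an equation between powers of \<open>S\<close> at
  \<open>h y\<close> and \<open>h x\<close> with locally fixed exponents, whose difference is
  \<open>e * (n - m)\<close>.\<close>

lemma continuous_DR_map:
  assumes X: "deaconu_renault X T" and Y: "deaconu_renault Y S"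
    and lk: "continuous_orbit_map X T Y S l k h"
    and e: "\<And>x. x \<in> topspace X \<Longrightarrow> int (l x) - int (k x) = e"
  shows "continuous_map (gtop (DR_groupoid X T)) (gtop (DR_groupoid Y S)) (DR_map h e)"
proof -
  interpret X: deaconu_renault X T by fact
  interpret Y: deaconu_renault Y S by fact
  have h: "continuous_map X Y h" using lk by (simp add: continuous_orbit_map_def)
  have hY: "h x \<in> topspace Y" if "x \<in> topspace X" for x using h that by (auto simp: continuous_map_def)
  have *: "\<exists>y a b x. DR_map h e \<alpha> = (y, int a - int b, x) \<and> (S ^^ a) y = (S ^^ b) x \<and> y \<in> topspace Y \<and> x \<in> topspace Y \<and>
      (\<forall>U V. openin Y U \<and> openin Y V \<and> y \<in> U \<and> x \<in> V \<longrightarrow>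
        (\<exists>N. openin (gtop (DR_groupoid X T)) N \<and> \<alpha> \<in> N \<and> (\<forall>z'\<in>N. DR_map h e z' \<in> DR_basic Y S U a b V)))"
    if a: "\<alpha> \<in> arrows (DR_groupoid X T)" for \<alpha>
  proof -
    obtain y n m x where al: "\<alpha> = (y, int n - int m, x)" "y \<in> topspace X" "x \<in> topspace X" "(T ^^ n) y = (T ^^ m) x"
      using a by (rule X.arrowE)
    have itn: "\<exists>a b U. openin X U \<and> y \<in> U \<and> int a - int b = e * int n \<and>
        (\<forall>x'\<in>U. (S ^^ a) (h x') = (S ^^ b) (h ((T ^^ n) x')))"
      by (rule orbit_map_iterate[OF X lk _ al(2)]) (rule e)
    have itm: "\<exists>a b U. openin X U \<and> x \<in> U \<and> int a - int b = e * int m \<and>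
        (\<forall>x'\<in>U. (S ^^ a) (h x') = (S ^^ b) (h ((T ^^ m) x')))"
      by (rule orbit_map_iterate[OF X lk _ al(3)]) (rule e)
    obtain a b U where U: "openin X U" "y \<in> U" "int a - int b = e * int n"
      "\<And>y'. y' \<in> U \<Longrightarrow> (S ^^ a) (h y') = (S ^^ b) (h ((T ^^ n) y'))"
      using itn
      by (elim exE conjE) (rule that, assumption+, drule (1) bspec, assumption)
    obtain a' b' V where V: "openin X V" "x \<in> V" "int a' - int b' = e * int m"
      "\<And>x'. x' \<in> V \<Longrightarrow> (S ^^ a') (h x') = (S ^^ b') (h ((T ^^ m) x'))"
      using itm
      by (elim exE conjE) (rule that, assumption+, drule (1) bspec, assumption)
    \<comment> \<open>Each relation is raised by the exponent left over from the other,
      \<open>b'\<close> and \<open>b\<close>, so that the middle terms agree.\<close>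
    have comp: "(S ^^ (b' + a)) (h y') = (S ^^ (b + a')) (h x')"
      if "y' \<in> U" "x' \<in> V" "(T ^^ n) y' = (T ^^ m) x'" for y' x'
    proof -
      have "(S ^^ (b' + a)) (h y') = (S ^^ b') ((S ^^ b) (h ((T ^^ m) x')))" using U(4) that by (simp add: funpow_add)
      also have "\<dots> = (S ^^ b) ((S ^^ b') (h ((T ^^ m) x')))" by (rule funpow_commute)
      finally show ?thesis using V(4) that by (simp add: funpow_add)
    qed
    have ab: "int (b' + a) - int (b + a') = e * (int n - int m)"
      using U(3) V(3) by (simp add: algebra_simps)
    show ?thesis
    proof (rule exI[of _ "h y"], rule exI[of _ "b' + a"], rule exI[of _ "b + a'"], rule exI[of _ "h x"], intro conjI allI impI)
      show "DR_map h e \<alpha> = (h y, int (b' + a) - int (b + a'), h x)" unfolding ab by (simp add: DR_map_def al)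
      show "(S ^^ (b' + a)) (h y) = (S ^^ (b + a')) (h x)" using comp U V al by blast
      show "h y \<in> topspace Y" "h x \<in> topspace Y" using hY al by auto
      fix A B assume AB: "openin Y A \<and> openin Y B \<and> h y \<in> A \<and> h x \<in> B"
      let ?N = "DR_basic X T (U \<inter> {z\<in>topspace X. h z \<in> A}) n m (V \<inter> {z\<in>topspace X. h z \<in> B})"
      have "openin (gtop (DR_groupoid X T)) ?N"
        using U V AB by (intro X.openin_basic openin_Int openin_continuous_map_preimage[OF h]) auto
      moreover have "\<alpha> \<in> ?N" using al U V AB by (simp add: X.basic_iff)
      moreover have "DR_map h e z \<in> DR_basic Y S A (b' + a) (b + a') B" if z: "z \<in> ?N" for z
      proof -
        obtain y' j x' where zz: "z = (y', j, x')" by (cases z)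
        have q: "j = int n - int m" "y' \<in> topspace X" "x' \<in> topspace X" "y' \<in> U" "x' \<in> V" "h y' \<in> A" "h x' \<in> B"
          "(T ^^ n) y' = (T ^^ m) x'"
          using z unfolding zz X.basic_iff by auto
        have dr: "DR_map h e z = (h y', int (b' + a) - int (b + a'), h x')"
          unfolding ab by (simp add: DR_map_def zz q)
        show ?thesis unfolding dr Y.basic_iff using q hY comp by auto
      qed
      ultimately show "\<exists>N. openin (gtop (DR_groupoid X T)) N \<and> \<alpha> \<in> N \<and> (\<forall>z'\<in>N. DR_map h e z' \<in> DR_basic Y S A (b' + a) (b + a') B)"
        by blast
    qed
  qed
  show ?thesis
  proof (rule Y.continuous_into_groupoid)
    fix \<alpha> assume a: "\<alpha> \<in> arrows (DR_groupoid X T)"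
    obtain y a b x where o: "DR_map h e \<alpha> = (y, int a - int b, x)" "(S ^^ a) y = (S ^^ b) x" "y \<in> topspace Y" "x \<in> topspace Y"
      using *[OF a] by metis
    show "DR_map h e \<alpha> \<in> arrows (DR_groupoid Y S)"
      unfolding o(1) Y.arrow_iff by (intro conjI exI[of _ a] exI[of _ b] o refl)
    show "\<exists>y n m x. DR_map h e \<alpha> = (y, int n - int m, x) \<and> (S ^^ n) y = (S ^^ m) x \<and>
        (\<forall>U V. openin Y U \<and> openin Y V \<and> y \<in> U \<and> x \<in> V \<longrightarrow>
          (\<exists>N. openin (gtop (DR_groupoid X T)) N \<and> \<alpha> \<in> N \<and> (\<forall>z'\<in>N. DR_map h e z' \<in> DR_basic Y S U n m V)))"
      using *[OF a] by metis
  qed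
qed

lemma flip_eventually_conjugate_imp_isomorphism:
  assumes X: "deaconu_renault X T" and Y: "deaconu_renault Y S" and fl: "flip_eventually_conjugate X T Y S"
  shows "\<exists>\<Phi> \<tau>. groupoid_isomorphism (DR_groupoid X T) (DR_groupoid Y S) \<Phi> \<and> \<tau> \<in> auto integer_group \<and>
    (\<forall>\<alpha>\<in>arrows (DR_groupoid X T). DR_cocycle (\<Phi> \<alpha>) = \<tau> (DR_cocycle \<alpha>))"
proof -
  interpret X: deaconu_renault X T by fact
  interpret Y: deaconu_renault Y S by fact
  obtain l k l' k' h e where coe: "continuous_orbit_equivalence X T Y S l k l' k' h" and e1: "\<bar>e\<bar> = (1::int)"
    and e: "\<And>x. x \<in> topspace X \<Longrightarrow> int (l x) - int (k x) = e" "\<And>y. y \<in> topspace Y \<Longrightarrow> int (l' y) - int (k' y) = e"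
  proof -
    obtain l k l' k' h where c: "continuous_orbit_equivalence X T Y S l k l' k' h" and
      d: "(\<forall>x\<in>topspace X. int (l x) - int (k x) = 1) \<and> (\<forall>y\<in>topspace Y. int (l' y) - int (k' y) = 1) \<or>
         (\<forall>x\<in>topspace X. int (l x) - int (k x) = - 1) \<and> (\<forall>y\<in>topspace Y. int (l' y) - int (k' y) = - 1)"
      using fl unfolding flip_eventually_conjugate_def by blast
    from d show thesis
    proof
      assume "(\<forall>x\<in>topspace X. int (l x) - int (k x) = 1) \<and> (\<forall>y\<in>topspace Y. int (l' y) - int (k' y) = 1)"
      then show thesis using that[OF c, of 1] by simp
    next
      assume "(\<forall>x\<in>topspace X. int (l x) - int (k x) = - 1) \<and> (\<forall>y\<in>topspace Y. int (l' y) - int (k' y) = - 1)"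
      then show thesis using that[OF c, of "- 1"] by simp
    qed
  qed
  let ?g = "inv_into (topspace X) h"
  have h: "homeomorphic_map X Y h" and lk: "continuous_orbit_map X T Y S l k h" and lk': "continuous_orbit_map Y S X T l' k' ?g"
    using coe by (auto simp: continuous_orbit_equivalence_def)
  have gh: "?g (h x) = x" if "x \<in> topspace X" for x
    using homeomorphic_imp_injective_map[OF h] that by simp
  have hg: "h (?g y) = y" if "y \<in> topspace Y" for y
    using homeomorphic_imp_surjective_map[OF h] that by (simp add: f_inv_into_f)
  \<comment> \<open>A sign is its own inverse, so the map built from the inverse homeomorphism with
    the same \<open>e\<close> is inverse to \<open>?\<Phi>\<close>.\<close>
  have ee: "e * (e * n) = n" for n using e1 by (auto simp: abs_if split: if_splits)
  let ?\<Phi> = "DR_map h e" and ?\<Psi> = "DR_map ?g e"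
  have "homeomorphic_maps (gtop (DR_groupoid X T)) (gtop (DR_groupoid Y S)) ?\<Phi> ?\<Psi>"
    unfolding homeomorphic_maps_def
  proof (intro conjI ballI)
    show "continuous_map (gtop (DR_groupoid X T)) (gtop (DR_groupoid Y S)) ?\<Phi>"
      by (rule continuous_DR_map[OF X Y lk e(1)])
    show "continuous_map (gtop (DR_groupoid Y S)) (gtop (DR_groupoid X T)) ?\<Psi>"
      by (rule continuous_DR_map[OF Y X lk' e(2)])
    fix \<alpha> assume "\<alpha> \<in> arrows (DR_groupoid X T)"
    then show "?\<Psi> (?\<Phi> \<alpha>) = \<alpha>" by (rule X.arrowE) (simp add: DR_map_def gh ee)
  next
    fix \<alpha> assume "\<alpha> \<in> arrows (DR_groupoid Y S)"
    then show "?\<Phi> (?\<Psi> \<alpha>) = \<alpha>" by (rule Y.arrowE) (simp add: DR_map_def hg ee)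
  qed
  then have "homeomorphic_map (gtop (DR_groupoid X T)) (gtop (DR_groupoid Y S)) ?\<Phi>" using homeomorphic_map_maps by blast
  then have "groupoid_isomorphism (DR_groupoid X T) (DR_groupoid Y S) ?\<Phi>"
    unfolding groupoid_isomorphism_def
    by (auto simp: DR_map_def X.groupoid_ops Y.groupoid_ops algebra_simps)
  moreover have "(\<lambda>n. e * n) \<in> auto integer_group" using integer_group_auto_iff e1 by blast
  moreover have "DR_cocycle (?\<Phi> \<alpha>) = e * DR_cocycle \<alpha>" for \<alpha>
    by (cases \<alpha>) (simp add: DR_map_def DR_cocycle_def)
  ultimately show ?thesis by (intro exI[of _ ?\<Phi>] exI[of _ "\<lambda>n. e * n"]) simp
qed

section \<open>Orbit maps from isomorphisms compatible with the cocycles\<close>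

context deaconu_renault
begin

text \<open>Arrows of degree \<open>1\<close> along \<open>T\<close>: their images carry the orbit
  relation, and their products reach every positive degree.\<close>

definition edge :: "'a \<Rightarrow> 'a \<times> int \<times> 'a" where "edge x = (x, 1, T x)"

lemma edge_arrow: "x \<in> topspace X \<Longrightarrow> edge x \<in> arrows G"
  unfolding edge_def arrow_iff using T_closed1
  by (intro conjI exI[of _ 1] exI[of _ 0]) auto

lemma continuous_edge: "continuous_map X (gtop G) edge"
proof (rule continuous_into_groupoid)
  fix x assume x: "x \<in> topspace X"
  then show "edge x \<in> arrows G" by (rule edge_arrow)
  show "\<exists>y n m z. edge x = (y, int n - int m, z) \<and> (T ^^ n) y = (T ^^ m) z \<and>
      (\<forall>U V. openin X U \<and> openin X V \<and> y \<in> U \<and> z \<in> V \<longrightarrow>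
        (\<exists>N. openin X N \<and> x \<in> N \<and> (\<forall>z'\<in>N. edge z' \<in> DR_basic X T U n m V)))"
  proof (rule exI[of _ x], rule exI[of _ 1], rule exI[of _ 0], rule exI[of _ "T x"], intro conjI allI impI)
    show "edge x = (x, int 1 - int 0, T x)" "(T ^^ 1) x = (T ^^ 0) (T x)" by (simp_all add: edge_def)
    fix U V assume UV: "openin X U \<and> openin X V \<and> x \<in> U \<and> T x \<in> V"
    have "openin X (U \<inter> {z\<in>topspace X. (T ^^ 1) z \<in> V})"
      using UV by (intro openin_Int openin_continuous_map_preimage[OF continuous_T]) auto
    then show "\<exists>N. openin X N \<and> x \<in> N \<and> (\<forall>z'\<in>N. edge z' \<in> DR_basic X T U 1 0 V)"
      using UV x by (intro exI[of _ "U \<inter> {z\<in>topspace X. (T ^^ 1) z \<in> V}"])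
        (auto simp: edge_def basic_iff T_closed1)
  qed
qed

end

text \<open>Taking for \<open>k\<close> the least admissible exponent makes it continuous: the condition is open because the
  image of an edge moves in a basic set, and closed because the space is Hausdorff.\<close>

lemma isomorphism_imp_orbit_map:
  assumes X: "deaconu_renault X T" and Y: "deaconu_renault Y S"
    and \<Phi>: "groupoid_isomorphism (DR_groupoid X T) (DR_groupoid Y S) \<Phi>"
    and e: "\<And>\<alpha>. \<alpha> \<in> arrows (DR_groupoid X T) \<Longrightarrow> DR_cocycle (\<Phi> \<alpha>) = e * DR_cocycle \<alpha>"
    and h: "\<And>x. h x = fst (\<Phi> (x, 0, x))"
  shows "continuous_map X Y h \<and> (\<forall>x\<in>topspace X. \<Phi> (x, 0, x) = (h x, 0, h x)) \<and>
    (\<exists>l k. continuous_orbit_map X T Y S l k h \<and> (\<forall>x\<in>topspace X. int (l x) - int (k x) = e))"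
proof -
  interpret X: deaconu_renault X T by fact
  interpret Y: deaconu_renault Y S by fact
  have c\<Phi>: "continuous_map (gtop (DR_groupoid X T)) (gtop (DR_groupoid Y S)) \<Phi>"
    using \<Phi> homeomorphic_imp_continuous_map unfolding groupoid_isomorphism_def by blast
  have dom: "\<Phi> (gdom (DR_groupoid X T) \<alpha>) = gdom (DR_groupoid Y S) (\<Phi> \<alpha>)"
    and ran: "\<Phi> (gran (DR_groupoid X T) \<alpha>) = gran (DR_groupoid Y S) (\<Phi> \<alpha>)" if "\<alpha> \<in> arrows (DR_groupoid X T)" for \<alpha>
    using \<Phi> that unfolding groupoid_isomorphism_def by auto
  have unit: "\<Phi> (X.unit x) = (h x, 0, h x)" if x: "x \<in> topspace X" for x
  proof -
    have "\<Phi> (X.unit x) = gdom (DR_groupoid Y S) (\<Phi> (X.unit x))"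
      using dom[OF X.unit_arrow[OF x]] by (simp add: X.unit_def X.groupoid_ops)
    then obtain y where "\<Phi> (X.unit x) = (y, 0, y)" by (cases "\<Phi> (X.unit x)") (auto simp: Y.groupoid_ops)
    then show ?thesis by (simp add: h X.unit_def)
  qed
  have hc: "continuous_map X Y h"
  proof (rule continuous_map_eq)
    show "continuous_map X Y (Y.proj \<circ> (\<Phi> \<circ> X.unit))"
      by (intro continuous_map_compose[OF _ Y.continuous_proj] continuous_map_compose[OF X.continuous_unit c\<Phi>])
  qed (simp add: unit Y.proj_def)
  have hY: "h x \<in> topspace Y" if "x \<in> topspace X" for x using hc that by (auto simp: continuous_map_def)
  \<comment> \<open>Source and range are forced by the action on units, the degree by the cocycle.
    That this triple is an arrow is an orbit relation with difference \<open>e\<close>.\<close>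
  have edge: "\<Phi> (X.edge x) = (h x, e, h (T x))" if x: "x \<in> topspace X" for x
  proof -
    note a = X.edge_arrow[OF x]
    obtain u j v where uv: "\<Phi> (X.edge x) = (u, j, v)" by (cases "\<Phi> (X.edge x)")
    have "(h (T x), 0, h (T x)) = (v, 0, v)"
      using dom[OF a] unit[OF X.T_closed1[OF x]] uv by (simp add: X.edge_def X.unit_def X.groupoid_ops Y.groupoid_ops)
    moreover have "(h x, 0, h x) = (u, 0, u)"
      using ran[OF a] unit[OF x] uv by (simp add: X.edge_def X.unit_def X.groupoid_ops Y.groupoid_ops)
    moreover have "j = e" using e[OF a] uv by (simp add: DR_cocycle_def X.edge_def)
    ultimately show ?thesis using uv by simp
  qed
  have edge_arrow: "(h x, e, h (T x)) \<in> arrows (DR_groupoid Y S)" if x: "x \<in> topspace X" for x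
    using edge[OF x] X.edge_arrow[OF x] c\<Phi> by (auto simp: continuous_map_def Pi_iff)
  \<comment> \<open>\<open>nat\<close> sends negative numbers to \<open>0\<close>, so nonnegativity
    of the exponent \<open>int k + e\<close> is required explicitly.\<close>
  define P where "P x k \<longleftrightarrow> int k + e \<ge> 0 \<and> (S ^^ nat (int k + e)) (h x) = (S ^^ k) (h (T x))" for x k
  define k where "k x = (LEAST k. P x k)" for x
  define l where "l x = nat (int (k x) + e)" for x
  have ex: "\<exists>k. P x k" if x: "x \<in> topspace X" for x
  proof -
    obtain a b where ab: "e = int a - int b" "(S ^^ a) (h x) = (S ^^ b) (h (T x))"
      using edge_arrow[OF x] unfolding Y.arrow_iff by blast
    then have "P x b" unfolding P_def by simp
    then show ?thesis by blast
  qed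
  have Pk: "P x (k x)" if "x \<in> topspace X" for x unfolding k_def using ex[OF that] by (rule LeastI_ex)
  have lk_e: "int (l x) - int (k x) = e" if "x \<in> topspace X" for x
    using Pk[OF that] by (simp add: l_def P_def)
  have closed: "closedin X {x\<in>topspace X. P x j}" for j
  proof (cases "int j + e \<ge> 0")
    case True
    have "continuous_map X Y (\<lambda>x. (S ^^ nat (int j + e)) (h x))"
      using continuous_map_compose[OF hc Y.continuous_T] by (simp add: o_def)
    moreover have "continuous_map X Y (\<lambda>x. (S ^^ j) (h (T x)))"
      using continuous_map_compose[OF continuous_map_compose[OF X.continuous_T[of 1] hc] Y.continuous_T] by (simp add: o_def)
    ultimately have "closedin X {x\<in>topspace X. (S ^^ nat (int j + e)) (h x) = (S ^^ j) (h (T x))}"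
      by (rule closedin_continuous_maps_eq[OF Y.Hausdorff_X])
    then show ?thesis using True by (simp add: P_def)
  qed (simp add: P_def)
  have kc: "\<exists>U. openin X U \<and> x \<in> U \<and> (\<forall>y\<in>U. k y = k x)" if x: "x \<in> topspace X" for x
  proof -
    \<comment> \<open>Arrows in the basic set with the minimal exponents at \<open>x\<close> satisfy
      the equation with these exponents, so \<open>k x\<close> stays admissible nearby.\<close>
    let ?B = "DR_basic Y S (topspace Y) (l x) (k x) (topspace Y)"
    have kl: "int (l x) - int (k x) = e" by (rule lk_e[OF x])
    have Bo: "openin (gtop (DR_groupoid Y S)) ?B" by (simp add: Y.openin_basic)
    let ?U = "{y\<in>topspace X. (\<Phi> \<circ> X.edge) y \<in> ?B}"
    have U: "openin X ?U"
      by (rule openin_continuous_map_preimage[OF continuous_map_compose[OF X.continuous_edge c\<Phi>] Bo])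
    have xU: "x \<in> ?U"
      using x Pk[OF x] hY X.T_closed1 kl by (simp add: edge Y.basic_iff P_def l_def)
    have PU: "P y (k x)" if "y \<in> ?U" for y
      using that Pk[OF x] by (auto simp: edge Y.basic_iff P_def l_def)
    \<comment> \<open>Finitely many closed conditions for smaller exponents fail at
      \<open>x\<close>, hence nearby; together with \<open>?U\<close> this makes \<open>k\<close>
      locally constant.\<close>
    let ?V = "topspace X - (\<Union>j<k x. {y\<in>topspace X. P y j})"
    have V: "openin X ?V" by (intro openin_diff openin_topspace closedin_Union) (auto intro: closed)
    have nP: "\<not> P x j" if "j < k x" for j using that not_less_Least unfolding k_def by blast
    have "k y = k x" if y: "y \<in> ?U \<inter> ?V" for y
      unfolding k_def[of y]
    proof (rule Least_equality)
      show "P y (k x)" using PU y by blast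
      fix j assume j: "P y j"
      have "y \<in> ?V" using y by (rule IntD2)
      then have "\<not> j < k x" using j by auto
      then show "k x \<le> j" by simp
    qed
    moreover have "x \<in> ?V" using x nP by auto
    ultimately show ?thesis using openin_Int[OF U V] xU by (intro exI[of _ "?U \<inter> ?V"] conjI ballI IntI)
  qed
  have ck: "continuous_map X (discrete_topology UNIV) k" unfolding continuous_map_discrete_iff using kc by blast
  have cl: "continuous_map X (discrete_topology UNIV) l" unfolding continuous_map_discrete_iff
  proof
    fix x assume x: "x \<in> topspace X"
    obtain U where U: "openin X U" "x \<in> U" "\<And>y. y \<in> U \<Longrightarrow> k y = k x"
      using kc[OF x]
      by (elim exE conjE) (rule that, assumption+, drule (1) bspec, assumption)
    have "l y = l x" if "y \<in> U" for y unfolding l_def U(3)[OF that] ..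
    then show "\<exists>U. openin X U \<and> x \<in> U \<and> (\<forall>y\<in>U. l y = l x)" using U(1,2) by blast
  qed
  have "continuous_orbit_map X T Y S l k h"
    unfolding continuous_orbit_map_def using ck cl hc Pk by (auto simp: P_def l_def)
  then show ?thesis using hc unit lk_e unfolding X.unit_def by blast
qed

lemma isomorphism_imp_flip_eventually_conjugate:
  assumes X: "deaconu_renault X T" and Y: "deaconu_renault Y S"
    and \<Phi>: "groupoid_isomorphism (DR_groupoid X T) (DR_groupoid Y S) \<Phi>" and t: "\<tau> \<in> auto integer_group"
    and c: "\<And>\<alpha>. \<alpha> \<in> arrows (DR_groupoid X T) \<Longrightarrow> DR_cocycle (\<Phi> \<alpha>) = \<tau> (DR_cocycle \<alpha>)"
  shows "flip_eventually_conjugate X T Y S"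
proof -
  interpret X: deaconu_renault X T by fact
  interpret Y: deaconu_renault Y S by fact
  interpret GX: etale_groupoid "DR_groupoid X T" by (rule X.etale_groupoid)
  interpret GY: etale_groupoid "DR_groupoid Y S" by (rule Y.etale_groupoid)
  obtain e where e: "\<bar>e\<bar> = 1" "\<tau> = (\<lambda>n. e * n)" using t integer_group_auto_iff by blast
  have ee: "e * (e * n) = n" for n using e(1) by (auto simp: abs_if split: if_splits)
  obtain \<Psi> where homeo: "homeomorphic_maps (gtop (DR_groupoid X T)) (gtop (DR_groupoid Y S)) \<Phi> \<Psi>"
    using \<Phi> unfolding groupoid_isomorphism_def homeomorphic_map_maps by blast
  interpret I: etale_groupoid_isomorphism "DR_groupoid X T" "DR_groupoid Y S" \<Phi> \<Psi>
    by unfold_locales (use homeo \<Phi> in \<open>auto simp: groupoid_isomorphism_def\<close>)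
  have "homeomorphic_map (gtop (DR_groupoid Y S)) (gtop (DR_groupoid X T)) \<Psi>"
    using homeo homeomorphic_maps_map by blast
  then have \<Psi>: "groupoid_isomorphism (DR_groupoid Y S) (DR_groupoid X T) \<Psi>"
    unfolding groupoid_isomorphism_def using I.Psi_dom I.Psi_ran I.Psi_mult by blast
  have cX: "DR_cocycle (\<Phi> \<alpha>) = e * DR_cocycle \<alpha>" if "\<alpha> \<in> arrows (DR_groupoid X T)" for \<alpha>
    using c[OF that] e by simp
  have cY: "DR_cocycle (\<Psi> \<beta>) = e * DR_cocycle \<beta>" if "\<beta> \<in> arrows (DR_groupoid Y S)" for \<beta>
    using cX[OF I.Psi_arrow[OF that]] I.Phi_Psi[OF that] ee by metis
  define h where "h x = fst (\<Phi> (x, 0, x))" for x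
  define g where "g y = fst (\<Psi> (y, 0, y))" for y
  obtain l k where h: "continuous_map X Y h" "\<And>x. x \<in> topspace X \<Longrightarrow> \<Phi> (x, 0, x) = (h x, 0, h x)"
    and lk: "continuous_orbit_map X T Y S l k h" "\<And>x. x \<in> topspace X \<Longrightarrow> int (l x) - int (k x) = e"
    using isomorphism_imp_orbit_map[OF X Y \<Phi> cX h_def] by blast
  obtain l' k' where g: "continuous_map Y X g" "\<And>y. y \<in> topspace Y \<Longrightarrow> \<Psi> (y, 0, y) = (g y, 0, g y)"
    and lk': "continuous_orbit_map Y S X T l' k' g" "\<And>y. y \<in> topspace Y \<Longrightarrow> int (l' y) - int (k' y) = e"
    using isomorphism_imp_orbit_map[OF Y X \<Psi> cY g_def] by blast
  have gh: "g (h x) = x" if x: "x \<in> topspace X" for x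
  proof -
    have "h x \<in> topspace Y" using h(1) x by (auto simp: continuous_map_def)
    then have "(g (h x), 0, g (h x)) = \<Psi> (\<Phi> (x, 0, x))" using g(2) h(2)[OF x] by simp
    also have "\<dots> = (x, 0, x)" using I.Psi_Phi[OF X.unit_arrow[OF x]] by (simp add: X.unit_def)
    finally show ?thesis by simp
  qed
  have hg: "h (g y) = y" if y: "y \<in> topspace Y" for y
  proof -
    have "g y \<in> topspace X" using g(1) y by (auto simp: continuous_map_def)
    then have "(h (g y), 0, h (g y)) = \<Phi> (\<Psi> (y, 0, y))" using h(2) g(2)[OF y] by simp
    also have "\<dots> = (y, 0, y)" using I.Phi_Psi[OF Y.unit_arrow[OF y]] by (simp add: Y.unit_def)
    finally show ?thesis by simp
  qed
  have "homeomorphic_maps X Y h g" unfolding homeomorphic_maps_def using h(1) g(1) gh hg by blast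
  then have hh: "homeomorphic_map X Y h" using homeomorphic_map_maps by blast
  have inv: "inv_into (topspace X) h y = g y" if y: "y \<in> topspace Y" for y
  proof (rule inv_into_f_eq[OF homeomorphic_imp_injective_map[OF hh] _ hg[OF y]])
    show "g y \<in> topspace X" using g(1) y by (auto simp: continuous_map_def)
  qed
  have "continuous_map Y X (inv_into (topspace X) h)" by (rule continuous_map_eq[OF g(1)]) (simp add: inv)
  then have "continuous_orbit_map Y S X T l' k' (inv_into (topspace X) h)"
    using lk'(1) inv Y.T_closed1 by (simp add: continuous_orbit_map_def)
  then have coe: "continuous_orbit_equivalence X T Y S l k l' k' h"
    unfolding continuous_orbit_equivalence_def using hh lk(1) by blast
  have "e = 1 \<or> e = - 1" using e(1) by arith
  then show ?thesis unfolding flip_eventually_conjugate_def using coe lk(2) lk'(2) by metis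
qed

context deaconu_renault
begin

abbreviation "kernel_arrows \<equiv> {\<alpha>\<in>arrows G. DR_cocycle \<alpha> = 0}"

text \<open>The fibre of the cocycle over \<open>0\<close> contains triples that are not arrows;
  cutting down to arrows gives an open set, the form in which subgroupoids are treated
  above.\<close>

lemma DR_kernel_eq: "DR_kernel X T = restrict_groupoid G kernel_arrows"
proof -
  have "arrows G \<inter> DR_cocycle -` {0} = kernel_arrows" by auto
  then have "subtopology (gtop G) (DR_cocycle -` {0}) = subtopology (gtop G) kernel_arrows"
    by (metis subtopology_restrict)
  then show ?thesis by (simp add: DR_kernel_def restrict_groupoid_def)
qed

lemma arrows_DR_kernel: "arrows (DR_kernel X T) = kernel_arrows"
  by (auto simp: DR_kernel_eq restrict_groupoid_def)

lemma DR_kernel_ops: "gdom (DR_kernel X T) = gdom G" "gran (DR_kernel X T) = gran G"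
  by (simp_all add: DR_kernel_def restrict_groupoid_def)

text \<open>Units have degree \<open>0\<close>. Hence transitivity of the kernel applies to open
  sets of units of the whole groupoid.\<close>

lemma unit_space_DR_kernel: "unit_space (DR_kernel X T) = unit_space G"
proof -
  have sub: "gdom G ` arrows G \<subseteq> kernel_arrows"
    using etale_groupoid.dom_closed[OF etale_groupoid] by (auto simp: dom_eq unit_def DR_cocycle_def)
  have im: "gdom G ` kernel_arrows = gdom G ` arrows G"
  proof
    show "gdom G ` arrows G \<subseteq> gdom G ` kernel_arrows"
    proof
      fix x assume "x \<in> gdom G ` arrows G"
      then have "x \<in> kernel_arrows" "gdom G x = x"
        using sub etale_groupoid.dom_dom[OF etale_groupoid] by auto
      then show "x \<in> gdom G ` kernel_arrows" by (intro image_eqI[where x = x]) simp_all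
    qed
  qed (rule image_mono, blast)
  have top: "gtop (DR_kernel X T) = subtopology (gtop G) kernel_arrows"
    by (simp add: DR_kernel_eq restrict_groupoid_def)
  show ?thesis
    unfolding unit_space_def arrows_DR_kernel
    unfolding DR_kernel_ops top subtopology_subtopology im Int_absorb1[OF sub] ..
qed

lemma DR_cocycle_mult: "DR_cocycle (gmult G \<alpha> \<beta>) = DR_cocycle \<alpha> + DR_cocycle \<beta>"
  by (cases \<alpha>; cases \<beta>) (simp add: groupoid_ops DR_cocycle_def)

lemma DR_cocycle_inv: "DR_cocycle (ginv G \<alpha>) = - DR_cocycle \<alpha>"
  by (cases \<alpha>) (simp add: groupoid_ops DR_cocycle_def)

lemma DR_cocycle_dom: "DR_cocycle (gdom G \<alpha>) = 0"
  by (simp add: dom_eq unit_def DR_cocycle_def)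

lemma openin_kernel: "openin (gtop G) kernel_arrows"
  by (rule openin_level)

end

text \<open>The cocycle \<open>c\<close> pulled back along \<open>\<Phi>\<close> vanishes on the
  kernel. Once it depends on the degree alone, it multiplies the degree by its value
  \<open>t\<close> on an edge, and invertibility of \<open>\<Phi>\<close> forces \<open>t\<close> to
  be a sign.\<close>

lemma kernel_isomorphism_imp_cocycle:
  assumes X: "deaconu_renault X T" and Y: "deaconu_renault Y S"
    and tt: "topologically_transitive (DR_kernel X T)"
    and \<Phi>: "groupoid_isomorphism (DR_groupoid X T) (DR_groupoid Y S) \<Phi>"
    and ker: "\<Phi> ` arrows (DR_kernel X T) = arrows (DR_kernel Y S)"
  shows "\<exists>\<tau>\<in>auto integer_group. \<forall>\<alpha>\<in>arrows (DR_groupoid X T). DR_cocycle (\<Phi> \<alpha>) = \<tau> (DR_cocycle \<alpha>)"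
proof -
  interpret X: deaconu_renault X T by fact
  interpret Y: deaconu_renault Y S by fact
  interpret GX: etale_groupoid "DR_groupoid X T" by (rule X.etale_groupoid)
  interpret GY: etale_groupoid "DR_groupoid Y S" by (rule Y.etale_groupoid)
  obtain \<Psi> where homeo: "homeomorphic_maps (gtop (DR_groupoid X T)) (gtop (DR_groupoid Y S)) \<Phi> \<Psi>"
    using \<Phi> unfolding groupoid_isomorphism_def homeomorphic_map_maps by blast
  interpret I: etale_groupoid_isomorphism "DR_groupoid X T" "DR_groupoid Y S" \<Phi> \<Psi>
    by unfold_locales (use homeo \<Phi> in \<open>auto simp: groupoid_isomorphism_def\<close>)
  let ?G = "DR_groupoid X T"
  define c where "c \<alpha> = DR_cocycle (\<Phi> \<alpha>)" for \<alpha>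
  have c_mult: "c (gmult ?G \<alpha> \<beta>) = c \<alpha> + c \<beta>" if "\<alpha> \<in> arrows ?G" "\<beta> \<in> arrows ?G" "gdom ?G \<alpha> = gran ?G \<beta>" for \<alpha> \<beta>
    unfolding c_def using I.Phi_mult[OF that] by (simp add: Y.DR_cocycle_mult)
  have c_ker: "c \<alpha> = 0" if "\<alpha> \<in> arrows ?G" "DR_cocycle \<alpha> = 0" for \<alpha>
  proof -
    have "\<Phi> \<alpha> \<in> arrows (DR_kernel Y S)" unfolding ker[symmetric] X.arrows_DR_kernel using that by simp
    then show ?thesis by (simp add: Y.arrows_DR_kernel c_def)
  qed
  have c_inv: "c (ginv ?G \<alpha>) = - c \<alpha>" if "\<alpha> \<in> arrows ?G" for \<alpha>
    using c_mult[of "ginv ?G \<alpha>" \<alpha>] c_ker[of "gdom ?G \<alpha>"] that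
    by (simp add: GX.closed_simps X.DR_cocycle_dom)
  \<comment> \<open>Both cocycles are locally constant, so \<open>\<alpha>\<close> and
    \<open>\<beta>\<close> may be replaced by nearby arrows with the same values.\<close>
  have level_open: "openin (gtop ?G) {\<alpha>\<in>arrows ?G. DR_cocycle \<alpha> = k \<and> c \<alpha> = j}" for k j
  proof -
    have "openin (gtop ?G) ({\<alpha>\<in>arrows ?G. DR_cocycle \<alpha> = k} \<inter>
        {\<alpha>\<in>arrows ?G. \<Phi> \<alpha> \<in> {\<beta>\<in>arrows (DR_groupoid Y S). DR_cocycle \<beta> = j}})"
      by (intro openin_Int X.openin_level openin_continuous_map_preimage[OF I.continuous_Phi Y.openin_level])
    moreover have "\<dots> = {\<alpha>\<in>arrows ?G. DR_cocycle \<alpha> = k \<and> c \<alpha> = j}" using I.Phi_arrow by (auto simp: c_def)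
    ultimately show ?thesis by simp
  qed
  have const: "c \<alpha> = c \<beta>" if a: "\<alpha> \<in> arrows ?G" and b: "\<beta> \<in> arrows ?G" and eq: "DR_cocycle \<alpha> = DR_cocycle \<beta>" for \<alpha> \<beta>
  proof -
    let ?A = "{\<alpha>'\<in>arrows ?G. DR_cocycle \<alpha>' = DR_cocycle \<alpha> \<and> c \<alpha>' = c \<alpha>}"
    let ?B = "{\<beta>'\<in>arrows ?G. DR_cocycle \<beta>' = DR_cocycle \<beta> \<and> c \<beta>' = c \<beta>}"
    have "openin (gtop ?G) (gdom ?G ` ?A)" "openin (gtop ?G) (gdom ?G ` ?B)"
      using GX.open_map_dom level_open unfolding open_map_def by blast+
    moreover have "gdom ?G ` ?A \<subseteq> GX.units" "gdom ?G ` ?B \<subseteq> GX.units" using GX.dom_in_units by auto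
    ultimately have dA: "openin (unit_space ?G) (gdom ?G ` ?A)" and dB: "openin (unit_space ?G) (gdom ?G ` ?B)"
      unfolding GX.unit_space_eq openin_subtopology by (blast intro: Int_absorb2[symmetric])+
    have neA: "gdom ?G ` ?A \<noteq> {}" using a by blast
    have bB: "gdom ?G \<beta> \<in> gdom ?G ` ?B" using b by blast
    \<comment> \<open>Density meets the open set of sources of arrows like \<open>\<beta>\<close>,
      so a kernel arrow leads from the source of some \<open>\<alpha>'\<close> to the source of some
      \<open>\<beta>'\<close>.\<close>
    have "unit_space ?G closure_of (gran ?G ` {\<gamma>\<in>arrows (DR_kernel X T). gdom ?G \<gamma> \<in> gdom ?G ` ?A}) = topspace (unit_space ?G)"
      using tt dA neA unfolding topologically_transitive_def X.unit_space_DR_kernel X.DR_kernel_ops by blast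
    then have "gdom ?G \<beta> \<in> unit_space ?G closure_of (gran ?G ` {\<gamma>\<in>arrows (DR_kernel X T). gdom ?G \<gamma> \<in> gdom ?G ` ?A})"
      using GX.dom_in_units[OF b] by (simp only: GX.topspace_unit_space)
    then have "\<exists>y. y \<in> gran ?G ` {\<gamma>\<in>arrows (DR_kernel X T). gdom ?G \<gamma> \<in> gdom ?G ` ?A} \<and> y \<in> gdom ?G ` ?B"
      unfolding in_closure_of using dB bB by meson
    then obtain \<gamma> where g: "\<gamma> \<in> arrows (DR_kernel X T)" "gdom ?G \<gamma> \<in> gdom ?G ` ?A" "gran ?G \<gamma> \<in> gdom ?G ` ?B" by auto
    obtain \<alpha>' where a': "\<alpha>' \<in> arrows ?G" "DR_cocycle \<alpha>' = DR_cocycle \<alpha>" "c \<alpha>' = c \<alpha>" "gdom ?G \<alpha>' = gdom ?G \<gamma>"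
      using g(2) by auto
    obtain \<beta>' where b': "\<beta>' \<in> arrows ?G" "DR_cocycle \<beta>' = DR_cocycle \<beta>" "c \<beta>' = c \<beta>" "gdom ?G \<beta>' = gran ?G \<gamma>"
      using g(3) by auto
    have gA: "\<gamma> \<in> arrows ?G" "DR_cocycle \<gamma> = 0" using g(1) by (simp_all add: X.arrows_DR_kernel)
    have prod: "gmult ?G \<gamma> (ginv ?G \<alpha>') \<in> arrows ?G" "gran ?G (gmult ?G \<gamma> (ginv ?G \<alpha>')) = gdom ?G \<beta>'"
      using a' b' gA by (simp_all add: GX.closed_simps)
    \<comment> \<open>The composite has degree \<open>0\<close>, so \<open>c\<close> vanishes on it,
      and additivity compares \<open>c \<alpha>'\<close> with \<open>c \<beta>'\<close>.\<close>
    let ?\<delta> = "gmult ?G \<beta>' (gmult ?G \<gamma> (ginv ?G \<alpha>'))"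
    have "?\<delta> \<in> arrows ?G" using prod b'(1) by (simp add: GX.closed_simps)
    moreover have "DR_cocycle ?\<delta> = 0" using a' b' gA eq by (simp add: X.DR_cocycle_mult X.DR_cocycle_inv)
    ultimately have "c ?\<delta> = 0" by (rule c_ker)
    moreover have "c ?\<delta> = c \<beta>' + (c \<gamma> + - c \<alpha>')"
      using a' b' gA prod by (simp add: c_mult c_inv GX.closed_simps)
    ultimately show ?thesis using a'(3) b'(3) c_ker[OF gA] by simp
  qed
  show ?thesis
  \<comment> \<open>Without points there is no edge to define \<open>t\<close>, and the condition on
    arrows is vacuous.\<close>
  proof (cases "topspace X = {}")
    case True
    then have "\<alpha> \<notin> arrows ?G" for \<alpha> by (metis X.arrowE empty_iff)
    then have "arrows ?G = {}" by blast
    moreover have "(\<lambda>n. 1 * n) \<in> auto integer_group" using integer_group_auto_iff abs_one by blast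
    ultimately show ?thesis by (intro bexI[of _ "\<lambda>n. 1 * n"]) auto
  next
    case False
    then obtain x where x: "x \<in> topspace X" by blast
    define t where "t = c (X.edge x)"
    \<comment> \<open>Products of edges along the orbit of \<open>x\<close> give one arrow of each
      nonnegative degree to compare with; negative degrees follow by inversion.\<close>
    have pos: "(x, int n, (T ^^ n) x) \<in> arrows ?G \<and> c (x, int n, (T ^^ n) x) = t * int n" for n
    proof (induction n)
      case 0
      have "(x, 0, x) \<in> arrows ?G" using X.unit_arrow[OF x] by (simp add: X.unit_def)
      then show ?case using c_ker[of "(x, 0, x)"] by (simp add: DR_cocycle_def)
    next
      case (Suc n)
      let ?z = "(T ^^ n) x"
      have e: "X.edge ?z \<in> arrows ?G" by (rule X.edge_arrow[OF X.T_closed[OF x]])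
      have pr: "gmult ?G (x, int n, ?z) (X.edge ?z) = (x, int (Suc n), (T ^^ Suc n) x)"
        by (simp add: X.edge_def X.groupoid_ops add.commute)
      have dr: "gdom ?G (x, int n, ?z) = gran ?G (X.edge ?z)" by (simp add: X.edge_def X.groupoid_ops)
      have "c (X.edge ?z) = t"
        unfolding t_def by (rule const[OF e X.edge_arrow[OF x]]) (simp add: X.edge_def DR_cocycle_def)
      then show ?case
        using GX.mult_closed[OF conjunct1[OF Suc.IH] e dr] c_mult[OF conjunct1[OF Suc.IH] e dr] conjunct2[OF Suc.IH]
        unfolding pr by (simp add: algebra_simps)
    qed
    have ct: "c \<alpha> = t * DR_cocycle \<alpha>" if a: "\<alpha> \<in> arrows ?G" for \<alpha>
    proof (cases "DR_cocycle \<alpha> \<ge> 0")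
      case True
      have "c \<alpha> = c (x, int (nat (DR_cocycle \<alpha>)), (T ^^ nat (DR_cocycle \<alpha>)) x)"
        by (rule const[OF a conjunct1[OF pos]]) (use True in \<open>simp add: DR_cocycle_def\<close>)
      then show ?thesis using pos[of "nat (DR_cocycle \<alpha>)"] True by simp
    next
      case False
      let ?n = "nat (- DR_cocycle \<alpha>)"
      have "c (ginv ?G \<alpha>) = c (x, int ?n, (T ^^ ?n) x)"
        by (rule const[OF GX.inv_closed[OF a] conjunct1[OF pos]])
          (use False in \<open>simp add: X.DR_cocycle_inv, simp add: DR_cocycle_def\<close>)
      then show ?thesis using pos[of ?n] False c_inv[OF a] by simp
    qed
    \<comment> \<open>The preimage of an edge of \<open>Y\<close> has a degree that \<open>t\<close>
      multiplies to \<open>1\<close>.\<close>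
    obtain u v w where "\<Phi> (X.unit x) = (u, v, w)" by (cases "\<Phi> (X.unit x)")
    then have "u \<in> topspace Y" using I.Phi_arrow[OF X.unit_arrow[OF x]] by (simp add: Y.arrow_iff)
    then have eu: "Y.edge u \<in> arrows (DR_groupoid Y S)" by (rule Y.edge_arrow)
    have "t * DR_cocycle (\<Psi> (Y.edge u)) = 1"
      using ct[OF I.Psi_arrow[OF eu]] I.Phi_Psi[OF eu] by (simp add: c_def Y.edge_def DR_cocycle_def)
    then have "\<bar>t\<bar> = 1" by (auto simp: zmult_eq_1_iff)
    then have "(\<lambda>n. t * n) \<in> auto integer_group" using integer_group_auto_iff by blast
    then show ?thesis using ct unfolding c_def by blast
  qed
qed

text \<open>Multiplication by a sign vanishes only at \<open>0\<close>.\<close>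

lemma cocycle_isomorphism_kernel:
  assumes X: "deaconu_renault X T" and Y: "deaconu_renault Y S"
    and \<Phi>: "groupoid_isomorphism (DR_groupoid X T) (DR_groupoid Y S) \<Phi>" and t: "\<tau> \<in> auto integer_group"
    and c: "\<forall>\<alpha>\<in>arrows (DR_groupoid X T). DR_cocycle (\<Phi> \<alpha>) = \<tau> (DR_cocycle \<alpha>)"
  shows "\<Phi> ` arrows (DR_kernel X T) = arrows (DR_kernel Y S)"
proof -
  interpret X: deaconu_renault X T by fact
  interpret Y: deaconu_renault Y S by fact
  obtain e where e: "\<bar>e\<bar> = 1" "\<tau> = (\<lambda>n. e * n)" using t integer_group_auto_iff by blast
  have im: "\<Phi> ` arrows (DR_groupoid X T) = arrows (DR_groupoid Y S)"
    using \<Phi> homeomorphic_imp_surjective_map unfolding groupoid_isomorphism_def by blast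
  have z: "DR_cocycle (\<Phi> \<alpha>) = 0 \<longleftrightarrow> DR_cocycle \<alpha> = 0" if "\<alpha> \<in> arrows (DR_groupoid X T)" for \<alpha>
    using c that e by auto
  show ?thesis
    unfolding X.arrows_DR_kernel Y.arrows_DR_kernel im[symmetric] using z by auto
qed

theorem theorem5p3p12:
  fixes X :: "'a topology" and T :: "'a \<Rightarrow> 'a"
    and Y :: "'b topology" and S :: "'b \<Rightarrow> 'b"
  assumes "deaconu_renault_system X T" and "topologically_free X T"
    and "deaconu_renault_system Y S" and "topologically_free Y S"
  shows
    "let
       G = DR_groupoid X T; H = DR_groupoid Y S;
       G0 = DR_kernel X T; H0 = DR_kernel Y S;
       C1 = flip_eventually_conjugate X T Y S;
       C2 = (\<exists>\<Phi> \<tau>. groupoid_isomorphism G H \<Phi> \<and> \<tau> \<in> auto integer_group \<and>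
               (\<forall>\<alpha>\<in>arrows G. DR_cocycle (\<Phi> \<alpha>) = \<tau> (DR_cocycle \<alpha>)));
       C3 = (\<exists>\<Phi>. groupoid_isomorphism G H \<Phi> \<and> \<Phi> ` arrows G0 = arrows H0);
       C4 = (\<exists>\<phi>. star_isomorphism (Cstar_r G) (Cstar_r H) \<phi> \<and>
               \<phi> ` Cstar_r_sub G G0 = Cstar_r_sub H H0 \<and>
               \<phi> ` diagonal_subalgebra G = diagonal_subalgebra H)
     in (C1 \<longleftrightarrow> C2) \<and> (C2 \<longrightarrow> C3) \<and> (C3 \<longleftrightarrow> C4) \<and>
        (topologically_transitive G0 \<and> topologically_transitive H0 \<longrightarrow>
           (C3 \<longrightarrow> C2) \<and> (C1 \<longleftrightarrow> C2) \<and> (C2 \<longleftrightarrow> C3) \<and> (C3 \<longleftrightarrow> C4))"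
proof -
  have X: "deaconu_renault X T" and Y: "deaconu_renault Y S"
    using assms by (simp_all add: deaconu_renault_def)
  interpret X: deaconu_renault X T by fact
  interpret Y: deaconu_renault Y S by fact
  let ?G = "DR_groupoid X T" and ?H = "DR_groupoid Y S"
  let ?C1 = "flip_eventually_conjugate X T Y S"
  let ?C2 = "\<exists>\<Phi> \<tau>. groupoid_isomorphism ?G ?H \<Phi> \<and> \<tau> \<in> auto integer_group \<and>
               (\<forall>\<alpha>\<in>arrows ?G. DR_cocycle (\<Phi> \<alpha>) = \<tau> (DR_cocycle \<alpha>))"
  let ?C3 = "\<exists>\<Phi>. groupoid_isomorphism ?G ?H \<Phi> \<and> \<Phi> ` arrows (DR_kernel X T) = arrows (DR_kernel Y S)"
  let ?C4 = "\<exists>\<phi>. star_isomorphism (Cstar_r ?G) (Cstar_r ?H) \<phi> \<and>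
               \<phi> ` Cstar_r_sub ?G (DR_kernel X T) = Cstar_r_sub ?H (DR_kernel Y S) \<and>
               \<phi> ` diagonal_subalgebra ?G = diagonal_subalgebra ?H"
  have 12: "?C1 \<longleftrightarrow> ?C2"
  proof
    assume ?C1 then show ?C2 by (rule flip_eventually_conjugate_imp_isomorphism[OF X Y])
  next
    assume ?C2
    then obtain \<Phi> \<tau> where \<Phi>: "groupoid_isomorphism ?G ?H \<Phi>" and \<tau>: "\<tau> \<in> auto integer_group"
      and c: "\<forall>\<alpha>\<in>arrows ?G. DR_cocycle (\<Phi> \<alpha>) = \<tau> (DR_cocycle \<alpha>)" by (elim exE conjE)
    show ?C1 by (rule isomorphism_imp_flip_eventually_conjugate[OF X Y \<Phi> \<tau> bspec[OF c]])
  qed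
  have 23: "?C2 \<longrightarrow> ?C3" using cocycle_isomorphism_kernel[OF X Y] by blast
  have 34: "?C3 \<longleftrightarrow> ?C4"
  proof
    assume ?C3
    then obtain \<Phi> where \<Phi>: "groupoid_isomorphism ?G ?H \<Phi>" "\<Phi> ` X.kernel_arrows = Y.kernel_arrows"
      unfolding X.arrows_DR_kernel Y.arrows_DR_kernel by blast
    \<comment> \<open>The kernels are rewritten as restrictions to open sets of arrows, the form in
      which functoriality is proved.\<close>
    show ?C4 unfolding X.DR_kernel_eq Y.DR_kernel_eq
      by (rule reduced_algebra_isomorphism[OF X.etale_groupoid Y.etale_groupoid \<Phi>(1) X.openin_kernel Y.openin_kernel \<Phi>(2)])
  next
    assume ?C4
    then obtain \<phi> where \<phi>: "star_isomorphism (Cstar_r ?G) (Cstar_r ?H) \<phi>"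
      "\<phi> ` Cstar_r_sub ?G (restrict_groupoid ?G X.kernel_arrows) = Cstar_r_sub ?H (restrict_groupoid ?H Y.kernel_arrows)"
      "\<phi> ` diagonal_subalgebra ?G = diagonal_subalgebra ?H"
      unfolding X.DR_kernel_eq Y.DR_kernel_eq by blast
    show ?C3 unfolding X.arrows_DR_kernel Y.arrows_DR_kernel
      by (rule groupoid_reconstruction[OF X.etale_groupoid Y.etale_groupoid assms(2)[unfolded topologically_free_def]
            assms(4)[unfolded topologically_free_def] \<phi>(1,3) X.openin_kernel Y.openin_kernel \<phi>(2)])
  qed
  have 32: "?C2" if tt: "topologically_transitive (DR_kernel X T)" and c3: ?C3
  proof -
    obtain \<Phi> where \<Phi>: "groupoid_isomorphism ?G ?H \<Phi>" "\<Phi> ` arrows (DR_kernel X T) = arrows (DR_kernel Y S)"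
      using c3 by blast
    obtain \<tau> where "\<tau> \<in> auto integer_group" "\<forall>\<alpha>\<in>arrows ?G. DR_cocycle (\<Phi> \<alpha>) = \<tau> (DR_cocycle \<alpha>)"
      using kernel_isomorphism_imp_cocycle[OF X Y tt \<Phi>] by (rule bexE)
    with \<Phi>(1) show ?thesis by (intro exI[of _ \<Phi>] exI[of _ \<tau>] conjI)
  qed
  show ?thesis
    unfolding Let_def
  proof (intro conjI impI 12 34)
    show "?C2 \<Longrightarrow> ?C3" using 23 by (rule mp)
    assume tt: "topologically_transitive (DR_kernel X T) \<and> topologically_transitive (DR_kernel Y S)"
    show "?C3 \<Longrightarrow> ?C2" by (rule 32[OF conjunct1[OF tt]])
    show "?C2 \<longleftrightarrow> ?C3" by (rule iffI[OF mp[OF 23] 32[OF conjunct1[OF tt]]])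
  qed
qed

end
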